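(* Let $n=3$. There is $c_*>0$ with the following property. Assume that $g\in C^1(\mathbb R)$ is convex and that there is $d\in\mathbb R$ such that $$|g'(t)-g'(s)|\le d(|t|+|s|)\qquad\text{for all }s,t\in\mathbb R .$$ With $a,e>0$, set $$W_3(\xi):=\tfrac12|\xi|^2+\tfrac14a|\xi|^4+\tfrac16e|\xi|^6+g(\det\xi),\qquad\xi\in\mathbb R^{3\times3}.$$ If $d\le c_*e$, then the data set $\mathcal D_{\mathrm{loc},DW_3}:=\{(F,DW_3(F)):F\in\mathbb R^{3\times3}\}$ is locally $(6,\frac65)$-div-curl-closed.
   Context: $|\xi|$ is the Euclidean (Frobenius) norm. With $n=3$, $p=6$, $q=6/5$: for open $\omega\subseteq\mathbb R^n$, $X_{p,q}(\omega):=L^p(\omega;\mathbb R^{n\times n})\times L^q(\omega;\mathbb R^{n\times n})$. Distributional operators act rowwise: $(\mathrm{curl}\,F)_{ijk}=\partial_kF_{ij}-\partial_jF_{ik}$, $(\mathrm{div}\,P)_i=\sum_j\partial_jP_{ij}$. $W^{-1,p}(\omega)$ is the dual of $W^{1,q}_0(\omega)$ and $W^{-1,q}(\omega)$ is the dual of $W^{1,p}_0(\omega)$. A sequence $(F_k,P_k)\in X_{p,q}(\omega)$ is div-curl-convergent to $(F,P)$ if it converges weakly in $X_{p,q}(\omega)$ and $\mathrm{curl}\,F_k\to\mathrm{curl}\,F$ strongly in $W^{-1,p}(\omega;\mathbb R^{n\times n\times n})$ and $\mathrm{div}\,P_k\to\mathrm{div}\,P$ strongly in $W^{-1,q}(\omega;\mathbb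 R^n)$. A set $\mathcal D_{\mathrm{loc}}\subseteq\mathbb R^{n\times n}\times\mathbb R^{n\times n}$ is locally $(p,q)$-div-curl-closed if, for all bounded nonempty open $\omega\subseteq\mathbb R^n$ and all $(F_*,P_* )\in\mathbb R^{n\times n}\times\mathbb R^{n\times n}$: if there is a sequence $(F_k,P_k)\in X_{p,q}(\omega)$ div-curl-converging to the constant function $(F_*,P_* )$ with $(F_k,P_k)\in\mathcal D_{\mathrm{loc}}$ a.e., then $(F_*,P_* )\in\mathcal D_{\mathrm{loc}}$. *)

theory Defs
  imports "HOL-Analysis.Analysis"
begin

definition grad :: "('a::real_inner \<Rightarrow> real) \<Rightarrow> 'a \<Rightarrow> 'a" where
  "grad f x = (THE D. GDERIV f x :> D)"

text \<open>Elements of the Lebesgue and Sobolev spaces below are represented by functions rather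
  than by classes modulo null sets; values outside \<open>\<omega>\<close> are irrelevant.\<close>

definition Lp_space :: "real \<Rightarrow> (real^'n) set \<Rightarrow> (real^'n \<Rightarrow> 'b::euclidean_space) set" where
  "Lp_space p \<omega> = {f. f \<in> borel_measurable (lebesgue_on \<omega>) \<and>
                      integrable (lebesgue_on \<omega>) (\<lambda>x. norm (f x) powr p)}"

definition Lp_norm :: "real \<Rightarrow> (real^'n) set \<Rightarrow> (real^'n \<Rightarrow> 'b::euclidean_space) \<Rightarrow> real" where
  "Lp_norm p \<omega> f = (LINT x|lebesgue_on \<omega>. norm (f x) powr p) powr (1 / p)"

primrec C_k :: "nat \<Rightarrow> (real^'n \<Rightarrow> real) \<Rightarrow> bool" where
  "C_k 0 \<phi> \<longleftrightarrow> continuous_on UNIV \<phi>"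
| "C_k (Suc k) \<phi> \<longleftrightarrow> (\<forall>x. \<phi> differentiable (at x)) \<and> (\<forall>i. C_k k (\<lambda>x. grad \<phi> x $ i))"

definition test_functions :: "(real^'n) set \<Rightarrow> (real^'n \<Rightarrow> real) set" where
  "test_functions \<omega> = {\<phi>. (\<forall>k. C_k k \<phi>) \<and> compact (closure {x. \<phi> x \<noteq> 0}) \<and>
                           closure {x. \<phi> x \<noteq> 0} \<subseteq> \<omega>}"

definition has_weak_grad ::
    "(real^'n) set \<Rightarrow> (real^'n \<Rightarrow> real) \<Rightarrow> (real^'n \<Rightarrow> real^'n) \<Rightarrow> bool" where
  "has_weak_grad \<omega> u G \<longleftrightarrow> (\<forall>\<phi>\<in>test_functions \<omega>. \<forall>i.
     (LINT x|lebesgue_on \<omega>. u x * grad \<phi> x $ i) = - (LINT x|lebesgue_on \<omega>. G x $ i * \<phi> x))"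

text \<open>An element of a Sobolev space is represented by the pair of the function and its weak
  gradient. \<open>W0_space r \<omega>\<close> is \<open>W\<^sub>0\<^sup>1\<^sup>,\<^sup>r(\<omega>)\<close>, the closure of the test functions.\<close>

definition W0_space :: "real \<Rightarrow> (real^'n) set \<Rightarrow> ((real^'n \<Rightarrow> real) \<times> (real^'n \<Rightarrow> real^'n)) set" where
  "W0_space r \<omega> = {(u, G). u \<in> Lp_space r \<omega> \<and> G \<in> Lp_space r \<omega> \<and> has_weak_grad \<omega> u G \<and>
     (\<exists>\<phi>. (\<forall>m. \<phi> m \<in> test_functions \<omega>) \<and>
          (\<lambda>m. Lp_norm r \<omega> (\<lambda>x. \<phi> m x - u x)) \<longlonglongrightarrow> 0 \<and>
          (\<lambda>m. Lp_norm r \<omega> (\<lambda>x. grad (\<phi> m) x - G x)) \<longlonglongrightarrow> 0)}"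

definition W1_norm ::
    "real \<Rightarrow> (real^'n) set \<Rightarrow> (real^'n \<Rightarrow> real) \<times> (real^'n \<Rightarrow> real^'n) \<Rightarrow> real" where
  "W1_norm r \<omega> v = Lp_norm r \<omega> (fst v) + Lp_norm r \<omega> (snd v)"

text \<open>The norm of a functional in the dual of \<open>W\<^sub>0\<^sup>1\<^sup>,\<^sup>r(\<omega>)\<close>, that is, in \<open>W\<^sup>-\<^sup>1\<^sup>,\<^sup>s(\<omega>)\<close> for the conjugate
  exponent \<open>s\<close> of \<open>r\<close>.\<close>

definition dual_W0_norm ::
    "real \<Rightarrow> (real^'n) set \<Rightarrow> ((real^'n \<Rightarrow> real) \<times> (real^'n \<Rightarrow> real^'n) \<Rightarrow> real) \<Rightarrow> ennreal" where
  "dual_W0_norm r \<omega> T = (SUP v\<in>{v \<in> W0_space r \<omega>. W1_norm r \<omega> v \<le> 1}. ennreal \<bar>T v\<bar>)"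

definition dual_W0_tendsto ::
    "real \<Rightarrow> (real^'n) set \<Rightarrow> (nat \<Rightarrow> (real^'n \<Rightarrow> real) \<times> (real^'n \<Rightarrow> real^'n) \<Rightarrow> real) \<Rightarrow>
     ((real^'n \<Rightarrow> real) \<times> (real^'n \<Rightarrow> real^'n) \<Rightarrow> real) \<Rightarrow> bool" where
  "dual_W0_tendsto r \<omega> T S \<longleftrightarrow> (\<lambda>m. dual_W0_norm r \<omega> (\<lambda>v. T m v - S v)) \<longlonglongrightarrow> 0"

text \<open>The distributional derivative \<open>\<phi> \<mapsto> - \<integral> f \<partial>\<^sub>k\<phi>\<close> of a function \<open>f\<close> in \<open>L\<^sup>s(\<omega>)\<close>, extended by
  continuity from test functions to \<open>W\<^sub>0\<^sup>1\<^sup>,\<^sup>r(\<omega>)\<close>, where \<open>r\<close> and \<open>s\<close> are conjugate exponents.\<close>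

definition dist_partial ::
    "(real^'n) set \<Rightarrow> 'n \<Rightarrow> (real^'n \<Rightarrow> real) \<Rightarrow> (real^'n \<Rightarrow> real) \<times> (real^'n \<Rightarrow> real^'n) \<Rightarrow> real" where
  "dist_partial \<omega> k f v = - (LINT x|lebesgue_on \<omega>. f x * snd v x $ k)"

definition dist_curl ::
    "(real^'n) set \<Rightarrow> (real^'n \<Rightarrow> real^'n^'n) \<Rightarrow> 'n \<Rightarrow> 'n \<Rightarrow> 'n \<Rightarrow>
     (real^'n \<Rightarrow> real) \<times> (real^'n \<Rightarrow> real^'n) \<Rightarrow> real" where
  "dist_curl \<omega> F i j k v =
     dist_partial \<omega> k (\<lambda>x. F x $ i $ j) v - dist_partial \<omega> j (\<lambda>x. F x $ i $ k) v"

definition dist_div ::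
    "(real^'n) set \<Rightarrow> (real^'n \<Rightarrow> real^'n^'n) \<Rightarrow> 'n \<Rightarrow>
     (real^'n \<Rightarrow> real) \<times> (real^'n \<Rightarrow> real^'n) \<Rightarrow> real" where
  "dist_div \<omega> P i v = (\<Sum>j\<in>UNIV. dist_partial \<omega> j (\<lambda>x. P x $ i $ j) v)"

definition X_space ::
    "real \<Rightarrow> real \<Rightarrow> (real^'n) set \<Rightarrow> ((real^'n \<Rightarrow> real^'n^'n) \<times> (real^'n \<Rightarrow> real^'n^'n)) set" where
  "X_space p q \<omega> = Lp_space p \<omega> \<times> Lp_space q \<omega>"

definition X_norm ::
    "real \<Rightarrow> real \<Rightarrow> (real^'n) set \<Rightarrow> (real^'n \<Rightarrow> real^'n^'n) \<times> (real^'n \<Rightarrow> real^'n^'n) \<Rightarrow> real" where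
  "X_norm p q \<omega> z = Lp_norm p \<omega> (fst z) + Lp_norm q \<omega> (snd z)"

text \<open>The continuous linear functionals on \<open>X_space\<close>; the bound forces them to respect equality
  almost everywhere.\<close>

definition X_dual ::
    "real \<Rightarrow> real \<Rightarrow> (real^'n) set \<Rightarrow>
     ((real^'n \<Rightarrow> real^'n^'n) \<times> (real^'n \<Rightarrow> real^'n^'n) \<Rightarrow> real) set" where
  "X_dual p q \<omega> = {l.
     (\<forall>(F, P)\<in>X_space p q \<omega>. \<forall>(F', P')\<in>X_space p q \<omega>.
        l (\<lambda>x. F x + F' x, \<lambda>x. P x + P' x) = l (F, P) + l (F', P')) \<and>
     (\<forall>c. \<forall>(F, P)\<in>X_space p q \<omega>. l (\<lambda>x. c *\<^sub>R F x, \<lambda>x. c *\<^sub>R P x) = c * l (F, P)) \<and>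
     (\<exists>C. \<forall>z\<in>X_space p q \<omega>. \<bar>l z\<bar> \<le> C * X_norm p q \<omega> z)}"

definition X_weakly_tendsto ::
    "real \<Rightarrow> real \<Rightarrow> (real^'n) set \<Rightarrow>
     (nat \<Rightarrow> (real^'n \<Rightarrow> real^'n^'n) \<times> (real^'n \<Rightarrow> real^'n^'n)) \<Rightarrow>
     (real^'n \<Rightarrow> real^'n^'n) \<times> (real^'n \<Rightarrow> real^'n^'n) \<Rightarrow> bool" where
  "X_weakly_tendsto p q \<omega> Z z \<longleftrightarrow>
     (\<forall>m. Z m \<in> X_space p q \<omega>) \<and> z \<in> X_space p q \<omega> \<and>
     (\<forall>l\<in>X_dual p q \<omega>. (\<lambda>m. l (Z m)) \<longlonglongrightarrow> l z)"

text \<open>The exponents \<open>p\<close> and \<open>q\<close> are meant to be conjugate, so convergence in \<open>W\<^sup>-\<^sup>1\<^sup>,\<^sup>p\<close> is convergence in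
  the dual of \<open>W\<^sub>0\<^sup>1\<^sup>,\<^sup>q\<close> and vice versa. Tensor- and vector-valued convergence is componentwise.\<close>

definition div_curl_tendsto ::
    "real \<Rightarrow> real \<Rightarrow> (real^'n) set \<Rightarrow>
     (nat \<Rightarrow> (real^'n \<Rightarrow> real^'n^'n) \<times> (real^'n \<Rightarrow> real^'n^'n)) \<Rightarrow>
     (real^'n \<Rightarrow> real^'n^'n) \<times> (real^'n \<Rightarrow> real^'n^'n) \<Rightarrow> bool" where
  "div_curl_tendsto p q \<omega> Z z \<longleftrightarrow>
     X_weakly_tendsto p q \<omega> Z z \<and>
     (\<forall>i j k. dual_W0_tendsto q \<omega> (\<lambda>m. dist_curl \<omega> (fst (Z m)) i j k) (dist_curl \<omega> (fst z) i j k)) \<and>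
     (\<forall>i. dual_W0_tendsto p \<omega> (\<lambda>m. dist_div \<omega> (snd (Z m)) i) (dist_div \<omega> (snd z) i))"

definition locally_div_curl_closed ::
    "real \<Rightarrow> real \<Rightarrow> ((real^'n^'n) \<times> (real^'n^'n)) set \<Rightarrow> bool" where
  "locally_div_curl_closed p q D \<longleftrightarrow>
     (\<forall>\<omega> F\<^sub>0 P\<^sub>0. bounded \<omega> \<and> \<omega> \<noteq> {} \<and> open \<omega> \<and>
        (\<exists>Z. div_curl_tendsto p q \<omega> Z (\<lambda>x. F\<^sub>0, \<lambda>x. P\<^sub>0) \<and>
             (\<forall>m. AE x in lebesgue_on \<omega>. (fst (Z m) x, snd (Z m) x) \<in> D))
        \<longrightarrow> (F\<^sub>0, P\<^sub>0) \<in> D)"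

definition W3 :: "real \<Rightarrow> real \<Rightarrow> (real \<Rightarrow> real) \<Rightarrow> real^3^3 \<Rightarrow> real" where
  "W3 a e g \<xi> = 1/2 * norm \<xi> ^ 2 + 1/4 * a * norm \<xi> ^ 4 + 1/6 * e * norm \<xi> ^ 6 + g (det \<xi>)"

definition data_set_of_gradient :: "(real^'n^'n \<Rightarrow> real) \<Rightarrow> ((real^'n^'n) \<times> (real^'n^'n)) set" where
  "data_set_of_gradient W = {(F, grad W F) | F. True}"

end

theory Submission
  imports Defs "HOL-Probability.Probability_Measure"
begin

text \<open>
  The gradient \<open>DW\<close> of \<open>W3\<close> satisfies \<open>(DW \<xi> - DW \<eta>) \<bullet> (\<xi> - \<eta>) \<ge> N\<^sub>\<eta> (\<xi> - \<eta>)\<close>, where \<open>N\<^sub>\<eta>\<close> is a combination of the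
  cofactors and the determinant. Indeed, the error made by freezing \<open>g' (det \<xi>)\<close> at \<open>\<eta>\<close> is of order
  \<open>d |\<xi> - \<eta>|\<^sup>2 (|\<xi>|\<^sup>4 + |\<eta>|\<^sup>4)\<close>, which the sextic term absorbs. Minty's argument applies: multiply by a cutoff, set
  \<open>\<eta> = F\<^sub>0 - t H\<close>, pass to the limit and let \<open>t \<rightarrow> 0\<close>.

  The limit needs weak continuity of the div-curl product, the minors and the determinant along
  sequences with compact curl. After localization such a field is, up to a null sequence in \<open>L\<^sup>6\<close>, the gradient of a test
  function. This Helmholtz decomposition inverts the Laplacian through the Green function of a
  simple random walk; the required \<open>L\<^sup>p\<close> bound for its second differences comes from a Bellman function
  instead of singular integral theory.
\<close>

section \<open>Lebesgue spaces\<close>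

text \<open>\<open>det\<close> is not convex, so \<open>g (det \<xi>)\<close> with convex
  \<open>g\<close> need not have a monotone gradient. Freezing costs at most 360 d with the crude
  bounds used here; absorbing this in e/2 produces the constant 1/720. The analytic obstacle is that
  curls converge only in a negative Sobolev norm. Correcting a field to a gradient therefore asks
  for a bound on second derivatives of the inverse Laplacian in L^(6/5), the exponent dual to 6. The
  walk is chosen because it is exact before any limit: the walk minus the identity is a sum of pure
  second derivatives of averages. The energy of the Bellman function drops at each step by at least
  half the modulus of a mixed second difference paired with the dual function; these drops
  telescope, so the bound depends neither on the step length nor on the number of steps. The weight
  of the final integration is the fourth power of a cutoff: each field factor of a cubic minor needs
  one copy to become almost a gradient, and one copy is left as a test function.\<close>

definition lspace :: "'a measure \<Rightarrow> real \<Rightarrow> ('a \<Rightarrow> real) set" where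
  "lspace M s = {f. f \<in> borel_measurable M \<and> integrable M (\<lambda>x. \<bar>f x\<bar> powr s)}"

text \<open>The Bochner integral of a non-integrable function is 0, so a bound on
  \<open>lnorm\<close> means something only together with membership in \<open>lspace\<close>; the
  two are carried side by side throughout.\<close>

definition lnorm :: "'a measure \<Rightarrow> real \<Rightarrow> ('a \<Rightarrow> real) \<Rightarrow> real" where
  "lnorm M s f = (LINT x|M. \<bar>f x\<bar> powr s) powr (1 / s)"

definition conjugate :: "real \<Rightarrow> real \<Rightarrow> bool" where
  "conjugate s t \<longleftrightarrow> 1 < s \<and> 1 < t \<and> 1 / s + 1 / t = 1"

lemma conjugateD:
  assumes "conjugate s t"
  shows "1 < s" "1 < t" "1 / s + 1 / t = 1" "conjugate t s"
  using assms by (auto simp: conjugate_def)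

lemma conjugate_6: "conjugate 6 (6/5)" "conjugate (6/5) 6"
  by (auto simp: conjugate_def)

lemma lspaceI: "f \<in> borel_measurable M \<Longrightarrow> integrable M (\<lambda>x. \<bar>f x\<bar> powr s) \<Longrightarrow> f \<in> lspace M s"
  by (simp add: lspace_def)

lemma lspace_measurable: "f \<in> lspace M s \<Longrightarrow> f \<in> borel_measurable M"
  by (simp add: lspace_def)

lemma lspace_integrable: "f \<in> lspace M s \<Longrightarrow> integrable M (\<lambda>x. \<bar>f x\<bar> powr s)"
  by (simp add: lspace_def)

lemma lnorm_nonneg [simp]: "0 \<le> lnorm M s f"
  by (simp add: lnorm_def)

lemma lnorm_powr: "0 < s \<Longrightarrow> lnorm M s f powr s = (LINT x|M. \<bar>f x\<bar> powr s)"
  by (simp add: lnorm_def powr_powr)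

lemma lnorm_le_iff:
  assumes "0 < s" "0 \<le> c"
  shows "lnorm M s f \<le> c \<longleftrightarrow> (LINT x|M. \<bar>f x\<bar> powr s) \<le> c powr s"
  unfolding lnorm_powr[OF assms(1), symmetric]
  using assms powr_mono2[of s "lnorm M s f" c] powr_less_mono2[of s c "lnorm M s f"]
  by (meson lnorm_nonneg less_imp_le not_le)

lemma lspace_mono:
  assumes "g \<in> lspace M s" "f \<in> borel_measurable M" "AE x in M. \<bar>f x\<bar> \<le> \<bar>g x\<bar>" "0 < s"
  shows "f \<in> lspace M s" and "lnorm M s f \<le> lnorm M s g"
proof -
  show f: "f \<in> lspace M s"
  proof (rule lspaceI[OF assms(2)])
    show "integrable M (\<lambda>x. \<bar>f x\<bar> powr s)"
      using assms(3) by (intro Bochner_Integration.integrable_bound[OF lspace_integrable[OF assms(1)]])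
        (use assms in \<open>auto intro!: powr_mono2\<close>)
  qed
  show "lnorm M s f \<le> lnorm M s g"
    unfolding lnorm_def using assms
    by (intro powr_mono2 integral_mono_AE lspace_integrable[OF f] lspace_integrable)
       (auto intro!: powr_mono2)
qed

lemma lspace_cmult:
  assumes "f \<in> lspace M s"
  shows "(\<lambda>x. c * f x) \<in> lspace M s"
  using assms by (auto simp: lspace_def abs_mult powr_mult)

lemma lnorm_cmult: "0 < s \<Longrightarrow> lnorm M s (\<lambda>x. c * f x) = \<bar>c\<bar> * lnorm M s f"
  by (simp add: lnorm_def abs_mult powr_mult powr_powr)

lemma lspace_uminus: "f \<in> lspace M s \<Longrightarrow> (\<lambda>x. - f x) \<in> lspace M s"
  by (simp add: lspace_def)

lemma lnorm_uminus: "lnorm M s (\<lambda>x. - f x) = lnorm M s f"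
  by (simp add: lnorm_def)

lemma powr_add_le:
  fixes a b :: real
  assumes "0 \<le> a" "0 \<le> b" "0 < s"
  shows "(a + b) powr s \<le> 2 powr s * (a powr s + b powr s)"
proof -
  have "(a + b) powr s \<le> (2 * max a b) powr s"
    using assms by (intro powr_mono2) auto
  also have "\<dots> = 2 powr s * max a b powr s" using assms by (simp add: powr_mult)
  also have "\<dots> \<le> 2 powr s * (a powr s + b powr s)"
    by (intro mult_left_mono) (auto simp: max_def)
  finally show ?thesis .
qed

lemma lspace_add:
  assumes "f \<in> lspace M s" "g \<in> lspace M s" "0 < s"
  shows "(\<lambda>x. f x + g x) \<in> lspace M s"
proof (rule lspaceI)
  have [measurable]: "f \<in> borel_measurable M" "g \<in> borel_measurable M"
    using assms by (auto simp: lspace_def)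
  show "(\<lambda>x. f x + g x) \<in> borel_measurable M" by measurable
  have "integrable M (\<lambda>x. 2 powr s * (\<bar>f x\<bar> powr s + \<bar>g x\<bar> powr s))"
    using assms by (auto simp: lspace_def)
  moreover have "\<bar>f x + g x\<bar> powr s \<le> 2 powr s * (\<bar>f x\<bar> powr s + \<bar>g x\<bar> powr s)" for x
    using powr_add_le[of "\<bar>f x\<bar>" "\<bar>g x\<bar>" s] assms(3)
    by (smt (verit) powr_mono2)
  ultimately show "integrable M (\<lambda>x. \<bar>f x + g x\<bar> powr s)"
    by (elim Bochner_Integration.integrable_bound) auto
qed

lemma lspace_diff:
  assumes "f \<in> lspace M s" "g \<in> lspace M s" "0 < s"
  shows "(\<lambda>x. f x - g x) \<in> lspace M s"
  using lspace_add[OF assms(1) lspace_uminus[OF assms(2)] assms(3)] by simp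

lemma lspace_zero: "(\<lambda>x. 0) \<in> lspace M s"
  by (simp add: lspace_def)

lemma lspace_sum:
  assumes "\<And>i. i \<in> I \<Longrightarrow> f i \<in> lspace M s" "0 < s"
  shows "(\<lambda>x. \<Sum>i\<in>I. f i x) \<in> lspace M s"
  using assms by (induction I rule: infinite_finite_induct) (auto intro: lspace_add lspace_zero)

lemma lnorm_eq_0D:
  assumes "f \<in> lspace M s" "lnorm M s f = 0" "0 < s"
  shows "AE x in M. f x = 0"
proof -
  have "(LINT x|M. \<bar>f x\<bar> powr s) = 0"
    using lnorm_powr[OF assms(3), of M f] assms(2) by simp
  then have "AE x in M. \<bar>f x\<bar> powr s = 0"
    by (subst (asm) integral_nonneg_eq_0_iff_AE) (auto intro: lspace_integrable assms)
  then show ?thesis by simp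
qed

text \<open>Young's inequality integrated after dividing each factor by its norm. If one norm
  vanishes, the product is zero almost everywhere and the normalization is bypassed.\<close>

lemma Holder:
  assumes st: "conjugate s t" and f: "f \<in> lspace M s" and g: "g \<in> lspace M t"
  shows Holder_integrable: "integrable M (\<lambda>x. f x * g x)"
    and Holder_abs: "(LINT x|M. \<bar>f x * g x\<bar>) \<le> lnorm M s f * lnorm M t g"
    and Holder_le: "\<bar>LINT x|M. f x * g x\<bar> \<le> lnorm M s f * lnorm M t g"
proof -
  have [measurable]: "f \<in> borel_measurable M" "g \<in> borel_measurable M"
    using assms by (auto simp: lspace_def)
  note c = conjugateD[OF st]
  have young: "\<bar>a * b\<bar> \<le> \<bar>a\<bar> powr s / s + \<bar>b\<bar> powr t / t" for a b :: real
    using Youngs_inequality[of s t "\<bar>a\<bar>" "\<bar>b\<bar>"] c by (simp add: abs_mult)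
  have int: "integrable M (\<lambda>x. \<bar>f x\<bar> powr s / s + \<bar>g x\<bar> powr t / t)"
    using lspace_integrable[OF f] lspace_integrable[OF g] by simp
  show fg: "integrable M (\<lambda>x. f x * g x)"
    by (rule Bochner_Integration.integrable_bound[OF int])
       (use young c in \<open>auto intro!: AE_I2 order_trans[OF young]\<close>)
  show le: "(LINT x|M. \<bar>f x * g x\<bar>) \<le> lnorm M s f * lnorm M t g"
  proof (cases "lnorm M s f = 0 \<or> lnorm M t g = 0")
    case True
    then have "AE x in M. f x * g x = 0"
      using lnorm_eq_0D[OF f] lnorm_eq_0D[OF g] c by auto
    then have "(LINT x|M. \<bar>f x * g x\<bar>) = 0"
      by (intro integral_eq_zero_AE) auto
    then show ?thesis by simp
  next
    case False
    define A where "A = lnorm M s f"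
    define B where "B = lnorm M t g"
    have pos: "0 < A" "0 < B" using False unfolding A_def B_def by (auto simp: less_le)
    have "(LINT x|M. \<bar>f x * g x\<bar>) / (A * B) = (LINT x|M. \<bar>(f x / A) * (g x / B)\<bar>)"
      using pos by (simp add: abs_mult)
    also have "\<dots> \<le> (LINT x|M. \<bar>f x\<bar> powr s / (A powr s * s) + \<bar>g x\<bar> powr t / (B powr t * t))"
    proof (intro integral_mono)
      show "integrable M (\<lambda>x. \<bar>f x / A * (g x / B)\<bar>)"
        using fg by (simp add: integrable_abs)
      show "integrable M (\<lambda>x. \<bar>f x\<bar> powr s / (A powr s * s) + \<bar>g x\<bar> powr t / (B powr t * t))"
        using lspace_integrable[OF f] lspace_integrable[OF g] by simp
      show "\<bar>f x / A * (g x / B)\<bar> \<le> \<bar>f x\<bar> powr s / (A powr s * s) + \<bar>g x\<bar> powr t / (B powr t * t)" for x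
        using young[of "f x / A" "g x / B"] pos by (simp add: powr_divide)
    qed
    also have "\<dots> = (LINT x|M. \<bar>f x\<bar> powr s) / (A powr s * s) + (LINT x|M. \<bar>g x\<bar> powr t) / (B powr t * t)"
      using lspace_integrable[OF f] lspace_integrable[OF g] by simp
    also have "\<dots> = 1 / s + 1 / t"
    proof -
      have "(LINT x|M. \<bar>f x\<bar> powr s) = A powr s" "(LINT x|M. \<bar>g x\<bar> powr t) = B powr t"
        using c lnorm_powr[of s M f] lnorm_powr[of t M g] by (auto simp: A_def B_def)
      then show ?thesis using pos by simp
    qed
    finally show ?thesis using c pos by (simp add: divide_le_eq A_def B_def)
  qed
  show "\<bar>LINT x|M. f x * g x\<bar> \<le> lnorm M s f * lnorm M t g"
    using integral_abs_bound[of M "\<lambda>x. f x * g x"] le by linarith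
qed

text \<open>The duality map of L^s: paired with |f|, its image |f|^(s-1) gives the s-th power of the
  norm. Both claims rest on (s-1) t = s.\<close>

lemma lspace_dual:
  assumes st: "conjugate s t" and f: "f \<in> lspace M s"
  shows "(\<lambda>x. \<bar>f x\<bar> powr (s - 1)) \<in> lspace M t"
    and "lnorm M t (\<lambda>x. \<bar>f x\<bar> powr (s - 1)) = lnorm M s f powr (s - 1)"
proof -
  note c = conjugateD[OF st]
  have e: "(s - 1) * t = s" using c by (simp add: field_simps)
  have [measurable]: "f \<in> borel_measurable M" using f by (simp add: lspace_def)
  show "(\<lambda>x. \<bar>f x\<bar> powr (s - 1)) \<in> lspace M t"
    using f by (auto simp: lspace_def powr_powr e)
  have e2: "1 / t = (s - 1) / s" using c by (simp add: field_simps)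
  show "lnorm M t (\<lambda>x. \<bar>f x\<bar> powr (s - 1)) = lnorm M s f powr (s - 1)"
    by (simp add: lnorm_def powr_powr e e2)
qed

lemma conjugate_ex: "1 < s \<Longrightarrow> conjugate s (s / (s - 1))"
  by (auto simp: conjugate_def field_simps)

text \<open>Minkowski by duality: write |f+g|^s as |f+g| times |f+g|^(s-1), apply Hoelder to each
  summand, and cancel the common power of the norm, which is allowed unless that norm is 0.\<close>

lemma lnorm_triangle:
  assumes f: "f \<in> lspace M s" and g: "g \<in> lspace M s" and s: "1 < s"
  shows "lnorm M s (\<lambda>x. f x + g x) \<le> lnorm M s f + lnorm M s g"
proof -
  define t where "t = s / (s - 1)"
  have st: "conjugate s t" using s unfolding t_def by (rule conjugate_ex)
  let ?h = "\<lambda>x. f x + g x"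
  have h: "?h \<in> lspace M s" using f g s by (intro lspace_add) auto
  let ?d = "\<lambda>x. \<bar>?h x\<bar> powr (s - 1)"
  have "\<bar>?h x\<bar> powr s = \<bar>?h x\<bar> * ?d x" for x
    using powr_add[of "\<bar>?h x\<bar>" 1 "s - 1"] by (cases "?h x = 0") auto
  then have "(LINT x|M. \<bar>?h x\<bar> powr s) = (LINT x|M. \<bar>?h x\<bar> * ?d x)" by simp
  also have "\<dots> \<le> (LINT x|M. \<bar>f x * ?d x\<bar> + \<bar>g x * ?d x\<bar>)"
    using Holder_integrable[OF st _ lspace_dual(1)[OF st h]] f g h
    by (intro integral_mono Bochner_Integration.integrable_add integrable_abs)
       (auto simp: abs_mult distrib_right[symmetric] mult_right_mono
             intro!: Bochner_Integration.integrable_bound[OF Holder_integrable[OF st h lspace_dual(1)[OF st h]]] borel_measurable_times borel_measurable_abs lspace_measurable[OF h] lspace_measurable[OF lspace_dual(1)[OF st h]])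
  also have "\<dots> = (LINT x|M. \<bar>f x * ?d x\<bar>) + (LINT x|M. \<bar>g x * ?d x\<bar>)"
    using Holder_integrable[OF st f lspace_dual(1)[OF st h]] Holder_integrable[OF st g lspace_dual(1)[OF st h]]
    by (intro Bochner_Integration.integral_add integrable_abs)
  also have "\<dots> \<le> (lnorm M s f + lnorm M s g) * lnorm M s ?h powr (s - 1)"
    using Holder_abs[OF st f lspace_dual(1)[OF st h]] Holder_abs[OF st g lspace_dual(1)[OF st h]]
    by (simp add: lspace_dual(2)[OF st h] distrib_right)
  finally have "lnorm M s ?h powr s \<le> (lnorm M s f + lnorm M s g) * lnorm M s ?h powr (s - 1)"
    using s by (simp add: lnorm_powr)
  then have le: "lnorm M s ?h * lnorm M s ?h powr (s - 1) \<le> (lnorm M s f + lnorm M s g) * lnorm M s ?h powr (s - 1)"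
    using powr_add[of "lnorm M s ?h" 1 "s - 1"] by (cases "lnorm M s ?h = 0") auto
  show ?thesis
  proof (cases "lnorm M s ?h = 0")
    case True then show ?thesis by simp
  next
    case False
    then have "0 < lnorm M s ?h powr (s - 1)" by simp
    with le show ?thesis by simp
  qed
qed

lemma lnorm_triangle_diff:
  assumes f: "f \<in> lspace M s" and g: "g \<in> lspace M s" and s: "1 < s"
  shows "lnorm M s (\<lambda>x. f x - g x) \<le> lnorm M s f + lnorm M s g"
  using lnorm_triangle[OF f lspace_uminus[OF g] s] by (simp add: lnorm_uminus)

lemma lnorm_triangle_sum:
  assumes "\<And>i. i \<in> I \<Longrightarrow> f i \<in> lspace M s" and s: "1 < s"
  shows "lnorm M s (\<lambda>x. \<Sum>i\<in>I. f i x) \<le> (\<Sum>i\<in>I. lnorm M s (f i))"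
  using assms(1)
proof (induction I rule: infinite_finite_induct)
  case (insert i I)
  have "lnorm M s (\<lambda>x. f i x + (\<Sum>i\<in>I. f i x)) \<le> lnorm M s (f i) + lnorm M s (\<lambda>x. \<Sum>i\<in>I. f i x)"
    using insert s by (intro lnorm_triangle lspace_sum) auto
  with insert show ?case by simp
qed (use s in \<open>auto simp: lnorm_def\<close>)

lemma lspace_bounded_mult:
  assumes f: "f \<in> lspace M s" and g: "g \<in> borel_measurable M" "\<And>x. \<bar>g x\<bar> \<le> c" and s: "0 < s"
  shows "(\<lambda>x. g x * f x) \<in> lspace M s" and "lnorm M s (\<lambda>x. g x * f x) \<le> c * lnorm M s f"
proof -
  have c: "0 \<le> c" using g(2) by (meson abs_ge_zero order_trans)
  have le: "AE x in M. \<bar>g x * f x\<bar> \<le> \<bar>c * f x\<bar>"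
    using g(2) c by (auto simp: abs_mult intro!: mult_right_mono)
  have m: "(\<lambda>x. g x * f x) \<in> borel_measurable M" using g f by (auto simp: lspace_def)
  show "(\<lambda>x. g x * f x) \<in> lspace M s" "lnorm M s (\<lambda>x. g x * f x) \<le> c * lnorm M s f"
    using lspace_mono[OF lspace_cmult[OF f] m le s] c s by (auto simp: lnorm_cmult)
qed

lemma lnorm_cong_AE:
  assumes "AE x in M. f x = g x" "f \<in> borel_measurable M" "g \<in> borel_measurable M"
  shows "lnorm M s f = lnorm M s g"
  unfolding lnorm_def using assms by (intro arg_cong2[where f="(powr)"] integral_cong_AE) auto

section \<open>Averages of translates\<close>

text \<open>On the open half-line this is convexity of the power; an endpoint at 0 reduces to u^s
  \<le> u for 0 < u < 1, and the modulus can be put in front because the power is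
  increasing.\<close>

lemma convex_abs_powr:
  assumes "1 \<le> s"
  shows "convex_on UNIV (\<lambda>x::real. \<bar>x\<bar> powr s)"
proof (intro convex_onI)
  fix t x y :: real assume t: "0 < t" "t < 1"
  have *: "((1 - t) * a + t * b) powr s \<le> (1 - t) * a powr s + t * b powr s" if "0 \<le> a" "0 \<le> b" for a b
  proof -
    have le: "u powr s \<le> u" if "0 < u" "u < 1" for u :: real
      using powr_mono'[of 1 s u] that assms by simp
    consider "a = 0" | "b = 0" | "0 < a" "0 < b" using \<open>0 \<le> a\<close> \<open>0 \<le> b\<close> by linarith
    then show ?thesis
    proof cases
      case 1
      then show ?thesis using le[of t] t that by (simp add: powr_mult mult_right_mono)
    next
      case 2
      then show ?thesis using le[of "1 - t"] t that by (simp add: powr_mult mult_right_mono)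
    next
      case 3
      then show ?thesis using convex_onD[OF powr_convex[OF assms], of t a b] t by simp
    qed
  qed
  have "\<bar>(1 - t) *\<^sub>R x + t *\<^sub>R y\<bar> \<le> (1 - t) * \<bar>x\<bar> + t * \<bar>y\<bar>"
    using abs_triangle_ineq[of "(1 - t) * x" "t * y"] t by (simp add: abs_mult)
  then have "\<bar>(1 - t) *\<^sub>R x + t *\<^sub>R y\<bar> powr s \<le> ((1 - t) * \<bar>x\<bar> + t * \<bar>y\<bar>) powr s"
    using assms by (intro powr_mono2) auto
  also have "\<dots> \<le> (1 - t) * \<bar>x\<bar> powr s + t * \<bar>y\<bar> powr s" by (rule *) auto
  finally show "\<bar>(1 - t) *\<^sub>R x + t *\<^sub>R y\<bar> powr s \<le> (1 - t) * \<bar>x\<bar> powr s + t * \<bar>y\<bar> powr s" .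
qed auto

text \<open>Jensen in a form that covers all measurable f: a non-integrable f has Bochner integral
  0, and a non-integrable power makes the right-hand side infinite.\<close>

lemma (in prob_space) abs_powr_integral_le_nn_integral:
  assumes "1 \<le> s" and [measurable]: "f \<in> borel_measurable M"
  shows "ennreal (\<bar>LINT x|M. f x\<bar> powr s) \<le> (\<integral>\<^sup>+x. ennreal (\<bar>f x\<bar> powr s) \<partial>M)"
proof -
  consider "\<not> integrable M f" | "\<not> integrable M (\<lambda>x. \<bar>f x\<bar> powr s)"
    | "integrable M f" "integrable M (\<lambda>x. \<bar>f x\<bar> powr s)" by blast
  then show ?thesis
  proof cases
    case 1
    then show ?thesis by (simp add: not_integrable_integral_eq)
  next
    case 2
    have "(\<integral>\<^sup>+x. ennreal (\<bar>f x\<bar> powr s) \<partial>M) = \<infinity>"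
    proof (rule ccontr)
      assume "(\<integral>\<^sup>+x. ennreal (\<bar>f x\<bar> powr s) \<partial>M) \<noteq> \<infinity>"
      then have "integrable M (\<lambda>x. \<bar>f x\<bar> powr s)"
        by (intro integrableI_nonneg) (simp_all add: top.not_eq_extremum)
      with 2 show False by blast
    qed
    then show ?thesis by simp
  next
    case 3
    then have "\<bar>LINT x|M. f x\<bar> powr s \<le> (LINT x|M. \<bar>f x\<bar> powr s)"
      using jensens_inequality[of f UNIV 0 0 "\<lambda>x. \<bar>x\<bar> powr s"] convex_abs_powr[OF assms(1)] by simp
    then show ?thesis
      using nn_integral_eq_integral[OF 3(2)] by (simp add: ennreal_leI)
  qed
qed

definition avg :: "'a::euclidean_space measure \<Rightarrow> ('a \<Rightarrow> real) \<Rightarrow> 'a \<Rightarrow> real" where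
  "avg \<mu> f x = (LINT z|\<mu>. f (x + z))"

text \<open>Holds for every f: translation preserves measurability in both directions, and for
  non-measurable f both integrals take the default value 0.\<close>

lemma integral_shift:
  fixes f :: "'a::euclidean_space \<Rightarrow> 'b::{banach, second_countable_topology}"
  shows "(LINT x|lborel. f (x + z)) = (LINT x|lborel. f x)"
    and "integrable lborel (\<lambda>x. f (x + z)) \<longleftrightarrow> integrable lborel f"
proof -
  have eq: "distr lborel borel (\<lambda>x. x + z) = (lborel :: 'a measure)"
  proof -
    have "(\<lambda>x. x + z) = (+) z" by (auto simp: add.commute)
    then show ?thesis by (simp add: lborel_distr_plus)
  qed
  have m: "(\<lambda>x. x + z) \<in> borel_measurable (lborel :: 'a measure)" by simp
  have inv: "(\<lambda>x. x - z) \<in> borel_measurable (borel :: 'a measure)" by simp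
  have meas: "(\<lambda>x. f (x + z)) \<in> borel_measurable borel \<longleftrightarrow> f \<in> borel_measurable borel"
  proof
    assume "(\<lambda>x. f (x + z)) \<in> borel_measurable borel"
    from measurable_compose[OF inv this] show "f \<in> borel_measurable borel" by simp
  qed simp
  show i: "integrable lborel (\<lambda>x. f (x + z)) \<longleftrightarrow> integrable lborel f"
  proof (cases "f \<in> borel_measurable borel")
    case True
    show ?thesis
      using integrable_distr_eq[OF m, of f] True by (simp add: eq)
  next
    case False
    then show ?thesis using meas borel_measurable_integrable by force
  qed
  show "(LINT x|lborel. f (x + z)) = (LINT x|lborel. f x)"
  proof (cases "f \<in> borel_measurable borel")
    case True
    show ?thesis using integral_distr[OF m, of f] True by (simp add: eq)
  next
    case False
    then have "\<not> integrable lborel f" "\<not> integrable lborel (\<lambda>x. f (x + z))"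
      using meas borel_measurable_integrable by force+
    then show ?thesis by (simp add: not_integrable_integral_eq)
  qed
qed

lemma nn_integral_shift:
  fixes f :: "'a::euclidean_space \<Rightarrow> ennreal"
  assumes "f \<in> borel_measurable borel"
  shows "(\<integral>\<^sup>+x. f (x + z) \<partial>lborel) = (\<integral>\<^sup>+x. f x \<partial>lborel)"
proof -
  have eq: "distr lborel borel (\<lambda>x. x + z) = (lborel :: 'a measure)"
  proof -
    have "(\<lambda>x. x + z) = (+) z" by (auto simp: add.commute)
    then show ?thesis by (simp add: lborel_distr_plus)
  qed
  show ?thesis using nn_integral_distr[of "\<lambda>x. x + z" lborel borel f] assms by (simp add: eq)
qed

text \<open>Bounded support preserves compact supports, and its radius \<open>r\<close> measures how
  far \<open>avg \<mu> f\<close> is from f; reflection symmetry makes averaging self-adjoint.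
  Mollifiers, two-point averages, segment averages and ball means are all instances.\<close>

locale averaging = prob_space \<mu> for \<mu> :: "'a::euclidean_space measure" +
  fixes r :: real
  assumes sets_eq [measurable_cong, simp]: "sets \<mu> = sets borel"
    and bounded_supp: "AE z in \<mu>. norm z \<le> r"
    and symmetric: "distr \<mu> borel uminus = \<mu>"
begin

lemma space_eq [simp]: "space \<mu> = UNIV"
  using sets_eq_imp_space_eq[OF sets_eq] by simp

lemma r_nonneg: "0 \<le> r"
proof -
  have "AE z in \<mu>. 0 \<le> r"
    using bounded_supp by (rule eventually_mono) (use norm_ge_zero order_trans in blast)
  then show ?thesis by simp
qed

sublocale zx: pair_sigma_finite \<mu> "lborel :: 'a measure" ..

sublocale xz: pair_sigma_finite "lborel :: 'a measure" \<mu> ..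

lemma integral_reflect: "(LINT z|\<mu>. g (- z)) = (LINT z|\<mu>. g z)" if "g \<in> borel_measurable borel" for g :: "'a \<Rightarrow> real"
  using integral_distr[of uminus \<mu> borel g] that by (simp add: symmetric)

lemma avg_measurable [measurable]:
  assumes [measurable]: "f \<in> borel_measurable borel"
  shows "avg \<mu> f \<in> borel_measurable borel"
proof -
  have "(\<lambda>x. LINT z|\<mu>. f (x + z)) \<in> borel_measurable borel"
    by (rule borel_measurable_lebesgue_integral) measurable
  then show ?thesis by (simp add: avg_def[abs_def])
qed

lemma nn_integral_abs_powr_le:
  fixes w :: "'a \<Rightarrow> 'a \<Rightarrow> real"
  assumes s: "1 \<le> s" and [measurable]: "case_prod w \<in> borel_measurable (borel \<Otimes>\<^sub>M borel)"
  shows "(\<integral>\<^sup>+x. ennreal (\<bar>LINT z|\<mu>. w x z\<bar> powr s) \<partial>lborel)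
    \<le> (\<integral>\<^sup>+z. (\<integral>\<^sup>+x. ennreal (\<bar>w x z\<bar> powr s) \<partial>lborel) \<partial>\<mu>)"
proof -
  have "(\<integral>\<^sup>+x. ennreal (\<bar>LINT z|\<mu>. w x z\<bar> powr s) \<partial>lborel)
      \<le> (\<integral>\<^sup>+x. (\<integral>\<^sup>+z. ennreal (\<bar>w x z\<bar> powr s) \<partial>\<mu>) \<partial>lborel)"
    by (intro nn_integral_mono abs_powr_integral_le_nn_integral s) measurable
  also have "\<dots> = (\<integral>\<^sup>+z. (\<integral>\<^sup>+x. ennreal (\<bar>w x z\<bar> powr s) \<partial>lborel) \<partial>\<mu>)"
    by (rule zx.Fubini'[of "\<lambda>z x. ennreal (\<bar>w x z\<bar> powr s)"]) measurable
  finally show ?thesis .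
qed

text \<open>Minkowski's integral inequality for a probability measure: Jensen in the averaging
  variable followed by Tonelli. Contraction of averages and the bounds on f -
  \<open>avg \<mu> f\<close> are obtained by a choice of \<open>w\<close>.\<close>

lemma lnorm_integral_le:
  fixes w :: "'a \<Rightarrow> 'a \<Rightarrow> real"
  assumes s: "1 \<le> s" and w [measurable]: "case_prod w \<in> borel_measurable (borel \<Otimes>\<^sub>M borel)"
    and c: "0 \<le> c" and le: "AE z in \<mu>. (\<lambda>x. w x z) \<in> lspace lborel s \<and> lnorm lborel s (\<lambda>x. w x z) \<le> c"
  shows "(\<lambda>x. LINT z|\<mu>. w x z) \<in> lspace lborel s"
    and "lnorm lborel s (\<lambda>x. LINT z|\<mu>. w x z) \<le> c"
proof -
  have m [measurable]: "(\<lambda>x. LINT z|\<mu>. w x z) \<in> borel_measurable lborel"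
    by (rule borel_measurable_lebesgue_integral) measurable
  have "(\<integral>\<^sup>+x. ennreal (\<bar>LINT z|\<mu>. w x z\<bar> powr s) \<partial>lborel) \<le> (\<integral>\<^sup>+z. ennreal (c powr s) \<partial>\<mu>)"
  proof (rule order_trans[OF nn_integral_abs_powr_le[OF s w] nn_integral_mono_AE])
    show "AE z in \<mu>. (\<integral>\<^sup>+x. ennreal (\<bar>w x z\<bar> powr s) \<partial>lborel) \<le> ennreal (c powr s)"
      using le
    proof (rule eventually_mono)
      fix z assume z: "(\<lambda>x. w x z) \<in> lspace lborel s \<and> lnorm lborel s (\<lambda>x. w x z) \<le> c"
      then have "(\<integral>\<^sup>+x. ennreal (\<bar>w x z\<bar> powr s) \<partial>lborel) = ennreal (LINT x|lborel. \<bar>w x z\<bar> powr s)"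
        by (intro nn_integral_eq_integral lspace_integrable) auto
      also have "\<dots> \<le> ennreal (c powr s)"
        using z s c by (intro ennreal_leI) (auto simp: lnorm_le_iff)
      finally show "(\<integral>\<^sup>+x. ennreal (\<bar>w x z\<bar> powr s) \<partial>lborel) \<le> ennreal (c powr s)" .
    qed
  qed
  also have "\<dots> = ennreal (c powr s)"
    using emeasure_space_1 by simp
  finally have nn: "(\<integral>\<^sup>+x. ennreal (\<bar>LINT z|\<mu>. w x z\<bar> powr s) \<partial>lborel) \<le> ennreal (c powr s)" .
  have int: "integrable lborel (\<lambda>x. \<bar>LINT z|\<mu>. w x z\<bar> powr s)"
    using nn by (intro integrableI_nonneg) (auto intro: le_less_trans)
  then show "(\<lambda>x. LINT z|\<mu>. w x z) \<in> lspace lborel s" by (intro lspaceI m)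
  have "(LINT x|lborel. \<bar>LINT z|\<mu>. w x z\<bar> powr s) \<le> c powr s"
    using nn nn_integral_eq_integral[OF int] by (simp add: ennreal_le_iff)
  then show "lnorm lborel s (\<lambda>x. LINT z|\<mu>. w x z) \<le> c"
    using s c by (subst lnorm_le_iff) auto
qed

lemma lspace_shift:
  assumes "f \<in> lspace lborel s"
  shows "(\<lambda>x. f (x + z)) \<in> lspace lborel s" "lnorm lborel s (\<lambda>x. f (x + z)) = lnorm lborel s f"
  using assms integral_shift(1)[of "\<lambda>x. \<bar>f x\<bar> powr s" z] integral_shift(2)[of "\<lambda>x. \<bar>f x\<bar> powr s" z]
  by (auto simp: lspace_def lnorm_def)

lemma avg_lspace:
  assumes s: "1 \<le> s" and f: "f \<in> lspace lborel s"
  shows "avg \<mu> f \<in> lspace lborel s" "lnorm lborel s (avg \<mu> f) \<le> lnorm lborel s f"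
proof -
  have [measurable]: "f \<in> borel_measurable borel" using lspace_measurable[OF f] by simp
  have m: "case_prod (\<lambda>x z. f (x + z)) \<in> borel_measurable (borel \<Otimes>\<^sub>M borel)" by measurable
  show "avg \<mu> f \<in> lspace lborel s" "lnorm lborel s (avg \<mu> f) \<le> lnorm lborel s f"
    using lnorm_integral_le[OF s m, of "lnorm lborel s f"] lspace_shift[OF f]
    by (auto simp: avg_def[abs_def])
qed

lemma integral_avg:
  assumes f: "integrable lborel f"
  shows "(LINT x|lborel. avg \<mu> f x) = (LINT x|lborel. f x)"
proof -
  have [measurable]: "f \<in> borel_measurable borel" using borel_measurable_integrable[OF f] by simp
  have i: "integrable lborel (\<lambda>x. norm (f x))" using f by simp
  have "integrable (\<mu> \<Otimes>\<^sub>M lborel) (case_prod (\<lambda>z x. f (x + z)))"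
  proof (rule zx.Fubini_integrable)
    show "integrable \<mu> (\<lambda>z. LINT x|lborel. norm (case_prod (\<lambda>z x. f (x + z)) (z, x)))"
      using integral_shift(1)[of "\<lambda>x. norm (f x)"] by simp
    show "AE z in \<mu>. integrable lborel (\<lambda>x. case_prod (\<lambda>z x. f (x + z)) (z, x))"
      using f by (simp add: integral_shift(2))
  qed measurable
  from zx.Fubini_integral[OF this] show ?thesis
    using integral_shift(1)[of f] prob_space by (simp add: avg_def)
qed

text \<open>Self-adjointness: Fubini turns the left side into a correlation at shift z, translation
  moves the shift to the other factor with the opposite sign, and the symmetry of \<mu> removes the
  sign.\<close>

lemma integral_avg_mult:
  assumes st: "conjugate s t" and f: "f \<in> lspace lborel s" and g: "g \<in> lspace lborel t"
  shows "(LINT x|lborel. avg \<mu> f x * g x) = (LINT x|lborel. f x * avg \<mu> g x)"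
proof -
  have [measurable]: "f \<in> borel_measurable borel" "g \<in> borel_measurable borel"
    using lspace_measurable[OF f] lspace_measurable[OF g] by auto
  \<comment> \<open>Stated for arbitrary functions and exponents, since it is used a second time
    with \<open>f\<close>, \<open>g\<close> and \<open>s\<close>, \<open>t\<close>
    exchanged.\<close>
  have gen: "(LINT x|lborel. avg \<mu> f x * g x) = (LINT z|\<mu>. LINT x|lborel. f (x + z) * g x)"
    if st: "conjugate s t" and f: "f \<in> lspace lborel s" and g: "g \<in> lspace lborel t" for f g s t
  proof -
    have [measurable]: "f \<in> borel_measurable borel" "g \<in> borel_measurable borel"
      using lspace_measurable[OF f] lspace_measurable[OF g] by auto
    have [measurable]: "(\<lambda>z. LINT x|lborel. norm (f (x + z) * g x)) \<in> borel_measurable borel"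
      by (rule lborel.borel_measurable_lebesgue_integral) measurable
    have "integrable (\<mu> \<Otimes>\<^sub>M lborel) (case_prod (\<lambda>z x. f (x + z) * g x))"
    proof (rule zx.Fubini_integrable)
      show "integrable \<mu> (\<lambda>z. LINT x|lborel. norm (case_prod (\<lambda>z x. f (x + z) * g x) (z, x)))"
      proof (rule integrable_const_bound[where B="lnorm lborel s f * lnorm lborel t g"])
        show "AE z in \<mu>. norm (LINT x|lborel. norm (case_prod (\<lambda>z x. f (x + z) * g x) (z, x))) \<le> lnorm lborel s f * lnorm lborel t g"
          using Holder_abs[OF st lspace_shift(1)[OF f] g] by (auto simp: lspace_shift(2)[OF f])
      qed simp
      show "AE z in \<mu>. integrable lborel (\<lambda>x. case_prod (\<lambda>z x. f (x + z) * g x) (z, x))"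
        using Holder_integrable[OF st lspace_shift(1)[OF f] g] by simp
    qed measurable
    from zx.Fubini_integral[OF this] show ?thesis by (simp add: avg_def)
  qed
  have "(LINT x|lborel. avg \<mu> f x * g x) = (LINT z|\<mu>. LINT x|lborel. f (x + z) * g x)"
    by (rule gen[OF st f g])
  also have "\<dots> = (LINT z|\<mu>. LINT x|lborel. f (x + - z + z) * g (x + - z))"
    by (subst integral_shift(1)[where f="\<lambda>x. f (x + z) * g x" and z="- z" for z]) (rule refl)
  also have "\<dots> = (LINT z|\<mu>. LINT x|lborel. g (x + - z) * f x)"
    by (simp add: mult.commute)
  also have "\<dots> = (LINT z|\<mu>. LINT x|lborel. g (x + z) * f x)"
  proof (rule integral_reflect)
    show "(\<lambda>z. LINT x|lborel. g (x + z) * f x) \<in> borel_measurable borel"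
      by (rule lborel.borel_measurable_lebesgue_integral) measurable
  qed
  also have "\<dots> = (LINT x|lborel. avg \<mu> g x * f x)"
    using gen[OF conjugateD(4)[OF st] g f] by simp
  finally show ?thesis by (simp add: mult.commute)
qed

end

section \<open>Smooth functions\<close>

definition pd :: "'n \<Rightarrow> (real^'n \<Rightarrow> real) \<Rightarrow> real^'n \<Rightarrow> real" where
  "pd i f x = grad f x $ i"

definition smooth :: "(real^'n \<Rightarrow> real) \<Rightarrow> bool" where
  "smooth f \<longleftrightarrow> (\<forall>k. C_k k f)"

lemma grad_eqI:
  assumes "GDERIV f x :> D"
  shows "grad f x = D"
  unfolding grad_def
proof (rule the_equality)
  fix E assume "GDERIV f x :> E"
  then have "(\<lambda>h. h \<bullet> E) = (\<lambda>h. h \<bullet> D)"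
    using assms unfolding gderiv_def by (rule has_derivative_unique)
  then show "E = D" by (metis vector_eq_ldot)
qed fact

lemma GDERIV_grad:
  fixes f :: "'a::euclidean_space \<Rightarrow> real"
  assumes "f differentiable (at x)"
  shows "GDERIV f x :> grad f x"
proof -
  obtain f' where f': "(f has_derivative f') (at x)" using assms unfolding differentiable_def by blast
  then have "linear f'" using has_derivative_linear by blast
  then have "f' = (\<lambda>h. h \<bullet> adjoint f' 1)" using adjoint_works[of f' _ 1] by auto
  then have "GDERIV f x :> adjoint f' 1" using f' by (simp add: gderiv_def)
  then show ?thesis using grad_eqI by metis
qed

lemma pd_eqI: "GDERIV f x :> D \<Longrightarrow> pd i f x = D $ i"
  by (simp add: pd_def grad_eqI)

lemma pd_add: "f differentiable (at x) \<Longrightarrow> g differentiable (at x) \<Longrightarrow> pd i (\<lambda>x. f x + g x) x = pd i f x + pd i g x"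
  by (subst pd_eqI[OF GDERIV_add[OF GDERIV_grad GDERIV_grad]]) (auto simp: pd_def)

lemma pd_mult: "f differentiable (at x) \<Longrightarrow> g differentiable (at x) \<Longrightarrow> pd i (\<lambda>x. f x * g x) x = f x * pd i g x + g x * pd i f x"
  by (subst pd_eqI[OF GDERIV_mult[OF GDERIV_grad GDERIV_grad]]) (auto simp: pd_def)

lemma pd_const: "pd i (\<lambda>x. c) = (\<lambda>x. 0)"
  by (rule ext, subst pd_eqI[OF GDERIV_const]) simp

lemma C_k_SucD: "C_k (Suc k) f \<Longrightarrow> C_k k f"
proof (induction k arbitrary: f)
  case 0
  then show ?case
    by (auto intro!: continuous_at_imp_continuous_on differentiable_imp_continuous_within)
next
  case (Suc k)
  show ?case
    unfolding C_k.simps(2)[of k f]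
  proof (intro conjI allI)
    show "f differentiable (at x)" for x using Suc.prems by simp
    show "C_k k (\<lambda>x. grad f x $ i)" for i
      using Suc.prems unfolding C_k.simps(2)[of "Suc k" f] by (intro Suc.IH) blast
  qed
qed

lemma smooth_iff: "smooth f \<longleftrightarrow> (\<forall>x. f differentiable (at x)) \<and> (\<forall>i. smooth (pd i f))"
proof
  assume "smooth f"
  then have *: "C_k (Suc k) f" for k by (simp only: smooth_def)
  show "(\<forall>x. f differentiable (at x)) \<and> (\<forall>i. smooth (pd i f))"
    using * unfolding C_k.simps(2) smooth_def pd_def[abs_def] by blast
next
  assume "(\<forall>x. f differentiable (at x)) \<and> (\<forall>i. smooth (pd i f))"
  then have *: "C_k (Suc k) f" for k
    unfolding C_k.simps(2) smooth_def pd_def[abs_def] by blast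
  then show "smooth f" unfolding smooth_def using C_k_SucD by blast
qed

lemma smooth_differentiable: "smooth f \<Longrightarrow> f differentiable (at x)"
  using smooth_iff by blast

lemma smooth_pd: "smooth f \<Longrightarrow> smooth (pd i f)"
  using smooth_iff by blast

lemma smooth_GDERIV: "smooth f \<Longrightarrow> GDERIV f x :> grad f x"
  by (simp add: GDERIV_grad smooth_differentiable)

lemma smooth_continuous: "smooth f \<Longrightarrow> continuous_on S f"
  by (auto intro!: continuous_at_imp_continuous_on differentiable_imp_continuous_within smooth_differentiable)

text \<open>Induction on the order, all members of the class at once; order 0 uses only that
  differentiable functions are continuous. It suits classes that derivatives map into themselves,
  such as translates and convolutions.\<close>

lemma smooth_coinduct [consumes 1]:
  assumes "P f" and step: "\<And>f. P f \<Longrightarrow> (\<forall>x. f differentiable (at x)) \<and> (\<forall>i. P (pd i f))"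
  shows "smooth f"
proof -
  have "\<forall>f. P f \<longrightarrow> C_k k f" for k
  proof (induction k)
    case 0
    then show ?case
      using step by (auto intro!: continuous_at_imp_continuous_on differentiable_imp_continuous_within)
  next
    case (Suc k)
    then show ?case using step unfolding C_k.simps(2) pd_def[abs_def] by blast
  qed
  then show ?thesis using assms(1) by (auto simp: smooth_def)
qed

lemma smooth_const: "smooth (\<lambda>x::real^'n. c)"
proof -
  have "\<forall>c. C_k k (\<lambda>x::real^'n. c)" for k
    by (induction k) (auto simp: pd_const[unfolded pd_def[abs_def]])
  then show ?thesis by (simp add: smooth_def)
qed

lemma smooth_add:
  fixes f g :: "real^'n \<Rightarrow> real"
  assumes "smooth f" "smooth g"
  shows "smooth (\<lambda>x. f x + g x)"
proof -
  have pd: "pd i (\<lambda>x. f x + g x) = (\<lambda>x. pd i f x + pd i g x)" if "smooth f" "smooth g" for i and f g :: "real^'n \<Rightarrow> real"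
    using that by (auto simp: pd_add smooth_differentiable)
  show ?thesis
  proof (rule smooth_coinduct[of "\<lambda>F. \<exists>u v. smooth u \<and> smooth v \<and> F = (\<lambda>x. u x + v x)"])
    show "\<exists>u v. smooth u \<and> smooth v \<and> (\<lambda>x. f x + g x) = (\<lambda>x. u x + v x)"
      using assms by blast
    fix F :: "real^'n \<Rightarrow> real"
    assume "\<exists>u v. smooth u \<and> smooth v \<and> F = (\<lambda>x. u x + v x)"
    then obtain u v where uv: "smooth u" "smooth v" "F = (\<lambda>x. u x + v x)" by blast
    then show "(\<forall>x. F differentiable (at x)) \<and> (\<forall>i. \<exists>u v. smooth u \<and> smooth v \<and> pd i F = (\<lambda>x. u x + v x))"
      using pd[OF uv(1,2)] smooth_pd[OF uv(1)] smooth_pd[OF uv(2)]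
        differentiable_add[OF smooth_differentiable[OF uv(1)] smooth_differentiable[OF uv(2)]]
      by blast
  qed
qed

text \<open>The derivative of a product is a sum of products, so the class of products is not closed
  under derivatives. The induction runs over the order with both factors smooth, using that each
  \<open>C_k\<close> is closed under sums.\<close>

lemma smooth_mult:
  fixes f g :: "real^'n \<Rightarrow> real"
  assumes "smooth f" "smooth g"
  shows "smooth (\<lambda>x. f x * g x)"
proof -
  have "\<forall>f g :: real^'n \<Rightarrow> real. smooth f \<longrightarrow> smooth g \<longrightarrow> C_k k (\<lambda>x. f x * g x)" for k
  proof (induction k)
    case 0
    then show ?case by (simp add: continuous_on_mult smooth_continuous)
  next
    case (Suc k)
    have add: "C_k k (\<lambda>x. f x + g x)" if "C_k k f" "C_k k g" for k and f g :: "real^'n \<Rightarrow> real"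
      using that
    proof (induction k arbitrary: f g)
      case 0
      then show ?case by (auto intro: continuous_on_add)
    next
      case (Suc k)
      have "(\<lambda>x. grad (\<lambda>x. f x + g x) x $ i) = (\<lambda>x. grad f x $ i + grad g x $ i)" for i
        using pd_add[of f _ g i] Suc.prems by (auto simp: pd_def)
      then show ?case using Suc by auto
    qed
    have "C_k (Suc k) (\<lambda>x. f x * g x)" if "smooth f" "smooth g" for f g :: "real^'n \<Rightarrow> real"
    proof -
      have pd: "pd i (\<lambda>x. f x * g x) = (\<lambda>x. f x * pd i g x + g x * pd i f x)" for i
        using that by (auto simp: pd_mult smooth_differentiable)
      have "C_k k (\<lambda>x. f x * pd i g x + g x * pd i f x)" for i
        using that by (intro add Suc.IH[rule_format] smooth_pd)
      then show ?thesis
        using pd that unfolding C_k.simps(2) pd_def[abs_def]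
        by (simp add: differentiable_mult smooth_differentiable)
    qed
    then show ?case by blast
  qed
  then show ?thesis using assms by (auto simp: smooth_def)
qed

lemma pd_smooth:
  assumes "smooth f" "smooth g"
  shows "pd i (\<lambda>x. f x + g x) = (\<lambda>x. pd i f x + pd i g x)"
    and "pd i (\<lambda>x. f x * g x) = (\<lambda>x. f x * pd i g x + g x * pd i f x)"
    and "pd i (\<lambda>x. c * f x) = (\<lambda>x. c * pd i f x)"
    and "pd i (\<lambda>x. - f x) = (\<lambda>x. - pd i f x)"
    and "pd i (\<lambda>x. f x - g x) = (\<lambda>x. pd i f x - pd i g x)"
proof -
  note d = smooth_differentiable[OF assms(1)] smooth_differentiable[OF assms(2)]
  show "pd i (\<lambda>x. f x + g x) = (\<lambda>x. pd i f x + pd i g x)" using d by (auto simp: pd_add)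
  show "pd i (\<lambda>x. f x * g x) = (\<lambda>x. f x * pd i g x + g x * pd i f x)" using d by (auto simp: pd_mult)
  show c: "pd i (\<lambda>x. c * f x) = (\<lambda>x. c * pd i f x)" for c
    using pd_mult[of "\<lambda>x. c" _ f i] d(1) by (auto simp: pd_const[THEN fun_cong])
  show "pd i (\<lambda>x. - f x) = (\<lambda>x. - pd i f x)"
    using c[of "-1"] by simp
  show "pd i (\<lambda>x. f x - g x) = (\<lambda>x. pd i f x - pd i g x)"
    by (rule ext, subst pd_eqI[OF GDERIV_diff[OF GDERIV_grad[OF d(1)] GDERIV_grad[OF d(2)]]]) (simp add: pd_def)
qed

lemma smooth_cmult: "smooth f \<Longrightarrow> smooth (\<lambda>x. c * f x)"
  by (intro smooth_mult smooth_const)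

lemma smooth_uminus: "smooth f \<Longrightarrow> smooth (\<lambda>x. - f x)"
  using smooth_cmult[of f "-1"] by simp

lemma smooth_diff: "smooth f \<Longrightarrow> smooth g \<Longrightarrow> smooth (\<lambda>x. f x - g x)"
  using smooth_add[of f "\<lambda>x. - g x"] smooth_uminus[of g] by simp

lemma smooth_sum: "(\<And>i. i \<in> I \<Longrightarrow> smooth (f i)) \<Longrightarrow> smooth (\<lambda>x. \<Sum>i\<in>I. f i x)"
  by (induction I rule: infinite_finite_induct) (auto intro: smooth_add smooth_const)

lemma pd_sum:
  assumes "\<And>j. j \<in> I \<Longrightarrow> smooth (f j)"
  shows "pd i (\<lambda>x. \<Sum>j\<in>I. f j x) = (\<lambda>x. \<Sum>j\<in>I. pd i (f j) x)"
  using assms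
  by (induction I rule: infinite_finite_induct) (auto simp: pd_const pd_smooth smooth_sum)

lemma pd_component: "pd i (\<lambda>x::real^'n. x $ j) = (\<lambda>x. if i = j then 1 else 0)"
proof
  fix x :: "real^'n"
  have "GDERIV (\<lambda>x. x $ j) x :> axis j 1"
    unfolding gderiv_def inner_axis
    by (simp add: bounded_linear_imp_has_derivative bounded_linear_vec_nth)
  then show "pd i (\<lambda>x. x $ j) x = (if i = j then 1 else 0)"
    by (subst pd_eqI) (auto simp: axis_def)
qed

lemma smooth_component: "smooth (\<lambda>x::real^'n. x $ j)"
proof -
  have "(\<lambda>x::real^'n. x $ j) differentiable (at x)" for x
    by (simp add: bounded_linear_imp_differentiable bounded_linear_vec_nth)
  then show ?thesis
    by (subst smooth_iff) (auto simp: pd_component smooth_const)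
qed

lemma smooth_mvt:
  fixes f :: "real^'n \<Rightarrow> real"
  assumes "smooth f" "0 < h"
  shows "\<exists>s. 0 < s \<and> s < h \<and> f (x + h *\<^sub>R v) - f x = h * (v \<bullet> grad f (x + s *\<^sub>R v))"
proof -
  have "((\<lambda>s. f (x + s *\<^sub>R v)) has_real_derivative v \<bullet> grad f (x + s *\<^sub>R v)) (at s)" for s
  proof -
    have "((\<lambda>s. f (x + s *\<^sub>R v)) has_derivative (\<lambda>t. (t *\<^sub>R v) \<bullet> grad f (x + s *\<^sub>R v))) (at s)"
      using smooth_GDERIV[OF assms(1), of "x + s *\<^sub>R v"] unfolding gderiv_def
      by (rule has_derivative_compose[rotated]) (auto intro!: derivative_eq_intros)
    then show ?thesis by (simp add: has_field_derivative_def mult.commute[of _ "_ \<bullet> _"] mult_commute_abs)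
  qed
  from MVT2[OF assms(2) this] show ?thesis by auto
qed

lemma smooth_shift:
  fixes f :: "real^'n \<Rightarrow> real"
  assumes "smooth f"
  shows "smooth (\<lambda>y. f (y + z))" and "pd k (\<lambda>y. f (y + z)) = (\<lambda>y. pd k f (y + z))"
proof -
  have g: "GDERIV (\<lambda>y. f (y + z)) y :> grad f (y + z)" if "smooth f" for y and f :: "real^'n \<Rightarrow> real"
  proof -
    have "((\<lambda>y. f (y + z)) has_derivative (\<lambda>h. h \<bullet> grad f (y + z))) (at y)"
      using smooth_GDERIV[OF that, of "y + z"] unfolding gderiv_def
      by (rule has_derivative_compose[rotated]) (auto intro!: derivative_eq_intros)
    then show ?thesis by (simp add: gderiv_def)
  qed
  have pd: "pd k (\<lambda>y. f (y + z)) = (\<lambda>y. pd k f (y + z))" if "smooth f" for k and f :: "real^'n \<Rightarrow> real"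
    using pd_eqI[OF g[OF that]] by (auto simp: pd_def)
  have "smooth (\<lambda>y. f (y + z))"
  proof (rule smooth_coinduct[of "\<lambda>F. \<exists>u. smooth u \<and> F = (\<lambda>y. u (y + z))"])
    show "\<exists>u. smooth u \<and> (\<lambda>y. f (y + z)) = (\<lambda>y. u (y + z))" using assms by blast
    fix F :: "real^'n \<Rightarrow> real"
    assume "\<exists>u. smooth u \<and> F = (\<lambda>y. u (y + z))"
    then obtain u where u: "smooth u" "F = (\<lambda>y. u (y + z))" by blast
    show "(\<forall>x. F differentiable (at x)) \<and> (\<forall>i. \<exists>u. smooth u \<and> pd i F = (\<lambda>y. u (y + z)))"
      using g[OF u(1)] pd[OF u(1)] smooth_pd[OF u(1)] unfolding u(2) gderiv_def differentiable_def by blast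
  qed
  then show "smooth (\<lambda>y. f (y + z))" .
  show "pd k (\<lambda>y. f (y + z)) = (\<lambda>y. pd k f (y + z))" by (rule pd[OF assms])
qed

text \<open>The second difference of f over a small parallelogram is symmetric in the two
  directions. The mean value theorem, applied in either order, writes it as h^2 times a mixed
  derivative at a nearby point, and continuity at x compares the two.\<close>

lemma pd_commute:
  fixes f :: "real^'n \<Rightarrow> real"
  assumes f: "smooth f"
  shows "pd i (pd j f) = pd j (pd i f)"
proof
  fix x :: "real^'n"
  have near: "\<exists>p. norm (p - x) \<le> 2 * h \<and> f (x + h *\<^sub>R axis i 1 + h *\<^sub>R axis j 1) - f (x + h *\<^sub>R axis i 1)
      - f (x + h *\<^sub>R axis j 1) + f x = h * (h * pd j (pd i f) p)" if h: "0 < h" for h i j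
  proof -
    let ?F = "\<lambda>y. f (y + h *\<^sub>R axis j 1) - f y"
    have F: "smooth ?F" by (intro smooth_diff smooth_shift(1) f)
    obtain s where s: "0 < s" "s < h" "?F (x + h *\<^sub>R axis i 1) - ?F x = h * (axis i 1 \<bullet> grad ?F (x + s *\<^sub>R axis i 1))"
      using smooth_mvt[OF F h] by blast
    have "axis i 1 \<bullet> grad ?F (x + s *\<^sub>R axis i 1) = pd i ?F (x + s *\<^sub>R axis i 1)"
      by (simp add: pd_def inner_axis')
    also have "\<dots> = pd i f (x + s *\<^sub>R axis i 1 + h *\<^sub>R axis j 1) - pd i f (x + s *\<^sub>R axis i 1)"
      using pd_smooth(5)[OF smooth_shift(1)[OF f] f] smooth_shift(2)[OF f] by metis
    finally have 1: "axis i 1 \<bullet> grad ?F (x + s *\<^sub>R axis i 1) = pd i f (x + s *\<^sub>R axis i 1 + h *\<^sub>R axis j 1) - pd i f (x + s *\<^sub>R axis i 1)" .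
    obtain t where t: "0 < t" "t < h" "pd i f (x + s *\<^sub>R axis i 1 + h *\<^sub>R axis j 1) - pd i f (x + s *\<^sub>R axis i 1)
       = h * (axis j 1 \<bullet> grad (pd i f) (x + s *\<^sub>R axis i 1 + t *\<^sub>R axis j 1))"
      using smooth_mvt[OF smooth_pd[OF f] h] by blast
    have "norm (x + s *\<^sub>R axis i 1 + t *\<^sub>R axis j 1 - x) \<le> s + t"
      using norm_triangle_ineq[of "s *\<^sub>R axis i (1::real)" "t *\<^sub>R axis j 1"] s t by simp
    then show ?thesis
      using s t 1 by (intro exI[of _ "x + s *\<^sub>R axis i 1 + t *\<^sub>R axis j 1"])
        (auto simp: pd_def inner_axis' algebra_simps)
  qed
  have "\<bar>pd i (pd j f) x - pd j (pd i f) x\<bar> < 2 * e" if e: "0 < e" for e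
  proof -
    have c: "continuous (at x) (pd i (pd j f))" "continuous (at x) (pd j (pd i f))"
      using smooth_continuous[OF smooth_pd[OF smooth_pd[OF f]], of UNIV] by (auto simp: continuous_on_eq_continuous_at)
    obtain d1 where d1: "0 < d1" "\<And>y. dist y x < d1 \<Longrightarrow> dist (pd i (pd j f) y) (pd i (pd j f) x) < e"
      using c(1) e unfolding continuous_at_eps_delta by metis
    obtain d2 where d2: "0 < d2" "\<And>y. dist y x < d2 \<Longrightarrow> dist (pd j (pd i f) y) (pd j (pd i f) x) < e"
      using c(2) e unfolding continuous_at_eps_delta by metis
    define h where "h = min d1 d2 / 3"
    have h: "0 < h" "2 * h < d1" "2 * h < d2" using d1 d2 by (auto simp: h_def)
    obtain p where p: "norm (p - x) \<le> 2 * h" "f (x + h *\<^sub>R axis i 1 + h *\<^sub>R axis j 1) - f (x + h *\<^sub>R axis i 1)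
      - f (x + h *\<^sub>R axis j 1) + f x = h * (h * pd j (pd i f) p)" using near[OF h(1)] by blast
    obtain q where q: "norm (q - x) \<le> 2 * h" "f (x + h *\<^sub>R axis j 1 + h *\<^sub>R axis i 1) - f (x + h *\<^sub>R axis j 1)
      - f (x + h *\<^sub>R axis i 1) + f x = h * (h * pd i (pd j f) q)" using near[OF h(1)] by blast
    have eq: "x + h *\<^sub>R axis j 1 + h *\<^sub>R axis i 1 = x + h *\<^sub>R axis i 1 + h *\<^sub>R (axis j 1 :: real^'n)" by simp
    have "h * (h * pd j (pd i f) p) = h * (h * pd i (pd j f) q)"
      using p(2) q(2)[unfolded eq] by linarith
    with h have "pd j (pd i f) p = pd i (pd j f) q" by simp
    moreover have "\<bar>pd i (pd j f) q - pd i (pd j f) x\<bar> < e" "\<bar>pd j (pd i f) p - pd j (pd i f) x\<bar> < e"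
      using d1(2)[of q] d2(2)[of p] p q h by (auto simp: dist_norm)
    ultimately show ?thesis by linarith
  qed
  from this[of "\<bar>pd i (pd j f) x - pd j (pd i f) x\<bar> / 2"]
  show "pd i (pd j f) x = pd j (pd i f) x" by fastforce
qed

section \<open>Test functions\<close>

definition compact_supp :: "('a::euclidean_space \<Rightarrow> real) \<Rightarrow> bool" where
  "compact_supp f \<longleftrightarrow> (\<exists>K. compact K \<and> (\<forall>x. x \<notin> K \<longrightarrow> f x = 0))"

text \<open>A companion of the test functions for the Bellman argument: composing with
  \<open>root 5\<close> or \<open>bell\<close> destroys smoothness but keeps continuity and compact
  support.\<close>

definition cont_cs :: "('a::euclidean_space \<Rightarrow> real) set" where
  "cont_cs = {f. continuous_on UNIV f \<and> compact_supp f}"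

lemma compact_supp_iff_cball: "compact_supp f \<longleftrightarrow> (\<exists>r. \<forall>x. r < norm x \<longrightarrow> f x = 0)"
proof
  assume "compact_supp f"
  then obtain K where K: "compact K" "\<And>x. x \<notin> K \<Longrightarrow> f x = 0" by (auto simp: compact_supp_def)
  then obtain r where "\<And>x. x \<in> K \<Longrightarrow> norm x \<le> r" using compact_imp_bounded bounded_iff by metis
  with K(2) show "\<exists>r. \<forall>x. r < norm x \<longrightarrow> f x = 0" by (metis not_less)
next
  assume "\<exists>r. \<forall>x. r < norm x \<longrightarrow> f x = 0"
  then obtain r where r: "\<And>x. r < norm x \<Longrightarrow> f x = 0" by blast
  then show "compact_supp f" unfolding compact_supp_def
    by (intro exI[of _ "cball 0 r"]) (auto simp: not_le)
qed

lemma compact_supp_mono: "compact_supp f \<Longrightarrow> (\<And>x. f x = 0 \<Longrightarrow> g x = 0) \<Longrightarrow> compact_supp g"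
  by (auto simp: compact_supp_def)

lemma compact_supp_mono2:
  assumes "compact_supp f" "compact_supp g" "\<And>x. f x = 0 \<Longrightarrow> g x = 0 \<Longrightarrow> h x = 0"
  shows "compact_supp h"
proof -
  obtain K L where "compact K" "\<And>x. x \<notin> K \<Longrightarrow> f x = 0" "compact L" "\<And>x. x \<notin> L \<Longrightarrow> g x = 0"
    using assms by (auto simp: compact_supp_def)
  then show ?thesis
    using assms(3) unfolding compact_supp_def by (intro exI[of _ "K \<union> L"]) auto
qed

lemma cont_csI: "continuous_on UNIV f \<Longrightarrow> compact_supp f \<Longrightarrow> f \<in> cont_cs"
  by (simp add: cont_cs_def)

lemma cont_cs_measurable: "f \<in> cont_cs \<Longrightarrow> f \<in> borel_measurable borel"
  by (simp add: cont_cs_def borel_measurable_continuous_onI)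

lemma cont_cs_integrable:
  assumes "f \<in> cont_cs"
  shows "integrable lborel f"
proof -
  obtain K where K: "compact K" "\<And>x. x \<notin> K \<Longrightarrow> f x = 0" and f: "continuous_on UNIV f"
    using assms by (auto simp: cont_cs_def compact_supp_def)
  have "integrable lborel (\<lambda>x. indicator K x *\<^sub>R f x)"
    using K(1) continuous_on_subset[OF f] by (intro borel_integrable_compact) auto
  also have "(\<lambda>x. indicator K x *\<^sub>R f x) = f" using K(2) by (auto simp: fun_eq_iff indicator_def)
  finally show ?thesis .
qed

lemma cont_cs_compose:
  assumes "f \<in> cont_cs" "continuous_on UNIV g" "g 0 = 0"
  shows "(\<lambda>x. g (f x)) \<in> cont_cs"
  using assms
  by (auto simp: cont_cs_def intro: compact_supp_mono continuous_on_compose2)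

lemma cont_cs_add: "f \<in> cont_cs \<Longrightarrow> g \<in> cont_cs \<Longrightarrow> (\<lambda>x. f x + g x) \<in> cont_cs"
  by (auto simp: cont_cs_def intro: compact_supp_mono2[of f g] continuous_on_add)

lemma cont_cs_diff: "f \<in> cont_cs \<Longrightarrow> g \<in> cont_cs \<Longrightarrow> (\<lambda>x. f x - g x) \<in> cont_cs"
  by (auto simp: cont_cs_def intro: compact_supp_mono2[of f g] continuous_on_diff)

lemma cont_cs_cmult: "f \<in> cont_cs \<Longrightarrow> (\<lambda>x. c * f x) \<in> cont_cs"
  by (auto simp: cont_cs_def intro: compact_supp_mono[of f] continuous_on_mult_left)

lemma cont_cs_mult: "f \<in> cont_cs \<Longrightarrow> continuous_on UNIV g \<Longrightarrow> (\<lambda>x. g x * f x) \<in> cont_cs"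
  by (auto simp: cont_cs_def intro: compact_supp_mono[of f] continuous_on_mult)

lemma cont_cs_mult': "f \<in> cont_cs \<Longrightarrow> g \<in> cont_cs \<Longrightarrow> (\<lambda>x. g x * f x) \<in> cont_cs"
  by (intro cont_cs_mult) (auto simp: cont_cs_def)

lemma cont_cs_zero: "(\<lambda>x. 0) \<in> cont_cs"
  by (auto simp: cont_cs_def compact_supp_def)

lemma cont_cs_sum: "(\<And>i. i \<in> I \<Longrightarrow> f i \<in> cont_cs) \<Longrightarrow> (\<lambda>x. \<Sum>i\<in>I. f i x) \<in> cont_cs"
  by (induction I rule: infinite_finite_induct) (auto intro: cont_cs_add cont_cs_zero)

lemma cont_cs_shift:
  assumes "f \<in> cont_cs"
  shows "(\<lambda>x. f (x + z)) \<in> cont_cs"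
proof -
  obtain r where r: "\<And>x. r < norm x \<Longrightarrow> f x = 0"
    using assms by (auto simp: cont_cs_def compact_supp_iff_cball)
  have "f (x + z) = 0" if "r + norm z < norm x" for x
    using r[of "x + z"] that norm_triangle_ineq4[of "x + z" z] by simp
  then have "compact_supp (\<lambda>x. f (x + z))" by (auto simp: compact_supp_iff_cball)
  moreover have "continuous_on UNIV (\<lambda>x. f (x + z))"
    using assms by (auto simp: cont_cs_def intro!: continuous_on_compose2[of UNIV f] continuous_intros)
  ultimately show ?thesis by (intro cont_csI)
qed

lemma cont_cs_lspace: "f \<in> cont_cs \<Longrightarrow> 0 < s \<Longrightarrow> f \<in> lspace lborel s"
  by (intro lspaceI cont_cs_integrable cont_cs_compose[of f "\<lambda>y. \<bar>y\<bar> powr s"] continuous_on_powr' continuous_intros)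
     (auto intro!: cont_cs_measurable)

lemma cont_cs_bounded:
  assumes "f \<in> cont_cs"
  obtains B where "0 \<le> B" "\<And>x. \<bar>f x\<bar> \<le> B"
proof -
  obtain K where K: "compact K" "\<And>x. x \<notin> K \<Longrightarrow> f x = 0" and f: "continuous_on UNIV f"
    using assms by (auto simp: cont_cs_def compact_supp_def)
  have "compact (f ` K)" using K(1) f by (intro compact_continuous_image) (auto intro: continuous_on_subset)
  then obtain B where B: "\<And>y. y \<in> f ` K \<Longrightarrow> norm y \<le> B"
    using compact_imp_bounded bounded_iff by metis
  have "\<bar>f x\<bar> \<le> max B 0" for x using K(2)[of x] B[of "f x"] by (cases "x \<in> K") auto
  then show ?thesis by (intro that[of "max B 0"]) auto
qed

lemma cont_cs_uniformly_continuous: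
  assumes "f \<in> cont_cs"
  shows "uniformly_continuous_on UNIV f"
proof -
  obtain r where r: "\<And>x. r < norm x \<Longrightarrow> f x = 0" and f: "continuous_on UNIV f"
    using assms by (auto simp: cont_cs_def compact_supp_iff_cball)
  have u: "uniformly_continuous_on (cball 0 (r + 1)) f"
    using f by (intro compact_uniformly_continuous) (auto intro: continuous_on_subset)
  show ?thesis
    unfolding uniformly_continuous_on_def
  proof (intro allI impI)
    fix e :: real assume e: "0 < e"
    then obtain d where d: "0 < d" "\<And>x y. x \<in> cball 0 (r + 1) \<Longrightarrow> y \<in> cball 0 (r + 1) \<Longrightarrow> dist y x < d \<Longrightarrow> dist (f y) (f x) < e"
      using u unfolding uniformly_continuous_on_def by metis
    have "dist (f y) (f x) < e" if xy: "dist y x < min d 1" for x y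
    proof (cases "norm x \<le> r \<or> norm y \<le> r")
      case True
      have "norm y \<le> norm x + dist y x" "norm x \<le> norm y + dist y x"
        using norm_triangle_sub[of y x] norm_triangle_sub[of x y] by (auto simp: dist_norm norm_minus_commute)
      then show ?thesis using True xy by (intro d(2)) auto
    next
      case False
      then show ?thesis using r[of x] r[of y] e by auto
    qed
    then show "\<exists>d>0. \<forall>x\<in>UNIV. \<forall>x'\<in>UNIV. dist x' x < d \<longrightarrow> dist (f x') (f x) < e"
      using d(1) by (intro exI[of _ "min d 1"]) auto
  qed
qed

abbreviation TF :: "(real^'n \<Rightarrow> real) set" where
  "TF \<equiv> test_functions UNIV"

lemma test_functions_iff:
  "f \<in> test_functions S \<longleftrightarrow> smooth f \<and> (\<exists>K. compact K \<and> K \<subseteq> S \<and> (\<forall>x. x \<notin> K \<longrightarrow> f x = 0))"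
proof
  assume f: "f \<in> test_functions S"
  have "\<forall>x. x \<notin> closure {x. f x \<noteq> 0} \<longrightarrow> f x = 0"
    using closure_subset[of "{x. f x \<noteq> 0}"] by blast
  then show "smooth f \<and> (\<exists>K. compact K \<and> K \<subseteq> S \<and> (\<forall>x. x \<notin> K \<longrightarrow> f x = 0))"
    using f unfolding test_functions_def smooth_def by blast
next
  assume "smooth f \<and> (\<exists>K. compact K \<and> K \<subseteq> S \<and> (\<forall>x. x \<notin> K \<longrightarrow> f x = 0))"
  then obtain K where K: "compact K" "K \<subseteq> S" "\<And>x. x \<notin> K \<Longrightarrow> f x = 0" and f: "smooth f" by blast
  have sub: "closure {x. f x \<noteq> 0} \<subseteq> K"
    using K by (intro closure_minimal compact_imp_closed) auto
  then have "compact (closure {x. f x \<noteq> 0})"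
    using compact_imp_bounded[OF K(1)] closure_subset bounded_subset
    unfolding compact_closure by (metis sub)
  then show "f \<in> test_functions S" using f sub K(2) unfolding test_functions_def smooth_def by blast
qed

lemma test_smooth: "f \<in> test_functions S \<Longrightarrow> smooth f"
  by (simp add: test_functions_iff)

lemma test_TF: "f \<in> test_functions S \<Longrightarrow> f \<in> TF"
  unfolding test_functions_iff by blast

lemma test_cont_cs: "f \<in> test_functions S \<Longrightarrow> f \<in> cont_cs"
  unfolding test_functions_iff cont_cs_def compact_supp_def using smooth_continuous by blast

lemma pd_eq_0_outside:
  assumes K: "closed K" "\<And>x. x \<notin> K \<Longrightarrow> f x = 0" and x: "x \<notin> K"
  shows "pd i f x = 0"
proof -
  have "((\<lambda>x. 0) has_derivative (\<lambda>h. 0)) (at x)" by simp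
  then have "(f has_derivative (\<lambda>h. 0)) (at x)"
    by (rule has_derivative_transform_within_open[of _ _ _ _ "- K"]) (use K x in \<open>auto simp: open_Compl\<close>)
  then have "GDERIV f x :> 0" by (simp add: gderiv_def)
  then show ?thesis by (simp add: pd_eqI)
qed

lemma test_pd:
  assumes "f \<in> test_functions S"
  shows "pd i f \<in> test_functions S"
proof -
  obtain K where K: "compact K" "K \<subseteq> S" "\<And>x. x \<notin> K \<Longrightarrow> f x = 0" and f: "smooth f"
    using assms by (auto simp: test_functions_iff)
  have "pd i f x = 0" if "x \<notin> K" for x
    using pd_eq_0_outside[of K f x i] K that compact_imp_closed by blast
  with K f show ?thesis by (auto simp: test_functions_iff intro!: smooth_pd)
qed

lemma test_mult: "f \<in> test_functions S \<Longrightarrow> smooth g \<Longrightarrow> (\<lambda>x. g x * f x) \<in> test_functions S"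
  unfolding test_functions_iff by (auto intro: smooth_mult)

lemma test_mult': "f \<in> test_functions S \<Longrightarrow> smooth g \<Longrightarrow> (\<lambda>x. f x * g x) \<in> test_functions S"
  unfolding test_functions_iff by (auto intro: smooth_mult)

lemma test_cmult: "f \<in> test_functions S \<Longrightarrow> (\<lambda>x. c * f x) \<in> test_functions S"
  by (intro test_mult smooth_const)

lemma test_add:
  assumes "f \<in> test_functions S" "g \<in> test_functions S"
  shows "(\<lambda>x. f x + g x) \<in> test_functions S"
proof -
  obtain K L where "compact K" "K \<subseteq> S" "\<And>x. x \<notin> K \<Longrightarrow> f x = 0" "compact L" "L \<subseteq> S" "\<And>x. x \<notin> L \<Longrightarrow> g x = 0"
    using assms by (auto simp: test_functions_iff)
  then show ?thesis
    using assms unfolding test_functions_iff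
    by (intro conjI smooth_add exI[of _ "K \<union> L"]) auto
qed

lemma test_uminus: "f \<in> test_functions S \<Longrightarrow> (\<lambda>x. - f x) \<in> test_functions S"
  using test_cmult[of f S "-1"] by simp

lemma test_diff: "f \<in> test_functions S \<Longrightarrow> g \<in> test_functions S \<Longrightarrow> (\<lambda>x. f x - g x) \<in> test_functions S"
  using test_add[of f S "\<lambda>x. - g x"] test_uminus[of g S] by simp

lemma test_zero: "(\<lambda>x. 0) \<in> test_functions S"
  by (auto simp: test_functions_iff smooth_const)

lemma test_sum: "(\<And>i. i \<in> I \<Longrightarrow> f i \<in> test_functions S) \<Longrightarrow> (\<lambda>x. \<Sum>i\<in>I. f i x) \<in> test_functions S"
  by (induction I rule: infinite_finite_induct) (auto intro: test_add test_zero)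

lemma smooth_power: "smooth f \<Longrightarrow> smooth (\<lambda>x. f x ^ n)"
  by (induction n) (auto intro: smooth_mult smooth_const)

lemma test_power: "f \<in> test_functions S \<Longrightarrow> (\<lambda>x. f x ^ Suc n) \<in> test_functions S"
  using test_mult[of f S "\<lambda>x. f x ^ n"] by (simp add: mult.commute smooth_power test_smooth)

lemma test_integrable: "f \<in> test_functions S \<Longrightarrow> integrable lborel f"
  by (intro cont_cs_integrable test_cont_cs)

lemma test_lspace: "f \<in> test_functions S \<Longrightarrow> 0 < s \<Longrightarrow> f \<in> lspace lborel s"
  by (intro cont_cs_lspace test_cont_cs)

lemma test_measurable: "f \<in> test_functions S \<Longrightarrow> f \<in> borel_measurable borel"
  by (intro cont_cs_measurable test_cont_cs)

text \<open>The remainder is uniform in x because the partial derivatives are uniformly continuous;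
  this uniformity lets \<open>smooth_convolution\<close> differentiate under an integral with any
  integrable weight.\<close>

lemma test_taylor:
  assumes f: "f \<in> TF" and e: "0 < e"
  shows "\<exists>d>0. \<forall>x h. norm h < d \<longrightarrow> \<bar>f (x + h) - f x - (\<Sum>i\<in>UNIV. h $ i * pd i f x)\<bar> \<le> e * norm h"
proof -
  have "\<exists>d>0. \<forall>x y. dist y x < d \<longrightarrow> \<bar>pd i f y - pd i f x\<bar> < e / CARD('a)" for i :: 'a
    using cont_cs_uniformly_continuous[OF test_cont_cs[OF test_pd[OF f]], of i] e
    unfolding uniformly_continuous_on_def dist_real_def by (auto simp: card_gt_0_iff)
  then obtain D where D: "\<And>i. 0 < D i" "\<And>i x y. dist y x < D i \<Longrightarrow> \<bar>pd i f y - pd i f x\<bar> < e / CARD('a)"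
    by metis
  define d where "d = Min (range D)"
  have d: "0 < d" "\<And>i. d \<le> D i" using D(1) by (auto simp: d_def)
  have "\<bar>f (x + h) - f x - (\<Sum>i\<in>UNIV. h $ i * pd i f x)\<bar> \<le> e * norm h" if h: "norm h < d" for x h
  proof -
    obtain s where s: "0 < s" "s < 1" "f (x + h) - f x = h \<bullet> grad f (x + s *\<^sub>R h)"
      using smooth_mvt[OF test_smooth[OF f], of 1 x h] by auto
    have "s * norm h \<le> 1 * norm h" using s by (intro mult_right_mono) auto
    then have near: "dist (x + s *\<^sub>R h) x < D i" for i
      using s h d(2)[of i] by (simp add: dist_norm)
    have "f (x + h) - f x - (\<Sum>i\<in>UNIV. h $ i * pd i f x) = (\<Sum>i\<in>UNIV. h $ i * (pd i f (x + s *\<^sub>R h) - pd i f x))"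
      unfolding s(3) inner_vec_def pd_def by (simp add: sum_subtractf right_diff_distrib)
    also have "\<bar>\<dots>\<bar> \<le> (\<Sum>i::'a\<in>UNIV. norm h * (e / CARD('a)))"
    proof (rule order_trans[OF sum_abs sum_mono])
      fix i
      show "\<bar>h $ i * (pd i f (x + s *\<^sub>R h) - pd i f x)\<bar> \<le> norm h * (e / CARD('a))"
        unfolding abs_mult using D(2)[OF near, of i] component_le_norm_cart[of h i]
        by (intro mult_mono) auto
    qed
    also have "\<dots> = e * norm h" by simp
    finally show ?thesis .
  qed
  with d show ?thesis by blast
qed

text \<open>Covers both averages of test functions (\<open>k = 1\<close>, \<open>M\<close> a probability measure) and
  convolutions of integrable functions with test functions (\<open>M\<close> the Lebesgue measure).\<close>

lemma smooth_convolution: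
  fixes f :: "real^'n \<Rightarrow> real" and M :: "(real^'n) measure"
  assumes f: "f \<in> TF" and sets: "sets M = sets borel" and k: "integrable M k"
  shows "smooth (\<lambda>x. LINT z|M. f (x + z) * k z)"
    and "pd i (\<lambda>x. LINT z|M. f (x + z) * k z) = (\<lambda>x. LINT z|M. pd i f (x + z) * k z)"
proof -
  note [measurable_cong] = sets
  have km [measurable]: "k \<in> borel_measurable M" using k by simp
  have int: "integrable M (\<lambda>z. f (x + z) * k z)" if f: "f \<in> TF" for f :: "real^'n \<Rightarrow> real" and x
  proof -
    obtain B where B: "0 \<le> B" "\<And>x. \<bar>f x\<bar> \<le> B" using cont_cs_bounded[OF test_cont_cs[OF f]] by blast
    have [measurable]: "f \<in> borel_measurable borel" using f by (rule test_measurable)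
    show ?thesis
      by (rule Bochner_Integration.integrable_bound[of _ "\<lambda>z. B * \<bar>k z\<bar>"])
         (use k B in \<open>auto simp: abs_mult intro!: mult_right_mono\<close>)
  qed
  have der: "GDERIV (\<lambda>x. LINT z|M. f (x + z) * k z) x :> (\<chi> i. LINT z|M. pd i f (x + z) * k z)"
    if f: "f \<in> TF" for f :: "real^'n \<Rightarrow> real" and x
    unfolding gderiv_def has_derivative_at_alt
  proof (intro conjI allI impI)
    show "bounded_linear (\<lambda>h. h \<bullet> (\<chi> i. LINT z|M. pd i f (x + z) * k z))"
      by (rule bounded_linear_inner_left)
    fix e :: real assume e: "0 < e"
    define A where "A = (LINT z|M. \<bar>k z\<bar>) + 1"
    have A: "0 < A" unfolding A_def by (simp add: add_nonneg_pos)
    obtain d where d: "0 < d" "\<And>x h. norm h < d \<Longrightarrow> \<bar>f (x + h) - f x - (\<Sum>i\<in>UNIV. h $ i * pd i f x)\<bar> \<le> e / A * norm h"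
      using test_taylor[OF f, of "e / A"] e A by auto
    have "norm ((LINT z|M. f (y + z) * k z) - (LINT z|M. f (x + z) * k z) - (y - x) \<bullet> (\<chi> i. LINT z|M. pd i f (x + z) * k z)) \<le> e * norm (y - x)"
      if y: "norm (y - x) < d" for y
    proof -
      let ?h = "y - x"
      have eq: "(LINT z|M. f (y + z) * k z) - (LINT z|M. f (x + z) * k z) - ?h \<bullet> (\<chi> i. LINT z|M. pd i f (x + z) * k z)
        = (LINT z|M. (f (x + z + ?h) - f (x + z) - (\<Sum>i\<in>UNIV. ?h $ i * pd i f (x + z))) * k z)" (is "?L = (LINT z|M. ?R z * k z)")
      proof -
        have "?h \<bullet> (\<chi> i. LINT z|M. pd i f (x + z) * k z) = (LINT z|M. (\<Sum>i\<in>UNIV. ?h $ i * (pd i f (x + z) * k z)))"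
          by (subst Bochner_Integration.integral_sum)
             (auto simp: inner_vec_def intro!: sum.cong integrable_mult_right int test_pd f)
        moreover have "integrable M (\<lambda>z. \<Sum>i\<in>UNIV. ?h $ i * (pd i f (x + z) * k z))"
          by (intro Bochner_Integration.integrable_sum integrable_mult_right int test_pd f)
        ultimately have "?L = (LINT z|M. f (y + z) * k z - f (x + z) * k z - (\<Sum>i\<in>UNIV. ?h $ i * (pd i f (x + z) * k z)))"
          using int[OF f, of y] int[OF f, of x] by simp
        also have "\<dots> = (LINT z|M. ?R z * k z)"
        proof -
          have e1: "x + z + (y - x) = y + z" for z by simp
          have e2: "(\<Sum>i\<in>UNIV. ?h $ i * (pd i f (x + z) * k z)) = (\<Sum>i\<in>UNIV. ?h $ i * pd i f (x + z)) * k z" for z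
            by (simp add: sum_distrib_right mult.assoc)
          show ?thesis unfolding e1 e2 left_diff_distrib by (rule refl)
        qed
        finally show ?thesis .
      qed
      have "norm ?L \<le> (LINT z|M. \<bar>?R z * k z\<bar>)"
        unfolding eq real_norm_def by (rule integral_abs_bound)
      also have "\<dots> \<le> (LINT z|M. (e / A * norm ?h) * \<bar>k z\<bar>)"
      proof (rule integral_mono')
        show "integrable M (\<lambda>z. e / A * norm (y - x) * \<bar>k z\<bar>)" using k by simp
        show "\<bar>?R z * k z\<bar> \<le> (e / A * norm ?h) * \<bar>k z\<bar>" for z
          unfolding abs_mult using d(2)[OF y, of "x + z"] by (intro mult_right_mono) auto
      qed (use e A in simp)
      also have "\<dots> = e * norm ?h * ((LINT z|M. \<bar>k z\<bar>) / A)" by simp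
      also have "\<dots> \<le> e * norm ?h * 1"
        using e A by (intro mult_left_mono) (auto simp: A_def)
      finally show ?thesis unfolding mult_1_right .
    qed
    then show "\<exists>d>0. \<forall>y. norm (y - x) < d \<longrightarrow> norm ((LINT z|M. f (y + z) * k z) - (LINT z|M. f (x + z) * k z) - (y - x) \<bullet> (\<chi> i. LINT z|M. pd i f (x + z) * k z)) \<le> e * norm (y - x)"
      using d(1) by blast
  qed
  have pd: "pd i (\<lambda>x. LINT z|M. f (x + z) * k z) = (\<lambda>x. LINT z|M. pd i f (x + z) * k z)" if "f \<in> TF" for i and f :: "real^'n \<Rightarrow> real"
    using pd_eqI[OF der[OF that]] by auto
  show "pd i (\<lambda>x. LINT z|M. f (x + z) * k z) = (\<lambda>x. LINT z|M. pd i f (x + z) * k z)"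
    by (rule pd[OF f])
  show "smooth (\<lambda>x. LINT z|M. f (x + z) * k z)"
  proof (rule smooth_coinduct[of "\<lambda>F. \<exists>g\<in>TF. F = (\<lambda>x. LINT z|M. g (x + z) * k z)"])
    show "\<exists>g\<in>TF. (\<lambda>x. LINT z|M. f (x + z) * k z) = (\<lambda>x. LINT z|M. g (x + z) * k z)" using f by blast
    fix F :: "real^'n \<Rightarrow> real" assume "\<exists>g\<in>TF. F = (\<lambda>x. LINT z|M. g (x + z) * k z)"
    then obtain g where g: "g \<in> TF" "F = (\<lambda>x. LINT z|M. g (x + z) * k z)" by blast
    show "(\<forall>x. F differentiable (at x)) \<and> (\<forall>i. \<exists>g\<in>TF. pd i F = (\<lambda>x. LINT z|M. g (x + z) * k z))"
      using der[OF g(1)] pd[OF g(1)] test_pd[OF g(1)] unfolding g(2) gderiv_def differentiable_def by blast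
  qed
qed

section \<open>Mollifiers\<close>

lemma tendsto_poly_exp_0: "((\<lambda>s. poly p s * exp (- s)) \<longlongrightarrow> (0::real)) at_top"
proof -
  have "((\<lambda>s. \<Sum>i\<le>degree p. coeff p i * (s ^ i / exp s)) \<longlongrightarrow> (\<Sum>i\<le>degree p. coeff p i * 0)) at_top"
    by (intro tendsto_sum tendsto_mult tendsto_const tendsto_power_div_exp_0)
  moreover have "(\<lambda>s. \<Sum>i\<le>degree p. coeff p i * (s ^ i / exp s)) = (\<lambda>s. poly p s * exp (- s))"
    by (auto simp: poly_altdef sum_divide_distrib exp_minus field_simps)
  ultimately show ?thesis by simp
qed

text \<open>Indexed by polynomials so that the family is closed under differentiation: the
  derivative replaces p by X^2 (p - p'). The extension by 0 is flat at 0 because exp(-1/t) beats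
  every power of 1/t.\<close>

definition flat_exp :: "real poly \<Rightarrow> real \<Rightarrow> real" where
  "flat_exp p t = (if 0 < t then poly p (1 / t) * exp (- (1 / t)) else 0)"

lemma flat_exp_has_derivative:
  "(flat_exp p has_real_derivative flat_exp ([:0, 0, 1:] * (p - pderiv p)) t) (at t)"
proof -
  consider "0 < t" | "t < 0" | "t = 0" by linarith
  then show ?thesis
  proof cases
    case 1
    have "((\<lambda>t. poly p (1 / t) * exp (- (1 / t))) has_real_derivative
        flat_exp ([:0, 0, 1:] * (p - pderiv p)) t) (at t)"
      using 1 by (auto simp: flat_exp_def field_simps power2_eq_square intro!: derivative_eq_intros DERIV_chain'[OF _ poly_DERIV])
    then show ?thesis
      by (rule DERIV_cong_ev[THEN iffD1, rotated -1])
         (use 1 in \<open>auto simp: flat_exp_def eventually_nhds intro!: exI[of _ "{0<..}"]\<close>)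
  next
    case 2
    have "((\<lambda>t. 0) has_real_derivative flat_exp ([:0, 0, 1:] * (p - pderiv p)) t) (at t)"
      using 2 by (simp add: flat_exp_def)
    then show ?thesis
      by (rule DERIV_cong_ev[THEN iffD1, rotated -1])
         (use 2 in \<open>auto simp: flat_exp_def eventually_nhds intro!: exI[of _ "{..<0}"]\<close>)
  next
    case 3
    have "((\<lambda>h. flat_exp p h / h) \<longlongrightarrow> 0) (at_right 0)"
    proof -
      have "((\<lambda>h. poly ([:0, 1:] * p) (inverse h) * exp (- inverse h)) \<longlongrightarrow> 0) (at_right 0)"
        by (rule filterlim_compose[OF tendsto_poly_exp_0 filterlim_inverse_at_top_right])
      then show ?thesis
        by (rule Lim_transform_eventually)
           (auto simp: eventually_at_filter flat_exp_def field_simps inverse_eq_divide)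
    qed
    moreover have "((\<lambda>h. flat_exp p h / h) \<longlongrightarrow> 0) (at_left 0)"
      by (rule Lim_transform_eventually[OF tendsto_const])
         (auto simp: eventually_at_filter flat_exp_def)
    ultimately have "((\<lambda>h. flat_exp p h / h) \<longlongrightarrow> 0) (at 0)"
      by (simp add: filterlim_split_at)
    then show ?thesis
      using 3 by (simp add: DERIV_def flat_exp_def)
  qed
qed

text \<open>Each derivative changes the polynomial and produces a factor \<open>pd i q\<close>,
  hence the induction on the order is over all \<open>p\<close> simultaneously.\<close>

lemma smooth_flat_exp:
  assumes q: "smooth (q :: real^'n \<Rightarrow> real)"
  shows "smooth (\<lambda>x. flat_exp p (q x))"
proof -
  have "\<forall>p. C_k k (\<lambda>x. flat_exp p (q x))" for k
  proof (induction k)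
    case 0
    have "continuous_on UNIV (flat_exp p)" for p
      using flat_exp_has_derivative by (intro DERIV_continuous_on) (auto intro: has_field_derivative_at_within)
    then show ?case
      using continuous_on_compose2[of UNIV "flat_exp _" UNIV q] smooth_continuous[OF q, of UNIV] by auto
  next
    case (Suc k)
    have mult: "C_k k (\<lambda>x. f x * g x)" if "C_k k f" "C_k k g" for k and f g :: "real^'n \<Rightarrow> real"
      using that
    proof (induction k arbitrary: f g)
      case 0
      then show ?case by (auto intro: continuous_on_mult)
    next
      case (Suc k)
      have eq: "(\<lambda>x. grad (\<lambda>x. f x * g x) x $ i) = (\<lambda>x. f x * grad g x $ i + g x * grad f x $ i)" for i
        using pd_mult[of f _ g i] Suc.prems by (auto simp: pd_def)
      have add: "C_k k (\<lambda>x. f x + g x)" if "C_k k f" "C_k k g" for k and f g :: "real^'n \<Rightarrow> real"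
        using that
      proof (induction k arbitrary: f g)
        case 0
        then show ?case by (auto intro: continuous_on_add)
      next
        case (Suc k)
        have "(\<lambda>x. grad (\<lambda>x. f x + g x) x $ i) = (\<lambda>x. grad f x $ i + grad g x $ i)" for i
          using pd_add[of f _ g i] Suc.prems by (auto simp: pd_def)
        then show ?case using Suc by auto
      qed
      have "C_k k (\<lambda>x. grad (\<lambda>x. f x * g x) x $ i)" for i
        unfolding eq using Suc.prems C_k_SucD[OF Suc.prems(1)] C_k_SucD[OF Suc.prems(2)]
        by (intro add Suc.IH) auto
      then show ?case using Suc.prems by (auto simp: differentiable_mult)
    qed
    have der: "GDERIV (\<lambda>x. flat_exp p (q x)) x :> flat_exp ([:0, 0, 1:] * (p - pderiv p)) (q x) *\<^sub>R grad q x" for p x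
      by (rule GDERIV_DERIV_compose[OF smooth_GDERIV[OF q] flat_exp_has_derivative])
    have "(\<lambda>x. grad (\<lambda>x. flat_exp p (q x)) x $ i) = (\<lambda>x. flat_exp ([:0, 0, 1:] * (p - pderiv p)) (q x) * pd i q x)" for p i
      using grad_eqI[OF der] by (auto simp: pd_def)
    moreover have "C_k k (\<lambda>x. flat_exp ([:0, 0, 1:] * (p - pderiv p)) (q x) * pd i q x)" for p i
      using Suc.IH smooth_pd[OF q] by (intro mult) (auto simp: smooth_def)
    ultimately show ?case
      using der unfolding C_k.simps(2) gderiv_def differentiable_def by metis
  qed
  then show ?thesis by (simp add: smooth_def)
qed

text \<open>The profile is exp(-1/(r^2 - |x - a|^2)), set to 0 outside the ball. Its symmetry about
  the centre is recorded because a mollifier must be even to be an averaging measure.\<close>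

lemma exists_bump:
  fixes a :: "real^'n"
  assumes "0 < r"
  obtains \<phi> where "\<phi> \<in> TF" "\<And>x. 0 \<le> \<phi> x" "\<And>x. norm (x - a) < r \<Longrightarrow> 0 < \<phi> x"
    "\<And>x. r \<le> norm (x - a) \<Longrightarrow> \<phi> x = 0" "\<And>y. \<phi> (a - y) = \<phi> (a + y)"
proof -
  define q where "q x = r^2 - (\<Sum>i\<in>UNIV. (x $ i + - a $ i) * (x $ i + - a $ i))" for x :: "real^'n"
  have q: "q x = r^2 - (norm (x - a))^2" for x
    by (simp add: q_def norm_vec_def L2_set_def sum_nonneg power2_eq_square)
  have "smooth q" unfolding q_def[abs_def]
    by (intro smooth_diff smooth_sum smooth_mult smooth_add smooth_component smooth_const)
  then have s: "smooth (\<lambda>x. flat_exp 1 (q x))" by (rule smooth_flat_exp)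
  have z: "flat_exp 1 (q x) = 0" if "r \<le> norm (x - a)" for x
  proof -
    have "\<not> 0 < q x"
      unfolding q using power_mono[OF that less_imp_le[OF assms], of 2] by linarith
    then show ?thesis by (simp add: flat_exp_def)
  qed
  show ?thesis
  proof (rule that[of "\<lambda>x. flat_exp 1 (q x)"])
    show "(\<lambda>x. flat_exp 1 (q x)) \<in> TF"
      using s z by (auto simp: test_functions_iff dist_norm norm_minus_commute intro!: exI[of _ "cball a r"])
    show "0 < flat_exp 1 (q x)" if "norm (x - a) < r" for x
      using that assms power_strict_mono[OF that, of 2] by (auto simp: flat_exp_def q)
    show "flat_exp 1 (q (a - y)) = flat_exp 1 (q (a + y))" for y by (simp add: q)
    show "0 \<le> flat_exp 1 (q x)" for x by (simp add: flat_exp_def)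
  qed (rule z)
qed

section \<open>Mollifiers as averaging measures\<close>

lemma lborel_distr_uminus_euclidean: "distr lborel borel uminus = (lborel :: 'a::euclidean_space measure)"
proof -
  have "(\<lambda>x::'a. 0 + (- 1) *\<^sub>R x) = uminus" by auto
  then show ?thesis using lborel_affine[of "-1" "0::'a"] by (simp add: density_1)
qed

lemma integral_uminus_lborel:
  fixes f :: "'a::euclidean_space \<Rightarrow> real"
  assumes "f \<in> borel_measurable borel"
  shows "(LINT x|lborel. f (- x)) = (LINT x|lborel. f x)"
  using integral_distr[of uminus lborel borel f] assms by (simp add: lborel_distr_uminus_euclidean)

lemma integrable_uminus_lborel:
  fixes f :: "'a::euclidean_space \<Rightarrow> real"
  assumes "integrable lborel f"
  shows "integrable lborel (\<lambda>x. f (- x))"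
  using integrable_distr_eq[of uminus lborel borel f] assms by (simp add: lborel_distr_uminus_euclidean)

lemma averaging_density:
  fixes \<rho> :: "'a::euclidean_space \<Rightarrow> real"
  assumes \<rho>: "integrable lborel \<rho>" "\<And>x. 0 \<le> \<rho> x" "(LINT x|lborel. \<rho> x) = 1"
    and supp: "\<And>x. r < norm x \<Longrightarrow> \<rho> x = 0" and even: "\<And>x. \<rho> (- x) = \<rho> x"
  shows "averaging (density lborel \<rho>) r"
proof -
  have [measurable]: "\<rho> \<in> borel_measurable borel" using borel_measurable_integrable[OF \<rho>(1)] by simp
  have "(\<integral>\<^sup>+x. ennreal (\<rho> x) \<partial>lborel) = 1"
    using nn_integral_eq_integral[OF \<rho>(1)] \<rho> by simp
  then have "prob_space (density lborel \<rho>)"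
    by (intro prob_spaceI) (simp add: emeasure_density)
  then interpret prob_space "density lborel \<rho>" .
  show ?thesis
  proof
  show "sets (density lborel \<rho>) = sets borel" by simp
  show "AE z in density lborel \<rho>. norm z \<le> r"
    using supp by (subst AE_density) (auto intro!: AE_I2 simp: not_le[symmetric] intro: ccontr)
  have "distr (density lborel \<rho>) borel uminus = distr (density lborel (\<lambda>x. ennreal (\<rho> (- x)))) borel uminus"
    by (simp add: even)
  also have "\<dots> = density (distr lborel borel uminus) \<rho>"
    by (subst density_distr) auto
  finally show "distr (density lborel \<rho>) borel uminus = density lborel \<rho>"
    by (simp add: lborel_distr_uminus_euclidean)
  qed
qed

lemma integral_pos_if_pos_on_ball:
  fixes f :: "'a::euclidean_space \<Rightarrow> real"
  assumes f: "integrable lborel f" and nonneg: "\<And>x. 0 \<le> f x" and pos: "\<And>x. norm (x - a) < r \<Longrightarrow> 0 < f x" and r: "0 < r"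
  shows "0 < (LINT x|lborel. f x)"
proof -
  have "(LINT x|lborel. f x) \<noteq> 0"
  proof
    assume "(LINT x|lborel. f x) = 0"
    then have "AE x in lborel. f x = 0"
      using integral_nonneg_eq_0_iff_AE[OF f] nonneg by simp
    then have "AE x in lborel. x \<notin> ball a r"
      by (rule eventually_mono) (use pos in \<open>force simp: dist_norm norm_minus_commute\<close>)
    then have "emeasure lborel (ball a r) = 0"
      by (subst (asm) AE_iff_measurable[OF _ refl]) (auto simp: ball_def)
    then have "negligible (ball a r)" by (simp add: negligible_iff_emeasure0)
    then show False using r open_not_negligible[of "ball a r"] by simp
  qed
  then show ?thesis using Bochner_Integration.integral_nonneg[of lborel f] nonneg by (simp add: less_le)
qed

lemma exists_mollifier:
  assumes "0 < r"
  obtains \<rho> :: "real^'n \<Rightarrow> real" where "\<rho> \<in> TF" "\<And>x. 0 \<le> \<rho> x" "\<And>x. \<rho> (- x) = \<rho> x" "averaging (density lborel \<rho>) r"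
proof -
  obtain \<phi> where \<phi>: "\<phi> \<in> TF" "\<And>x::real^'n. 0 \<le> \<phi> x" "\<And>x. norm (x - 0) < r \<Longrightarrow> 0 < \<phi> x"
    "\<And>x. r \<le> norm (x - 0) \<Longrightarrow> \<phi> x = 0" "\<And>y. \<phi> (0 - y) = \<phi> (0 + y)"
    using exists_bump[OF assms, of "0::real^'n"] by blast
  define c where "c = (LINT x|lborel. \<phi> x)"
  have int: "integrable lborel \<phi>" using \<phi>(1) by (rule test_integrable)
  have c: "0 < c" unfolding c_def by (rule integral_pos_if_pos_on_ball[OF int \<phi>(2,3) assms])
  define \<rho> where "\<rho> x = 1 / c * \<phi> x" for x
  have \<rho>: "\<rho> \<in> TF" unfolding \<rho>_def[abs_def] using \<phi>(1) by (rule test_cmult)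
  have nonneg: "0 \<le> \<rho> x" for x unfolding \<rho>_def using c \<phi>(2)[of x] by simp
  have even: "\<rho> (- x) = \<rho> x" for x unfolding \<rho>_def using \<phi>(5)[of x] by simp
  show ?thesis
  proof (rule that[OF \<rho> nonneg even])
    show "averaging (density lborel \<rho>) r"
      using c \<phi>(4) by (intro averaging_density test_integrable[OF \<rho>] nonneg even)
        (auto simp: \<rho>_def c_def)
  qed
qed

section \<open>Derivatives of averages and integration by parts\<close>

context averaging
begin

lemma avg_compact_supp:
  fixes f :: "'a \<Rightarrow> real"
  assumes "compact_supp f"
  shows "compact_supp (avg \<mu> f)"
proof -
  obtain R where R: "\<And>x. R < norm x \<Longrightarrow> f x = 0" using assms by (auto simp: compact_supp_iff_cball)
  have "avg \<mu> f x = 0" if "R + r < norm x" for x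
    unfolding avg_def
  proof (rule integral_eq_zero_AE)
    show "AE z in \<mu>. f (x + z) = 0"
      using bounded_supp
    proof (rule eventually_mono)
      fix z :: 'a assume "norm z \<le> r"
      then show "f (x + z) = 0"
        using that norm_triangle_ineq4[of "x + z" z] by (intro R) simp
    qed
  qed
  then show ?thesis by (auto simp: compact_supp_iff_cball)
qed

lemma integrable_shift_cont_cs:
  assumes "f \<in> cont_cs"
  shows "integrable \<mu> (\<lambda>z. f (x + z))"
proof -
  obtain B where "\<And>x. \<bar>f x\<bar> \<le> B" using cont_cs_bounded[OF assms] by blast
  moreover have [measurable]: "f \<in> borel_measurable borel" by (rule cont_cs_measurable[OF assms])
  ultimately show ?thesis by (intro integrable_const_bound[where B=B]) auto
qed

lemma avg_add: "f \<in> cont_cs \<Longrightarrow> g \<in> cont_cs \<Longrightarrow> avg \<mu> (\<lambda>x. f x + g x) = (\<lambda>x. avg \<mu> f x + avg \<mu> g x)"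
  by (simp add: avg_def integrable_shift_cont_cs fun_eq_iff)

lemma avg_cmult: "avg \<mu> (\<lambda>x. c * f x) = (\<lambda>x. c * avg \<mu> f x)"
  by (simp add: avg_def fun_eq_iff)

lemma avg_shift: "avg \<mu> (\<lambda>x. f (x + z)) = (\<lambda>x. avg \<mu> f (x + z))"
  by (simp add: avg_def fun_eq_iff add_ac)

end

lemma avg_TF:
  assumes "averaging \<mu> r" "f \<in> TF"
  shows "avg \<mu> f \<in> TF" "pd i (avg \<mu> f) = avg \<mu> (pd i f)"
proof -
  interpret averaging \<mu> r by fact
  have "integrable \<mu> (\<lambda>z. 1)" by simp
  note s = smooth_convolution[OF assms(2) sets_eq this]
  show "pd i (avg \<mu> f) = avg \<mu> (pd i f)" using s(2)[of i] by (simp add: avg_def[abs_def])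
  have "smooth (avg \<mu> f)" using s(1) by (simp add: avg_def[abs_def])
  moreover have "compact_supp (avg \<mu> f)"
    using test_cont_cs[OF assms(2)] by (intro avg_compact_supp) (simp add: cont_cs_def)
  ultimately show "avg \<mu> f \<in> TF" by (auto simp: test_functions_iff compact_supp_def)
qed

lemma avg_commute:
  assumes "averaging \<mu> r" "averaging \<nu> r'" "f \<in> cont_cs"
  shows "avg \<mu> (avg \<nu> f) = avg \<nu> (avg \<mu> f)"
proof
  fix x
  interpret M: averaging \<mu> r by fact
  interpret N: averaging \<nu> r' by fact
  interpret P: pair_sigma_finite \<mu> \<nu> ..
  interpret PP: pair_prob_space \<mu> \<nu> ..
  obtain B where B: "\<And>x. \<bar>f x\<bar> \<le> B" using cont_cs_bounded[OF assms(3)] by blast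
  have [measurable]: "f \<in> borel_measurable borel" by (rule cont_cs_measurable[OF assms(3)])
  have "integrable (\<mu> \<Otimes>\<^sub>M \<nu>) (case_prod (\<lambda>z w. f (x + z + w)))"
    by (rule PP.integrable_const_bound[where B=B]) (use B in auto)
  from P.Fubini_integral[OF this]
  have "(LINT w|\<nu>. LINT z|\<mu>. f (x + z + w)) = (LINT z|\<mu>. LINT w|\<nu>. f (x + z + w))" .
  then show "avg \<mu> (avg \<nu> f) x = avg \<nu> (avg \<mu> f) x" by (simp add: avg_def add_ac)
qed

section \<open>Two-point averages, segment averages and central differences\<close>

definition pt :: "'a::euclidean_space \<Rightarrow> 'a measure" where
  "pt z = distr (uniform_count_measure {-1, 1}) borel (\<lambda>s::real. s *\<^sub>R z)"

text \<open>The uniform distribution on the segment from -z to z. Averaging the derivative along z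
  against it gives \<open>dif z f\<close> exactly, so differences and derivatives can be exchanged
  without error terms.\<close>

definition seg :: "'a::euclidean_space \<Rightarrow> 'a measure" where
  "seg z = distr (density lborel (\<lambda>s::real. ennreal (indicator {-1..1} s / 2))) borel (\<lambda>s. s *\<^sub>R z)"

definition av :: "'a::euclidean_space \<Rightarrow> ('a \<Rightarrow> real) \<Rightarrow> 'a \<Rightarrow> real" where
  "av z f x = (f (x + z) + f (x - z)) / 2"

text \<open>With the factor 1/2, \<open>av z f\<close> \<plusminus> \<open>dif z f\<close> are the
  values of f at x \<plusminus> z, and applying \<open>av z\<close> twice equals the identity plus
  \<open>dif z\<close> applied twice.\<close>

definition dif :: "'a::euclidean_space \<Rightarrow> ('a \<Rightarrow> real) \<Rightarrow> 'a \<Rightarrow> real" where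
  "dif z f x = (f (x + z) - f (x - z)) / 2"

lemma averaging_pt: "averaging (pt z) (norm z)"
proof -
  let ?U = "uniform_count_measure {-1, 1::real}"
  interpret U: prob_space ?U by (rule prob_space_uniform_count_measure) auto
  have m [measurable]: "g \<in> borel_measurable ?U" for g :: "real \<Rightarrow> 'a"
    by (simp add: measurable_def sets_uniform_count_measure space_uniform_count_measure)
  interpret P: prob_space "pt z" unfolding pt_def by (rule U.prob_space_distr) (rule m)
  show ?thesis
  proof
    show "sets (pt z) = sets borel" by (simp add: pt_def)
    show "AE y in pt z. norm y \<le> norm z"
      unfolding pt_def by (subst AE_distr_iff) (auto intro!: AE_I2 simp: space_uniform_count_measure m)
    show "distr (pt z) borel uminus = pt z"
    proof (rule measure_eqI)
      fix X assume "X \<in> sets (distr (pt z) borel uminus)"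
      then have X: "X \<in> sets borel" by simp
      let ?A = "{s \<in> {-1, 1::real}. - (s *\<^sub>R z) \<in> X}" and ?B = "{s \<in> {-1, 1::real}. s *\<^sub>R z \<in> X}"
      have "?A = uminus ` ?B" by (auto simp: image_iff)
      then have card: "card ?A = card ?B" by (simp add: card_image)
      have A: "(\<lambda>s. - (s *\<^sub>R z)) -` X \<inter> space ?U = ?A" and B: "(\<lambda>s. s *\<^sub>R z) -` X \<inter> space ?U = ?B"
        by (auto simp: space_uniform_count_measure)
      have "emeasure (distr (pt z) borel uminus) X = emeasure (distr ?U borel (\<lambda>s. - (s *\<^sub>R z))) X"
        unfolding pt_def by (subst distr_distr) (simp_all add: m comp_def)
      also have "\<dots> = emeasure ?U ?A"
        using X by (subst emeasure_distr[OF m]) (simp_all only: A)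
      also have "\<dots> = emeasure ?U ?B"
        using card by (subst (1 2) emeasure_uniform_count_measure) auto
      also have "\<dots> = emeasure (pt z) X"
        unfolding pt_def using X by (subst emeasure_distr[OF m]) (simp_all only: B)
      finally show "emeasure (distr (pt z) borel uminus) X = emeasure (pt z) X" .
    qed (simp add: pt_def)
  qed
qed

lemma avg_pt:
  assumes "f \<in> borel_measurable borel"
  shows "avg (pt z) f = av z f"
proof
  fix x
  have m: "g \<in> borel_measurable (uniform_count_measure {-1, 1::real})" for g :: "real \<Rightarrow> 'a"
    by (simp add: measurable_def sets_uniform_count_measure space_uniform_count_measure)
  show "avg (pt z) f x = av z f x"
    unfolding avg_def pt_def av_def using assms
    by (subst integral_distr[OF m]) (simp_all add: integral_uniform_count_measure add.commute)
qed

lemma averaging_seg: "averaging (seg z) (norm z)"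
proof -
  let ?d = "\<lambda>s::real. indicator {-1..1} s / 2 :: real"
  let ?U = "density lborel (\<lambda>s. ennreal (?d s))"
  have int: "integrable lborel ?d" "(LINT s|lborel. ?d s) = 1"
    by (auto simp: integrable_indicator_iff)
  interpret U: averaging ?U 1
    by (rule averaging_density) (use int in \<open>auto simp: indicator_def\<close>)
  interpret P: prob_space "seg z" unfolding seg_def by (rule U.prob_space_distr) simp
  show ?thesis
  proof
    show "sets (seg z) = sets borel" by (simp add: seg_def)
    show "AE y in seg z. norm y \<le> norm z"
      unfolding seg_def using U.bounded_supp
      by (subst AE_distr_iff) (auto elim!: eventually_mono intro: mult_left_le_one_le)
    have "distr (seg z) borel uminus = distr ?U borel (\<lambda>s. (- s) *\<^sub>R z)"
      by (simp add: seg_def distr_distr comp_def)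
    also have "\<dots> = distr (distr ?U borel uminus) borel (\<lambda>s. s *\<^sub>R z)"
      by (simp add: distr_distr comp_def)
    also have "\<dots> = seg z" unfolding U.symmetric by (simp add: seg_def)
    finally show "distr (seg z) borel uminus = seg z" .
  qed
qed

text \<open>The fundamental theorem of calculus along the segment with parameter in [-1, 1]; the
  halves in \<open>dif\<close> and in the density of \<open>seg\<close> match.\<close>

lemma avg_seg:
  fixes f :: "real^'n \<Rightarrow> real"
  assumes f: "smooth f"
  shows "dif z f x = avg (seg z) (\<lambda>y. \<Sum>i\<in>UNIV. z $ i * pd i f y) x"
proof -
  let ?g = "\<lambda>y. \<Sum>i\<in>UNIV. z $ i * pd i f y"
  have c: "continuous_on UNIV ?g"
    by (intro continuous_on_sum continuous_on_mult_left smooth_continuous smooth_pd f)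
  then have [measurable]: "?g \<in> borel_measurable borel" by (rule borel_measurable_continuous_onI)
  have "avg (seg z) ?g x = (LINT s|lborel. (indicator {-1..1} s / 2) *\<^sub>R ?g (x + s *\<^sub>R z))"
    unfolding avg_def seg_def
    by (subst integral_distr, simp, simp, subst integral_density) auto
  also have "\<dots> = (LINT s|lborel. ?g (x + s *\<^sub>R z) / 2 * indicator {-1..1} s)"
    by (intro Bochner_Integration.integral_cong refl) (auto simp: indicator_def)
  also have "\<dots> = f (x + 1 *\<^sub>R z) / 2 - f (x + (-1) *\<^sub>R z) / 2"
  proof (rule integral_FTC_Icc_real)
    fix s :: real
    have "((\<lambda>s. f (x + s *\<^sub>R z)) has_derivative (\<lambda>t. (t *\<^sub>R z) \<bullet> grad f (x + s *\<^sub>R z))) (at s)"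
      using smooth_GDERIV[OF f, of "x + s *\<^sub>R z"] unfolding gderiv_def
      by (rule has_derivative_compose[rotated]) (auto intro!: derivative_eq_intros)
    moreover have "z \<bullet> grad f (x + s *\<^sub>R z) = ?g (x + s *\<^sub>R z)"
      by (simp add: inner_vec_def pd_def)
    ultimately have "((\<lambda>s. f (x + s *\<^sub>R z)) has_real_derivative ?g (x + s *\<^sub>R z)) (at s)"
      by (simp add: has_field_derivative_def mult_commute_abs)
    then show "((\<lambda>s. f (x + s *\<^sub>R z) / 2) has_real_derivative ?g (x + s *\<^sub>R z) / 2) (at s)"
      by (rule DERIV_cdivide)
    show "isCont (\<lambda>s. ?g (x + s *\<^sub>R z) / 2) s"
    proof -
      have "continuous_on UNIV (\<lambda>s. ?g (x + s *\<^sub>R z))"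
        by (rule continuous_on_compose2[OF c]) (auto intro!: continuous_intros)
      then have "isCont (\<lambda>s. ?g (x + s *\<^sub>R z)) s" by (simp only: continuous_on_eq_continuous_at[OF open_UNIV] UNIV_I)
      then show ?thesis by (rule continuous_divide) auto
    qed
  qed simp
  finally show ?thesis by (simp add: dif_def diff_divide_distrib)
qed

lemma avg_seg_axis:
  fixes f :: "real^'n \<Rightarrow> real"
  assumes "smooth f"
  shows "dif (h *\<^sub>R axis j 1) f x = h * avg (seg (h *\<^sub>R axis j 1)) (pd j f) x"
proof -
  have "(\<Sum>i\<in>UNIV. (h *\<^sub>R axis j 1) $ i * pd i f y) = h * pd j f y" for y
    by (simp add: axis_def if_distrib if_distribR cong: if_cong)
  then show ?thesis
    using avg_seg[OF assms, of "h *\<^sub>R axis j 1" x] by (simp add: averaging.avg_cmult[OF averaging_seg])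
qed

lemma integral_dif:
  assumes "integrable lborel f"
  shows "(LINT x|lborel. dif z f x) = 0"
  using assms integral_shift[of f z] integral_shift[of f "- z"] by (simp add: dif_def)

text \<open>Averaging preserves integrals, and the segment average of \<open>pd i f\<close> is a
  central difference, whose integral vanishes by translation invariance.\<close>

lemma integral_pd:
  fixes f :: "real^'n \<Rightarrow> real"
  assumes f: "f \<in> TF"
  shows "(LINT x|lborel. pd i f x) = 0"
proof -
  interpret averaging "seg (axis i 1 :: real^'n)" "norm (axis i 1 :: real^'n)" by (rule averaging_seg)
  have "(LINT x|lborel. pd i f x) = (LINT x|lborel. avg (seg (axis i 1)) (pd i f) x)"
    by (rule integral_avg[symmetric]) (intro test_integrable[OF test_pd[OF f]])
  also have "\<dots> = (LINT x|lborel. dif (axis i 1) f x)"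
    using avg_seg_axis[OF test_smooth[OF f], of 1 i] by simp
  also have "\<dots> = 0" by (intro integral_dif test_integrable[OF f])
  finally show ?thesis .
qed

lemma integral_by_parts_pd:
  assumes f: "f \<in> TF" and g: "smooth g"
  shows "(LINT x|lborel. pd i f x * g x) = - (LINT x|lborel. f x * pd i g x)"
proof -
  have "0 = (LINT x|lborel. pd i (\<lambda>x. f x * g x) x)"
    by (simp add: integral_pd test_mult'[OF f g])
  also have "\<dots> = (LINT x|lborel. f x * pd i g x + pd i f x * g x)"
    by (simp add: pd_smooth(2)[OF test_smooth[OF f] g] mult.commute)
  also have "\<dots> = (LINT x|lborel. f x * pd i g x) + (LINT x|lborel. pd i f x * g x)"
    by (intro Bochner_Integration.integral_add test_integrable[OF test_mult'[OF f smooth_pd[OF g]]]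
        test_integrable[OF test_mult'[OF test_pd[OF f] g]])
  finally show ?thesis by simp
qed

text \<open>Equivalent to the L^s norm of the gradient; the sum over components avoids vector-valued
  integrals.\<close>

definition dnorm :: "real \<Rightarrow> (real^'n \<Rightarrow> real) \<Rightarrow> real" where
  "dnorm s f = (\<Sum>i\<in>UNIV. lnorm lborel s (pd i f))"

lemma dnorm_nonneg [simp]: "0 \<le> dnorm s f"
  by (simp add: dnorm_def sum_nonneg)

lemma lnorm_pd_le_dnorm: "lnorm lborel s (pd i f) \<le> dnorm s f"
  unfolding dnorm_def by (rule member_le_sum) auto

text \<open>Centred at the midpoint x + z/2 the difference is -2 times a \<open>dif\<close>, that
  is, a segment average of the derivative along z/2; averages contract L^s.\<close>

lemma lnorm_shift_diff_le:
  fixes f :: "real^'n \<Rightarrow> real" and z :: "real^'n"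
  assumes f: "f \<in> TF" and s: "1 < s"
  shows "lnorm lborel s (\<lambda>x. f x - f (x + z)) \<le> norm z * dnorm s f"
proof -
  define v where "v = (1/2) *\<^sub>R z"
  interpret averaging "seg v" "norm v" by (rule averaging_seg)
  let ?g = "\<lambda>y. \<Sum>i\<in>UNIV. v $ i * pd i f y"
  have pdl: "pd i f \<in> lspace lborel s" for i
    using s by (intro test_lspace[OF test_pd[OF f]]) auto
  have g: "?g \<in> lspace lborel s"
    using s by (intro lspace_sum lspace_cmult pdl) auto
  have vv: "v + v = z" by (simp add: v_def scaleR_left_distrib[symmetric])
  have "f x - f (x + z) = (-2) * avg (seg v) ?g (x + v)" for x
    using avg_seg[OF test_smooth[OF f], of v "x + v"] by (simp add: dif_def add.assoc vv)
  then have "lnorm lborel s (\<lambda>x. f x - f (x + z)) = 2 * lnorm lborel s (\<lambda>x. avg (seg v) ?g (x + v))"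
    using s lnorm_cmult[of s lborel "-2"] by simp
  also have "\<dots> = 2 * lnorm lborel s (avg (seg v) ?g)"
    using s by (subst lspace_shift(2)) (auto intro: avg_lspace g)
  also have "\<dots> \<le> 2 * lnorm lborel s ?g"
    using s by (intro mult_left_mono avg_lspace g) auto
  also have "\<dots> \<le> 2 * (\<Sum>i\<in>UNIV. norm v * lnorm lborel s (pd i f))"
  proof (intro mult_left_mono order_trans[OF lnorm_triangle_sum] sum_mono)
    show "lnorm lborel s (\<lambda>x. v $ i * pd i f x) \<le> norm v * lnorm lborel s (pd i f)" for i
      using s by (subst lnorm_cmult) (auto intro!: mult_right_mono component_le_norm_cart)
  qed (use s in \<open>auto intro: lspace_cmult pdl\<close>)
  also have "\<dots> = norm z * dnorm s f"
    by (simp add: dnorm_def sum_distrib_left v_def)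
  finally show ?thesis .
qed

lemma lnorm_avg_diff_le:
  fixes f :: "real^'n \<Rightarrow> real" and \<mu> :: "(real^'n) measure"
  assumes \<mu>: "averaging \<mu> r" and f: "f \<in> TF" and s: "1 < s"
  shows "lnorm lborel s (\<lambda>x. f x - avg \<mu> f x) \<le> r * dnorm s f"
proof -
  interpret averaging \<mu> r by fact
  have [measurable]: "f \<in> borel_measurable borel" using f by (rule test_measurable)
  have int: "integrable \<mu> (\<lambda>z. f (x + z))" for x
    by (rule integrable_shift_cont_cs) (rule test_cont_cs[OF f])
  have "lnorm lborel s (\<lambda>x. LINT z|\<mu>. f x - f (x + z)) \<le> r * dnorm s f"
  proof (rule lnorm_integral_le(2))
    show "AE z in \<mu>. (\<lambda>x. f x - f (x + z)) \<in> lspace lborel s \<and> lnorm lborel s (\<lambda>x. f x - f (x + z)) \<le> r * dnorm s f"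
      using bounded_supp
    proof (rule eventually_mono)
      fix z :: "real^'n" assume z: "norm z \<le> r"
      have "lnorm lborel s (\<lambda>x. f x - f (x + z)) \<le> norm z * dnorm s f" by (rule lnorm_shift_diff_le[OF f s])
      also have "\<dots> \<le> r * dnorm s f" using z by (intro mult_right_mono) auto
      finally show "(\<lambda>x. f x - f (x + z)) \<in> lspace lborel s \<and> lnorm lborel s (\<lambda>x. f x - f (x + z)) \<le> r * dnorm s f"
        using s by (auto intro!: lspace_diff lspace_shift test_lspace[OF f])
    qed
  qed (use s r_nonneg in \<open>auto simp: mult_nonneg_nonneg\<close>)
  moreover have "(LINT z|\<mu>. f x - f (x + z)) = f x - avg \<mu> f x" for x
    using int prob_space by (simp add: avg_def)
  ultimately show ?thesis by simp
qed

lemma dnorm_avg_le: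
  fixes f :: "real^'n \<Rightarrow> real" and \<mu> :: "(real^'n) measure"
  assumes \<mu>: "averaging \<mu> r" and f: "f \<in> TF" and s: "1 < s"
  shows "dnorm s (avg \<mu> f) \<le> dnorm s f"
  unfolding dnorm_def using s
  by (intro sum_mono) (auto simp: avg_TF(2)[OF \<mu> f] intro!: averaging.avg_lspace(2)[OF \<mu>] test_lspace[OF test_pd[OF f]])

section \<open>Second differences along a random walk\<close>

text \<open>The Bellman function \<open>bell\<close> is a Legendre transform in \<open>y\<close> of \<open>bell_pot\<close>. Since \<open>bell_pot\<close> is
  concave along the directions \<open>(1, \<plusminus>1)\<close>, both \<open>bell x y + x y\<close> and \<open>bell x y - x y\<close> are convex.\<close>

definition bell_pot :: "real \<Rightarrow> real \<Rightarrow> real" where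
  "bell_pot x v = v^6 - 20 * x^2 * v^4 - 40000 * x^6"

definition bell :: "real \<Rightarrow> real \<Rightarrow> real" where
  "bell x y = (SUP v. v * y - bell_pot x v)"

lemma bell_pot_concave:
  assumes "\<sigma> = 1 \<or> \<sigma> = (-1::real)"
  shows "convex_on UNIV (\<lambda>x. - bell_pot x (c + \<sigma> * x))"
proof (rule f''_ge0_imp_convex)
  let ?w = "\<lambda>x. c + \<sigma> * x"
  let ?f' = "\<lambda>x. - (6 * \<sigma> * ?w x ^ 5 - 40 * x * ?w x ^ 4 - 80 * \<sigma> * x^2 * ?w x ^ 3 - 240000 * x^5)"
  let ?f'' = "\<lambda>x. 10 * ?w x ^ 4 + 320 * (\<sigma> * x) * ?w x ^ 3 + 240 * (\<sigma> * x)^2 * ?w x ^ 2 + 1200000 * (\<sigma> * x) ^ 4"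
  show "((\<lambda>x. - bell_pot x (c + \<sigma> * x)) has_real_derivative ?f' x) (at x)" for x
    unfolding bell_pot_def by (auto intro!: derivative_eq_intros simp: algebra_simps)
  show "(?f' has_real_derivative ?f'' x) (at x)" for x
  proof -
    have "(?f' has_real_derivative - (30 * (\<sigma> * \<sigma>) * ?w x ^ 4 - 40 * ?w x ^ 4 - 160 * \<sigma> * x * ?w x ^ 3
        - 160 * \<sigma> * x * ?w x ^ 3 - 240 * (\<sigma> * \<sigma>) * x^2 * ?w x ^ 2 - 1200000 * x ^ 4)) (at x)"
      by (auto intro!: derivative_eq_intros simp: algebra_simps)
    then show ?thesis
      by (rule DERIV_cong) (use assms in \<open>auto simp: algebra_simps\<close>)
  qed
  show "0 \<le> ?f'' x" for x
  proof -
    \<comment> \<open>The 40 w^4 produced by 20 x^2 w^4 exceeds the 30 w^4 produced by w^6 and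
      leaves 10 w^4. The coefficient 40000 is large enough to dominate the mixed terms, as this sum
      of squares shows.\<close>
    have sos: "10 * w^4 + 320 * u * w^3 + 240 * u^2 * w^2 + 1200000 * u^4
      = 5 * (w * (w + 32 * u))^2 + 5 * (w^2 - 488 * u^2)^2 + 9280 * (u^2)^2" for u w :: real by algebra
    show ?thesis unfolding sos by simp
  qed
qed auto

text \<open>The power v^6 is spent in two halves: one absorbs v y at the price 2 |y|^(6/5), the
  other absorbs 20 x^2 v^4 at the price 32000 x^6, whence 72000 = 40000 + 32000. In particular the
  supremum defining \<open>bell\<close> is finite.\<close>

lemma bell_bound: "v * y - bell_pot x v \<le> 72000 * x^6 + 2 * \<bar>y\<bar> powr (6/5)"
proof -
  define w where "w = \<bar>y\<bar> powr (1/5)"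
  have w: "0 \<le> w" "\<bar>y\<bar> powr (6/5) = w^6" "\<bar>y\<bar> = w^5"
    using powr_numeral[of w "num.Bit0 (num.Bit1 num.One)"] powr_numeral[of w "num.Bit1 (num.Bit0 num.One)"]
    by (simp_all add: w_def powr_powr)
  have "\<bar>v\<bar> * w^5 \<le> 2 * w^6 + \<bar>v\<bar>^6 / 2"
  proof (cases "\<bar>v\<bar> \<le> 2 * w")
    case True
    then have "\<bar>v\<bar> * w^5 \<le> 2 * w * w^5" using w(1) by (intro mult_right_mono) auto
    moreover have "2 * w * w^5 = 2 * w^6" using power_Suc[of w 5] by simp
    moreover have "0 \<le> \<bar>v\<bar>^6 / 2" by simp
    ultimately show ?thesis by linarith
  next
    case False
    then have "w^5 \<le> (\<bar>v\<bar>/2)^5" using w(1) by (intro power_mono) auto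
    then have "\<bar>v\<bar> * w^5 \<le> \<bar>v\<bar> * (\<bar>v\<bar>/2)^5" by (intro mult_left_mono) auto
    also have "\<dots> = \<bar>v\<bar>^6 / 32" using power_Suc[of "\<bar>v\<bar>" 5] by (simp add: power_divide)
    also have "\<dots> \<le> 2 * w^6 + \<bar>v\<bar>^6 / 2" using w(1) by simp
    finally show ?thesis .
  qed
  moreover have "v * y \<le> \<bar>v\<bar> * w^5" using abs_ge_self[of "v * y"] by (simp add: abs_mult w(3))
  moreover have "20 * x^2 * v^4 \<le> v^6 / 2 + 32000 * x^6"
  proof (cases "v^2 \<le> 40 * x^2")
    case True
    then have "(v^2)^2 \<le> (40 * x^2)^2" by (intro power_mono) auto
    then have "20 * x^2 * (v^2)^2 \<le> 20 * x^2 * (40 * x^2)^2" by (intro mult_left_mono) auto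
    moreover have "20 * x^2 * (40 * x^2)^2 = 32000 * x^6" "20 * x^2 * (v^2)^2 = 20 * x^2 * v^4" by algebra+
    moreover have "0 \<le> v^6 / 2" by simp
    ultimately show ?thesis by linarith
  next
    case False
    then have "40 * x^2 * v^4 \<le> v^2 * v^4" by (intro mult_right_mono) auto
    moreover have "v^2 * v^4 = v^6" by algebra
    moreover have "0 \<le> 32000 * x^6" by simp
    ultimately show ?thesis by linarith
  qed
  ultimately show ?thesis unfolding bell_pot_def w(2) by simp
qed

lemma bell_upper: "v * y - bell_pot x v \<le> bell x y"
  unfolding bell_def using bell_bound[of _ y x] by (intro cSUP_upper bdd_aboveI) auto

lemma bell_le: "bell x y \<le> 72000 * x^6 + 2 * \<bar>y\<bar> powr (6/5)"
  unfolding bell_def by (rule cSUP_least) (use bell_bound in auto)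

lemma bell_nonneg: "0 \<le> bell x y"
proof -
  have "0 \<le> 40000 * x^6" by simp
  also have "\<dots> \<le> bell x y" using bell_upper[of 0 y x] by (simp add: bell_pot_def)
  finally show ?thesis .
qed

lemma bell_0: "bell 0 0 = 0"
  using bell_le[of 0 0] bell_nonneg[of 0 0] by simp

text \<open>The excess t (1 - t) (x1 - x2) (y1 - y2) later becomes a product of differences. It
  arises from comparing any v at the mean point with competitors that are tied to x1 and x2 along a
  direction of concavity.\<close>

lemma bell_convex_gap:
  assumes t: "0 \<le> t" "t \<le> 1" and \<sigma>: "\<sigma> = 1 \<or> \<sigma> = (-1::real)"
  shows "bell ((1 - t) * x1 + t * x2) ((1 - t) * y1 + t * y2) + \<sigma> * (t * (1 - t) * ((x1 - x2) * (y1 - y2)))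
    \<le> (1 - t) * bell x1 y1 + t * bell x2 y2"
proof -
  define m where "m = (1 - t) * x1 + t * x2"
  let ?y = "(1 - t) * y1 + t * y2" and ?g = "\<sigma> * (t * (1 - t) * ((x1 - x2) * (y1 - y2)))"
  have "bell m ?y \<le> (1 - t) * bell x1 y1 + t * bell x2 y2 - ?g"
    unfolding bell_def[of m ?y]
  proof (rule cSUP_least)
    fix v
    \<comment> \<open>The competitors c + \<sigma> x1 and c + \<sigma> x2 average to v and differ by
      \<sigma> (x1 - x2), so the bilinear terms give v times the mean of y plus the gap; concavity
      handles \<open>bell_pot\<close>.\<close>
    define c where "c = v - \<sigma> * m"
    have "- bell_pot m (c + \<sigma> * m) \<le> (1 - t) * - bell_pot x1 (c + \<sigma> * x1) + t * - bell_pot x2 (c + \<sigma> * x2)"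
      using convex_onD[OF bell_pot_concave[OF \<sigma>, of c], of t x1 x2] t by (simp add: m_def)
    moreover have "(1 - t) * ((c + \<sigma> * x1) * y1 - bell_pot x1 (c + \<sigma> * x1)) \<le> (1 - t) * bell x1 y1"
      using t by (intro mult_left_mono bell_upper) auto
    moreover have "t * ((c + \<sigma> * x2) * y2 - bell_pot x2 (c + \<sigma> * x2)) \<le> t * bell x2 y2"
      using t by (intro mult_left_mono bell_upper) auto
    moreover have "(1 - t) * ((c + \<sigma> * x1) * y1) + t * ((c + \<sigma> * x2) * y2) = v * ?y + ?g"
      unfolding c_def m_def by (simp add: algebra_simps)
    ultimately show "v * ?y - bell_pot m v \<le> (1 - t) * bell x1 y1 + t * bell x2 y2 - ?g"
      by (simp add: c_def right_diff_distrib)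
  qed auto
  then show ?thesis by (simp add: m_def)
qed

text \<open>Adding the two gap inequalities cancels the gap, so \<open>bell\<close> is jointly
  convex, and a finite convex function on the plane is continuous.\<close>

lemma bell_continuous: "continuous_on UNIV (\<lambda>p. bell (fst p) (snd p))"
proof (rule convex_on_continuous)
  show "convex_on UNIV (\<lambda>p. bell (fst p) (snd p))"
  proof (rule convex_onI)
    fix t :: real and p q :: "real \<times> real" assume t: "0 < t" "t < 1"
    show "bell (fst ((1 - t) *\<^sub>R p + t *\<^sub>R q)) (snd ((1 - t) *\<^sub>R p + t *\<^sub>R q)) \<le> (1 - t) * bell (fst p) (snd p) + t * bell (fst q) (snd q)"
      using bell_convex_gap[of t 1 "fst p" "fst q" "snd p" "snd q"] bell_convex_gap[of t "-1" "fst p" "fst q" "snd p" "snd q"] t by simp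
  qed auto
qed auto

lemma bell_cont_cs:
  assumes "f \<in> cont_cs" "g \<in> cont_cs"
  shows "(\<lambda>x. bell (f x) (g x)) \<in> cont_cs"
proof (rule cont_csI)
  show "continuous_on UNIV (\<lambda>x. bell (f x) (g x))"
    using continuous_on_compose2[OF bell_continuous, of UNIV "\<lambda>x. (f x, g x)"] assms
    by (auto simp: cont_cs_def intro: continuous_on_Pair)
  show "compact_supp (\<lambda>x. bell (f x) (g x))"
    by (rule compact_supp_mono2[of f g]) (use assms in \<open>auto simp: cont_cs_def bell_0\<close>)
qed

section \<open>Energy of a pair of functions and its loss under averaging\<close>

definition energy :: "('a::euclidean_space \<Rightarrow> real) \<Rightarrow> ('a \<Rightarrow> real) \<Rightarrow> real" where
  "energy f g = (LINT x|lborel. bell (f x) (g x))"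

lemma energy_nonneg: "0 \<le> energy f g"
  by (simp add: energy_def bell_nonneg)

lemma cont_cs_shift': "f \<in> cont_cs \<Longrightarrow> (\<lambda>x. f (x - z)) \<in> cont_cs"
  using cont_cs_shift[of f "- z"] by simp

lemma av_cont_cs: "f \<in> cont_cs \<Longrightarrow> av z f \<in> cont_cs"
  unfolding av_def[abs_def]
  using cont_cs_cmult[of "\<lambda>x. f (x + z) + f (x - z)" "1/2"] by (simp add: cont_cs_add cont_cs_shift cont_cs_shift')

lemma dif_cont_cs: "f \<in> cont_cs \<Longrightarrow> dif z f \<in> cont_cs"
  unfolding dif_def[abs_def]
  using cont_cs_cmult[of "\<lambda>x. f (x + z) - f (x - z)" "1/2"] by (simp add: cont_cs_diff cont_cs_shift cont_cs_shift')

text \<open>The gap inequality at t = 1/2 for the values at x + z and x - z: the gap is exactly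
  \<open>dif z f\<close> times \<open>dif z g\<close>, and using both signs gives the modulus of its
  integral.\<close>

lemma energy_av:
  assumes f: "f \<in> cont_cs" and g: "g \<in> cont_cs"
  shows "energy (av z f) (av z g) + \<bar>LINT x|lborel. dif z f x * dif z g x\<bar> \<le> energy f g"
proof -
  have "energy (av z f) (av z g) + \<sigma> * (LINT x|lborel. dif z f x * dif z g x) \<le> energy f g"
    if \<sigma>: "\<sigma> = 1 \<or> \<sigma> = (-1::real)" for \<sigma>
  proof -
    let ?b = "\<lambda>x. bell (f x) (g x)"
    have b: "?b \<in> cont_cs" by (rule bell_cont_cs[OF f g])
    have i1: "integrable lborel (\<lambda>x. bell (av z f x) (av z g x))"
      by (intro cont_cs_integrable bell_cont_cs av_cont_cs f g)
    have i2: "integrable lborel (\<lambda>x. dif z f x * dif z g x)"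
      by (intro cont_cs_integrable cont_cs_mult' dif_cont_cs f g)
    have "energy (av z f) (av z g) + \<sigma> * (LINT x|lborel. dif z f x * dif z g x)
      = (LINT x|lborel. bell (av z f x) (av z g x) + \<sigma> * (dif z f x * dif z g x))"
      using i1 i2 by (simp add: energy_def)
    also have "\<dots> \<le> (LINT x|lborel. ?b (x + z) / 2 + ?b (x - z) / 2)"
    proof (rule integral_mono)
      show "bell (av z f x) (av z g x) + \<sigma> * (dif z f x * dif z g x) \<le> ?b (x + z) / 2 + ?b (x - z) / 2" for x
        using bell_convex_gap[of "1/2" \<sigma> "f (x + z)" "f (x - z)" "g (x + z)" "g (x - z)"] \<sigma>
        by (simp add: av_def dif_def field_simps)
    qed (use i1 i2 cont_cs_integrable[OF cont_cs_shift[OF b]] cont_cs_integrable[OF cont_cs_shift'[OF b]] in auto)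
    also have "\<dots> = energy f g"
      using cont_cs_integrable[OF cont_cs_shift[OF b]] cont_cs_integrable[OF cont_cs_shift'[OF b]]
        integral_shift(1)[of ?b z] integral_shift(1)[of ?b "- z"]
      by (simp add: energy_def)
    finally show ?thesis .
  qed
  from this[of 1] this[of "-1"] show ?thesis by (simp add: abs_if)
qed

lemma energy_av_le: "f \<in> cont_cs \<Longrightarrow> g \<in> cont_cs \<Longrightarrow> energy (av z f) (av z g) \<le> energy f g"
  using energy_av[of f g z] by linarith

lemma energy_mid:
  assumes "f1 \<in> cont_cs" "g1 \<in> cont_cs" "f2 \<in> cont_cs" "g2 \<in> cont_cs"
  shows "energy (\<lambda>x. (f1 x + f2 x) / 2) (\<lambda>x. (g1 x + g2 x) / 2) \<le> (energy f1 g1 + energy f2 g2) / 2"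
proof -
  note i = cont_cs_integrable[OF bell_cont_cs[OF assms(1,2)]] cont_cs_integrable[OF bell_cont_cs[OF assms(3,4)]]
  have half: "(\<lambda>x. (f x + g x) / 2) \<in> cont_cs" if "f \<in> cont_cs" "g \<in> cont_cs" for f g :: "'a \<Rightarrow> real"
    using cont_cs_cmult[OF cont_cs_add[OF that], of "1/2"] by simp
  have "energy (\<lambda>x. (f1 x + f2 x) / 2) (\<lambda>x. (g1 x + g2 x) / 2) \<le> (LINT x|lborel. bell (f1 x) (g1 x) / 2 + bell (f2 x) (g2 x) / 2)"
    unfolding energy_def
  proof (rule integral_mono)
    show "bell ((f1 x + f2 x) / 2) ((g1 x + g2 x) / 2) \<le> bell (f1 x) (g1 x) / 2 + bell (f2 x) (g2 x) / 2" for x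
      using bell_convex_gap[of "1/2" 1 "f1 x" "f2 x" "g1 x" "g2 x"] bell_convex_gap[of "1/2" "-1" "f1 x" "f2 x" "g1 x" "g2 x"]
      by (simp add: add_divide_distrib)
  qed (use i in \<open>auto intro!: cont_cs_integrable bell_cont_cs half assms\<close>)
  also have "\<dots> = (energy f1 g1 + energy f2 g2) / 2"
    using i by (simp add: energy_def)
  finally show ?thesis .
qed

lemma av_av: "av z (av w f) = (\<lambda>x. (av (z + w) f x + av (z - w) f x) / 2)"
  by (simp add: av_def fun_eq_iff algebra_simps add_divide_distrib)

lemma av_commute: "av z (av w f) = av w (av z f)"
  by (simp add: av_def fun_eq_iff algebra_simps add_divide_distrib)

lemma av_dif: "av z (dif w f) = dif w (av z f)"
  by (simp add: av_def dif_def fun_eq_iff algebra_simps add_divide_distrib diff_divide_distrib)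

text \<open>Polarization: a mixed second difference with doubled steps is a difference of two pure
  ones in the directions z + w and z - w, the kind that the energy inequality controls.\<close>

lemma dif_dif: "dif (2 *\<^sub>R z) (dif (2 *\<^sub>R w) f) = (\<lambda>x. dif (z + w) (dif (z + w) f) x - dif (z - w) (dif (z - w) f) x)"
  by (simp add: dif_def fun_eq_iff algebra_simps scaleR_2 add_divide_distrib diff_divide_distrib)

lemma integral_dif_mult:
  assumes f: "f \<in> cont_cs" and g: "g \<in> cont_cs"
  shows "(LINT x|lborel. f x * dif z g x) = - (LINT x|lborel. dif z f x * g x)"
proof -
  have i: "integrable lborel (\<lambda>x. f (x + u) * g (x + w))" for u w
    by (intro cont_cs_integrable cont_cs_mult' cont_cs_shift f g)
  have "(LINT x|lborel. f x * g (x + z)) = (LINT x|lborel. f (x + - z) * g x)"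
    using integral_shift(1)[of "\<lambda>x. f x * g (x + z)" "- z"] by simp
  moreover have "(LINT x|lborel. f x * g (x + - z)) = (LINT x|lborel. f (x + z) * g x)"
    using integral_shift(1)[of "\<lambda>x. f x * g (x + - z)" z] by simp
  moreover have "(LINT x|lborel. f x * dif z g x) = ((LINT x|lborel. f x * g (x + z)) - (LINT x|lborel. f x * g (x + - z))) / 2"
    using i[of 0 z] i[of 0 "- z"] by (simp add: dif_def right_diff_distrib)
  moreover have "(LINT x|lborel. dif z f x * g x) = ((LINT x|lborel. f (x + z) * g x) - (LINT x|lborel. f (x + - z) * g x)) / 2"
    using i[of z 0] i[of "- z" 0] by (simp add: dif_def left_diff_distrib)
  ultimately show ?thesis by simp
qed

lemma integral_av_mult:
  assumes f: "f \<in> cont_cs" and g: "g \<in> cont_cs"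
  shows "(LINT x|lborel. av z f x * g x) = (LINT x|lborel. f x * av z g x)"
  using averaging.integral_avg_mult[OF averaging_pt conjugate_6(1) cont_cs_lspace[OF f] cont_cs_lspace[OF g], of z]
  by (simp add: avg_pt cont_cs_measurable f g)

text \<open>By \<open>av_av\<close> the product of two averages is the mean of the averages in the
  directions z + w and z - w, so by convexity the energy it loses is at least half the sum of the
  two pure terms. Polarization turns these into the mixed difference.\<close>

lemma integral_dif_dif_le:
  assumes f: "f \<in> cont_cs" and g: "g \<in> cont_cs"
  shows "\<bar>LINT x|lborel. f x * dif (2 *\<^sub>R z) (dif (2 *\<^sub>R w) g) x\<bar>
    \<le> 2 * (energy f g - energy (av z (av w f)) (av z (av w g)))"
proof -
  let ?I = "\<lambda>v. LINT x|lborel. dif v f x * dif v g x"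
  have "energy (av z (av w f)) (av z (av w g)) \<le> (energy (av (z + w) f) (av (z + w) g) + energy (av (z - w) f) (av (z - w) g)) / 2"
    unfolding av_av by (intro energy_mid av_cont_cs f g)
  also have "\<dots> \<le> energy f g - (\<bar>?I (z + w)\<bar> + \<bar>?I (z - w)\<bar>) / 2"
    using energy_av[OF f g, of "z + w"] energy_av[OF f g, of "z - w"] by argo
  finally have le: "\<bar>?I (z + w)\<bar> + \<bar>?I (z - w)\<bar> \<le> 2 * (energy f g - energy (av z (av w f)) (av z (av w g)))" by argo
  have i: "integrable lborel (\<lambda>x. f x * dif v (dif v g) x)" for v
    by (intro cont_cs_integrable cont_cs_mult' dif_cont_cs f g)
  have "(LINT x|lborel. f x * dif (2 *\<^sub>R z) (dif (2 *\<^sub>R w) g) x) = - ?I (z + w) + ?I (z - w)"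
    using i[of "z + w"] i[of "z - w"] integral_dif_mult[OF f dif_cont_cs[OF g]]
    by (simp add: dif_dif right_diff_distrib)
  then show ?thesis using le by linarith
qed

section \<open>The random walk and its summed second differences\<close>

definition dir :: "real \<Rightarrow> 'n \<Rightarrow> real^'n" where
  "dir h j = h *\<^sub>R axis j 1"

lemma dir_double: "dir (2 * h) j = 2 *\<^sub>R dir h j"
  by (simp add: dir_def)

text \<open>Every axis appears twice, so for any pair of directions l and j, equal or not, one
  average along l and one along j can be split off.\<close>

definition walk :: "real \<Rightarrow> (real^3 \<Rightarrow> real) \<Rightarrow> real^3 \<Rightarrow> real" where
  "walk h f = av (dir h 1) (av (dir h 1) (av (dir h 2) (av (dir h 2) (av (dir h 3) (av (dir h 3) f)))))"

lemma walk_split: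
  "\<exists>a b c d. \<forall>f. walk h f = av a (av b (av c (av d (av (dir h l) (av (dir h j) f)))))"
proof -
  have W: "\<forall>f. walk h f = av (dir h 1) (av (dir h 1) (av (dir h 2) (av (dir h 2) (av (dir h 3) (av (dir h 3) f)))))"
    "\<forall>f. walk h f = av (dir h 2) (av (dir h 2) (av (dir h 3) (av (dir h 3) (av (dir h 1) (av (dir h 1) f)))))"
    "\<forall>f. walk h f = av (dir h 1) (av (dir h 1) (av (dir h 3) (av (dir h 3) (av (dir h 2) (av (dir h 2) f)))))"
    "\<forall>f. walk h f = av (dir h 1) (av (dir h 2) (av (dir h 3) (av (dir h 3) (av (dir h 1) (av (dir h 2) f)))))"
    "\<forall>f. walk h f = av (dir h 1) (av (dir h 2) (av (dir h 3) (av (dir h 3) (av (dir h 2) (av (dir h 1) f)))))"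
    "\<forall>f. walk h f = av (dir h 1) (av (dir h 3) (av (dir h 2) (av (dir h 2) (av (dir h 1) (av (dir h 3) f)))))"
    "\<forall>f. walk h f = av (dir h 1) (av (dir h 3) (av (dir h 2) (av (dir h 2) (av (dir h 3) (av (dir h 1) f)))))"
    "\<forall>f. walk h f = av (dir h 1) (av (dir h 1) (av (dir h 2) (av (dir h 3) (av (dir h 2) (av (dir h 3) f)))))"
    "\<forall>f. walk h f = av (dir h 1) (av (dir h 1) (av (dir h 2) (av (dir h 3) (av (dir h 3) (av (dir h 2) f)))))"
    unfolding walk_def by (simp_all only: av_commute simp_thms)
  show ?thesis
    by (insert exhaust_3[of l] exhaust_3[of j], elim disjE; simp only:; intro exI; rule W)
qed

lemma walk_cont_cs: "f \<in> cont_cs \<Longrightarrow> walk h f \<in> cont_cs"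
  unfolding walk_def by (intro av_cont_cs)

lemma walk_pow_cont_cs: "f \<in> cont_cs \<Longrightarrow> (walk h ^^ n) f \<in> cont_cs"
  by (induction n) (auto intro: walk_cont_cs)

lemma walk_dif: "walk h (dif z f) = dif z (walk h f)"
  unfolding walk_def by (simp only: av_dif)

lemma walk_pow_dif: "(walk h ^^ n) (dif z f) = dif z ((walk h ^^ n) f)"
  by (induction n) (auto simp: walk_dif)

lemma integral_walk_mult:
  assumes "f \<in> cont_cs" "g \<in> cont_cs"
  shows "(LINT x|lborel. walk h f x * g x) = (LINT x|lborel. f x * walk h g x)"
proof -
  have "(LINT x|lborel. walk h f x * g x) = (LINT x|lborel. f x * av (dir h 3) (av (dir h 3) (av (dir h 2) (av (dir h 2) (av (dir h 1) (av (dir h 1) g))))) x)"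
    unfolding walk_def by (simp only: integral_av_mult av_cont_cs assms)
  also have "av (dir h 3) (av (dir h 3) (av (dir h 2) (av (dir h 2) (av (dir h 1) (av (dir h 1) g))))) = walk h g"
    unfolding walk_def by (simp only: av_commute)
  finally show ?thesis .
qed

lemma integral_walk_pow_mult:
  assumes "f \<in> cont_cs" "g \<in> cont_cs"
  shows "(LINT x|lborel. (walk h ^^ n) f x * g x) = (LINT x|lborel. f x * (walk h ^^ n) g x)"
  using assms
proof (induction n arbitrary: g)
  case (Suc n)
  have "(LINT x|lborel. (walk h ^^ Suc n) f x * g x) = (LINT x|lborel. (walk h ^^ n) f x * walk h g x)"
    using Suc by (simp add: integral_walk_mult walk_pow_cont_cs)
  also have "\<dots> = (LINT x|lborel. f x * (walk h ^^ n) (walk h g) x)"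
    using Suc by (simp add: walk_cont_cs)
  finally show ?case by (simp add: funpow_swap1)
qed simp

lemma integral_walk_dif_dif_le:
  assumes f: "f \<in> cont_cs" and g: "g \<in> cont_cs"
  shows "\<bar>LINT x|lborel. f x * dif (dir (2*h) l) (dif (dir (2*h) j) g) x\<bar>
    \<le> 2 * (energy f g - energy (walk h f) (walk h g))"
proof -
  obtain a b c d where w: "\<And>f. walk h f = av a (av b (av c (av d (av (dir h l) (av (dir h j) f)))))"
    using walk_split by blast
  have "energy (walk h f) (walk h g) \<le> energy (av b (av c (av d (av (dir h l) (av (dir h j) f))))) (av b (av c (av d (av (dir h l) (av (dir h j) g)))))"
    unfolding w by (intro energy_av_le av_cont_cs f g)
  also have "\<dots> \<le> energy (av c (av d (av (dir h l) (av (dir h j) f)))) (av c (av d (av (dir h l) (av (dir h j) g))))"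
    by (intro energy_av_le av_cont_cs f g)
  also have "\<dots> \<le> energy (av d (av (dir h l) (av (dir h j) f))) (av d (av (dir h l) (av (dir h j) g)))"
    by (intro energy_av_le av_cont_cs f g)
  also have "\<dots> \<le> energy (av (dir h l) (av (dir h j) f)) (av (dir h l) (av (dir h j) g))"
    by (intro energy_av_le av_cont_cs f g)
  finally show ?thesis
    using integral_dif_dif_le[OF f g, of "dir h l" "dir h j"] by (simp add: dir_double)
qed

text \<open>Self-adjointness distributes the even power equally over f and g, so the m-th term is
  bounded by the energy lost in step m, and the losses telescope. The bound depends on neither N nor
  h.\<close>

lemma sum_walk_dif_dif_le:
  assumes f: "f \<in> cont_cs" and g: "g \<in> cont_cs"
  shows "(\<Sum>m<N. \<bar>LINT x|lborel. f x * (walk h ^^ (2 * m)) (dif (dir (2*h) l) (dif (dir (2*h) j) g)) x\<bar>) \<le> 2 * energy f g"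
proof -
  let ?A = "walk h" and ?D = "\<lambda>g. dif (dir (2*h) l) (dif (dir (2*h) j) g)"
  have "(\<Sum>m<N. \<bar>LINT x|lborel. f x * (?A ^^ (2 * m)) (?D g) x\<bar>)
    \<le> (\<Sum>m<N. 2 * (energy ((?A ^^ m) f) ((?A ^^ m) g) - energy ((?A ^^ Suc m) f) ((?A ^^ Suc m) g)))"
  proof (rule sum_mono)
    fix m
    have "(LINT x|lborel. f x * (?A ^^ (2 * m)) (?D g) x) = (LINT x|lborel. (?A ^^ m) f x * (?A ^^ m) (?D g) x)"
      using integral_walk_pow_mult[OF f walk_pow_cont_cs[OF dif_cont_cs[OF dif_cont_cs[OF g]], where h=h and n=m], where h=h and n=m]
      by (simp only: mult_2 funpow_add comp_apply)
    also have "\<dots> = (LINT x|lborel. (?A ^^ m) f x * ?D ((?A ^^ m) g) x)"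
      by (simp add: walk_pow_dif)
    finally show "\<bar>LINT x|lborel. f x * (?A ^^ (2 * m)) (?D g) x\<bar>
      \<le> 2 * (energy ((?A ^^ m) f) ((?A ^^ m) g) - energy ((?A ^^ Suc m) f) ((?A ^^ Suc m) g))"
      using integral_walk_dif_dif_le[OF walk_pow_cont_cs[OF f, where h=h and n=m] walk_pow_cont_cs[OF g, where h=h and n=m]] by simp
  qed
  also have "\<dots> = 2 * (energy f g - energy ((?A ^^ N) f) ((?A ^^ N) g))"
    by (subst sum_distrib_left[symmetric], subst sum_lessThan_telescope') simp
  also have "\<dots> \<le> 2 * energy f g" using energy_nonneg by simp
  finally show ?thesis .
qed

lemma sum_double: "(\<Sum>n<2 * (N::nat). a n) = (\<Sum>m<N. a (2 * m)) + (\<Sum>m<N. a (2 * m + 1) :: real)"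
proof (induction N)
  case (Suc N)
  have "2 * Suc N = Suc (Suc (2 * N))" by simp
  then show ?case using Suc by (simp only: sum.lessThan_Suc) simp
qed simp

lemma energy_le:
  assumes f: "f \<in> cont_cs" and g: "g \<in> cont_cs"
  shows "energy f g \<le> 72000 * (LINT x|lborel. f x ^ 6) + 2 * (LINT x|lborel. \<bar>g x\<bar> powr (6/5))"
proof -
  have i: "integrable lborel (\<lambda>x. f x ^ 6)" "integrable lborel (\<lambda>x. \<bar>g x\<bar> powr (6/5))"
    by (auto intro!: cont_cs_integrable cont_cs_compose[OF f, of "\<lambda>y. y ^ 6"] continuous_intros lspace_integrable cont_cs_lspace[OF g])
  have "energy f g \<le> (LINT x|lborel. 72000 * f x ^ 6 + 2 * \<bar>g x\<bar> powr (6/5))"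
    unfolding energy_def using i
    by (intro integral_mono cont_cs_integrable[OF bell_cont_cs[OF f g]] bell_le) auto
  then show ?thesis using i by simp
qed

lemma walk_lnorm_le:
  assumes g: "g \<in> cont_cs" and s: "1 \<le> s"
  shows "lnorm lborel s (walk h g) \<le> lnorm lborel s g"
proof -
  have *: "lnorm lborel s (av z f) \<le> lnorm lborel s f" if "f \<in> cont_cs" for z and f :: "real^3 \<Rightarrow> real"
    using averaging.avg_lspace(2)[OF averaging_pt s cont_cs_lspace[OF that], of z] s
    unfolding avg_pt[OF cont_cs_measurable[OF that]] by simp
  note c = av_cont_cs
  show ?thesis
    unfolding walk_def
    by (rule order_trans[OF *[OF c[OF c[OF c[OF c[OF c[OF g]]]]]] order_trans[OF *[OF c[OF c[OF c[OF c[OF g]]]]]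
        order_trans[OF *[OF c[OF c[OF c[OF g]]]] order_trans[OF *[OF c[OF c[OF g]]] order_trans[OF *[OF c[OF g]] *[OF g]]]]]])
qed

text \<open>The discrete counterpart of the L^(6/5) bound on second derivatives of the inverse
  Laplacian: the sum of walk powers is a truncated Green function. The proof pairs the sum with a
  multiple of its own dual function and absorbs the sixth-power term of the energy.\<close>

lemma walk_second_differences_bounded:
  fixes g :: "real^3 \<Rightarrow> real"
  assumes g: "g \<in> cont_cs"
  shows "lnorm lborel (6/5) (\<lambda>x. \<Sum>n<2*N. (walk h ^^ n) (dif (dir (2*h) l) (dif (dir (2*h) j) g)) x)
    \<le> 200 * lnorm lborel (6/5) g"
proof -
  let ?A = "walk h" and ?D = "\<lambda>g. dif (dir (2*h) l) (dif (dir (2*h) j) g)"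
  define X where "X x = (\<Sum>n<2*N. (?A ^^ n) (?D g) x)" for x
  have Dg: "?D g \<in> cont_cs" by (intro dif_cont_cs g)
  have X: "X \<in> cont_cs" unfolding X_def[abs_def] by (intro cont_cs_sum walk_pow_cont_cs Dg)
  \<comment> \<open>The dual function of X in L^(6/5) up to the factor 1/20, which is small enough
    that the energy contribution 288000 (1/20)^6 I of f is absorbed by I/20.\<close>
  define f where "f x = 1/20 * root 5 (X x)" for x
  have f: "f \<in> cont_cs"
    unfolding f_def[abs_def] by (intro cont_cs_cmult cont_cs_compose[OF X, of "root 5"]) (auto intro!: continuous_intros)
  define I where "I = (LINT x|lborel. \<bar>X x\<bar> powr (6/5))"
  define G where "G = (LINT x|lborel. \<bar>g x\<bar> powr (6/5))"
  have root: "root 5 y * y = \<bar>y\<bar> powr (6/5)" "root 5 y ^ 6 = \<bar>y\<bar> powr (6/5)" for y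
  proof -
    have "root 5 y * y = root 5 y ^ 6" using odd_real_root_pow[of 5 y] power_Suc[of "root 5 y" 5] by simp
    moreover have "root 5 y ^ 6 = root 5 \<bar>y\<bar> ^ 6" by (simp add: real_root_abs)
    moreover have "root 5 \<bar>y\<bar> ^ 6 = \<bar>y\<bar> powr (6/5)"
      by (cases "y = 0") (auto simp: root_powr_inverse powr_power)
    ultimately show "root 5 y * y = \<bar>y\<bar> powr (6/5)" "root 5 y ^ 6 = \<bar>y\<bar> powr (6/5)" by auto
  qed
  have nonneg: "0 \<le> I" "0 \<le> G" by (auto simp: I_def G_def)
  have "1/20 * I = (LINT x|lborel. f x * X x)"
    unfolding I_def by (simp add: f_def root flip: Bochner_Integration.integral_mult_right_zero)
  also have "\<dots> = (\<Sum>n<2*N. LINT x|lborel. f x * (?A ^^ n) (?D g) x)"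
    unfolding X_def sum_distrib_left
    by (intro Bochner_Integration.integral_sum cont_cs_integrable cont_cs_mult' walk_pow_cont_cs Dg f)
  \<comment> \<open>Odd powers are even powers applied to \<open>walk h g\<close>, whose norm is no
    larger than that of g.\<close>
  also have "\<dots> = (\<Sum>m<N. LINT x|lborel. f x * (?A ^^ (2*m)) (?D g) x) + (\<Sum>m<N. LINT x|lborel. f x * (?A ^^ (2*m)) (?D (?A g)) x)"
    by (simp add: sum_double funpow_swap1 walk_dif)
  also have "\<dots> \<le> (\<Sum>m<N. \<bar>LINT x|lborel. f x * (?A ^^ (2*m)) (?D g) x\<bar>) + (\<Sum>m<N. \<bar>LINT x|lborel. f x * (?A ^^ (2*m)) (?D (?A g)) x\<bar>)"
    by (intro add_mono sum_mono abs_ge_self)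
  also have "\<dots> \<le> 2 * energy f g + 2 * energy f (?A g)"
    by (intro add_mono sum_walk_dif_dif_le f g walk_cont_cs)
  also have "\<dots> \<le> 2 * (72000 * (LINT x|lborel. f x ^ 6) + 2 * G) + 2 * (72000 * (LINT x|lborel. f x ^ 6) + 2 * G)"
  proof -
    have "(LINT x|lborel. \<bar>?A g x\<bar> powr (6/5)) \<le> G"
      unfolding G_def using powr_mono2[OF _ _ walk_lnorm_le[OF g, of "6/5" h], of "6/5"] by (simp add: lnorm_powr)
    then show ?thesis
      using energy_le[OF f g] energy_le[OF f walk_cont_cs[OF g], of h] by (simp add: G_def)
  qed
  also have "(LINT x|lborel. f x ^ 6) = (1/20)^6 * I"
    unfolding I_def by (simp add: f_def power_mult_distrib power_divide root)
  finally have "I \<le> 200 * G" using nonneg by (simp add: power_divide)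
  \<comment> \<open>The norm is the power 5/6 of the integral; 200 \<le> 200^(6/5) lets the constant
    200 survive the root.\<close>
  also have "\<dots> \<le> 200 powr (6/5) * G"
    using nonneg powr_mono[of 1 "6/5" "200::real"] by (intro mult_right_mono) auto
  also have "\<dots> = (200 * lnorm lborel (6/5) g) powr (6/5)"
    by (simp add: powr_mult lnorm_powr G_def)
  finally have "lnorm lborel (6/5) X \<le> 200 * lnorm lborel (6/5) g"
    by (subst lnorm_le_iff) (auto simp: I_def)
  then show ?thesis by (simp add: X_def[abs_def])
qed

section \<open>Mollification\<close>

lemma lnorm_tendsto_0:
  assumes u: "\<And>m. u m \<in> borel_measurable M" and w: "w \<in> lspace M s" and s: "0 < s"
    and le: "\<And>m. AE x in M. \<bar>u m x\<bar> \<le> \<bar>w x\<bar>" and lim: "AE x in M. (\<lambda>m. u m x) \<longlonglongrightarrow> 0"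
  shows "(\<lambda>m. lnorm M s (u m)) \<longlonglongrightarrow> 0"
proof -
  have [measurable]: "u m \<in> borel_measurable M" for m by (rule u)
  have "(\<lambda>m. LINT x|M. \<bar>u m x\<bar> powr s) \<longlonglongrightarrow> (LINT x|M. 0)"
  proof (rule integral_dominated_convergence)
    show "integrable M (\<lambda>x. \<bar>w x\<bar> powr s)" by (rule lspace_integrable[OF w])
    show "AE x in M. (\<lambda>m. \<bar>u m x\<bar> powr s) \<longlonglongrightarrow> 0"
      using lim
    proof (rule eventually_mono)
      fix x assume "(\<lambda>m. u m x) \<longlonglongrightarrow> 0"
      then have "(\<lambda>m. \<bar>u m x\<bar> powr s) \<longlonglongrightarrow> 0 powr s"
        using s by (intro tendsto_powr2) (auto intro: tendsto_rabs_zero)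
      then show "(\<lambda>m. \<bar>u m x\<bar> powr s) \<longlonglongrightarrow> 0" using s by simp
    qed
    show "AE x in M. norm (\<bar>u m x\<bar> powr s) \<le> \<bar>w x\<bar> powr s" for m
      using le[of m] by (rule eventually_mono) (use s in \<open>auto intro: powr_mono2\<close>)
  qed auto
  then have "(\<lambda>m. (LINT x|M. \<bar>u m x\<bar> powr s) powr (1/s)) \<longlonglongrightarrow> 0 powr (1/s)"
    using s by (intro tendsto_powr2) auto
  then show ?thesis using s by (simp add: lnorm_def)
qed

lemma indicator_cball_lspace: "(\<lambda>x. indicator (cball a R) x * c) \<in> lspace (lborel :: 'a::euclidean_space measure) s"
proof (rule lspaceI)
  have "(\<lambda>x::'a. \<bar>indicator (cball a R) x * c\<bar> powr s) = (\<lambda>x. indicator (cball a R) x * \<bar>c\<bar> powr s)"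
    by (auto simp: indicator_def)
  then show "integrable lborel (\<lambda>x::'a. \<bar>indicator (cball a R) x * c\<bar> powr s)"
    using emeasure_lborel_cball_finite[of a R] by (simp add: integrable_indicator_iff less_top)
qed (intro borel_measurable_times borel_measurable_indicator borel_measurable_const, simp)

lemma indicator_cball_lspace': "indicator (cball a R) \<in> lspace (lborel :: 'a::euclidean_space measure) s"
  using indicator_cball_lspace[of a R 1 s] by simp

lemma lspace_bounded_support_integrable:
  fixes f :: "'a::euclidean_space \<Rightarrow> real"
  assumes f: "f \<in> lspace lborel s" and s: "1 < s" and supp: "\<And>x. R < norm x \<Longrightarrow> f x = 0"
  shows "integrable lborel f"
proof -
  have "integrable lborel (\<lambda>x. f x * indicator (cball 0 R) x)"
    by (rule Holder_integrable[OF conjugate_ex[OF s] f indicator_cball_lspace'])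
  also have "(\<lambda>x. f x * indicator (cball 0 R) x) = f"
    using supp by (auto simp: fun_eq_iff indicator_def)
  finally show ?thesis .
qed

lemma compact_supp_lspace_integrable:
  fixes f :: "'a::euclidean_space \<Rightarrow> real"
  assumes "f \<in> lspace lborel s" "1 < s" "compact_supp f"
  shows "integrable lborel f"
  using assms lspace_bounded_support_integrable by (auto simp: compact_supp_iff_cball)

text \<open>A measurable function is an almost everywhere limit of continuous ones; clipping these
  at \<plusminus>B and multiplying by a plateau function makes the sequence dominated and compactly
  supported.\<close>

lemma bounded_cont_cs_approx:
  fixes f :: "'a::euclidean_space \<Rightarrow> real"
  assumes f [measurable]: "f \<in> borel_measurable borel" and B: "\<And>x. \<bar>f x\<bar> \<le> B" and supp: "\<And>x. R < norm x \<Longrightarrow> f x = 0"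
    and s: "1 < s" and e: "0 < e"
  shows "\<exists>g\<in>cont_cs. lnorm lborel s (\<lambda>x. f x - g x) < e"
proof -
  have B0: "0 \<le> B" using B abs_ge_zero order_trans by blast
  have "f \<in> borel_measurable lebesgue" by (rule measurable_completion) simp
  then have "f measurable_on UNIV" by (rule lebesgue_measurable_imp_measurable_on) simp
  then obtain N g where N: "negligible N" and g: "\<And>n. continuous_on UNIV (g n)"
    and lim: "\<And>x. x \<notin> N \<Longrightarrow> (\<lambda>n. g n x) \<longlonglongrightarrow> f x"
    unfolding measurable_on_def by auto
  define \<theta> where "\<theta> x = max 0 (min 1 (R + 1 - norm x))" for x :: 'a
  define h where "h n x = \<theta> x * max (- B) (min B (g n x))" for n x
  have \<theta>: "\<theta> x = 0" if "R + 1 < norm x" for x using that by (simp add: \<theta>_def)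
  have \<theta>01: "0 \<le> \<theta> x" "\<theta> x \<le> 1" for x by (auto simp: \<theta>_def)
  have "continuous_on UNIV \<theta>" unfolding \<theta>_def[abs_def] by (intro continuous_intros)
  then have hc: "continuous_on UNIV (h n)" for n
    unfolding h_def[abs_def] by (intro continuous_intros continuous_on_min continuous_on_max g)
  have h: "h n \<in> cont_cs" for n
    using hc[of n] \<theta>
    by (intro cont_csI compact_supp_iff_cball[THEN iffD2] exI[of _ "R + 1"]) (auto simp: h_def)
  have "(\<lambda>n. lnorm lborel s (\<lambda>x. f x - h n x)) \<longlonglongrightarrow> 0"
  proof (rule lnorm_tendsto_0)
    show "(\<lambda>x. f x - h n x) \<in> borel_measurable lborel" for n
      using cont_cs_measurable[OF h[of n]] by simp
    show "(\<lambda>x. indicator (cball 0 (R + 1)) x * (2 * B)) \<in> lspace lborel s"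
      by (rule indicator_cball_lspace)
    have hB: "\<bar>h n x\<bar> \<le> B" for n x
      using \<theta>01[of x] B0 mult_mono[of "\<theta> x" 1 "\<bar>max (- B) (min B (g n x))\<bar>" B]
      by (auto simp: h_def abs_mult)
    show "AE x in lborel. \<bar>f x - h n x\<bar> \<le> \<bar>indicator (cball 0 (R + 1)) x * (2 * B)\<bar>" for n
    proof (rule AE_I2)
      fix x
      show "\<bar>f x - h n x\<bar> \<le> \<bar>indicator (cball 0 (R + 1)) x * (2 * B)\<bar>"
        using B[of x] hB[of n x] supp[of x] \<theta>[of x] B0 by (cases "R + 1 < norm x") (auto simp: h_def)
    qed
    have "N \<in> null_sets lebesgue" using N by (simp add: negligible_iff_null_sets)
    then have "AE x in lebesgue. x \<notin> N" by (rule AE_not_in)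
    then have "AE x in lborel. x \<notin> N" by (simp add: AE_completion_iff)
    then show "AE x in lborel. (\<lambda>n. f x - h n x) \<longlonglongrightarrow> 0"
    proof (rule eventually_mono)
      fix x assume "x \<notin> N"
      then have l: "(\<lambda>n. g n x) \<longlonglongrightarrow> f x" by (rule lim)
      have "(\<lambda>n. h n x) \<longlonglongrightarrow> \<theta> x * max (- B) (min B (f x))"
        unfolding h_def by (intro tendsto_intros tendsto_max tendsto_min l)
      also have "\<theta> x * max (- B) (min B (f x)) = f x"
        using B[of x] supp[of x] by (cases "R < norm x") (auto simp: \<theta>_def max_def min_def)
      finally show "(\<lambda>n. f x - h n x) \<longlonglongrightarrow> 0" using tendsto_diff[OF tendsto_const[of "f x"]] by fastforce
    qed
  qed (use s in auto)
  then have "\<forall>\<^sub>F n in sequentially. lnorm lborel s (\<lambda>x. f x - h n x) < e"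
    using e by (rule order_tendstoD)
  then show ?thesis using h eventually_happens trivial_limit_sequentially by blast
qed

lemma cont_cs_dense:
  fixes f :: "'a::euclidean_space \<Rightarrow> real"
  assumes f: "f \<in> lspace lborel s" and cs: "compact_supp f" and s: "1 < s" and e: "0 < e"
  shows "\<exists>g\<in>cont_cs. lnorm lborel s (\<lambda>x. f x - g x) < e"
proof -
  have [measurable]: "f \<in> borel_measurable borel" using lspace_measurable[OF f] by simp
  obtain R where R: "\<And>x. R < norm x \<Longrightarrow> f x = 0" using cs by (auto simp: compact_supp_iff_cball)
  define u where "u n x = max (- real n) (min (real n) (f x))" for n x
  have um [measurable]: "u n \<in> borel_measurable borel" for n unfolding u_def[abs_def] by measurable
  have "(\<lambda>n. lnorm lborel s (\<lambda>x. f x - u n x)) \<longlonglongrightarrow> 0"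
  proof (rule lnorm_tendsto_0[OF _ f])
    show "AE x in lborel. (\<lambda>n. f x - u n x) \<longlonglongrightarrow> 0"
    proof (rule AE_I2)
      fix x
      have "\<forall>\<^sub>F n in sequentially. \<bar>f x\<bar> \<le> real n"
        using eventually_ge_at_top[of "nat \<lceil>\<bar>f x\<bar>\<rceil>"] by (rule eventually_mono) linarith
      then have "\<forall>\<^sub>F n in sequentially. f x - u n x = 0"
        by (rule eventually_mono) (auto simp: u_def max_def min_def)
      then show "(\<lambda>n. f x - u n x) \<longlonglongrightarrow> 0" by (rule tendsto_eventually)
    qed
    show "AE x in lborel. \<bar>f x - u n x\<bar> \<le> \<bar>f x\<bar>" for n
      by (rule AE_I2) (auto simp: u_def max_def min_def abs_if)
  qed (use s in auto)
  then have "\<forall>\<^sub>F n in sequentially. lnorm lborel s (\<lambda>x. f x - u n x) < e / 2"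
    using e by (intro order_tendstoD) auto
  then obtain n where n: "lnorm lborel s (\<lambda>x. f x - u n x) < e / 2"
    using eventually_happens trivial_limit_sequentially by blast
  have ule: "\<bar>u n x\<bar> \<le> real n" for x by (auto simp: u_def)
  obtain g where g: "g \<in> cont_cs" "lnorm lborel s (\<lambda>x. u n x - g x) < e / 2"
    using bounded_cont_cs_approx[OF um ule, of R s "e / 2"] R s e by (auto simp: u_def)
  have ul: "u n \<in> lspace lborel s"
    by (rule lspace_mono(1)[OF f]) (use s in \<open>auto simp: u_def max_def min_def abs_if\<close>)
  have gl: "g \<in> lspace lborel s" using s by (intro cont_cs_lspace g) auto
  have "lnorm lborel s (\<lambda>x. (f x - u n x) + (u n x - g x)) \<le> lnorm lborel s (\<lambda>x. f x - u n x) + lnorm lborel s (\<lambda>x. u n x - g x)"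
    using s by (intro lnorm_triangle lspace_diff f ul gl) auto
  then show ?thesis using g n by (intro bexI[of _ g]) auto
qed

text \<open>Since \<rho> is even, the average can be read as a convolution in which x sits in the
  argument of \<rho>, so that derivatives fall on the kernel and not on f.\<close>

lemma mollify_TF:
  fixes f \<rho> :: "real^'n \<Rightarrow> real"
  assumes \<rho>: "\<rho> \<in> TF" "\<And>x. 0 \<le> \<rho> x" "\<And>x. \<rho> (- x) = \<rho> x" and mu: "averaging (density lborel \<rho>) r"
    and f: "integrable lborel f" "compact_supp f"
  shows "avg (density lborel \<rho>) f \<in> TF"
    and "avg (density lborel \<rho>) f x = (LINT y|lborel. f y * \<rho> (y - x))"
proof -
  have [measurable]: "f \<in> borel_measurable borel" "\<rho> \<in> borel_measurable borel"
    using f test_measurable[OF \<rho>(1)] borel_measurable_integrable by auto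
  have eq: "avg (density lborel \<rho>) f x = (LINT y|lborel. f y * \<rho> (y - x))" for x
  proof -
    have "avg (density lborel \<rho>) f x = (LINT z|lborel. \<rho> z * f (x + z))"
      unfolding avg_def by (subst integral_density) (auto simp: \<rho>)
    also have "\<dots> = (LINT y|lborel. \<rho> (y + - x) * f (x + (y + - x)))"
      by (rule integral_shift(1)[symmetric])
    finally show ?thesis by (simp add: mult.commute)
  qed
  show "avg (density lborel \<rho>) f x = (LINT y|lborel. f y * \<rho> (y - x))" by (rule eq)
  have "avg (density lborel \<rho>) f x = (LINT y|lborel. \<rho> (x + y) * f (- y))" for x
  proof -
    have "avg (density lborel \<rho>) f x = (LINT y|lborel. f (- y) * \<rho> (- y - x))"
      unfolding eq by (rule integral_uminus_lborel[symmetric]) simp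
    also have "\<dots> = (LINT y|lborel. \<rho> (x + y) * f (- y))"
      using \<rho>(3)[of "x + y" for y] by (intro Bochner_Integration.integral_cong refl) (simp add: mult.commute algebra_simps)
    finally show ?thesis .
  qed
  then have conv: "avg (density lborel \<rho>) f = (\<lambda>x. LINT y|lborel. \<rho> (x + y) * f (- y))" by auto
  have "smooth (avg (density lborel \<rho>) f)"
    unfolding conv by (rule smooth_convolution(1)[OF \<rho>(1) sets_lborel integrable_uminus_lborel[OF f(1)]])
  moreover have "compact_supp (avg (density lborel \<rho>) f)"
    by (rule averaging.avg_compact_supp[OF mu f(2)])
  ultimately show "avg (density lborel \<rho>) f \<in> TF" by (auto simp: test_functions_iff compact_supp_def)
qed

text \<open>Insert a continuous g near f: the two outer terms are f - g and an average of it, and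
  the middle one is small by uniform continuity. The radius works for all averaging measures at
  once, so one mollifier can serve several functions.\<close>

lemma mollify_approx:
  fixes f :: "real^'n \<Rightarrow> real"
  assumes f: "f \<in> lspace lborel s" and cs: "compact_supp f" and s: "1 < s" and e: "0 < e"
  shows "\<exists>d>0. \<forall>\<mu> r. averaging \<mu> r \<longrightarrow> r \<le> d \<longrightarrow> lnorm lborel s (\<lambda>x. f x - avg \<mu> f x) < e"
proof -
  obtain g where g: "g \<in> cont_cs" "lnorm lborel s (\<lambda>x. f x - g x) < e / 4"
    using cont_cs_dense[OF f cs s, of "e / 4"] e by auto
  obtain R where R: "\<And>x. R < norm x \<Longrightarrow> g x = 0"
    using g(1) by (auto simp: cont_cs_def compact_supp_iff_cball)
  define b where "b = lnorm lborel s (indicator (cball (0::real^'n) (R + 1))) + 1"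
  have b: "0 < b" using lnorm_nonneg[of lborel s "indicator (cball (0::real^'n) (R + 1))"] unfolding b_def by linarith
  have eb: "0 < e / 4 / b" using e b by simp
  obtain d where d: "0 < d" "\<And>x y. dist y x < d \<Longrightarrow> dist (g y) (g x) < e / 4 / b"
    using cont_cs_uniformly_continuous[OF g(1)] eb unfolding uniformly_continuous_on_def by (metis UNIV_I)
  have gl: "g \<in> lspace lborel s" using s by (intro cont_cs_lspace g) auto
  have "lnorm lborel s (\<lambda>x. f x - avg \<mu> f x) < e" if mu: "averaging \<mu> r" and r: "r \<le> min (d / 2) 1" for \<mu> r
  proof -
    interpret averaging \<mu> r by fact
    have close: "\<bar>g x - avg \<mu> g x\<bar> \<le> \<bar>indicator (cball 0 (R + 1)) x * (e / 4 / b)\<bar>" for x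
    proof -
      have i: "integrable \<mu> (\<lambda>z. g (x + z))" by (rule integrable_shift_cont_cs[OF g(1)])
      have "g x - avg \<mu> g x = (LINT z|\<mu>. g x - g (x + z))"
        using i prob_space by (simp add: avg_def)
      also have "\<bar>\<dots>\<bar> \<le> (LINT z|\<mu>. \<bar>g x - g (x + z)\<bar>)" by (rule integral_abs_bound)
      also have "\<dots> \<le> (LINT z|\<mu>. indicator (cball 0 (R + 1)) x * (e / 4 / b))"
      proof (rule integral_mono_AE)
        show "integrable \<mu> (\<lambda>z. \<bar>g x - g (x + z)\<bar>)" using i by simp
        show "AE z in \<mu>. \<bar>g x - g (x + z)\<bar> \<le> indicator (cball 0 (R + 1)) x * (e / 4 / b)"
          using bounded_supp
        proof (rule eventually_mono)
          fix z :: "real^'n" assume z: "norm z \<le> r"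
          show "\<bar>g x - g (x + z)\<bar> \<le> indicator (cball 0 (R + 1)) x * (e / 4 / b)"
          proof (cases "norm x \<le> R + 1")
            case True
            then show ?thesis
              using d(2)[of "x + z" x] z r d(1) by (simp add: dist_norm abs_minus_commute)
          next
            case False
            then have "R < norm (x + z)" using norm_triangle_ineq4[of "x + z" z] z r by simp
            with False show ?thesis using R[of x] R[of "x + z"] by simp
          qed
        qed
      qed simp
      also have "\<dots> = indicator (cball 0 (R + 1)) x * (e / 4 / b)" using prob_space by simp
      finally show ?thesis by (rule order_trans[OF _ abs_ge_self])
    qed
    have [measurable]: "g \<in> borel_measurable borel" by (rule cont_cs_measurable[OF g(1)])
    have s0: "0 < s" "1 \<le> s" using s by auto
    note a = avg_lspace[OF s0(2)]
    have 1: "lnorm lborel s (\<lambda>x. g x - avg \<mu> g x) \<le> e / 4"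
    proof -
      have "lnorm lborel s (\<lambda>x. g x - avg \<mu> g x) \<le> lnorm lborel s (\<lambda>x. indicator (cball (0::real^'n) (R + 1)) x * (e / 4 / b))"
        by (rule lspace_mono(2)[OF indicator_cball_lspace]) (use close s0 in auto)
      also have "\<dots> = (e / 4 / b) * lnorm lborel s (indicator (cball (0::real^'n) (R + 1)))"
        using lnorm_cmult[OF s0(1), of lborel "e / 4 / b" "indicator (cball (0::real^'n) (R + 1))"] e b by (simp add: mult.commute)
      also have "\<dots> \<le> (e / 4 / b) * b" using eb by (intro mult_left_mono) (auto simp: b_def)
      also have "\<dots> = e / 4" using b by simp
      finally show ?thesis .
    qed
    have fg: "(\<lambda>x. f x - g x) \<in> lspace lborel s" by (rule lspace_diff[OF f gl s0(1)])
    have fint: "integrable lborel f" by (rule compact_supp_lspace_integrable[OF f s cs])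
    have eq: "lnorm lborel s (\<lambda>x. avg \<mu> g x - avg \<mu> f x) \<le> e / 4"
    proof -
      have m: "case_prod (\<lambda>x z. g (x + z) - f (x + z)) \<in> borel_measurable (borel \<Otimes>\<^sub>M borel)"
        using lspace_measurable[OF f] by measurable
      \<comment> \<open>The average of a difference is split into averages only where f(x + z) is
        integrable in z, which Fubini guarantees for almost every x.\<close>
      have "AE x in lborel. (LINT z|\<mu>. g (x + z) - f (x + z)) = avg \<mu> g x - avg \<mu> f x"
      proof -
        have [measurable]: "f \<in> borel_measurable borel" using lspace_measurable[OF f] by simp
        have "integrable (\<mu> \<Otimes>\<^sub>M lborel) (case_prod (\<lambda>z x. f (x + z)))"
        proof (rule zx.Fubini_integrable)
          show "integrable \<mu> (\<lambda>z. LINT x|lborel. norm (case_prod (\<lambda>z x. f (x + z)) (z, x)))"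
            using integral_shift(1)[of "\<lambda>x. norm (f x)"] by simp
          show "AE z in \<mu>. integrable lborel (\<lambda>x. case_prod (\<lambda>z x. f (x + z)) (z, x))"
            using fint by (simp add: integral_shift(2))
        qed measurable
        from zx.integrable_product_swap[OF this]
        have "integrable (lborel \<Otimes>\<^sub>M \<mu>) (case_prod (\<lambda>x z. f (x + z)))" by (simp add: case_prod_beta')
        from xz.AE_integrable_fst'[OF this] have "AE x in lborel. integrable \<mu> (\<lambda>z. f (x + z))" by simp
        then show ?thesis
          by (rule eventually_mono) (simp add: avg_def integrable_shift_cont_cs[OF g(1)])
      qed
      then have "lnorm lborel s (\<lambda>x. avg \<mu> g x - avg \<mu> f x) = lnorm lborel s (\<lambda>x. LINT z|\<mu>. g (x + z) - f (x + z))"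
      proof (intro lnorm_cong_AE)
        have [measurable]: "f \<in> borel_measurable borel" using lspace_measurable[OF f] by simp
        show "(\<lambda>x. LINT z|\<mu>. g (x + z) - f (x + z)) \<in> borel_measurable lborel"
          by (rule borel_measurable_lebesgue_integral) measurable
        show "(\<lambda>x. avg \<mu> g x - avg \<mu> f x) \<in> borel_measurable lborel"
          by (intro borel_measurable_diff lspace_measurable[OF a(1)[OF f]] lspace_measurable[OF a(1)[OF gl]])
      qed (auto elim: eventually_mono)
      also have "\<dots> \<le> lnorm lborel s (\<lambda>x. f x - g x)"
      proof (rule lnorm_integral_le(2)[OF s0(2) m lnorm_nonneg])
        have gf: "(\<lambda>x. g x - f x) \<in> lspace lborel s" by (rule lspace_diff[OF gl f s0(1)])
        have "lnorm lborel s (\<lambda>x. g x - f x) = lnorm lborel s (\<lambda>x. f x - g x)"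
          using lnorm_uminus[of lborel s "\<lambda>x. f x - g x"] by simp
        then show "AE z in \<mu>. (\<lambda>x. g (x + z) - f (x + z)) \<in> lspace lborel s \<and> lnorm lborel s (\<lambda>x. g (x + z) - f (x + z)) \<le> lnorm lborel s (\<lambda>x. f x - g x)"
          using lspace_shift[OF gf] by simp
      qed
      finally show ?thesis using g(2) by simp
    qed
    have "lnorm lborel s (\<lambda>x. (f x - g x) + ((g x - avg \<mu> g x) + (avg \<mu> g x - avg \<mu> f x)))
      \<le> lnorm lborel s (\<lambda>x. f x - g x) + (lnorm lborel s (\<lambda>x. g x - avg \<mu> g x) + lnorm lborel s (\<lambda>x. avg \<mu> g x - avg \<mu> f x))"
      by (intro order_trans[OF lnorm_triangle] add_left_mono lnorm_triangle lspace_add lspace_diff f gl a(1) s s0)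
    then show ?thesis using g(2) 1 eq e by simp
  qed
  then show ?thesis using d(1) by (intro exI[of _ "min (d / 2) 1"]) auto
qed

section \<open>Compactness modulo means\<close>

definition ball_mean :: "real \<Rightarrow> ('a::euclidean_space \<Rightarrow> real) \<Rightarrow> real" where
  "ball_mean R v = (LINT x|lborel. indicator (cball 0 R) x / measure lborel (cball (0::'a) R) * v x)"

lemma measure_cball_pos:
  assumes "0 < R"
  shows "0 < measure lborel (cball (0::'a::euclidean_space) R)"
  using content_cball_pos[OF assms, of "0::'a"] by simp

lemma averaging_ball:
  assumes "0 < R"
  shows "averaging (density lborel (\<lambda>x::'a::euclidean_space. ennreal (indicator (cball 0 R) x / measure lborel (cball (0::'a) R)))) R"
proof (rule averaging_density)
  have int: "integrable lborel (indicator (cball (0::'a) R) :: 'a \<Rightarrow> real)"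
    using emeasure_lborel_cball_finite[of "0::'a" R] by (simp add: integrable_indicator_iff less_top)
  then show "integrable lborel (\<lambda>x::'a. indicator (cball 0 R) x / measure lborel (cball (0::'a) R))" by simp
  show "(LINT x::'a|lborel. indicator (cball 0 R) x / measure lborel (cball (0::'a) R)) = 1"
    using measure_cball_pos[OF assms, where 'a='a] by simp
qed (auto simp: indicator_def)

text \<open>By Jensen the deviation from the mean is bounded by a double integral of |v(x) - v(y)|^s
  over the ball. Substituting z = x - y, which ranges in the ball of radius 2 R, leaves translation
  differences, each controlled by |z| times \<open>dnorm\<close>.\<close>

lemma poincare:
  assumes s: "1 < s" and R: "0 < R"
  shows "\<exists>C\<ge>0. \<forall>v\<in>(TF :: (real^'n \<Rightarrow> real) set).
    (\<lambda>x. indicator (cball 0 R) x * (v x - ball_mean R v)) \<in> lspace lborel s \<and>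
    lnorm lborel s (\<lambda>x. indicator (cball 0 R) x * (v x - ball_mean R v)) \<le> C * dnorm s v"
proof -
  let ?B = "cball (0::real^'n) R" and ?B2 = "cball (0::real^'n) (2 * R)"
  define b where "b = measure lborel ?B"
  define b2 where "b2 = measure lborel ?B2"
  have b: "0 < b" unfolding b_def by (rule measure_cball_pos[OF R])
  have b2: "0 < b2" unfolding b2_def by (rule measure_cball_pos) (use R in simp)
  let ?\<rho> = "\<lambda>x::real^'n. indicator ?B x / b :: real"
  let ?\<mu> = "density lborel (\<lambda>x. ennreal (?\<rho> x))"
  interpret averaging ?\<mu> R unfolding b_def by (rule averaging_ball[OF R])
  have [measurable]: "?B \<in> sets borel" "?B2 \<in> sets borel" by auto
  have \<rho>m [measurable]: "?\<rho> \<in> borel_measurable borel"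
    by (intro borel_measurable_divide borel_measurable_indicator borel_measurable_const) simp
  define C where "C = (b2 / b) powr (1 / s) * (2 * R)"
  have "(\<lambda>x. indicator ?B x * (v x - ball_mean R v)) \<in> lspace lborel s \<and>
    lnorm lborel s (\<lambda>x. indicator ?B x * (v x - ball_mean R v)) \<le> C * dnorm s v" if v: "v \<in> TF" for v
  proof -
    have s1: "1 \<le> s" "0 < s" using s by auto
    have vm [measurable]: "v \<in> borel_measurable borel" by (rule test_measurable[OF v])
    define D where "D = (2 * R * dnorm s v) powr s"
    let ?w = "\<lambda>x y. indicator ?B x * (v x - v y) :: real"
    have iv: "integrable ?\<mu> v" using integrable_shift_cont_cs[OF test_cont_cs[OF v], of 0] by simp
    have mean: "(LINT y|?\<mu>. v y) = ball_mean R v"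
      using \<rho>m b unfolding ball_mean_def b_def[symmetric] by (subst integral_density) (auto simp: b_def)
    have eq: "(LINT y|?\<mu>. ?w x y) = indicator ?B x * (v x - ball_mean R v)" for x
      using iv mean prob_space by simp
    have tr: "(\<integral>\<^sup>+y. ennreal (\<bar>v (z + y) - v y\<bar> powr s) \<partial>lborel) \<le> ennreal D" if z: "norm z \<le> 2 * R" for z
    proof -
      have l: "(\<lambda>x. v x - v (x + z)) \<in> lspace lborel s"
        using s1 by (intro lspace_diff lspace_shift test_lspace[OF v])
      have "(\<integral>\<^sup>+y. ennreal (\<bar>v (z + y) - v y\<bar> powr s) \<partial>lborel) = (\<integral>\<^sup>+y. ennreal (\<bar>v y - v (y + z)\<bar> powr s) \<partial>lborel)"
        by (simp add: add.commute abs_minus_commute)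
      also have "\<dots> = ennreal (LINT y|lborel. \<bar>v y - v (y + z)\<bar> powr s)"
        by (rule nn_integral_eq_integral[OF lspace_integrable[OF l]]) simp
      also have "\<dots> \<le> ennreal D"
      proof (rule ennreal_leI)
        have "lnorm lborel s (\<lambda>x. v x - v (x + z)) \<le> 2 * R * dnorm s v"
          using lnorm_shift_diff_le[OF v s, of z] mult_right_mono[OF z dnorm_nonneg, of s v] by linarith
        then show "(LINT y|lborel. \<bar>v y - v (y + z)\<bar> powr s) \<le> D"
          unfolding D_def using s1 R by (subst (asm) lnorm_le_iff) auto
      qed
      finally show ?thesis .
    qed
    have "(\<integral>\<^sup>+x. ennreal (\<bar>LINT y|?\<mu>. ?w x y\<bar> powr s) \<partial>lborel)
      \<le> (\<integral>\<^sup>+y. (\<integral>\<^sup>+x. ennreal (\<bar>?w x y\<bar> powr s) \<partial>lborel) \<partial>?\<mu>)"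
      by (rule nn_integral_abs_powr_le[OF s1(1)]) measurable
    also have "\<dots> = (\<integral>\<^sup>+y. ennreal (?\<rho> y) * (\<integral>\<^sup>+x. ennreal (\<bar>?w x y\<bar> powr s) \<partial>lborel) \<partial>lborel)"
      by (subst nn_integral_density) auto
    also have "\<dots> \<le> (\<integral>\<^sup>+y. ennreal (1 / b) * (\<integral>\<^sup>+x. indicator ?B2 (x - y) * ennreal (\<bar>v x - v y\<bar> powr s) \<partial>lborel) \<partial>lborel)"
    proof (rule nn_integral_mono)
      fix y :: "real^'n"
      show "ennreal (?\<rho> y) * (\<integral>\<^sup>+x. ennreal (\<bar>?w x y\<bar> powr s) \<partial>lborel)
        \<le> ennreal (1 / b) * (\<integral>\<^sup>+x. indicator ?B2 (x - y) * ennreal (\<bar>v x - v y\<bar> powr s) \<partial>lborel)"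
      proof (cases "y \<in> ?B")
        case True
        have "(\<integral>\<^sup>+x. ennreal (\<bar>?w x y\<bar> powr s) \<partial>lborel) \<le> (\<integral>\<^sup>+x. indicator ?B2 (x - y) * ennreal (\<bar>v x - v y\<bar> powr s) \<partial>lborel)"
        proof (rule nn_integral_mono)
          fix x :: "real^'n"
          have "norm (x - y) \<le> norm x + norm y" by (rule norm_triangle_ineq4)
          then show "ennreal (\<bar>?w x y\<bar> powr s) \<le> indicator ?B2 (x - y) * ennreal (\<bar>v x - v y\<bar> powr s)"
            using True by (auto simp: indicator_def)
        qed
        then show ?thesis using True by (auto intro: mult_left_mono)
      qed simp
    qed
    also have "\<dots> = ennreal (1 / b) * (\<integral>\<^sup>+y. (\<integral>\<^sup>+x. indicator ?B2 (x - y) * ennreal (\<bar>v x - v y\<bar> powr s) \<partial>lborel) \<partial>lborel)"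
      by (rule nn_integral_cmult) measurable
    also have "(\<integral>\<^sup>+y. (\<integral>\<^sup>+x. indicator ?B2 (x - y) * ennreal (\<bar>v x - v y\<bar> powr s) \<partial>lborel) \<partial>lborel)
      = (\<integral>\<^sup>+y. (\<integral>\<^sup>+z. indicator ?B2 z * ennreal (\<bar>v (z + y) - v y\<bar> powr s) \<partial>lborel) \<partial>lborel)"
    proof (rule nn_integral_cong)
      fix y :: "real^'n"
      show "(\<integral>\<^sup>+x. indicator ?B2 (x - y) * ennreal (\<bar>v x - v y\<bar> powr s) \<partial>lborel)
        = (\<integral>\<^sup>+z. indicator ?B2 z * ennreal (\<bar>v (z + y) - v y\<bar> powr s) \<partial>lborel)"
        using nn_integral_shift[of "\<lambda>x. indicator ?B2 (x - y) * ennreal (\<bar>v x - v y\<bar> powr s)" y] by simp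
    qed
    also have "\<dots> = (\<integral>\<^sup>+z. (\<integral>\<^sup>+y. indicator ?B2 z * ennreal (\<bar>v (z + y) - v y\<bar> powr s) \<partial>lborel) \<partial>lborel)"
      by (rule lborel_pair.Fubini') measurable
    also have "\<dots> \<le> (\<integral>\<^sup>+z. ennreal D * indicator ?B2 z \<partial>lborel)"
    proof (rule nn_integral_mono)
      fix z :: "real^'n"
      show "(\<integral>\<^sup>+y. indicator ?B2 z * ennreal (\<bar>v (z + y) - v y\<bar> powr s) \<partial>lborel) \<le> ennreal D * indicator ?B2 z"
        using tr[of z] by (auto simp: indicator_def)
    qed
    also have "\<dots> = ennreal D * ennreal b2"
      using emeasure_lborel_cball_finite[of "0::real^'n" "2 * R"]
      by (subst nn_integral_cmult_indicator) (simp_all add: b2_def emeasure_eq_ennreal_measure less_top)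
    finally have "(\<integral>\<^sup>+x. ennreal (\<bar>LINT y|?\<mu>. ?w x y\<bar> powr s) \<partial>lborel) \<le> ennreal (1 / b) * (ennreal D * ennreal b2)"
      by (simp add: mult_left_mono)
    also have "\<dots> = ennreal ((C * dnorm s v) powr s)"
    proof -
      have "(C * dnorm s v) powr s = ((b2 / b) powr (1 / s)) powr s * D"
        using R b b2 by (simp add: C_def D_def powr_mult mult.assoc)
      also have "\<dots> = b2 / b * D" using s b b2 by (simp add: powr_powr)
      finally show ?thesis using b b2 by (simp add: D_def flip: ennreal_mult)
    qed
    finally have nn: "(\<integral>\<^sup>+x. ennreal (\<bar>indicator ?B x * (v x - ball_mean R v)\<bar> powr s) \<partial>lborel) \<le> ennreal ((C * dnorm s v) powr s)"
      unfolding eq .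
    have m: "(\<lambda>x. indicator ?B x * (v x - ball_mean R v)) \<in> borel_measurable lborel" by measurable
    have int: "integrable lborel (\<lambda>x. \<bar>indicator ?B x * (v x - ball_mean R v)\<bar> powr s)"
      using nn m by (intro integrableI_nonneg) (auto intro: le_less_trans)
    have "(LINT x|lborel. \<bar>indicator ?B x * (v x - ball_mean R v)\<bar> powr s) \<le> (C * dnorm s v) powr s"
      using nn nn_integral_eq_integral[OF int] by (simp add: ennreal_le_iff)
    moreover have "0 \<le> C * dnorm s v" using R by (simp add: C_def)
    ultimately show ?thesis using lspaceI[OF m int] s1 by (simp add: lnorm_le_iff)
  qed
  moreover have "0 \<le> C" using R by (simp add: C_def)
  ultimately show ?thesis by blast
qed

text \<open>A substitute for Rellich's theorem: weakly null sequences are null uniformly on the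
  functions with bounded gradient, up to subtraction of a mean.\<close>

lemma weakly_null_uniform:
  fixes g :: "nat \<Rightarrow> real^'n \<Rightarrow> real"
  assumes st: "conjugate s t" and g: "\<And>k. g k \<in> lspace lborel t" and C: "\<And>k. lnorm lborel t (g k) \<le> C"
    and supp: "\<And>k x. R < norm x \<Longrightarrow> g k x = 0" and R: "0 < R"
    and weak: "\<And>\<theta>. \<theta> \<in> TF \<Longrightarrow> (\<lambda>k. LINT x|lborel. g k x * \<theta> x) \<longlonglongrightarrow> 0"
    and e: "0 < \<epsilon>"
  shows "\<forall>\<^sub>F k in sequentially. \<forall>v\<in>TF. \<bar>LINT x|lborel. g k x * (v x - ball_mean (R + 1) v)\<bar> \<le> \<epsilon> * dnorm s v"
proof -
  note c = conjugateD[OF st]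
  have C0: "0 \<le> C" using C[of 0] lnorm_nonneg order_trans by blast
  \<comment> \<open>This radius makes the mollification error C d at most \<epsilon>/2; d \<le> 1
    keeps the mollified functions supported in the ball of radius R + 1.\<close>
  define d where "d = min 1 (\<epsilon> / (2 * (C + 1)))"
  have d: "0 < d" "d \<le> 1" using e C0 by (auto simp: d_def)
  have Cd: "C * d \<le> \<epsilon> / 2"
  proof -
    have "C * d \<le> (C + 1) * (\<epsilon> / (2 * (C + 1)))" using C0 d by (intro mult_mono) (auto simp: d_def)
    also have "\<dots> = \<epsilon> / 2" using C0 by (simp add: field_simps)
    finally show ?thesis .
  qed
  obtain \<rho> where \<rho>: "\<rho> \<in> TF" "\<And>x::real^'n. 0 \<le> \<rho> x" "\<And>x. \<rho> (- x) = \<rho> x" "averaging (density lborel \<rho>) d"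
    using exists_mollifier[OF d(1)] by metis
  let ?\<mu> = "density lborel \<rho>"
  interpret averaging ?\<mu> d by fact
  obtain P where P: "0 \<le> P" and poinc: "\<And>v. v \<in> (TF :: (real^'n \<Rightarrow> real) set) \<Longrightarrow>
    (\<lambda>x. indicator (cball 0 (R + 1)) x * (v x - ball_mean (R + 1) v)) \<in> lspace lborel s \<and>
    lnorm lborel s (\<lambda>x. indicator (cball 0 (R + 1)) x * (v x - ball_mean (R + 1) v)) \<le> P * dnorm s v"
    using poincare[OF c(1), of "R + 1"] R by fastforce
  have gint: "integrable lborel (g k)" for k
    by (rule lspace_bounded_support_integrable[OF g c(2) supp])
  have gcs: "compact_supp (g k)" for k using supp by (auto simp: compact_supp_iff_cball)
  let ?G = "\<lambda>k. avg ?\<mu> (g k)"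
  have Gl: "?G k \<in> lspace lborel t" for k using c by (intro avg_lspace g) auto
  have Gsupp: "?G k x = 0" if "R + 1 < norm x" for k x
    unfolding avg_def
  proof (rule integral_eq_zero_AE)
    show "AE z in ?\<mu>. g k (x + z) = 0"
      using bounded_supp
    proof (rule eventually_mono)
      fix z :: "real^'n" assume "norm z \<le> d"
      then show "g k (x + z) = 0"
        using that norm_triangle_ineq4[of "x + z" z] d by (intro supp) simp
    qed
  qed
  have \<rho>s: "(\<lambda>y. \<rho> (y - x)) \<in> TF" for x
  proof -
    have "smooth (\<lambda>y. \<rho> (y - x))"
      using smooth_shift(1)[OF test_smooth[OF \<rho>(1)], where z="- x"] by simp
    moreover have "compact_supp (\<lambda>y. \<rho> (y - x))"
      using cont_cs_shift'[OF test_cont_cs[OF \<rho>(1)], of x] by (simp add: cont_cs_def)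
    ultimately show ?thesis by (auto simp: test_functions_iff compact_supp_def)
  qed
  have Geq: "?G k x = (LINT y|lborel. g k y * \<rho> (y - x))" for k x
    by (rule mollify_TF(2)[OF \<rho> gint gcs])
  have Gbound: "\<bar>?G k x\<bar> \<le> \<bar>indicator (cball 0 (R + 1)) x * (C * lnorm lborel s \<rho>)\<bar>" for k x
  proof (cases "norm x \<le> R + 1")
    case True
    have \<rho>l: "\<rho> \<in> lspace lborel s" using c by (intro test_lspace[OF \<rho>(1)]) auto
    have "\<bar>?G k x\<bar> \<le> lnorm lborel t (g k) * lnorm lborel s (\<lambda>y. \<rho> (y + - x))"
      unfolding Geq using Holder_le[OF c(4) g lspace_shift(1)[OF \<rho>l, of "- x"], of k] by simp
    also have "\<dots> = lnorm lborel t (g k) * lnorm lborel s \<rho>" by (simp only: lspace_shift(2)[OF \<rho>l])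
    also have "\<dots> \<le> C * lnorm lborel s \<rho>" by (intro mult_right_mono C) simp
    finally show ?thesis using True C0 by simp
  next
    case False
    then show ?thesis using Gsupp[of x k] by simp
  qed
  \<comment> \<open>The mollified functions converge at every point, being pairings of g_k with
    translates of \<rho>, and they are uniformly bounded with common support. Weak convergence has
    thus become strong.\<close>
  have "(\<lambda>k. lnorm lborel t (?G k)) \<longlonglongrightarrow> 0"
  proof (rule lnorm_tendsto_0[OF _ indicator_cball_lspace])
    show "AE x in lborel. (\<lambda>k. ?G k x) \<longlonglongrightarrow> 0"
      unfolding Geq using weak[OF \<rho>s] by simp
    show "AE x in lborel. \<bar>?G k x\<bar> \<le> \<bar>indicator (cball 0 (R + 1)) x * (C * lnorm lborel s \<rho>)\<bar>" for k
      using Gbound by simp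
  qed (use lspace_measurable[OF Gl] c in auto)
  then have "(\<lambda>k. lnorm lborel t (?G k) * P) \<longlonglongrightarrow> 0 * P" by (rule tendsto_mult_right)
  then have "\<forall>\<^sub>F k in sequentially. lnorm lborel t (?G k) * P < \<epsilon> / 2"
    using e by (intro order_tendstoD(2)) auto
  then show ?thesis
  proof (rule eventually_mono)
    fix k assume small: "lnorm lborel t (?G k) * P < \<epsilon> / 2"
    show "\<forall>v\<in>TF. \<bar>LINT x|lborel. g k x * (v x - ball_mean (R + 1) v)\<bar> \<le> \<epsilon> * dnorm s v"
    proof
      fix v :: "real^'n \<Rightarrow> real" assume v: "v \<in> TF"
      let ?c = "ball_mean (R + 1) v"
      have vl: "v \<in> lspace lborel s" using c by (intro test_lspace[OF v]) auto
      have avl: "avg ?\<mu> v \<in> lspace lborel s" using c by (intro avg_lspace(1) vl) auto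
      have i1: "integrable lborel (\<lambda>x. g k x * v x)" and i2: "integrable lborel (\<lambda>x. g k x * avg ?\<mu> v x)"
        and i3: "integrable lborel (\<lambda>x. ?G k x * v x)"
        using Holder_integrable[OF c(4) g vl] Holder_integrable[OF c(4) g avl] Holder_integrable[OF c(4) Gl vl] by auto
      have Gint: "integrable lborel (?G k)"
        by (rule lspace_bounded_support_integrable[OF Gl c(2) Gsupp])
      have "(LINT x|lborel. g k x * (v x - ?c)) = (LINT x|lborel. g k x * v x) - (LINT x|lborel. g k x) * ?c"
        using i1 gint by (simp add: right_diff_distrib)
      also have "\<dots> = (LINT x|lborel. g k x * (v x - avg ?\<mu> v x)) + ((LINT x|lborel. g k x * avg ?\<mu> v x) - (LINT x|lborel. g k x) * ?c)"
        using i1 i2 by (simp add: right_diff_distrib)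
      \<comment> \<open>Averaging moves from v to g_k by self-adjointness, and the mean of v keeps
        its coefficient because averaging preserves the integral of g_k.\<close>
      also have "(LINT x|lborel. g k x * avg ?\<mu> v x) - (LINT x|lborel. g k x) * ?c = (LINT x|lborel. ?G k x * v x) - (LINT x|lborel. ?G k x) * ?c"
        by (simp add: integral_avg_mult[OF c(4) g vl] integral_avg[OF gint])
      also have "\<dots> = (LINT x|lborel. ?G k x * (v x - ?c))"
        using i3 Gint by (simp add: right_diff_distrib)
      also have "\<dots> = (LINT x|lborel. ?G k x * (indicator (cball 0 (R + 1)) x * (v x - ?c)))"
        using Gsupp by (intro Bochner_Integration.integral_cong refl) (auto simp: indicator_def)
      finally have eq: "(LINT x|lborel. g k x * (v x - ?c)) = (LINT x|lborel. g k x * (v x - avg ?\<mu> v x))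
        + (LINT x|lborel. ?G k x * (indicator (cball 0 (R + 1)) x * (v x - ?c)))" .
      have "\<bar>LINT x|lborel. g k x * (v x - avg ?\<mu> v x)\<bar> \<le> lnorm lborel t (g k) * lnorm lborel s (\<lambda>x. v x - avg ?\<mu> v x)"
        using c by (intro Holder_le[OF c(4) g] lspace_diff vl avl) auto
      also have "\<dots> \<le> C * (d * dnorm s v)"
        by (intro mult_mono C lnorm_avg_diff_le[OF \<rho>(4) v c(1)] C0) auto
      also have "\<dots> \<le> \<epsilon> / 2 * dnorm s v" using mult_right_mono[OF Cd dnorm_nonneg[of s v]] by (simp add: mult.assoc)
      finally have 1: "\<bar>LINT x|lborel. g k x * (v x - avg ?\<mu> v x)\<bar> \<le> \<epsilon> / 2 * dnorm s v" .
      have "\<bar>LINT x|lborel. ?G k x * (indicator (cball 0 (R + 1)) x * (v x - ?c))\<bar>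
        \<le> lnorm lborel t (?G k) * lnorm lborel s (\<lambda>x. indicator (cball 0 (R + 1)) x * (v x - ?c))"
        by (intro Holder_le[OF c(4) Gl]) (use poinc[OF v] in blast)
      also have "\<dots> \<le> lnorm lborel t (?G k) * (P * dnorm s v)"
        using poinc[OF v] by (intro mult_left_mono) auto
      also have "\<dots> \<le> \<epsilon> / 2 * dnorm s v"
        using mult_right_mono[OF less_imp_le[OF small] dnorm_nonneg[of s v]] by (simp add: mult.assoc)
      finally have 2: "\<bar>LINT x|lborel. ?G k x * (indicator (cball 0 (R + 1)) x * (v x - ?c))\<bar> \<le> \<epsilon> / 2 * dnorm s v" .
      show "\<bar>LINT x|lborel. g k x * (v x - ?c)\<bar> \<le> \<epsilon> * dnorm s v"
        unfolding eq using 1 2 by argo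
    qed
  qed
qed

section \<open>Decay of the random walk\<close>

lemma av_lnorm_le:
  assumes "f \<in> cont_cs" "1 \<le> s"
  shows "lnorm lborel s (av z f) \<le> lnorm lborel s f"
  using averaging.avg_lspace(2)[OF averaging_pt assms(2) cont_cs_lspace[OF assms(1)], of z] assms(2)
  unfolding avg_pt[OF cont_cs_measurable[OF assms(1)]] by simp

lemma av_pow_cont_cs: "f \<in> cont_cs \<Longrightarrow> (av z ^^ n) f \<in> cont_cs"
  by (induction n) (auto intro: av_cont_cs)

lemma av_pow_lnorm_le:
  assumes "f \<in> cont_cs" "1 \<le> s"
  shows "lnorm lborel s ((av z ^^ n) f) \<le> lnorm lborel s f"
  by (induction n) (auto intro: order_trans[OF av_lnorm_le] av_pow_cont_cs assms)

lemma av_pow_commute: "(av z ^^ n) (av w f) = av w ((av z ^^ n) f)"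
proof (induction n)
  case (Suc n)
  then show ?case by (simp add: av_commute[of z w])
qed simp

lemma av_pow_binomial:
  "(av z ^^ n) f x = (\<Sum>k\<le>n. real (n choose k) * f (x + (real n - 2 * real k) *\<^sub>R z)) / 2 ^ n"
proof (induction n arbitrary: x)
  case (Suc n)
  let ?g = "\<lambda>k. f (x + (real (Suc n) - 2 * real k) *\<^sub>R z)"
  have g1: "(x + z) + (real n - 2 * real k) *\<^sub>R z = x + (real (Suc n) - 2 * real k) *\<^sub>R z" for k
    by (simp add: algebra_simps)
  have g2: "(x - z) + (real n - 2 * real k) *\<^sub>R z = x + (real (Suc n) - 2 * real (Suc k)) *\<^sub>R z" for k
    by (simp add: algebra_simps scaleR_2)
  have "(av z ^^ Suc n) f x = ((\<Sum>k\<le>n. real (n choose k) * ?g k) + (\<Sum>k\<le>n. real (n choose k) * ?g (Suc k))) / 2 ^ Suc n"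
    unfolding funpow.simps comp_apply av_def[of z "(av z ^^ n) f"] Suc g1 g2 by (simp add: field_simps)
  also have "(\<Sum>k\<le>n. real (n choose k) * ?g k) = (\<Sum>k\<le>Suc n. real (n choose k) * ?g k)" by simp
  also have "\<dots> = ?g 0 + (\<Sum>k\<le>n. real (n choose Suc k) * ?g (Suc k))"
    by (subst sum.atMost_Suc_shift) simp
  also have "\<dots> + (\<Sum>k\<le>n. real (n choose k) * ?g (Suc k)) = (\<Sum>k\<le>Suc n. real (Suc n choose k) * ?g k)"
    by (subst sum.atMost_Suc_shift[of "\<lambda>k. real (Suc n choose k) * ?g k"]) (simp add: distrib_right sum.distrib)
  finally show ?case .
qed simp

text \<open>The left side is multiplied by (2n+1)(2n+3)/(2n+2)^2 \<le> 1 from n to n + 1 and starts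
  at 1. The probability of the central value thus decays at least like n^(-1/2).\<close>

lemma central_binomial_le: "(real ((2 * n) choose n) / 4 ^ n)\<^sup>2 * (2 * n + 1) \<le> 1"
proof (induction n)
  case (Suc n)
  have "Suc n * ((2 * Suc n) choose Suc n) = (2 * n + 2) * ((2 * n + 1) choose n)"
    using Suc_times_binomial[of n "2 * n + 1"] by simp
  also have "\<dots> = 2 * (Suc n * ((2 * n + 1) choose n))" by (simp only: mult.assoc[symmetric]) simp
  also have "((2 * n + 1) choose n) = ((2 * n + 1) choose Suc n)"
    using binomial_symmetric[of n "2 * n + 1"] by simp
  also have "Suc n * ((2 * n + 1) choose Suc n) = (2 * n + 1) * ((2 * n) choose n)"
    using Suc_times_binomial[of n "2 * n"] by simp
  finally have "Suc n * ((2 * Suc n) choose Suc n) = 2 * ((2 * n + 1) * ((2 * n) choose n))" .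
  then have real_eq: "real (Suc n * ((2 * Suc n) choose Suc n)) = real (2 * ((2 * n + 1) * ((2 * n) choose n)))"
    by (rule arg_cong)
  define X where "X = real ((2 * Suc n) choose Suc n)"
  define Z where "Z = real ((2 * n) choose n)"
  have "(real n + 1) * X = 2 * ((2 * real n + 1) * Z)"
    using real_eq unfolding of_nat_mult X_def[symmetric] Z_def[symmetric] by (simp add: add.commute)
  then have "X = 2 * ((2 * real n + 1) * Z) / (real n + 1)"
    by (simp add: field_simps)
  then have "X / 4 ^ Suc n = Z / 4 ^ n * (real (2 * n + 1) / (2 * (real n + 1)))"
    by (simp only: power_Suc) (simp add: divide_simps)
  then have rec: "real ((2 * Suc n) choose Suc n) / 4 ^ Suc n = real ((2 * n) choose n) / 4 ^ n * (real (2 * n + 1) / (2 * (real n + 1)))"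
    unfolding X_def Z_def .
  define a where "a = real ((2 * n) choose n) / 4 ^ n"
  have "(real ((2 * Suc n) choose Suc n) / 4 ^ Suc n)\<^sup>2 * (2 * Suc n + 1)
    = (a\<^sup>2 * real (2 * n + 1)) * (real (2 * n + 1) * real (2 * n + 3) / (2 * (real n + 1))\<^sup>2)"
    unfolding rec a_def[symmetric] by (simp add: power2_eq_square)
  also have "\<dots> \<le> 1 * 1"
  proof (rule mult_mono)
    have "(2 * real n + 1) * (2 * real n + 3) \<le> (2 * (real n + 1))\<^sup>2"
      by (simp add: power2_eq_square algebra_simps)
    then show "real (2 * n + 1) * real (2 * n + 3) / (2 * (real n + 1))\<^sup>2 \<le> 1"
      by (subst divide_le_eq_1_pos) (auto simp: add.commute)
  qed (use Suc.IH in \<open>auto simp: a_def\<close>)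
  finally show ?case by simp
qed simp

lemma central_binomial_tendsto_0: "(\<lambda>n. real ((2 * n) choose n) / 4 ^ n) \<longlonglongrightarrow> 0"
proof -
  have le: "real ((2 * n) choose n) / 4 ^ n \<le> sqrt (1 / real (2 * n + 1))" for n
    using central_binomial_le[of n] by (intro real_le_rsqrt) (simp add: field_simps)
  have "(\<lambda>n. 1 / real (2 * n + 1)) \<longlonglongrightarrow> 0" by (rule tendsto_0_le[OF LIMSEQ_inverse_real_of_nat, where K = 1]) (auto simp: divide_simps)
  from tendsto_real_sqrt[OF this] have lim: "(\<lambda>n. sqrt (1 / real (2 * n + 1))) \<longlonglongrightarrow> 0" by simp
  show ?thesis
    by (rule tendsto_sandwich[OF _ _ tendsto_const lim]) (intro always_eventually allI, simp, intro always_eventually allI le)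
qed

text \<open>The sampling points lie on a line with spacing 2 |z|, so at most R/|z| + 1 of them meet
  the support, and every weight is at most the central one.\<close>

lemma av_pow_sup_le:
  assumes B: "\<And>x. \<bar>f x\<bar> \<le> B" and supp: "\<And>x. R < norm x \<Longrightarrow> f x = 0" and z: "z \<noteq> 0"
  shows "\<bar>(av z ^^ (2 * n)) f x\<bar> \<le> real (nat \<lfloor>R / norm z\<rfloor> + 1) * B * (real ((2 * n) choose n) / 4 ^ n)"
proof -
  have B0: "0 \<le> B" using B abs_ge_zero order_trans by blast
  let ?y = "\<lambda>k. x + (real (2 * n) - 2 * real k) *\<^sub>R z"
  define K where "K = {k. k \<le> 2 * n \<and> norm (?y k) \<le> R}"
  have fin: "finite K" unfolding K_def by simp
  have card: "card K \<le> nat \<lfloor>R / norm z\<rfloor> + 1"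
  proof (cases "K = {}")
    case False
    define m where "m = Min K"
    have m: "m \<in> K" "\<And>k. k \<in> K \<Longrightarrow> m \<le> k" using fin False by (auto simp: m_def)
    have "K \<subseteq> {m..m + nat \<lfloor>R / norm z\<rfloor>}"
    proof
      fix k assume k: "k \<in> K"
      have "?y m - ?y k = (2 * (real k - real m)) *\<^sub>R z" by (simp add: algebra_simps)
      then have "2 * (real k - real m) * norm z = norm (?y m - ?y k)" using m(2)[OF k] by simp
      also have "\<dots> \<le> 2 * R" using norm_triangle_ineq4[of "?y m" "?y k"] k m(1) by (simp add: K_def)
      finally have "real k - real m \<le> R / norm z" using z by (simp add: field_simps)
      then have "int k - int m \<le> \<lfloor>R / norm z\<rfloor>" by (simp add: le_floor_iff)
      then show "k \<in> {m..m + nat \<lfloor>R / norm z\<rfloor>}" using m(2)[OF k] by auto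
    qed
    then have "card K \<le> card {m..m + nat \<lfloor>R / norm z\<rfloor>}" by (intro card_mono) auto
    then show ?thesis by simp
  qed simp
  have "\<bar>\<Sum>k\<le>2*n. real ((2*n) choose k) * f (?y k)\<bar> = \<bar>\<Sum>k\<in>K. real ((2*n) choose k) * f (?y k)\<bar>"
    by (intro arg_cong[where f=abs] sum.mono_neutral_right) (auto simp: K_def intro!: supp)
  also have "\<dots> \<le> (\<Sum>k\<in>K. real ((2*n) choose n) * B)"
  proof (rule order_trans[OF sum_abs sum_mono])
    fix k
    show "\<bar>real ((2*n) choose k) * f (?y k)\<bar> \<le> real ((2*n) choose n) * B"
      unfolding abs_mult using B[of "?y k"] binomial_maximum'[of n k] by (intro mult_mono) auto
  qed
  also have "\<dots> = real (card K) * (real ((2*n) choose n) * B)" by simp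
  also have "\<dots> \<le> real (nat \<lfloor>R / norm z\<rfloor> + 1) * (real ((2*n) choose n) * B)"
    using card B0 by (intro mult_right_mono) auto
  finally have le: "\<bar>\<Sum>k\<le>2*n. real ((2*n) choose k) * f (?y k)\<bar> \<le> real (nat \<lfloor>R / norm z\<rfloor> + 1) * (real ((2*n) choose n) * B)" .
  have "(2::real) ^ (2 * n) = 4 ^ n" by (simp add: power_mult)
  then have "\<bar>(av z ^^ (2 * n)) f x\<bar> = \<bar>\<Sum>k\<le>2*n. real ((2*n) choose k) * f (?y k)\<bar> / 4 ^ n"
    unfolding av_pow_binomial by simp
  also have "\<dots> \<le> real (nat \<lfloor>R / norm z\<rfloor> + 1) * (real ((2*n) choose n) * B) / 4 ^ n"
    using le by (rule divide_right_mono) simp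
  finally show ?thesis by (simp add: mult.assoc mult.left_commute mult.commute)
qed

text \<open>Interpolation between the contraction in L^1 and the uniform decay: |X|^s \<le>
  M_n^(s-1) |X|, and M_n^(s-1) tends to 0 since s > 1.\<close>

lemma av_pow_lnorm_tendsto_0:
  fixes f :: "'a::euclidean_space \<Rightarrow> real"
  assumes f: "f \<in> cont_cs" and z: "z \<noteq> 0" and s: "1 < s"
  shows "(\<lambda>n. lnorm lborel s ((av z ^^ (2 * n)) f)) \<longlonglongrightarrow> 0"
proof -
  obtain B where B: "\<And>x. \<bar>f x\<bar> \<le> B" using cont_cs_bounded[OF f] by blast
  have B0: "0 \<le> B" using B abs_ge_zero order_trans by blast
  obtain R where R: "\<And>x. R < norm x \<Longrightarrow> f x = 0" using f by (auto simp: cont_cs_def compact_supp_iff_cball)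
  define M where "M n = real (nat \<lfloor>R / norm z\<rfloor> + 1) * B * (real ((2 * n) choose n) / 4 ^ n)" for n
  have M0: "0 \<le> M n" for n using B0 by (simp add: M_def)
  have Mlim: "M \<longlonglongrightarrow> 0"
    unfolding M_def using tendsto_mult_right_zero[OF central_binomial_tendsto_0] by blast
  have le: "lnorm lborel s ((av z ^^ (2 * n)) f) \<le> (M n powr (s - 1) * lnorm lborel 1 f) powr (1 / s)" for n
  proof -
    let ?X = "(av z ^^ (2 * n)) f"
    have X: "?X \<in> cont_cs" by (rule av_pow_cont_cs[OF f])
    have X1: "integrable lborel (\<lambda>x. \<bar>?X x\<bar> powr 1)" "integrable lborel (\<lambda>x. \<bar>?X x\<bar> powr s)"
      using s lspace_integrable[OF cont_cs_lspace[OF X, of 1]] lspace_integrable[OF cont_cs_lspace[OF X, of s]] by auto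
    have "(LINT x|lborel. \<bar>?X x\<bar> powr s) \<le> (LINT x|lborel. M n powr (s - 1) * \<bar>?X x\<bar> powr 1)"
    proof (rule integral_mono)
      fix x
      have "\<bar>?X x\<bar> \<le> M n" unfolding M_def by (rule av_pow_sup_le[OF B R z])
      then have "\<bar>?X x\<bar> powr (s - 1) * \<bar>?X x\<bar> powr 1 \<le> M n powr (s - 1) * \<bar>?X x\<bar> powr 1"
        using s by (intro mult_right_mono powr_mono2) auto
      then show "\<bar>?X x\<bar> powr s \<le> M n powr (s - 1) * \<bar>?X x\<bar> powr 1" using powr_add[of "\<bar>?X x\<bar>" "s - 1" 1] by simp
    qed (use X1 in auto)
    also have "\<dots> = M n powr (s - 1) * lnorm lborel 1 ?X" using X1 by (simp add: lnorm_def)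
    also have "\<dots> \<le> M n powr (s - 1) * lnorm lborel 1 f"
      by (intro mult_left_mono av_pow_lnorm_le f) auto
    finally show ?thesis unfolding lnorm_def[of lborel s] using s by (intro powr_mono2) auto
  qed
  have "(\<lambda>n. (M n powr (s - 1) * lnorm lborel 1 f) powr (1 / s)) \<longlonglongrightarrow> (0 powr (s - 1) * lnorm lborel 1 f) powr (1 / s)"
    using s M0 by (intro tendsto_powr2 tendsto_mult tendsto_const Mlim always_eventually) auto
  then have lim: "(\<lambda>n. (M n powr (s - 1) * lnorm lborel 1 f) powr (1 / s)) \<longlonglongrightarrow> 0" using s by simp
  show ?thesis
    by (rule tendsto_sandwich[OF _ _ tendsto_const lim]) (use le in auto)
qed

text \<open>The averages along the second and third axes are contractions and are discarded; the
  decay along one axis suffices.\<close>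

lemma walk_pow_lnorm_le:
  assumes "f \<in> cont_cs" "1 \<le> s"
  shows "lnorm lborel s ((walk h ^^ n) f) \<le> lnorm lborel s ((av (dir h 1) ^^ (2 * n)) f)"
  using assms(1)
proof (induction n arbitrary: f)
  case (Suc n)
  let ?S = "av (dir h 1 :: real^3)"
  have w: "walk h f = av (dir h 2) (av (dir h 2) (av (dir h 3) (av (dir h 3) (?S (?S f)))))"
    unfolding walk_def by (simp only: av_commute)
  have "lnorm lborel s ((walk h ^^ Suc n) f) = lnorm lborel s ((walk h ^^ n) (walk h f))"
    by (simp add: funpow_swap1)
  also have "\<dots> \<le> lnorm lborel s ((?S ^^ (2 * n)) (walk h f))"
    by (rule Suc.IH) (rule walk_cont_cs[OF Suc.prems])
  also have "(?S ^^ (2 * n)) (walk h f) = av (dir h 2) (av (dir h 2) (av (dir h 3) (av (dir h 3) (?S (?S ((?S ^^ (2 * n)) f))))))"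
    unfolding w av_pow_commute ..
  also have "?S (?S ((?S ^^ (2 * n)) f)) = (?S ^^ (2 * Suc n)) f" by simp
  also have "lnorm lborel s (av (dir h 2) (av (dir h 2) (av (dir h 3) (av (dir h 3) ((?S ^^ (2 * Suc n)) f)))))
    \<le> lnorm lborel s ((?S ^^ (2 * Suc n)) f)"
  proof -
    let ?g = "(?S ^^ (2 * Suc n)) f"
    have g: "?g \<in> cont_cs" by (rule av_pow_cont_cs[OF Suc.prems])
    note c = av_cont_cs
    note l = av_lnorm_le[OF _ assms(2)]
    show ?thesis
      by (rule order_trans[OF l[OF c[OF c[OF c[OF g]]]] order_trans[OF l[OF c[OF c[OF g]]] order_trans[OF l[OF c[OF g]] l[OF g]]]])
  qed
  finally show ?case .
qed simp

lemma walk_pow_lnorm_tendsto_0: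
  assumes f: "f \<in> cont_cs" and h: "0 < h" and s: "1 < s"
  shows "(\<lambda>n. lnorm lborel s ((walk h ^^ n) f)) \<longlonglongrightarrow> 0"
proof (rule tendsto_sandwich[OF _ _ tendsto_const])
  show "(\<lambda>n. lnorm lborel s ((av (dir h (1::3)) ^^ (2 * n)) f)) \<longlonglongrightarrow> 0"
    using h by (intro av_pow_lnorm_tendsto_0 f s) (simp add: dir_def axis_eq_0_iff)
  show "\<forall>\<^sub>F n in sequentially. lnorm lborel s ((walk h ^^ n) f) \<le> lnorm lborel s ((av (dir h 1) ^^ (2 * n)) f)"
    using s by (intro always_eventually allI walk_pow_lnorm_le f) auto
qed auto

section \<open>Approximate Helmholtz decomposition\<close>

lemma test_shift:
  fixes f :: "real^'n \<Rightarrow> real"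
  assumes "f \<in> TF"
  shows "(\<lambda>x. f (x + z)) \<in> TF"
  using smooth_shift(1)[OF test_smooth[OF assms], of z] cont_cs_shift[OF test_cont_cs[OF assms], of z]
  by (auto simp: test_functions_iff cont_cs_def compact_supp_def)

text \<open>The monoid generated by averages, with operators compared only on test functions. Its
  members are linear and self-adjoint, contract every L^s, and commute with derivatives and with
  each other, so that the many operators in \<open>helmholtz\<close> can be moved around
  freely.\<close>

inductive avg_op :: "((real^'n \<Rightarrow> real) \<Rightarrow> real^'n \<Rightarrow> real) \<Rightarrow> bool" where
  id: "(\<And>f. f \<in> TF \<Longrightarrow> T f = f) \<Longrightarrow> avg_op T"
| avg: "averaging \<mu> r \<Longrightarrow> avg_op S \<Longrightarrow> (\<And>f. f \<in> TF \<Longrightarrow> T f = avg \<mu> (S f)) \<Longrightarrow> avg_op T"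

lemma avg_op_TF: "avg_op T \<Longrightarrow> f \<in> TF \<Longrightarrow> T f \<in> TF"
  by (induction arbitrary: f rule: avg_op.induct) (auto intro: avg_TF)

lemma avg_op_cong:
  assumes "avg_op S" and eq: "\<And>f. f \<in> TF \<Longrightarrow> T f = S f"
  shows "avg_op T"
  using assms(1)
proof (cases rule: avg_op.cases)
  case id
  then show ?thesis by (intro avg_op.id) (simp add: eq)
next
  case (avg \<mu> r S')
  show ?thesis by (rule avg_op.avg[OF avg(1,2)]) (simp add: eq avg(3))
qed

lemma avg_op_comp: "avg_op T \<Longrightarrow> avg_op S \<Longrightarrow> avg_op (\<lambda>f. T (S f))"
proof (induction rule: avg_op.induct)
  case (id T)
  show ?case by (rule avg_op_cong[OF id(2)]) (simp add: id(1) avg_op_TF[OF id(2)])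
next
  case (avg \<mu> r T' T)
  show ?case
    by (rule avg_op.avg[OF avg(1) avg(4)[OF avg(5)]]) (rule avg(3)[OF avg_op_TF[OF avg(5)]])
qed

lemma avg_op_averaging: "averaging \<mu> r \<Longrightarrow> avg_op (avg \<mu>)"
  by (rule avg_op.avg[of \<mu> r "\<lambda>f. f"]) (auto intro: avg_op.id)

lemma avg_op_av: "avg_op (av z)"
  by (rule avg_op.avg[OF averaging_pt, of "\<lambda>f. f"]) (auto intro: avg_op.id simp: avg_pt test_measurable)

lemma avg_op_pd: "avg_op T \<Longrightarrow> f \<in> TF \<Longrightarrow> pd i (T f) = T (pd i f)"
  by (induction arbitrary: f rule: avg_op.induct) (auto simp: avg_TF avg_op_TF test_pd)

lemma avg_op_lnorm: "avg_op T \<Longrightarrow> f \<in> TF \<Longrightarrow> 1 \<le> s \<Longrightarrow> lnorm lborel s (T f) \<le> lnorm lborel s f"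
proof (induction arbitrary: f rule: avg_op.induct)
  case (avg \<mu> r S T)
  then show ?case
    using averaging.avg_lspace(2)[OF avg(1), of s "S f"] avg_op_TF test_lspace[of "S f" UNIV s] by fastforce
qed auto

lemma avg_op_avg: "avg_op T \<Longrightarrow> averaging \<mu> r \<Longrightarrow> f \<in> TF \<Longrightarrow> T (avg \<mu> f) = avg \<mu> (T f)"
proof (induction arbitrary: f rule: avg_op.induct)
  case (avg \<nu> r' S T)
  then show ?case
    using avg_commute[OF avg(1) avg(5), of "S f"] avg_op_TF test_cont_cs by (simp add: avg_TF) blast
qed (auto simp: avg_TF)

lemma avg_op_commute: "avg_op S \<Longrightarrow> avg_op T \<Longrightarrow> f \<in> TF \<Longrightarrow> T (S f) = S (T f)"
  by (induction arbitrary: f rule: avg_op.induct) (auto simp: avg_op_TF avg_op_avg)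

lemma avg_op_shift: "avg_op T \<Longrightarrow> f \<in> TF \<Longrightarrow> T (\<lambda>x. f (x + z)) = (\<lambda>x. T f (x + z))"
proof (induction arbitrary: f rule: avg_op.induct)
  case (id T)
  then show ?case by (simp add: test_shift)
next
  case (avg \<mu> r S T)
  then show ?case by (simp add: test_shift averaging.avg_shift[OF avg(1)])
qed

lemma avg_op_add: "avg_op T \<Longrightarrow> f \<in> TF \<Longrightarrow> g \<in> TF \<Longrightarrow> T (\<lambda>x. f x + g x) = (\<lambda>x. T f x + T g x)"
proof (induction arbitrary: f g rule: avg_op.induct)
  case (avg \<mu> r S T)
  then show ?case
    by (simp add: test_add averaging.avg_add[OF avg(1)] test_cont_cs[OF avg_op_TF[OF avg(2)]])
qed (auto simp: test_add)

lemma avg_op_cmult: "avg_op T \<Longrightarrow> f \<in> TF \<Longrightarrow> T (\<lambda>x. c * f x) = (\<lambda>x. c * T f x)"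
proof (induction arbitrary: f rule: avg_op.induct)
  case (avg \<mu> r S T)
  then show ?case by (simp add: test_cmult averaging.avg_cmult[OF avg(1)])
qed (auto simp: test_cmult)

lemma avg_op_sum:
  assumes T: "avg_op T" and f: "\<And>i. i \<in> I \<Longrightarrow> f i \<in> TF" and I: "finite I"
  shows "T (\<lambda>x. \<Sum>i\<in>I. f i x) = (\<lambda>x. \<Sum>i\<in>I. T (f i) x)"
  using I f
proof (induction I)
  case empty
  show ?case using avg_op_cmult[OF T test_zero, of 0] by simp
next
  case (insert i I)
  then show ?case using avg_op_add[OF T, of "f i" "\<lambda>x. \<Sum>i\<in>I. f i x"] by (simp add: test_sum)
qed

lemma avg_op_dif:
  assumes T: "avg_op T" and f: "f \<in> TF"
  shows "T (dif z f) = dif z (T f)"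
proof -
  have sh: "(\<lambda>x. f (x + w)) \<in> TF" for w by (rule test_shift[OF f])
  have "T (dif z f) = T (\<lambda>x. 1/2 * (f (x + z) + (-1) * f (x + - z)))"
    by (rule arg_cong[where f=T]) (simp add: dif_def fun_eq_iff)
  also have "\<dots> = (\<lambda>x. 1/2 * (T f (x + z) + (-1) * T f (x + - z)))"
    by (subst avg_op_cmult[OF T], intro test_add test_cmult sh, subst avg_op_add[OF T sh test_cmult[OF sh]],
        subst avg_op_cmult[OF T sh], subst (1 2) avg_op_shift[OF T f]) simp
  finally show ?thesis by (simp add: dif_def fun_eq_iff)
qed

lemma avg_op_integral_mult:
  "avg_op T \<Longrightarrow> f \<in> TF \<Longrightarrow> g \<in> TF \<Longrightarrow> (LINT x|lborel. T f x * g x) = (LINT x|lborel. f x * T g x)"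
proof (induction arbitrary: f g rule: avg_op.induct)
  case (avg \<mu> r S T)
  have "(LINT x|lborel. T f x * g x) = (LINT x|lborel. S f x * avg \<mu> g x)"
    unfolding avg(3)[OF avg(5)]
    by (rule averaging.integral_avg_mult[OF avg(1) conjugate_6(1)])
       (auto intro!: test_lspace avg_op_TF[OF avg(2)] avg)
  also have "\<dots> = (LINT x|lborel. f x * S (avg \<mu> g) x)"
    using avg avg_TF(1) by blast
  also have "S (avg \<mu> g) = T g"
    using avg_op_avg[OF avg(2,1)] avg by simp
  finally show ?case .
qed auto

lemma avg_op_walk: "avg_op (walk h)"
  unfolding walk_def[abs_def] by (intro avg_op_comp[OF avg_op_av] avg_op_av)

lemma avg_op_walk_pow: "avg_op (walk h ^^ n)"
proof (induction n)
  case (Suc n)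
  show ?case using avg_op_comp[OF avg_op_walk Suc] by (simp add: comp_def)
qed (auto intro: avg_op.id)

section \<open>Exact passage between differences and derivatives\<close>

definition line_avg :: "real \<Rightarrow> 'n \<Rightarrow> (real^'n \<Rightarrow> real) \<Rightarrow> real^'n \<Rightarrow> real" where
  "line_avg h j = avg (seg (dir h j))"

lemma avg_op_line_avg: "avg_op (line_avg h j)"
  unfolding line_avg_def by (rule avg_op_averaging[OF averaging_seg])

lemma dif_eq_pd:
  fixes f :: "real^'n \<Rightarrow> real"
  assumes f: "f \<in> TF"
  shows "dif (dir h j) f = (\<lambda>x. h * pd j (line_avg h j f) x)"
  using avg_seg_axis[OF test_smooth[OF f], of h j]
  by (auto simp: fun_eq_iff line_avg_def dir_def avg_TF(2)[OF averaging_seg f])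

lemma line_avg_close:
  assumes "f \<in> TF" "1 < s"
  shows "lnorm lborel s (\<lambda>x. f x - line_avg h j f x) \<le> \<bar>h\<bar> * dnorm s f"
  using lnorm_avg_diff_le[OF averaging_seg assms, of "dir h j"] by (simp add: line_avg_def dir_def)

lemma test_dif: "f \<in> TF \<Longrightarrow> dif z f \<in> TF"
proof -
  assume f: "f \<in> TF"
  have "dif z f = (\<lambda>x. 1/2 * (f (x + z) - f (x + - z)))" by (simp add: dif_def fun_eq_iff)
  then show ?thesis by (simp only: test_cmult test_diff test_shift f)
qed

text \<open>One segment average per axis: whichever partial derivative is applied, the matching
  factor turns it into a difference quotient.\<close>

definition box_avg :: "real \<Rightarrow> (real^3 \<Rightarrow> real) \<Rightarrow> real^3 \<Rightarrow> real" where
  "box_avg h f = line_avg h 1 (line_avg h 2 (line_avg h 3 f))"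

lemma avg_op_box_avg: "avg_op (box_avg h)"
  unfolding box_avg_def[abs_def] by (intro avg_op_comp[OF avg_op_line_avg] avg_op_line_avg)

lemma box_avg_split: "\<exists>T. avg_op T \<and> (\<forall>f\<in>TF. box_avg h f = T (line_avg h j f))"
proof -
  note c = avg_op_commute[OF avg_op_line_avg avg_op_line_avg] and t = avg_op_TF[OF avg_op_line_avg]
  have "\<forall>f\<in>TF. box_avg h f = line_avg h 2 (line_avg h 3 (line_avg h 1 f))"
  proof
    fix f :: "real^3 \<Rightarrow> real" assume f: "f \<in> TF"
    show "box_avg h f = line_avg h 2 (line_avg h 3 (line_avg h 1 f))"
      unfolding box_avg_def using c[OF t[OF f], of h 1 h 2 h 3] c[OF f, of h 1 h 3] by metis
  qed
  moreover have "\<forall>f\<in>TF. box_avg h f = line_avg h 1 (line_avg h 3 (line_avg h 2 f))"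
    unfolding box_avg_def using c by metis
  moreover have "\<forall>f\<in>TF. box_avg h f = line_avg h 1 (line_avg h 2 (line_avg h 3 f))"
    unfolding box_avg_def by blast
  moreover have "avg_op (\<lambda>f. line_avg h i (line_avg h k f))" for i k :: 3
    by (intro avg_op_comp[OF avg_op_line_avg] avg_op_line_avg)
  ultimately show ?thesis using exhaust_3[of j] by (elim disjE) blast+
qed

lemma box_avg_close:
  assumes f: "f \<in> TF" and s: "1 < s"
  shows "lnorm lborel s (\<lambda>x. f x - box_avg h f x) \<le> 3 * \<bar>h\<bar> * dnorm s f"
proof -
  let ?L = "line_avg h"
  have t: "g \<in> TF \<Longrightarrow> ?L j g \<in> TF" for g and j :: 3 by (rule avg_op_TF[OF avg_op_line_avg])
  have dn: "dnorm s (?L j g) \<le> dnorm s g" if "g \<in> TF" for g and j :: 3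
    unfolding line_avg_def by (rule dnorm_avg_le[OF averaging_seg that s])
  have l: "g \<in> TF \<Longrightarrow> g \<in> lspace lborel s" for g :: "real^3 \<Rightarrow> real" using s by (intro test_lspace) auto
  let ?a = "\<lambda>x. f x - ?L 3 f x" and ?b = "\<lambda>x. ?L 3 f x - ?L 2 (?L 3 f) x" and ?c = "\<lambda>x. ?L 2 (?L 3 f) x - box_avg h f x"
  have "lnorm lborel s (\<lambda>x. ?a x + (?b x + ?c x)) \<le> lnorm lborel s ?a + (lnorm lborel s ?b + lnorm lborel s ?c)"
    by (intro order_trans[OF lnorm_triangle] add_left_mono lnorm_triangle lspace_add l test_diff test_add t f s avg_op_TF[OF avg_op_box_avg])
       (use s in auto)
  also have "\<dots> \<le> \<bar>h\<bar> * dnorm s f + (\<bar>h\<bar> * dnorm s f + \<bar>h\<bar> * dnorm s f)"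
  proof (intro add_mono)
    show "lnorm lborel s ?a \<le> \<bar>h\<bar> * dnorm s f" by (rule line_avg_close[OF f s])
    show "lnorm lborel s ?b \<le> \<bar>h\<bar> * dnorm s f"
      using line_avg_close[OF t[OF f] s, of 3 h 2] mult_left_mono[OF dn[OF f, of 3], of "\<bar>h\<bar>"] by simp
    show "lnorm lborel s ?c \<le> \<bar>h\<bar> * dnorm s f"
      using line_avg_close[OF t[OF t[OF f]] s, of 2 3 h 1]
        mult_left_mono[OF order_trans[OF dn[OF t[OF f], of 2 3] dn[OF f, of 3]], of "\<bar>h\<bar>"] unfolding box_avg_def by simp
  qed
  finally show ?thesis by simp
qed

text \<open>The tails in the telescoping of the walk: with S_j the double average along axis j,
  \<open>walk h\<close> minus the identity is (S_1 - 1) S_2 S_3 + (S_2 - 1) S_3 + (S_3 - 1).\<close>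

definition step_rest :: "real \<Rightarrow> 3 \<Rightarrow> (real^3 \<Rightarrow> real) \<Rightarrow> real^3 \<Rightarrow> real" where
  "step_rest h j f = (if j = 1 then av (dir h 2) (av (dir h 2) (av (dir h 3) (av (dir h 3) f)))
     else if j = 2 then av (dir h 3) (av (dir h 3) f) else f)"

definition step :: "real \<Rightarrow> 3 \<Rightarrow> (real^3 \<Rightarrow> real) \<Rightarrow> real^3 \<Rightarrow> real" where
  "step h j f = line_avg h j (line_avg h j (step_rest h j f))"

lemma avg_op_step_rest: "avg_op (step_rest h j)"
  using exhaust_3[of j] unfolding step_rest_def[abs_def]
  by (elim disjE; simp; intro avg_op_comp[OF avg_op_av] avg_op_av avg_op.id; simp)

lemma avg_op_step: "avg_op (step h j)"
  unfolding step_def[abs_def] by (intro avg_op_comp[OF avg_op_line_avg] avg_op_step_rest)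

text \<open>A double average exceeds the identity by a double difference, and each difference is h
  times the derivative of a segment average; there is no remainder.\<close>

lemma av_av_diff:
  assumes f: "f \<in> TF"
  shows "av (dir h j) (av (dir h j) f) x - f x = h\<^sup>2 * pd j (pd j (line_avg h j (line_avg h j f))) x"
proof -
  have "av (dir h j) (av (dir h j) f) x - f x = dif (dir h j) (dif (dir h j) f) x"
    by (simp add: av_def dif_def field_simps)
  also have "\<dots> = h * pd j (line_avg h j (dif (dir h j) f)) x"
    by (simp add: dif_eq_pd[OF test_dif[OF f]])
  also have "line_avg h j (dif (dir h j) f) = dif (dir h j) (line_avg h j f)"
    by (rule avg_op_dif[OF avg_op_line_avg f])
  also have "\<dots> = (\<lambda>x. h * pd j (line_avg h j (line_avg h j f)) x)"
    by (rule dif_eq_pd) (rule avg_op_TF[OF avg_op_line_avg f])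
  also have "pd j \<dots> = (\<lambda>x. h * pd j (pd j (line_avg h j (line_avg h j f))) x)"
    by (rule pd_smooth(3)[OF test_smooth[OF test_pd[OF avg_op_TF[OF avg_op_line_avg avg_op_TF[OF avg_op_line_avg f]]]] smooth_const])
  finally show ?thesis by (simp add: power2_eq_square)
qed

lemma walk_diff:
  assumes f: "f \<in> TF"
  shows "walk h f x - f x = h\<^sup>2 * (\<Sum>j\<in>UNIV. pd j (pd j (step h j f)) x)"
proof -
  let ?S = "\<lambda>j f. av (dir h j) (av (dir h j) f)"
  have t: "?S j g \<in> TF" if "g \<in> TF" for j g by (intro avg_op_TF[OF avg_op_av] that)
  have "walk h f x - f x = (?S 1 (?S 2 (?S 3 f)) x - ?S 2 (?S 3 f) x) + (?S 2 (?S 3 f) x - ?S 3 f x) + (?S 3 f x - f x)"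
    by (simp add: walk_def)
  also have "\<dots> = h\<^sup>2 * pd 1 (pd 1 (step h 1 f)) x + h\<^sup>2 * pd 2 (pd 2 (step h 2 f)) x + h\<^sup>2 * pd 3 (pd 3 (step h 3 f)) x"
    unfolding av_av_diff[OF t[OF t[OF f]]] av_av_diff[OF t[OF f]] av_av_diff[OF f]
    by (simp add: step_def step_rest_def)
  also have "\<dots> = h\<^sup>2 * (\<Sum>j\<in>UNIV. pd j (pd j (step h j f)) x)"
    by (simp add: sum_3 algebra_simps)
  finally show ?thesis .
qed

text \<open>Summing \<open>walk_diff\<close> over the steps gives a truncated Green operator, the
  sum of the powers of the walk below n, with the n-th power as remainder.\<close>

lemma walk_pow_diff:
  assumes f: "f \<in> TF"
  shows "(walk h ^^ n) f x - f x = h\<^sup>2 * (\<Sum>j\<in>UNIV. \<Sum>m<n. pd j (pd j (step h j ((walk h ^^ m) f))) x)"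
proof (induction n)
  case (Suc n)
  have "(walk h ^^ Suc n) f x - f x = (walk h ((walk h ^^ n) f) x - (walk h ^^ n) f x) + ((walk h ^^ n) f x - f x)"
    by simp
  then show ?case
    unfolding Suc walk_diff[OF avg_op_TF[OF avg_op_walk_pow f]] by (simp add: sum.distrib distrib_left add.commute)
qed simp

text \<open>Two box averages are spent, one per derivative. Their parameter 2 h matches the step of
  the differences in \<open>walk_second_differences_bounded\<close>.\<close>

lemma box_avg_pd_pd:
  "\<exists>T. avg_op T \<and> (\<forall>f\<in>TF. \<forall>x. pd l (pd j (box_avg (2*h) (box_avg (2*h) f))) x * (2*h)\<^sup>2 = T (dif (dir (2*h) l) (dif (dir (2*h) j) f)) x)"
proof -
  obtain T where T: "avg_op T" "\<And>f. f \<in> TF \<Longrightarrow> box_avg (2*h) f = T (line_avg (2*h) l f)"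
    using box_avg_split[of "2*h" l] by blast
  obtain S where S: "avg_op S" "\<And>f. f \<in> TF \<Longrightarrow> box_avg (2*h) f = S (line_avg (2*h) j f)"
    using box_avg_split[of "2*h" j] by blast
  have pd: "(\<lambda>x. 2*h * pd i (R (line_avg (2*h) i f)) x) = R (dif (dir (2*h) i) f)" if R: "avg_op R" and f: "f \<in> TF" for i R f
  proof -
    have lf: "line_avg (2*h) i f \<in> TF" by (rule avg_op_TF[OF avg_op_line_avg f])
    have "R (dif (dir (2*h) i) f) = R (\<lambda>x. 2*h * pd i (line_avg (2*h) i f) x)" by (simp only: dif_eq_pd[OF f])
    also have "\<dots> = (\<lambda>x. 2*h * R (pd i (line_avg (2*h) i f)) x)" by (rule avg_op_cmult[OF R test_pd[OF lf]])
    also have "R (pd i (line_avg (2*h) i f)) = pd i (R (line_avg (2*h) i f))" by (rule avg_op_pd[OF R lf, symmetric])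
    finally show ?thesis by simp
  qed
  have "pd l (pd j (box_avg (2*h) (box_avg (2*h) f))) x * (2*h)\<^sup>2 = T (S (dif (dir (2*h) l) (dif (dir (2*h) j) f))) x" if f: "f \<in> TF" for f x
  proof -
    let ?G = "box_avg (2*h)"
    have G: "?G g \<in> TF" if "g \<in> TF" for g by (rule avg_op_TF[OF avg_op_box_avg that])
    have Sf: "S (line_avg (2*h) j f) \<in> TF" by (intro avg_op_TF[OF S(1)] avg_op_TF[OF avg_op_line_avg] f)
    have "2*h * (2*h * pd l (pd j (?G (?G f))) x) = 2*h * (2*h * pd l (?G (pd j (?G f))) x)"
      by (simp add: avg_op_pd[OF avg_op_box_avg G[OF f]])
    also have "2*h * pd l (?G (pd j (?G f))) x = T (dif (dir (2*h) l) (pd j (?G f))) x"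
      using pd[OF T(1) test_pd[OF G[OF f]], of l j] T(2)[OF test_pd[OF G[OF f]]] by (metis (no_types))
    also have "2*h * T (dif (dir (2*h) l) (pd j (?G f))) x = T (dif (dir (2*h) l) (\<lambda>x. 2*h * pd j (?G f) x)) x"
    proof -
      have "dif (dir (2*h) l) (\<lambda>x. 2*h * pd j (?G f) x) = (\<lambda>x. 2*h * dif (dir (2*h) l) (pd j (?G f)) x)"
        by (simp add: dif_def fun_eq_iff algebra_simps)
      then show ?thesis by (simp add: avg_op_cmult[OF T(1) test_dif[OF test_pd[OF G[OF f]]]])
    qed
    also have "(\<lambda>x. 2*h * pd j (?G f) x) = S (dif (dir (2*h) j) f)"
      using pd[OF S(1) f, of j] unfolding S(2)[OF f] .
    also have "dif (dir (2*h) l) (S (dif (dir (2*h) j) f)) = S (dif (dir (2*h) l) (dif (dir (2*h) j) f))"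
      by (rule avg_op_dif[OF S(1) test_dif[OF f], symmetric])
    finally show ?thesis by (simp add: power2_eq_square mult_ac)
  qed
  then show ?thesis using avg_op_comp[OF T(1) S(1)] by blast
qed

text \<open>Summing over N steps writes the twice box-averaged field as a gradient, plus its image
  under N steps of the walk, plus a term r_i that sees only the curl. Box averaging is made harmless
  by small h, the walk by large N, and r_i by duality with the curl hypothesis.\<close>

lemma helmholtz:
  fixes F :: "3 \<Rightarrow> real^3 \<Rightarrow> real"
  assumes F: "\<And>i. F i \<in> TF" and \<epsilon>: "0 \<le> \<epsilon>"
    and curl: "\<And>w i j. w \<in> TF \<Longrightarrow> \<bar>LINT x|lborel. F i x * pd j w x - F j x * pd i w x\<bar> \<le> \<epsilon> * dnorm (6/5) w"
    and \<delta>: "0 < \<delta>"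
  shows "\<exists>u\<in>TF. \<forall>i. lnorm lborel 6 (\<lambda>x. F i x - pd i u x) \<le> 450 * \<epsilon> + \<delta>"
proof -
  define A where "A = (\<Sum>i\<in>UNIV. dnorm 6 (F i)) + 1"
  have A: "0 < A" "dnorm 6 (F i) \<le> A" for i
    using member_le_sum[of i UNIV "\<lambda>i. dnorm 6 (F i)"] by (auto simp: A_def add_nonneg_pos sum_nonneg)
  \<comment> \<open>The two box averages with parameter 2 h cost at most 12 h A, which is
    \<delta>/2.\<close>
  define h where "h = \<delta> / (24 * A)"
  have h: "0 < h" using \<delta> A(1) by (simp add: h_def)
  let ?G = "box_avg (2 * h)"
  have G: "?G f \<in> TF" if "f \<in> TF" for f by (rule avg_op_TF[OF avg_op_box_avg that])
  define H where "H i = ?G (?G (F i))" for i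
  have H: "H i \<in> TF" for i unfolding H_def by (intro G F)
  have close: "lnorm lborel 6 (\<lambda>x. F i x - H i x) \<le> \<delta> / 2" for i
  proof -
    have dn: "dnorm 6 (?G (F i)) \<le> dnorm 6 (F i)"
      unfolding dnorm_def
      by (intro sum_mono) (simp add: avg_op_pd[OF avg_op_box_avg F] avg_op_lnorm[OF avg_op_box_avg test_pd[OF F]])
    have "lnorm lborel 6 (\<lambda>x. (F i x - ?G (F i) x) + (?G (F i) x - H i x))
      \<le> lnorm lborel 6 (\<lambda>x. F i x - ?G (F i) x) + lnorm lborel 6 (\<lambda>x. ?G (F i) x - H i x)"
      by (intro lnorm_triangle test_lspace[where S=UNIV] test_diff F G H) auto
    also have "\<dots> \<le> 3 * \<bar>2 * h\<bar> * dnorm 6 (F i) + 3 * \<bar>2 * h\<bar> * dnorm 6 (?G (F i))"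
      unfolding H_def by (intro add_mono box_avg_close F G) auto
    also have "\<dots> \<le> 3 * \<bar>2 * h\<bar> * A + 3 * \<bar>2 * h\<bar> * A"
      using order_trans[OF dn A(2)] A(2) by (intro add_mono mult_left_mono) auto
    also have "\<dots> = \<delta> / 2" using h \<delta> A(1) by (simp add: h_def)
    finally show ?thesis by simp
  qed
  have "\<forall>\<^sub>F n in sequentially. \<forall>i\<in>UNIV. lnorm lborel 6 ((walk h ^^ n) (H i)) < \<delta> / 2"
    using \<delta> by (intro eventually_ball_finite ballI order_tendstoD(2)[OF walk_pow_lnorm_tendsto_0] test_cont_cs[OF H] h) auto
  then obtain n0 where n0: "\<And>n i. n0 \<le> n \<Longrightarrow> lnorm lborel 6 ((walk h ^^ n) (H i)) < \<delta> / 2"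
    by (auto simp: eventually_sequentially)
  \<comment> \<open>An even number of steps, since \<open>walk_second_differences_bounded\<close>
    sums an even number of terms.\<close>
  define N where "N = 2 * n0"
  have small: "lnorm lborel 6 ((walk h ^^ N) (H i)) \<le> \<delta> / 2" for i
    using n0[of N i] by (simp add: N_def)
  define K where "K j m f = step h j ((walk h ^^ m) f)" for j m f
  have K: "avg_op (K j m)" for j m
    unfolding K_def[abs_def] by (intro avg_op_comp[OF avg_op_step avg_op_walk_pow])
  have KH: "K j m (H i) \<in> TF" for j m i by (rule avg_op_TF[OF K H])
  \<comment> \<open>Up to sign the discrete inverse Laplacian of the divergence of H; the gradient
    that approximates F is that of -U.\<close>
  define U where "U = (\<lambda>x. h\<^sup>2 * (\<Sum>j\<in>UNIV. \<Sum>m<N. pd j (K j m (H j)) x))"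
  have U: "U \<in> TF" unfolding U_def by (intro test_cmult test_sum test_pd KH)
  have pdU: "pd i U = (\<lambda>x. h\<^sup>2 * (\<Sum>j\<in>UNIV. \<Sum>m<N. pd i (pd j (K j m (H j))) x))" for i
  proof -
    have sm: "smooth (\<lambda>x. \<Sum>m<N. pd j (K j m (H j)) x)" for j
      by (intro smooth_sum smooth_pd test_smooth[OF KH])
    show ?thesis
      unfolding U_def
      by (subst pd_smooth(3)[OF _ smooth_const], intro smooth_sum smooth_pd test_smooth[OF KH],
          subst pd_sum, rule sm, subst pd_sum, intro smooth_pd test_smooth[OF KH], rule refl)
  qed
  define r where "r i x = h\<^sup>2 * (\<Sum>j\<in>UNIV. \<Sum>m<N. pd j (pd j (K j m (H i))) x - pd i (pd j (K j m (H j))) x)" for i x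
  have r: "r i \<in> TF" for i
    unfolding r_def[abs_def] by (intro test_cmult test_sum test_diff test_pd KH)
  have decomp: "H i x = (walk h ^^ N) (H i) x - r i x - pd i U x" for i x
    using walk_pow_diff[OF H[of i], where h=h and n=N and x=x] by (simp add: r_def pdU K_def sum_subtractf right_diff_distrib)
  have rle: "lnorm lborel 6 (r i) \<le> 450 * \<epsilon>" for i
  proof -
    \<comment> \<open>The dual function of r_i in L^6; being an integer power of a test function it
      is again one.\<close>
    define \<psi> where "\<psi> x = r i x ^ 5" for x
    have \<psi>: "\<psi> \<in> TF" unfolding \<psi>_def[abs_def] using test_power[OF r, of i 4] by simp
    have \<psi>norm: "lnorm lborel (6/5) \<psi> = lnorm lborel 6 (r i) powr 5"
    proof -
      have "\<bar>\<psi> x\<bar> = \<bar>r i x\<bar> powr 5" for x by (simp add: \<psi>_def power_abs)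
      then have "lnorm lborel (6/5) \<psi> = lnorm lborel (6/5) (\<lambda>x. \<bar>r i x\<bar> powr (6 - 1))"
        by (simp add: lnorm_def)
      also have "\<dots> = lnorm lborel 6 (r i) powr (6 - 1)"
        by (rule lspace_dual(2)[OF conjugate_6(1)]) (rule test_lspace[OF r], simp)
      finally show ?thesis by simp
    qed
    define L where "L j m = K j m (?G (?G \<psi>))" for j m
    have L: "L j m \<in> TF" for j m unfolding L_def by (intro avg_op_TF[OF K] G \<psi>)
    \<comment> \<open>The curl will be tested with these functions, so everything rests on the
      L^(6/5) norm of their derivatives, which are averages of summed second differences of
      \<psi>.\<close>
    define w where "w j x = h\<^sup>2 * (\<Sum>m<N. pd j (L j m) x)" for j x
    have w: "w j \<in> TF" for j unfolding w_def[abs_def] by (intro test_cmult test_sum test_pd L)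
    have pdw: "pd l (w j) = (\<lambda>x. h\<^sup>2 * (\<Sum>m<N. pd l (pd j (L j m)) x))" for l j
      unfolding w_def[abs_def]
      by (subst pd_smooth(3)[OF _ smooth_const], intro smooth_sum smooth_pd test_smooth[OF L],
          subst pd_sum, intro smooth_pd test_smooth[OF L], rule refl)
    have dw: "dnorm (6/5) (w j) \<le> 150 * lnorm lborel (6/5) \<psi>" for j
    proof -
      have "lnorm lborel (6/5) (pd l (w j)) \<le> 50 * lnorm lborel (6/5) \<psi>" for l
      proof -
        let ?D = "dif (dir (2*h) l) (dif (dir (2*h) j) \<psi>)"
        obtain T where T: "avg_op T" "\<And>f x. f \<in> TF \<Longrightarrow> pd l (pd j (?G (?G f))) x * (2*h)\<^sup>2 = T (dif (dir (2*h) l) (dif (dir (2*h) j) f)) x"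
          using box_avg_pd_pd[of l j h] by blast
        have D: "?D \<in> TF" by (intro test_dif \<psi>)
        let ?X = "\<lambda>x. \<Sum>m<N. (walk h ^^ m) ?D x"
        have X: "?X \<in> TF" by (intro test_sum avg_op_TF[OF avg_op_walk_pow] D)
        \<comment> \<open>The factor 1/4 is h^2 / (2 h)^2. With the constant 200 it gives 50 for
          each derivative, 150 for \<open>dnorm\<close>, and 450 after the sum over j.\<close>
        have each: "h\<^sup>2 * pd l (pd j (L j m)) x = 1/4 * step h j (T ((walk h ^^ m) ?D)) x" for m x
        proof -
          have "pd l (pd j (L j m)) = K j m (pd l (pd j (?G (?G \<psi>))))"
            unfolding L_def by (simp add: avg_op_pd[OF K] G \<psi> test_pd)
          then have "(2*h)\<^sup>2 * pd l (pd j (L j m)) x = K j m (\<lambda>x. (2*h)\<^sup>2 * pd l (pd j (?G (?G \<psi>))) x) x"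
            by (simp only: avg_op_cmult[OF K] test_pd G \<psi>)
          also have "(\<lambda>x. (2*h)\<^sup>2 * pd l (pd j (?G (?G \<psi>))) x) = T ?D"
            using T(2)[OF \<psi>] by (simp add: fun_eq_iff mult.commute)
          also have "K j m (T ?D) = step h j (T ((walk h ^^ m) ?D))"
            unfolding K_def by (simp only: avg_op_commute[OF T(1) avg_op_walk_pow D])
          finally show ?thesis by (simp add: power2_eq_square)
        qed
        have "pd l (w j) = (\<lambda>x. 1/4 * (\<Sum>m<N. step h j (T ((walk h ^^ m) ?D)) x))"
          unfolding pdw by (simp add: fun_eq_iff sum_distrib_left each)
        also have "\<dots> = (\<lambda>x. 1/4 * step h j (T ?X) x)"
        proof -
          have "step h j (T ?X) = (\<lambda>x. \<Sum>m<N. step h j (T ((walk h ^^ m) ?D)) x)"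
            by (rule avg_op_sum[OF avg_op_comp[OF avg_op_step T(1)]]) (auto intro: avg_op_TF[OF avg_op_walk_pow] D)
          then show ?thesis by simp
        qed
        finally have "lnorm lborel (6/5) (pd l (w j)) = 1/4 * lnorm lborel (6/5) (step h j (T ?X))"
          using lnorm_cmult[of "6/5" lborel "1/4" "step h j (T ?X)"] by simp
        also have "\<dots> \<le> 1/4 * lnorm lborel (6/5) ?X"
          using avg_op_lnorm[OF avg_op_comp[OF avg_op_step[of h j] T(1)] X, of "6/5"] by simp
        also have "\<dots> \<le> 1/4 * (200 * lnorm lborel (6/5) \<psi>)"
          unfolding N_def by (intro mult_left_mono walk_second_differences_bounded test_cont_cs[OF \<psi>]) auto
        finally show ?thesis by simp
      qed
      then have "dnorm (6/5) (w j) \<le> (\<Sum>l\<in>(UNIV::3 set). 50 * lnorm lborel (6/5) \<psi>)"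
        unfolding dnorm_def by (intro sum_mono)
      then show ?thesis by simp
    qed
    \<comment> \<open>All averages and both derivatives move to \<psi>, so that the original field F
      reappears, for which the curl hypothesis is available.\<close>
    have parts: "(LINT x|lborel. pd a (pd b (K j m (H c))) x * \<psi> x) = (LINT x|lborel. F c x * pd a (pd b (L j m)) x)" for a b c j m
    proof -
      have "(LINT x|lborel. pd a (pd b (K j m (H c))) x * \<psi> x) = (LINT x|lborel. K j m (H c) x * pd b (pd a \<psi>) x)"
        using integral_by_parts_pd[OF test_pd[OF KH[of j m c], of b] test_smooth[OF \<psi>], of a]
          integral_by_parts_pd[OF KH[of j m c] smooth_pd[OF test_smooth[OF \<psi>], of a], of b] by simp
      also have "\<dots> = (LINT x|lborel. F c x * ?G (?G (K j m (pd b (pd a \<psi>)))) x)"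
        unfolding H_def
        by (simp add: avg_op_integral_mult[OF K] avg_op_integral_mult[OF avg_op_box_avg] G F test_pd \<psi> avg_op_TF[OF K])
      also have "?G (?G (K j m (pd b (pd a \<psi>)))) = pd b (pd a (L j m))"
        unfolding L_def by (simp add: avg_op_commute[OF avg_op_box_avg K] avg_op_pd[OF K] avg_op_pd[OF avg_op_box_avg] G test_pd \<psi> avg_op_TF[OF K])
      finally show ?thesis by (simp add: pd_commute[OF test_smooth[OF L], of a b])
    qed
    have i1: "integrable lborel (\<lambda>x. F c x * pd a (pd b (L j m)) x)" for a b c j m
      by (rule test_integrable[OF test_mult[OF test_pd[OF test_pd[OF L]] test_smooth[OF F]]])
    have i2: "integrable lborel (\<lambda>x. pd a (pd b (K j m (H c))) x * \<psi> x)" for a b c j m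
      by (rule test_integrable[OF test_mult'[OF test_pd[OF test_pd[OF KH]] test_smooth[OF \<psi>]]])
    have "(LINT x|lborel. r i x * \<psi> x) = h\<^sup>2 * (\<Sum>j\<in>UNIV. \<Sum>m<N. (LINT x|lborel. pd j (pd j (K j m (H i))) x * \<psi> x) - (LINT x|lborel. pd i (pd j (K j m (H j))) x * \<psi> x))"
    proof -
      have "(LINT x|lborel. r i x * \<psi> x) = (LINT x|lborel. h\<^sup>2 * (\<Sum>j\<in>UNIV. \<Sum>m<N. pd j (pd j (K j m (H i))) x * \<psi> x - pd i (pd j (K j m (H j))) x * \<psi> x))"
        by (intro Bochner_Integration.integral_cong refl)
           (simp add: r_def sum_distrib_right left_diff_distrib mult.assoc)
      also have "\<dots> = h\<^sup>2 * (\<Sum>j\<in>UNIV. \<Sum>m<N. (LINT x|lborel. pd j (pd j (K j m (H i))) x * \<psi> x - pd i (pd j (K j m (H j))) x * \<psi> x))"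
        by (subst Bochner_Integration.integral_mult_right_zero,
            (subst Bochner_Integration.integral_sum, intro Bochner_Integration.integrable_sum Bochner_Integration.integrable_diff i2)+)
           (rule refl)
      finally show ?thesis using i2 by simp
    qed
    also have "\<dots> = (\<Sum>j\<in>UNIV. LINT x|lborel. F i x * pd j (w j) x - F j x * pd i (w j) x)"
    proof -
      have "(LINT x|lborel. F i x * pd j (w j) x - F j x * pd i (w j) x)
        = h\<^sup>2 * (\<Sum>m<N. (LINT x|lborel. F i x * pd j (pd j (L j m)) x) - (LINT x|lborel. F j x * pd i (pd j (L j m)) x))" for j
      proof -
        have "(LINT x|lborel. F i x * pd j (w j) x - F j x * pd i (w j) x)
          = (LINT x|lborel. h\<^sup>2 * (\<Sum>m<N. F i x * pd j (pd j (L j m)) x - F j x * pd i (pd j (L j m)) x))"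
          by (intro Bochner_Integration.integral_cong refl)
             (simp add: pdw sum_distrib_left sum_subtractf right_diff_distrib mult_ac)
        also have "\<dots> = h\<^sup>2 * (\<Sum>m<N. LINT x|lborel. F i x * pd j (pd j (L j m)) x - F j x * pd i (pd j (L j m)) x)"
          by (subst Bochner_Integration.integral_mult_right_zero,
              subst Bochner_Integration.integral_sum, intro Bochner_Integration.integrable_diff i1) (rule refl)
        finally show ?thesis using i1 by simp
      qed
      then show ?thesis by (simp add: parts sum_distrib_left)
    qed
    also have "\<dots> \<le> (\<Sum>j\<in>(UNIV::3 set). \<epsilon> * (150 * lnorm lborel (6/5) \<psi>))"
    proof (rule sum_mono)
      fix j
      have "(LINT x|lborel. F i x * pd j (w j) x - F j x * pd i (w j) x) \<le> \<epsilon> * dnorm (6/5) (w j)"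
        using curl[OF w, of i j j] by linarith
      also have "\<dots> \<le> \<epsilon> * (150 * lnorm lborel (6/5) \<psi>)" by (rule mult_left_mono[OF dw \<epsilon>])
      finally show "(LINT x|lborel. F i x * pd j (w j) x - F j x * pd i (w j) x) \<le> \<epsilon> * (150 * lnorm lborel (6/5) \<psi>)" .
    qed
    also have "\<dots> = 450 * \<epsilon> * lnorm lborel 6 (r i) powr 5" by (simp add: \<psi>norm)
    also have "(LINT x|lborel. r i x * \<psi> x) = lnorm lborel 6 (r i) powr 6"
    proof -
      have "r i x * \<psi> x = \<bar>r i x\<bar> powr 6" for x
        using power_Suc[of "r i x" 5] by (simp add: \<psi>_def)
      then show ?thesis using lnorm_powr[of 6 lborel "r i"] by (simp only:)
    qed
    finally have le: "lnorm lborel 6 (r i) powr 6 \<le> 450 * \<epsilon> * lnorm lborel 6 (r i) powr 5" .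
    show ?thesis
    proof (cases "lnorm lborel 6 (r i) = 0")
      case False
      then have pos: "0 < lnorm lborel 6 (r i)" by (simp add: less_le)
      have "lnorm lborel 6 (r i) * lnorm lborel 6 (r i) powr 5 \<le> 450 * \<epsilon> * lnorm lborel 6 (r i) powr 5"
        using le powr_add[of "lnorm lborel 6 (r i)" 1 5] pos by simp
      then show ?thesis using pos by simp
    qed (use \<epsilon> in simp)
  qed
  have nU: "(\<lambda>x. - U x) \<in> TF" by (rule test_uminus[OF U])
  have "lnorm lborel 6 (\<lambda>x. F i x - pd i (\<lambda>x. - U x) x) \<le> 450 * \<epsilon> + \<delta>" for i
  proof -
    have W: "(walk h ^^ N) (H i) \<in> TF" by (rule avg_op_TF[OF avg_op_walk_pow H])
    have eq: "(\<lambda>x. F i x - pd i (\<lambda>x. - U x) x) = (\<lambda>x. (F i x - H i x) + ((walk h ^^ N) (H i) x - r i x))"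
      using decomp by (simp add: pd_smooth(4)[OF test_smooth[OF U] smooth_const] fun_eq_iff)
    have "lnorm lborel 6 (\<lambda>x. F i x - pd i (\<lambda>x. - U x) x) \<le> lnorm lborel 6 (\<lambda>x. F i x - H i x) + (lnorm lborel 6 ((walk h ^^ N) (H i)) + lnorm lborel 6 (r i))"
      unfolding eq by (intro order_trans[OF lnorm_triangle] add_left_mono lnorm_triangle_diff test_lspace[where S=UNIV] test_diff F H W r) auto
    also have "\<dots> \<le> \<delta> / 2 + (\<delta> / 2 + 450 * \<epsilon>)" by (intro add_mono close small rle)
    finally show ?thesis by simp
  qed
  then show ?thesis using nU by blast
qed

section \<open>Sequences with vanishing curl\<close>

text \<open>A diagonal choice: at index k take an element that meets the strictest tolerance 1/(n+1)
  with n \<le> k that can be met. It meets all weaker ones too, and every fixed tolerance can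
  eventually be met.\<close>

lemma eventually_choice_tendsto_0:
  fixes N :: "nat \<Rightarrow> 'i::finite \<Rightarrow> 'a \<Rightarrow> real"
  assumes nonneg: "\<And>k i u. 0 \<le> N k i u" and ne: "a \<in> S"
    and ev: "\<And>\<eta>. 0 < \<eta> \<Longrightarrow> \<forall>\<^sub>F k in sequentially. \<exists>u\<in>S. \<forall>i. N k i u \<le> \<eta>"
  shows "\<exists>u. (\<forall>k. u k \<in> S) \<and> (\<forall>i. (\<lambda>k. N k i (u k)) \<longlonglongrightarrow> 0)"
proof -
  define P where "P k n u \<longleftrightarrow> u \<in> S \<and> (\<forall>i. N k i u \<le> 1 / (real n + 1))" for k n u
  have "\<exists>u. u \<in> S \<and> (\<forall>n\<le>k. (\<exists>v. P k n v) \<longrightarrow> P k n u)" for k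
  proof (cases "\<exists>n\<le>k. \<exists>v. P k n v")
    case True
    define m where "m = Max {n. n \<le> k \<and> (\<exists>v. P k n v)}"
    have fin: "finite {n. n \<le> k \<and> (\<exists>v. P k n v)}" by simp
    have "m \<in> {n. n \<le> k \<and> (\<exists>v. P k n v)}" unfolding m_def using True fin by (intro Max_in) auto
    then obtain u where u: "P k m u" by blast
    have "P k n u" if n: "n \<le> k" "\<exists>v. P k n v" for n
    proof -
      have "n \<le> m" unfolding m_def using fin n by (intro Max_ge) auto
      then have "1 / (real m + 1) \<le> 1 / (real n + 1)" by (intro divide_left_mono) auto
      then show ?thesis using u order_trans unfolding P_def by blast
    qed
    then show ?thesis using u P_def by blast
  next
    case False
    then show ?thesis using ne by blast
  qed
  then obtain u where u: "\<And>k. u k \<in> S" "\<And>k n. n \<le> k \<Longrightarrow> (\<exists>v. P k n v) \<Longrightarrow> P k n (u k)" by metis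
  have "(\<lambda>k. N k i (u k)) \<longlonglongrightarrow> 0" for i
  proof (rule LIMSEQ_I)
    fix r :: real assume r: "0 < r"
    then obtain n where n: "1 / (real n + 1) < r"
      using reals_Archimedean[of r] by (auto simp: inverse_eq_divide add.commute)
    have "\<forall>\<^sub>F k in sequentially. \<exists>v. P k n v"
      using ev[of "1 / (real n + 1)"] unfolding P_def by (auto elim: eventually_mono)
    then obtain K where K: "\<And>k. K \<le> k \<Longrightarrow> \<exists>v. P k n v" by (auto simp: eventually_sequentially)
    have "norm (N k i (u k) - 0) < r" if k: "max K n \<le> k" for k
    proof -
      have "P k n (u k)" using u(2)[of n k] K[of k] k by simp
      then have "N k i (u k) \<le> 1 / (real n + 1)" by (simp add: P_def)
      with n nonneg[of k i "u k"] show ?thesis by simp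
    qed
    then show "\<exists>no. \<forall>k\<ge>no. norm (N k i (u k) - 0) < r" by blast
  qed
  then show ?thesis using u(1) by blast
qed

lemma test_cutoff_mean:
  fixes \<kappa> v :: "real^'n \<Rightarrow> real"
  assumes \<kappa>: "\<kappa> \<in> test_functions \<omega>" and v: "v \<in> TF"
  shows "(\<lambda>x. \<kappa> x * (v x - c)) \<in> test_functions \<omega>"
    and "pd j (\<lambda>x. \<kappa> x * (v x - c)) = (\<lambda>x. \<kappa> x * pd j v x + (v x - c) * pd j \<kappa> x)"
proof -
  have sv: "smooth (\<lambda>x. v x - c)" by (intro smooth_diff smooth_const test_smooth[OF v])
  show "(\<lambda>x. \<kappa> x * (v x - c)) \<in> test_functions \<omega>" by (rule test_mult'[OF \<kappa> sv])
  have "pd j (\<lambda>x. v x - c) = pd j v"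
    using pd_smooth(5)[OF test_smooth[OF v] smooth_const, of j c] by (simp add: pd_const)
  then show "pd j (\<lambda>x. \<kappa> x * (v x - c)) = (\<lambda>x. \<kappa> x * pd j v x + (v x - c) * pd j \<kappa> x)"
    by (simp add: pd_smooth(2)[OF test_smooth[OF \<kappa>] sv])
qed

text \<open>Negative norms see the full Sobolev norm of a test function. After subtraction of the
  mean, the Poincare inequality bounds the term of order zero, so the gradient alone remains on the
  right.\<close>

lemma cutoff_mean_bound:
  fixes \<kappa> :: "real^'n \<Rightarrow> real"
  assumes \<kappa>: "\<kappa> \<in> TF" and s: "1 < s" and R: "0 < R" and supp: "\<And>x. R < norm x \<Longrightarrow> \<kappa> x = 0"
  shows "\<exists>C\<ge>0. \<forall>v\<in>TF. lnorm lborel s (\<lambda>x. \<kappa> x * (v x - ball_mean R v)) + dnorm s (\<lambda>x. \<kappa> x * (v x - ball_mean R v)) \<le> C * dnorm s v"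
proof -
  obtain P where P: "0 \<le> P" and poinc: "\<And>v. v \<in> (TF :: (real^'n \<Rightarrow> real) set) \<Longrightarrow>
    (\<lambda>x. indicator (cball 0 R) x * (v x - ball_mean R v)) \<in> lspace lborel s \<and>
    lnorm lborel s (\<lambda>x. indicator (cball 0 R) x * (v x - ball_mean R v)) \<le> P * dnorm s v"
    using poincare[OF s R] by blast
  obtain B where B: "0 \<le> B" "\<And>x. \<bar>\<kappa> x\<bar> \<le> B" using cont_cs_bounded[OF test_cont_cs[OF \<kappa>]] by blast
  have "\<exists>B\<ge>0. \<forall>x. \<bar>pd j \<kappa> x\<bar> \<le> B" for j using cont_cs_bounded[OF test_cont_cs[OF test_pd[OF \<kappa>]]] by metis
  then obtain D where D: "\<And>j. 0 \<le> D j" "\<And>j x. \<bar>pd j \<kappa> x\<bar> \<le> D j" by metis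
  define C where "C = B * P + (\<Sum>j\<in>UNIV. B + D j * P)"
  have C: "0 \<le> C" unfolding C_def using B P D by (intro add_nonneg_nonneg sum_nonneg mult_nonneg_nonneg) auto
  have s0: "0 < s" using s by simp
  have psupp: "pd j \<kappa> x = 0" if "R < norm x" for j x
    using pd_eq_0_outside[of "cball 0 R" \<kappa> x j] supp that by auto
  have "lnorm lborel s (\<lambda>x. \<kappa> x * (v x - ball_mean R v)) + dnorm s (\<lambda>x. \<kappa> x * (v x - ball_mean R v)) \<le> C * dnorm s v" if v: "v \<in> TF" for v
  proof -
    let ?c = "ball_mean R v"
    let ?w = "\<lambda>x. indicator (cball 0 R) x * (v x - ?c)"
    have wl: "?w \<in> lspace lborel s" and wn: "lnorm lborel s ?w \<le> P * dnorm s v" using poinc[OF v] by auto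
    have cut: "(\<lambda>x. \<theta> x * (v x - ?c)) = (\<lambda>x. \<theta> x * ?w x)" if "\<And>x. R < norm x \<Longrightarrow> \<theta> x = 0" for \<theta> :: "real^'n \<Rightarrow> real"
      using that by (auto simp: fun_eq_iff indicator_def)
    have "lnorm lborel s (\<lambda>x. \<kappa> x * (v x - ?c)) = lnorm lborel s (\<lambda>x. \<kappa> x * ?w x)"
      by (rule arg_cong[OF cut]) (rule supp)
    also have "\<dots> \<le> B * lnorm lborel s ?w"
      by (rule lspace_bounded_mult(2)[OF wl _ B(2) s0]) (use test_measurable[OF \<kappa>] in simp)
    also have "\<dots> \<le> B * (P * dnorm s v)" by (rule mult_left_mono[OF wn B(1)])
    finally have 0: "lnorm lborel s (\<lambda>x. \<kappa> x * (v x - ?c)) \<le> B * (P * dnorm s v)" .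
    have "lnorm lborel s (pd j (\<lambda>x. \<kappa> x * (v x - ?c))) \<le> (B + D j * P) * dnorm s v" for j
    proof -
      have pv: "pd j v \<in> lspace lborel s" by (rule test_lspace[OF test_pd[OF v] s0])
      have l1: "(\<lambda>x. \<kappa> x * pd j v x) \<in> lspace lborel s" "lnorm lborel s (\<lambda>x. \<kappa> x * pd j v x) \<le> B * lnorm lborel s (pd j v)"
        by (rule lspace_bounded_mult[OF pv _ B(2) s0], use test_measurable[OF \<kappa>] in simp)+
      have l2: "(\<lambda>x. pd j \<kappa> x * ?w x) \<in> lspace lborel s" "lnorm lborel s (\<lambda>x. pd j \<kappa> x * ?w x) \<le> D j * lnorm lborel s ?w"
        by (rule lspace_bounded_mult[OF wl _ D(2) s0], use test_measurable[OF test_pd[OF \<kappa>]] in simp)+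
      have c: "pd j \<kappa> x * (v x - ?c) = pd j \<kappa> x * ?w x" for x
        by (rule fun_cong[OF cut]) (rule psupp)
      have "pd j (\<lambda>x. \<kappa> x * (v x - ?c)) = (\<lambda>x. \<kappa> x * pd j v x + pd j \<kappa> x * ?w x)"
        unfolding test_cutoff_mean(2)[OF \<kappa> v] c[symmetric] by (simp only: mult.commute)
      then have "lnorm lborel s (pd j (\<lambda>x. \<kappa> x * (v x - ?c))) = lnorm lborel s (\<lambda>x. \<kappa> x * pd j v x + pd j \<kappa> x * ?w x)"
        by (rule arg_cong)
      also have "\<dots> \<le> lnorm lborel s (\<lambda>x. \<kappa> x * pd j v x) + lnorm lborel s (\<lambda>x. pd j \<kappa> x * ?w x)"
        by (rule lnorm_triangle[OF l1(1) l2(1) s])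
      also have "\<dots> \<le> B * dnorm s v + D j * (P * dnorm s v)"
        using l1(2) l2(2) mult_left_mono[OF wn D(1)[of j]] mult_left_mono[OF lnorm_pd_le_dnorm[of s j v] B(1)] by linarith
      finally show ?thesis by (simp add: distrib_right mult.assoc)
    qed
    then have "dnorm s (\<lambda>x. \<kappa> x * (v x - ?c)) \<le> (\<Sum>j\<in>UNIV. (B + D j * P) * dnorm s v)"
      unfolding dnorm_def[of s "\<lambda>x. \<kappa> x * (v x - ?c)"] by (intro sum_mono)
    with 0 show ?thesis by (simp add: C_def distrib_right sum_distrib_right mult.assoc)
  qed
  with C show ?thesis by blast
qed

lemma test_support_ball:
  fixes \<kappa> :: "real^'n \<Rightarrow> real"
  assumes "\<kappa> \<in> TF"
  obtains R where "0 < R" "\<And>x. R < norm x \<Longrightarrow> \<kappa> x = 0"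
proof -
  obtain r where r: "\<And>x. r < norm x \<Longrightarrow> \<kappa> x = 0"
    using test_cont_cs[OF assms] by (auto simp: cont_cs_def compact_supp_iff_cball)
  show ?thesis by (rule that[of "max r 1"]) (simp_all add: r)
qed

lemma lspace_test_mult:
  fixes f \<theta> :: "real^'n \<Rightarrow> real"
  assumes f: "f \<in> lspace lborel s" and \<theta>: "\<theta> \<in> TF" and s: "0 < s"
  shows "(\<lambda>x. \<theta> x * f x) \<in> lspace lborel s"
proof -
  obtain B where B: "\<And>x. \<bar>\<theta> x\<bar> \<le> B" using cont_cs_bounded[OF test_cont_cs[OF \<theta>]] by blast
  show ?thesis by (rule lspace_bounded_mult(1)[OF f _ B s]) (use test_measurable[OF \<theta>] in simp)
qed

lemma lnorm_test_mult_bound: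
  fixes \<theta> :: "real^'n \<Rightarrow> real"
  assumes \<theta>: "\<theta> \<in> TF" and s: "0 < s"
  shows "\<exists>B\<ge>0. \<forall>f\<in>lspace lborel s. lnorm lborel s (\<lambda>x. \<theta> x * f x) \<le> B * lnorm lborel s f"
proof -
  obtain B where B: "0 \<le> B" "\<And>x. \<bar>\<theta> x\<bar> \<le> B" using cont_cs_bounded[OF test_cont_cs[OF \<theta>]] by blast
  have "lnorm lborel s (\<lambda>x. \<theta> x * f x) \<le> B * lnorm lborel s f" if "f \<in> lspace lborel s" for f
    by (rule lspace_bounded_mult(2)[OF that _ B(2) s]) (use test_measurable[OF \<theta>] in simp)
  with B(1) show ?thesis by blast
qed

lemma compact_supp_test_mult: "\<theta> \<in> TF \<Longrightarrow> compact_supp (\<lambda>x. \<theta> x * f x)"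
  by (rule compact_supp_mono[of \<theta>]) (use test_cont_cs[of \<theta> UNIV] in \<open>auto simp: cont_cs_def\<close>)

text \<open>One row of the difference between a field and its weak limit. The last assumption is
  convergence of the curl to 0 in the dual of W_0^(1,6/5), expressed on test functions only.\<close>

locale curl_null =
  fixes \<omega> :: "(real^3) set" and f :: "nat \<Rightarrow> 3 \<Rightarrow> real^3 \<Rightarrow> real" and C :: real
  assumes f: "\<And>k i. f k i \<in> lspace lborel 6"
    and bounded: "\<And>k i. lnorm lborel 6 (f k i) \<le> C"
    and weak: "\<And>i \<theta>. \<theta> \<in> TF \<Longrightarrow> (\<lambda>k. LINT x|lborel. f k i x * \<theta> x) \<longlonglongrightarrow> 0"
    and curl: "\<And>i j \<eta>. 0 < \<eta> \<Longrightarrow> \<forall>\<^sub>F k in sequentially. \<forall>v\<in>test_functions \<omega>.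
      \<bar>LINT x|lborel. f k i x * pd j v x - f k j x * pd i v x\<bar> \<le> \<eta> * (lnorm lborel (6/5) v + dnorm (6/5) v)"
begin

lemma integrable_mult_test:
  assumes "\<theta> \<in> TF"
  shows "integrable lborel (\<lambda>x. f k i x * \<theta> x)"
  by (rule Holder_integrable[OF conjugate_6(1) f test_lspace[OF assms]]) simp

text \<open>The curl of \<kappa> f is \<kappa> times the curl of f plus products of f with first
  derivatives of \<kappa>. The former is tested with \<kappa> (v - c); the latter are weakly null
  with compact support, hence null uniformly in v. The mean c may be subtracted because only
  derivatives of v occur on the left.\<close>

lemma localized_curl:
  assumes \<kappa>: "\<kappa> \<in> test_functions \<omega>" and \<eta>: "0 < \<eta>"
  shows "\<forall>\<^sub>F k in sequentially. \<forall>v\<in>TF. \<bar>LINT x|lborel. \<kappa> x * f k i x * pd j v x - \<kappa> x * f k j x * pd i v x\<bar> \<le> \<eta> * dnorm (6/5) v"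
proof -
  have \<kappa>': "\<kappa> \<in> TF" by (rule test_TF[OF \<kappa>])
  obtain R where R: "0 < R" "\<And>x. R < norm x \<Longrightarrow> \<kappa> x = 0" using test_support_ball[OF \<kappa>'] by blast
  obtain B where B: "0 \<le> B" "\<And>v. v \<in> (TF :: (real^3 \<Rightarrow> real) set) \<Longrightarrow>
      lnorm lborel (6/5) (\<lambda>x. \<kappa> x * (v x - ball_mean (R + 1) v)) + dnorm (6/5) (\<lambda>x. \<kappa> x * (v x - ball_mean (R + 1) v)) \<le> B * dnorm (6/5) v"
    using cutoff_mean_bound[OF \<kappa>', of "6/5" "R + 1"] R by fastforce
  define g where "g k x = pd j \<kappa> x * f k i x - pd i \<kappa> x * f k j x" for k x
  have pl: "(\<lambda>x. pd a \<kappa> x * f k b x) \<in> lspace lborel 6" for a b k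
    by (intro lspace_test_mult f test_pd \<kappa>') simp
  have gl: "g k \<in> lspace lborel 6" for k unfolding g_def[abs_def] by (intro lspace_diff pl) simp
  have psupp: "pd a \<kappa> x = 0" if "R < norm x" for a x
    using pd_eq_0_outside[of "cball 0 R" \<kappa> x a] R(2) that by auto
  obtain Di where Di: "0 \<le> Di" "\<And>h. h \<in> lspace lborel 6 \<Longrightarrow> lnorm lborel 6 (\<lambda>x. pd i \<kappa> x * h x) \<le> Di * lnorm lborel 6 h"
    using lnorm_test_mult_bound[OF test_pd[OF \<kappa>'], of 6 i] by auto
  obtain Dj where Dj: "0 \<le> Dj" "\<And>h. h \<in> lspace lborel 6 \<Longrightarrow> lnorm lborel 6 (\<lambda>x. pd j \<kappa> x * h x) \<le> Dj * lnorm lborel 6 h"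
    using lnorm_test_mult_bound[OF test_pd[OF \<kappa>'], of 6 j] by auto
  have gb: "lnorm lborel 6 (g k) \<le> Dj * C + Di * C" for k
  proof -
    have "lnorm lborel 6 (g k) \<le> lnorm lborel 6 (\<lambda>x. pd j \<kappa> x * f k i x) + lnorm lborel 6 (\<lambda>x. pd i \<kappa> x * f k j x)"
      unfolding g_def[abs_def] by (rule lnorm_triangle_diff[OF pl pl]) simp
    also have "\<dots> \<le> Dj * C + Di * C"
      using Dj(2)[OF f[of k i]] Di(2)[OF f[of k j]] mult_left_mono[OF bounded[of k i] Dj(1)] mult_left_mono[OF bounded[of k j] Di(1)] by linarith
    finally show ?thesis .
  qed
  have ev1: "\<forall>\<^sub>F k in sequentially. \<forall>v\<in>TF. \<bar>LINT x|lborel. g k x * (v x - ball_mean (R + 1) v)\<bar> \<le> \<eta> / 2 * dnorm (6/5) v"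
  proof (rule weakly_null_uniform[OF conjugate_6(2) gl gb])
    show "(\<lambda>k. LINT x|lborel. g k x * \<theta> x) \<longlonglongrightarrow> 0" if \<theta>: "\<theta> \<in> TF" for \<theta>
    proof -
      have t: "(\<lambda>x. pd a \<kappa> x * \<theta> x) \<in> TF" for a by (intro test_mult' test_pd \<kappa>' test_smooth[OF \<theta>])
      have "(LINT x|lborel. g k x * \<theta> x) = (LINT x|lborel. f k i x * (pd j \<kappa> x * \<theta> x)) - (LINT x|lborel. f k j x * (pd i \<kappa> x * \<theta> x))" for k
        using integrable_mult_test[OF t, of k i j] integrable_mult_test[OF t, of k j i]
        by (simp add: g_def algebra_simps flip: Bochner_Integration.integral_diff)
      then show ?thesis using tendsto_diff[OF weak[OF t, of i j] weak[OF t, of j i]] by simp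
    qed
  qed (use R \<eta> psupp in \<open>auto simp: g_def\<close>)
  have ev2: "\<forall>\<^sub>F k in sequentially. \<forall>v\<in>test_functions \<omega>.
      \<bar>LINT x|lborel. f k i x * pd j v x - f k j x * pd i v x\<bar> \<le> \<eta> / (2 * (B + 1)) * (lnorm lborel (6/5) v + dnorm (6/5) v)"
    using \<eta> B(1) by (intro curl) auto
  show ?thesis
    using ev1 ev2
  proof eventually_elim
    case (elim k)
    show ?case
    proof
      fix v :: "real^3 \<Rightarrow> real" assume v: "v \<in> TF"
      let ?c = "ball_mean (R + 1) v"
      let ?z = "\<lambda>x. \<kappa> x * (v x - ?c)"
      have z: "?z \<in> test_functions \<omega>" by (rule test_cutoff_mean(1)[OF \<kappa> v])
      have "\<bar>LINT x|lborel. f k i x * pd j ?z x - f k j x * pd i ?z x\<bar> \<le> \<eta> / (2 * (B + 1)) * (B * dnorm (6/5) v)"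
        using bspec[OF elim(2) z] mult_left_mono[OF B(2)[OF v], of "\<eta> / (2 * (B + 1))"] B(1) \<eta> by simp
      also have "\<dots> \<le> \<eta> / 2 * dnorm (6/5) v"
      proof -
        have "\<eta> / (2 * (B + 1)) * B \<le> \<eta> / 2" using B(1) \<eta> by (simp add: field_simps)
        from mult_right_mono[OF this dnorm_nonneg[of "6/5" v]] show ?thesis by (simp add: mult.assoc)
      qed
      finally have 1: "\<bar>LINT x|lborel. f k i x * pd j ?z x - f k j x * pd i ?z x\<bar> \<le> \<eta> / 2 * dnorm (6/5) v" .
      have 2: "\<bar>LINT x|lborel. g k x * (v x - ?c)\<bar> \<le> \<eta> / 2 * dnorm (6/5) v" using elim(1) v by blast
      have i1: "integrable lborel (\<lambda>x. f k a x * pd b ?z x)" for a b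
        by (intro integrable_mult_test test_pd test_TF[OF z])
      have sv: "smooth (\<lambda>x. v x - ?c)" by (intro smooth_diff smooth_const test_smooth[OF v])
      have ge: "g k x * (v x - ?c) = f k i x * (pd j \<kappa> x * (v x - ?c)) - f k j x * (pd i \<kappa> x * (v x - ?c))" for x
        by (simp add: g_def algebra_simps)
      have i2: "integrable lborel (\<lambda>x. g k x * (v x - ?c))"
        unfolding ge by (intro Bochner_Integration.integrable_diff integrable_mult_test test_mult' test_pd \<kappa>' sv)
      have pz: "pd b ?z = (\<lambda>x. \<kappa> x * pd b v x + (v x - ?c) * pd b \<kappa> x)" for b
        by (rule test_cutoff_mean(2)[OF \<kappa>' v])
      have "(LINT x|lborel. \<kappa> x * f k i x * pd j v x - \<kappa> x * f k j x * pd i v x)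
        = (LINT x|lborel. (f k i x * pd j ?z x - f k j x * pd i ?z x) - g k x * (v x - ?c))"
        unfolding pz ge by (intro Bochner_Integration.integral_cong refl) (simp add: algebra_simps)
      also have "\<dots> = (LINT x|lborel. f k i x * pd j ?z x - f k j x * pd i ?z x) - (LINT x|lborel. g k x * (v x - ?c))"
        using i1 i2 by simp
      finally show "\<bar>LINT x|lborel. \<kappa> x * f k i x * pd j v x - \<kappa> x * f k j x * pd i v x\<bar> \<le> \<eta> * dnorm (6/5) v"
        using 1 2 by argo
    qed
  qed
qed

text \<open>The localized field is mollified so that \<open>helmholtz\<close> applies. As averages
  are self-adjoint and do not increase \<open>dnorm\<close>, the curl bound survives
  mollification.\<close>

lemma curl_decomposition:
  assumes \<kappa>: "\<kappa> \<in> test_functions \<omega>"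
  shows "\<exists>u. (\<forall>k. u k \<in> TF) \<and> (\<forall>i. (\<lambda>k. lnorm lborel 6 (\<lambda>x. \<kappa> x * f k i x - pd i (u k) x)) \<longlonglongrightarrow> 0)"
proof (rule eventually_choice_tendsto_0[OF lnorm_nonneg test_zero])
  fix \<eta> :: real assume \<eta>: "0 < \<eta>"
  have \<kappa>': "\<kappa> \<in> TF" by (rule test_TF[OF \<kappa>])
  \<comment> \<open>Since 1800 = 4 * 450, the curl contributes \<eta>/4, as do the tolerance in
    \<open>helmholtz\<close> and the mollification error.\<close>
  have "\<forall>\<^sub>F k in sequentially. \<forall>p\<in>(UNIV :: (3 \<times> 3) set). \<forall>v\<in>TF. \<bar>LINT x|lborel. \<kappa> x * f k (fst p) x * pd (snd p) v x - \<kappa> x * f k (snd p) x * pd (fst p) v x\<bar> \<le> \<eta> / 1800 * dnorm (6/5) v"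
    using \<eta> by (intro eventually_ball_finite ballI localized_curl[OF \<kappa>]) auto
  then show "\<forall>\<^sub>F k in sequentially. \<exists>u\<in>TF. \<forall>i. lnorm lborel 6 (\<lambda>x. \<kappa> x * f k i x - pd i u x) \<le> \<eta>"
  proof (rule eventually_mono)
    fix k
    assume curl: "\<forall>p\<in>(UNIV :: (3 \<times> 3) set). \<forall>v\<in>TF. \<bar>LINT x|lborel. \<kappa> x * f k (fst p) x * pd (snd p) v x - \<kappa> x * f k (snd p) x * pd (fst p) v x\<bar> \<le> \<eta> / 1800 * dnorm (6/5) v"
    let ?g = "\<lambda>i x. \<kappa> x * f k i x"
    have gl: "?g i \<in> lspace lborel 6" for i by (intro lspace_test_mult f \<kappa>') simp
    have gcs: "compact_supp (?g i)" for i by (rule compact_supp_test_mult[OF \<kappa>'])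
    have gint: "integrable lborel (?g i)" for i
      by (rule compact_supp_lspace_integrable[OF gl _ gcs]) simp
    have "\<exists>d>0. \<forall>\<mu> r. averaging \<mu> r \<longrightarrow> r \<le> d \<longrightarrow> lnorm lborel 6 (\<lambda>x. ?g i x - avg \<mu> (?g i) x) < \<eta> / 4" for i
      using \<eta> by (intro mollify_approx gl gcs) auto
    then have "\<forall>i. \<exists>d>0. \<forall>\<mu> r. averaging \<mu> r \<longrightarrow> r \<le> d \<longrightarrow> lnorm lborel 6 (\<lambda>x. ?g i x - avg \<mu> (?g i) x) < \<eta> / 4"
      by (intro allI)
    from choice[OF this] obtain d where d: "\<And>i. 0 < d i" "\<And>i \<mu> r. averaging \<mu> r \<Longrightarrow> r \<le> d i \<Longrightarrow> lnorm lborel 6 (\<lambda>x. ?g i x - avg \<mu> (?g i) x) < \<eta> / 4"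
      by blast
    define r where "r = Min (range d)"
    have r: "0 < r" "r \<le> d i" for i using d(1) by (auto simp: r_def)
    obtain \<rho> where \<rho>: "\<rho> \<in> TF" "\<And>x::real^3. 0 \<le> \<rho> x" "\<And>x. \<rho> (- x) = \<rho> x" "averaging (density lborel \<rho>) r"
      using exists_mollifier[OF r(1)] by metis
    let ?\<mu> = "density lborel \<rho>"
    interpret averaging ?\<mu> r by fact
    define F where "F i = avg ?\<mu> (?g i)" for i
    have F: "F i \<in> TF" for i unfolding F_def by (rule mollify_TF(1)[OF \<rho> gint gcs])
    have close: "lnorm lborel 6 (\<lambda>x. ?g i x - F i x) \<le> \<eta> / 4" for i
      using d(2)[OF \<rho>(4) r(2), of i] by (simp add: F_def)
    have "\<exists>u\<in>TF. \<forall>i. lnorm lborel 6 (\<lambda>x. F i x - pd i u x) \<le> 450 * (\<eta> / 1800) + \<eta> / 4"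
    proof (rule helmholtz[OF F])
      fix w :: "real^3 \<Rightarrow> real" and i j assume w: "w \<in> TF"
      have aw: "avg ?\<mu> w \<in> TF" by (rule avg_TF(1)[OF \<rho>(4) w])
      have eq: "(LINT x|lborel. F a x * pd b w x) = (LINT x|lborel. ?g a x * pd b (avg ?\<mu> w) x)" for a b
        unfolding F_def avg_TF(2)[OF \<rho>(4) w]
        by (rule integral_avg_mult[OF conjugate_6(1) gl test_lspace[OF test_pd[OF w]]]) simp
      have i1: "integrable lborel (\<lambda>x. F a x * pd b w x)" for a b
        by (rule test_integrable[OF test_mult'[OF F test_smooth[OF test_pd[OF w]]]])
      have i2: "integrable lborel (\<lambda>x. ?g a x * pd b (avg ?\<mu> w) x)" for a b
        by (rule Holder_integrable[OF conjugate_6(1) gl test_lspace[OF test_pd[OF aw]]]) simp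
      have "(LINT x|lborel. F i x * pd j w x - F j x * pd i w x) = (LINT x|lborel. ?g i x * pd j (avg ?\<mu> w) x - ?g j x * pd i (avg ?\<mu> w) x)"
        using i1 i2 by (simp add: eq)
      also have "\<bar>\<dots>\<bar> \<le> \<eta> / 1800 * dnorm (6/5) (avg ?\<mu> w)"
        using curl[THEN bspec, of "(i, j)"] aw by simp
      also have "\<dots> \<le> \<eta> / 1800 * dnorm (6/5) w"
        using \<eta> by (intro mult_left_mono dnorm_avg_le[OF \<rho>(4) w]) auto
      finally show "\<bar>LINT x|lborel. F i x * pd j w x - F j x * pd i w x\<bar> \<le> \<eta> / 1800 * dnorm (6/5) w" .
    qed (use \<eta> in auto)
    then obtain u where u: "u \<in> TF" "\<And>i. lnorm lborel 6 (\<lambda>x. F i x - pd i u x) \<le> \<eta> / 2" by auto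
    have "lnorm lborel 6 (\<lambda>x. ?g i x - pd i u x) \<le> \<eta>" for i
    proof -
      have "lnorm lborel 6 (\<lambda>x. (?g i x - F i x) + (F i x - pd i u x)) \<le> lnorm lborel 6 (\<lambda>x. ?g i x - F i x) + lnorm lborel 6 (\<lambda>x. F i x - pd i u x)"
        by (intro lnorm_triangle lspace_diff gl test_lspace[OF F] test_lspace[OF test_pd[OF u(1)]]) auto
      then show ?thesis using close[of i] u(2)[of i] \<eta> by simp
    qed
    then show "\<exists>u\<in>TF. \<forall>i. lnorm lborel 6 (\<lambda>x. ?g i x - pd i u x) \<le> \<eta>" using u(1) by blast
  qed
qed

end

section \<open>The div-curl lemma\<close>

text \<open>On the support of \<theta> the growth condition gives an L^(6/5) bound depending on h
  only through the integral of w. With w = |a|^6 and w = |a|^6 + |b|^6 it places single entries and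
  products of two entries in the exponent dual to 6.\<close>

lemma lnorm_test_mult_growth:
  fixes \<theta> :: "real^'n \<Rightarrow> real"
  assumes \<theta>: "\<theta> \<in> TF"
  shows "\<exists>B\<ge>0. \<forall>h w. h \<in> borel_measurable borel \<longrightarrow> integrable lborel w \<longrightarrow> (LINT x|lborel. w x) \<le> D \<longrightarrow>
    (\<forall>x. 0 \<le> w x \<and> \<bar>h x\<bar> powr (6/5) \<le> 1 + w x) \<longrightarrow>
    (\<lambda>x. \<theta> x * h x) \<in> lspace lborel (6/5) \<and> lnorm lborel (6/5) (\<lambda>x. \<theta> x * h x) \<le> B"
proof -
  obtain b where b: "0 \<le> b" "\<And>x. \<bar>\<theta> x\<bar> \<le> b" using cont_cs_bounded[OF test_cont_cs[OF \<theta>]] by blast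
  define I where "I = (LINT x|lborel. \<bar>\<theta> x\<bar> powr (6/5))"
  have \<theta>i: "integrable lborel (\<lambda>x. \<bar>\<theta> x\<bar> powr (6/5))" by (intro lspace_integrable test_lspace[OF \<theta>]) simp
  have I: "0 \<le> I" by (simp add: I_def)
  have [measurable]: "\<theta> \<in> borel_measurable borel" by (rule test_measurable[OF \<theta>])
  define B where "B = (I + b powr (6/5) * max D 0) powr (5/6)"
  have "(\<lambda>x. \<theta> x * h x) \<in> lspace lborel (6/5) \<and> lnorm lborel (6/5) (\<lambda>x. \<theta> x * h x) \<le> B"
    if h [measurable]: "h \<in> borel_measurable borel" and w: "integrable lborel w" "(LINT x|lborel. w x) \<le> D"
      and le: "\<forall>x. 0 \<le> w x \<and> \<bar>h x\<bar> powr (6/5) \<le> 1 + w x" for h w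
  proof -
    have pt: "\<bar>\<theta> x * h x\<bar> powr (6/5) \<le> \<bar>\<theta> x\<bar> powr (6/5) + b powr (6/5) * w x" for x
    proof -
      have "\<bar>\<theta> x * h x\<bar> powr (6/5) = \<bar>\<theta> x\<bar> powr (6/5) * \<bar>h x\<bar> powr (6/5)" by (simp add: abs_mult powr_mult)
      also have "\<dots> \<le> \<bar>\<theta> x\<bar> powr (6/5) * (1 + w x)" using le by (intro mult_left_mono) auto
      also have "\<dots> \<le> \<bar>\<theta> x\<bar> powr (6/5) + b powr (6/5) * w x"
        using le b by (simp add: distrib_left mult_right_mono powr_mono2)
      finally show ?thesis .
    qed
    have i: "integrable lborel (\<lambda>x. \<bar>\<theta> x\<bar> powr (6/5) + b powr (6/5) * w x)" using \<theta>i w by simp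
    have l: "integrable lborel (\<lambda>x. \<bar>\<theta> x * h x\<bar> powr (6/5))"
      by (rule Bochner_Integration.integrable_bound[OF i]) (auto intro!: AE_I2 order_trans[OF pt])
    have "(LINT x|lborel. \<bar>\<theta> x * h x\<bar> powr (6/5)) \<le> (LINT x|lborel. \<bar>\<theta> x\<bar> powr (6/5) + b powr (6/5) * w x)"
      by (rule integral_mono[OF l i pt])
    also have "\<dots> = I + b powr (6/5) * (LINT x|lborel. w x)" using \<theta>i w by (simp add: I_def)
    also have "\<dots> \<le> I + b powr (6/5) * max D 0" using w(2) by (intro add_left_mono mult_left_mono) auto
    also have "\<dots> = B powr (6/5)" using I by (simp add: B_def powr_powr)
    finally have "lnorm lborel (6/5) (\<lambda>x. \<theta> x * h x) \<le> B" by (subst lnorm_le_iff) (auto simp: B_def)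
    then show ?thesis using l by (auto intro!: lspaceI)
  qed
  then show ?thesis by (intro exI[of _ B]) (auto simp: B_def)
qed

lemma powr_growth_6: fixes a :: real shows "\<bar>a\<bar> powr (6/5) \<le> 1 + \<bar>a\<bar> powr 6"
proof (cases "\<bar>a\<bar> \<le> 1")
  case True
  then have "\<bar>a\<bar> powr (6/5) \<le> 1" by (intro powr_le1) auto
  then show ?thesis by (simp add: add_increasing2)
next
  case False
  then have "\<bar>a\<bar> powr (6/5) \<le> \<bar>a\<bar> powr 6" by (intro powr_mono) auto
  then show ?thesis by simp
qed

lemma powr_growth_6_mult: fixes a b :: real shows "\<bar>a * b\<bar> powr (6/5) \<le> 1 + (\<bar>a\<bar> powr 6 + \<bar>b\<bar> powr 6)"
proof -
  let ?m = "max \<bar>a\<bar> \<bar>b\<bar>"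
  have "\<bar>a * b\<bar> powr (6/5) \<le> (?m * ?m) powr (6/5)"
    unfolding abs_mult by (intro powr_mono2 mult_mono) auto
  also have "\<dots> = ?m powr (12/5)" using powr_mult[of ?m ?m "6/5"] powr_add[of ?m "6/5" "6/5"] by simp
  also have "\<dots> \<le> 1 + ?m powr 6"
  proof (cases "?m \<le> 1")
    case True
    then have "?m powr (12/5) \<le> 1" by (intro powr_le1) auto
    then show ?thesis by (simp add: add_increasing2)
  next
    case False
    then have "?m powr (12/5) \<le> ?m powr 6" by (intro powr_mono) auto
    then show ?thesis by simp
  qed
  also have "\<dots> \<le> 1 + (\<bar>a\<bar> powr 6 + \<bar>b\<bar> powr 6)" by (simp add: max_def)
  finally show ?thesis .
qed

lemma lnorm_test_mult_6:
  fixes \<theta> :: "real^'n \<Rightarrow> real"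
  assumes \<theta>: "\<theta> \<in> TF"
  shows "\<exists>B\<ge>0. \<forall>h\<in>lspace lborel 6. lnorm lborel 6 h \<le> D \<longrightarrow>
    (\<lambda>x. \<theta> x * h x) \<in> lspace lborel (6/5) \<and> lnorm lborel (6/5) (\<lambda>x. \<theta> x * h x) \<le> B"
proof -
  obtain B where B: "0 \<le> B" "\<And>h w. h \<in> borel_measurable borel \<Longrightarrow> integrable lborel w \<Longrightarrow> (LINT x|lborel. w x) \<le> D powr 6 \<Longrightarrow>
    (\<forall>x. 0 \<le> w x \<and> \<bar>h x\<bar> powr (6/5) \<le> 1 + w x) \<Longrightarrow>
    (\<lambda>x. \<theta> x * h x) \<in> lspace lborel (6/5) \<and> lnorm lborel (6/5) (\<lambda>x. \<theta> x * h x) \<le> B"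
    using lnorm_test_mult_growth[OF \<theta>, of "D powr 6"] by blast
  have "(\<lambda>x. \<theta> x * h x) \<in> lspace lborel (6/5) \<and> lnorm lborel (6/5) (\<lambda>x. \<theta> x * h x) \<le> B"
    if h: "h \<in> lspace lborel 6" "lnorm lborel 6 h \<le> D" for h
  proof (rule B(2))
    have "0 \<le> D" using h(2) lnorm_nonneg order_trans by blast
    then show "(LINT x|lborel. \<bar>h x\<bar> powr 6) \<le> D powr 6" using h(2) by (subst (asm) lnorm_le_iff) auto
    show "integrable lborel (\<lambda>x. \<bar>h x\<bar> powr 6)" by (rule lspace_integrable[OF h(1)])
    show "h \<in> borel_measurable borel" using lspace_measurable[OF h(1)] by simp
  qed (intro allI conjI powr_growth_6, simp)
  with B(1) show ?thesis by blast
qed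

lemma lnorm_test_mult_6_6:
  fixes \<theta> :: "real^'n \<Rightarrow> real"
  assumes \<theta>: "\<theta> \<in> TF"
  shows "\<exists>B\<ge>0. \<forall>a\<in>lspace lborel 6. \<forall>b\<in>lspace lborel 6. lnorm lborel 6 a \<le> D \<longrightarrow> lnorm lborel 6 b \<le> D \<longrightarrow>
    (\<lambda>x. \<theta> x * (a x * b x)) \<in> lspace lborel (6/5) \<and> lnorm lborel (6/5) (\<lambda>x. \<theta> x * (a x * b x)) \<le> B"
proof -
  obtain B where B: "0 \<le> B" "\<And>h w. h \<in> borel_measurable borel \<Longrightarrow> integrable lborel w \<Longrightarrow> (LINT x|lborel. w x) \<le> 2 * D powr 6 \<Longrightarrow>
    (\<forall>x. 0 \<le> w x \<and> \<bar>h x\<bar> powr (6/5) \<le> 1 + w x) \<Longrightarrow>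
    (\<lambda>x. \<theta> x * h x) \<in> lspace lborel (6/5) \<and> lnorm lborel (6/5) (\<lambda>x. \<theta> x * h x) \<le> B"
    using lnorm_test_mult_growth[OF \<theta>, of "2 * D powr 6"] by blast
  have "(\<lambda>x. \<theta> x * (a x * b x)) \<in> lspace lborel (6/5) \<and> lnorm lborel (6/5) (\<lambda>x. \<theta> x * (a x * b x)) \<le> B"
    if h: "a \<in> lspace lborel 6" "b \<in> lspace lborel 6" "lnorm lborel 6 a \<le> D" "lnorm lborel 6 b \<le> D" for a b
  proof (rule B(2))
    have D: "0 \<le> D" using h(3) lnorm_nonneg order_trans by blast
    have i: "integrable lborel (\<lambda>x. \<bar>a x\<bar> powr 6)" "integrable lborel (\<lambda>x. \<bar>b x\<bar> powr 6)"
      by (intro lspace_integrable h)+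
    have "(LINT x|lborel. \<bar>a x\<bar> powr 6) \<le> D powr 6" "(LINT x|lborel. \<bar>b x\<bar> powr 6) \<le> D powr 6"
      using h(3,4) D by (auto simp: lnorm_le_iff)
    then show "(LINT x|lborel. \<bar>a x\<bar> powr 6 + \<bar>b x\<bar> powr 6) \<le> 2 * D powr 6" using i by simp
    show "integrable lborel (\<lambda>x. \<bar>a x\<bar> powr 6 + \<bar>b x\<bar> powr 6)" using i by simp
    show "(\<lambda>x. a x * b x) \<in> borel_measurable borel" using lspace_measurable[OF h(1)] lspace_measurable[OF h(2)] by simp
  qed (intro allI conjI powr_growth_6_mult, simp)
  with B(1) show ?thesis by blast
qed

lemma fraction_less:
  fixes e D :: real
  assumes "0 < e" "0 \<le> D"
  shows "e / (2 * (D + 1)) * D < e"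
proof -
  have "e * D < e * (2 * (D + 1))" using assms by (intro mult_strict_left_mono) auto
  then show ?thesis using assms by (simp add: pos_divide_less_eq)
qed

lemma tendsto_0_mult_le:
  fixes a n :: "nat \<Rightarrow> real"
  assumes "\<And>k. \<bar>a k\<bar> \<le> n k * B" "n \<longlonglongrightarrow> 0"
  shows "a \<longlonglongrightarrow> 0"
proof (rule tendsto_rabs_zero_cancel, rule tendsto_sandwich[OF _ _ tendsto_const])
  show "(\<lambda>k. n k * B) \<longlonglongrightarrow> 0" using tendsto_mult_left_zero[OF assms(2)] .
qed (use assms(1) in auto)

text \<open>A localized row with potentials whose gradients approach it strongly in L^6. Weak
  nullity passes to the gradients, while the potentials are controlled only modulo constants, hence
  the means subtracted below.\<close>

locale almost_grad =
  fixes U :: "nat \<Rightarrow> 3 \<Rightarrow> real^3 \<Rightarrow> real" and u :: "nat \<Rightarrow> real^3 \<Rightarrow> real" and C :: real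
  assumes U: "\<And>k i. U k i \<in> lspace lborel 6"
    and U_bounded: "\<And>k i. lnorm lborel 6 (U k i) \<le> C"
    and weak_U: "\<And>i \<theta>. \<theta> \<in> TF \<Longrightarrow> (\<lambda>k. LINT x|lborel. U k i x * \<theta> x) \<longlonglongrightarrow> 0"
    and u: "\<And>k. u k \<in> TF"
    and close: "\<And>i. (\<lambda>k. lnorm lborel 6 (\<lambda>x. U k i x - pd i (u k) x)) \<longlonglongrightarrow> 0"
begin

lemma pd_u: "pd i (u k) \<in> TF"
  by (rule test_pd[OF u])

lemma pd_u_lspace: "pd i (u k) \<in> lspace lborel 6"
  by (rule test_lspace[OF pd_u]) simp

lemma rem_lspace: "(\<lambda>x. U k i x - pd i (u k) x) \<in> lspace lborel 6"
  by (intro lspace_diff U pd_u_lspace) simp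

lemma ex_bound: "\<exists>D\<ge>0. \<forall>k i. dnorm 6 (u k) \<le> D \<and> lnorm lborel 6 (pd i (u k)) \<le> D \<and> lnorm lborel 6 (U k i) \<le> D"
proof -
  have "\<exists>E. \<forall>k. lnorm lborel 6 (\<lambda>x. U k i x - pd i (u k) x) \<le> E" for i
    using convergent_imp_Bseq[OF convergentI[OF close[of i]]] by (auto simp: Bseq_def)
  then obtain E where E: "\<And>i k. lnorm lborel 6 (\<lambda>x. U k i x - pd i (u k) x) \<le> E i" by metis
  have le: "lnorm lborel 6 (pd i (u k)) \<le> C + E i" for i k
  proof -
    have "lnorm lborel 6 (\<lambda>x. U k i x - (U k i x - pd i (u k) x)) \<le> lnorm lborel 6 (U k i) + lnorm lborel 6 (\<lambda>x. U k i x - pd i (u k) x)"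
      by (rule lnorm_triangle_diff[OF U rem_lspace]) simp
    then show ?thesis using U_bounded[of k i] E[of k i] by simp
  qed
  define D where "D = (\<Sum>i\<in>UNIV. C + E i) + C"
  have C: "0 \<le> C" using U_bounded[of 0 1] lnorm_nonneg order_trans by blast
  have d: "dnorm 6 (u k) \<le> (\<Sum>i\<in>UNIV. C + E i)" for k unfolding dnorm_def by (intro sum_mono le)
  have "0 \<le> (\<Sum>i\<in>UNIV. C + E i)" using d[of 0] dnorm_nonneg order_trans by blast
  then have "0 \<le> D" "dnorm 6 (u k) \<le> D" "lnorm lborel 6 (pd i (u k)) \<le> D" "lnorm lborel 6 (U k i) \<le> D" for k i
    using C d[of k] order_trans[OF lnorm_pd_le_dnorm d, of i k] U_bounded[of k i] by (auto simp: D_def)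
  then show ?thesis by blast
qed

lemma weak_pd_u:
  assumes \<theta>: "\<theta> \<in> TF"
  shows "(\<lambda>k. LINT x|lborel. pd i (u k) x * \<theta> x) \<longlonglongrightarrow> 0"
proof -
  have t: "\<theta> \<in> lspace lborel (6/5)" by (rule test_lspace[OF \<theta>]) simp
  have "(\<lambda>k. LINT x|lborel. (U k i x - pd i (u k) x) * \<theta> x) \<longlonglongrightarrow> 0"
    by (rule tendsto_0_mult_le[OF Holder_le[OF conjugate_6(1) rem_lspace t] close])
  from tendsto_diff[OF weak_U[OF \<theta>, of i] this]
  have "(\<lambda>k. (LINT x|lborel. U k i x * \<theta> x) - (LINT x|lborel. (U k i x - pd i (u k) x) * \<theta> x)) \<longlonglongrightarrow> 0" by simp
  moreover have "(LINT x|lborel. U k i x * \<theta> x) - (LINT x|lborel. (U k i x - pd i (u k) x) * \<theta> x) = (LINT x|lborel. pd i (u k) x * \<theta> x)" for k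
    using Holder_integrable[OF conjugate_6(1) U[of k i] t] Holder_integrable[OF conjugate_6(1) pd_u_lspace[of i k] t]
    by (simp add: left_diff_distrib)
  ultimately show ?thesis by simp
qed

text \<open>Weak against strong convergence: modulo means the potentials behave like a compact
  sequence in L^6, which is \<open>weakly_null_uniform\<close> for s = 6 and the uniform bound on
  \<open>dnorm\<close>.\<close>

lemma weakly_null_times_u:
  assumes g: "\<And>k. g k \<in> lspace lborel (6/5)" and B: "\<And>k. lnorm lborel (6/5) (g k) \<le> B"
    and supp: "\<And>k x. R < norm x \<Longrightarrow> g k x = 0" and R: "0 < R"
    and weak: "\<And>\<theta>. \<theta> \<in> TF \<Longrightarrow> (\<lambda>k. LINT x|lborel. g k x * \<theta> x) \<longlonglongrightarrow> 0"
  shows "(\<lambda>k. LINT x|lborel. g k x * (u k x - ball_mean (R + 1) (u k))) \<longlonglongrightarrow> 0"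
proof -
  obtain D where D: "0 \<le> D" "\<And>k. dnorm 6 (u k) \<le> D" using ex_bound by blast
  show ?thesis
  proof (rule tendstoI)
    fix e :: real assume e: "0 < e"
    have "\<forall>\<^sub>F k in sequentially. \<forall>v\<in>TF. \<bar>LINT x|lborel. g k x * (v x - ball_mean (R + 1) v)\<bar> \<le> e / (2 * (D + 1)) * dnorm 6 v"
      using e D(1) by (intro weakly_null_uniform[OF conjugate_6(1) g B supp R weak]) auto
    then show "\<forall>\<^sub>F k in sequentially. dist (LINT x|lborel. g k x * (u k x - ball_mean (R + 1) (u k))) 0 < e"
    proof (rule eventually_mono)
      fix k assume "\<forall>v\<in>TF. \<bar>LINT x|lborel. g k x * (v x - ball_mean (R + 1) v)\<bar> \<le> e / (2 * (D + 1)) * dnorm 6 v"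
      then have "\<bar>LINT x|lborel. g k x * (u k x - ball_mean (R + 1) (u k))\<bar> \<le> e / (2 * (D + 1)) * dnorm 6 (u k)"
        using u by blast
      also have "\<dots> \<le> e / (2 * (D + 1)) * D" using e D by (intro mult_left_mono) auto
      also have "\<dots> < e" using e D(1) by (rule fraction_less)
      finally show "dist (LINT x|lborel. g k x * (u k x - ball_mean (R + 1) (u k))) 0 < e" by simp
    qed
  qed
qed

text \<open>With U replaced by grad u, \<zeta> q . grad u equals q . grad (\<zeta> (u - c)) minus (q
  . grad \<zeta>) (u - c). The first term is small by the divergence hypothesis, the second by
  \<open>weakly_null_times_u\<close>.\<close>

lemma div_curl:
  fixes q :: "nat \<Rightarrow> 3 \<Rightarrow> real^3 \<Rightarrow> real"
  assumes q: "\<And>k j. q k j \<in> lspace lborel (6/5)" and B: "\<And>k j. lnorm lborel (6/5) (q k j) \<le> B"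
    and weak: "\<And>j \<theta>. \<theta> \<in> TF \<Longrightarrow> (\<lambda>k. LINT x|lborel. q k j x * \<theta> x) \<longlonglongrightarrow> 0"
    and divg: "\<And>\<eta>. 0 < \<eta> \<Longrightarrow> \<forall>\<^sub>F k in sequentially. \<forall>v\<in>test_functions \<omega>.
      \<bar>LINT x|lborel. (\<Sum>j\<in>UNIV. q k j x * pd j v x)\<bar> \<le> \<eta> * (lnorm lborel 6 v + dnorm 6 v)"
    and \<zeta>: "\<zeta> \<in> test_functions \<omega>"
  shows "(\<lambda>k. LINT x|lborel. \<zeta> x * (\<Sum>j\<in>UNIV. q k j x * U k j x)) \<longlonglongrightarrow> 0"
proof -
  have \<zeta>': "\<zeta> \<in> TF" by (rule test_TF[OF \<zeta>])
  obtain R where R: "0 < R" "\<And>x. R < norm x \<Longrightarrow> \<zeta> x = 0" using test_support_ball[OF \<zeta>'] by blast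
  have psupp: "pd a \<zeta> x = 0" if "R < norm x" for a x
    using pd_eq_0_outside[of "cball 0 R" \<zeta> x a] R(2) that by auto
  have ql: "(\<lambda>x. \<theta> x * q k j x) \<in> lspace lborel (6/5)" if "\<theta> \<in> TF" for \<theta> k j by (intro lspace_test_mult q that) simp
  obtain D where D: "0 \<le> D" "\<And>k. dnorm 6 (u k) \<le> D" using ex_bound by blast
  let ?c = "\<lambda>k. ball_mean (R + 1) (u k)"
  define g where "g k x = (\<Sum>j\<in>UNIV. pd j \<zeta> x * q k j x)" for k x
  define z where "z k x = \<zeta> x * (u k x - ?c k)" for k x
  have z: "z k \<in> test_functions \<omega>" for k unfolding z_def[abs_def] by (rule test_cutoff_mean(1)[OF \<zeta> u])
  have pdz: "pd j (z k) = (\<lambda>x. \<zeta> x * pd j (u k) x + (u k x - ?c k) * pd j \<zeta> x)" for j k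
    unfolding z_def[abs_def] by (rule test_cutoff_mean(2)[OF \<zeta> u])
  have 1: "(\<lambda>k. LINT x|lborel. (\<Sum>j\<in>UNIV. q k j x * pd j (z k) x)) \<longlonglongrightarrow> 0"
  proof (rule tendstoI)
    fix e :: real assume e: "0 < e"
    obtain A where A: "0 \<le> A" "\<And>v. v \<in> (TF :: (real^3 \<Rightarrow> real) set) \<Longrightarrow>
      lnorm lborel 6 (\<lambda>x. \<zeta> x * (v x - ball_mean (R + 1) v)) + dnorm 6 (\<lambda>x. \<zeta> x * (v x - ball_mean (R + 1) v)) \<le> A * dnorm 6 v"
      using cutoff_mean_bound[OF \<zeta>', of 6 "R + 1"] R by fastforce
    have AD: "0 \<le> A * D" using A(1) D(1) by simp
    then have "0 < e / (2 * (A * D + 1))" using e by simp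
    from divg[OF this] show "\<forall>\<^sub>F k in sequentially. dist (LINT x|lborel. (\<Sum>j\<in>UNIV. q k j x * pd j (z k) x)) 0 < e"
    proof (rule eventually_mono)
      fix k assume "\<forall>v\<in>test_functions \<omega>. \<bar>LINT x|lborel. (\<Sum>j\<in>UNIV. q k j x * pd j v x)\<bar> \<le> e / (2 * (A * D + 1)) * (lnorm lborel 6 v + dnorm 6 v)"
      from bspec[OF this z[of k]]
      have "\<bar>LINT x|lborel. (\<Sum>j\<in>UNIV. q k j x * pd j (z k) x)\<bar> \<le> e / (2 * (A * D + 1)) * (lnorm lborel 6 (z k) + dnorm 6 (z k))" .
      also have "\<dots> \<le> e / (2 * (A * D + 1)) * (A * D)"
      proof (rule mult_left_mono)
        show "lnorm lborel 6 (z k) + dnorm 6 (z k) \<le> A * D"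
          using A(2)[OF u, of k] mult_left_mono[OF D(2)[of k] A(1)] unfolding z_def[abs_def] by linarith
      qed (use e AD in simp)
      also have "\<dots> < e" using e AD by (rule fraction_less)
      finally show "dist (LINT x|lborel. (\<Sum>j\<in>UNIV. q k j x * pd j (z k) x)) 0 < e" by simp
    qed
  qed
  have ptl: "(\<lambda>x. pd j \<zeta> x * q k j x) \<in> lspace lborel (6/5)" for j k by (intro ql test_pd \<zeta>')
  have gl: "g k \<in> lspace lborel (6/5)" for k unfolding g_def[abs_def] by (intro lspace_sum ptl) simp
  have "\<exists>E. \<forall>k. lnorm lborel (6/5) (\<lambda>x. pd j \<zeta> x * q k j x) \<le> E" for j
  proof -
    obtain E where E: "0 \<le> E" "\<And>f. f \<in> lspace lborel (6/5) \<Longrightarrow> lnorm lborel (6/5) (\<lambda>x. pd j \<zeta> x * f x) \<le> E * lnorm lborel (6/5) f"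
      using lnorm_test_mult_bound[OF test_pd[OF \<zeta>'], of "6/5" j] by auto
    show ?thesis using order_trans[OF E(2)[OF q] mult_left_mono[OF B E(1)]] by blast
  qed
  then obtain E where E: "\<And>j k. lnorm lborel (6/5) (\<lambda>x. pd j \<zeta> x * q k j x) \<le> E j" by metis
  have gb: "lnorm lborel (6/5) (g k) \<le> (\<Sum>j\<in>UNIV. E j)" for k
    unfolding g_def[abs_def] by (rule order_trans[OF lnorm_triangle_sum]) (auto intro: ptl sum_mono E)
  have 2: "(\<lambda>k. LINT x|lborel. g k x * (u k x - ?c k)) \<longlonglongrightarrow> 0"
  proof (rule weakly_null_times_u[OF gl gb _ R(1)])
    show "g k x = 0" if "R < norm x" for k x using psupp[OF that] by (simp add: g_def)
    show "(\<lambda>k. LINT x|lborel. g k x * \<theta> x) \<longlonglongrightarrow> 0" if \<theta>: "\<theta> \<in> TF" for \<theta>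
    proof -
      have t: "(\<lambda>x. pd j \<zeta> x * \<theta> x) \<in> TF" for j by (intro test_mult' test_pd \<zeta>' test_smooth[OF \<theta>])
      have i: "integrable lborel (\<lambda>x. q k j x * (pd j \<zeta> x * \<theta> x))" for j k
        by (rule Holder_integrable[OF conjugate_6(2) q test_lspace[OF t]]) simp
      have "(LINT x|lborel. g k x * \<theta> x) = (LINT x|lborel. (\<Sum>j\<in>UNIV. q k j x * (pd j \<zeta> x * \<theta> x)))" for k
        unfolding g_def sum_distrib_right by (simp only: mult_ac)
      moreover have "(LINT x|lborel. (\<Sum>j\<in>UNIV. q k j x * (pd j \<zeta> x * \<theta> x))) = (\<Sum>j\<in>UNIV. LINT x|lborel. q k j x * (pd j \<zeta> x * \<theta> x))" for k
        by (rule Bochner_Integration.integral_sum) (rule i)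
      moreover have "(\<lambda>k. \<Sum>j\<in>UNIV. LINT x|lborel. q k j x * (pd j \<zeta> x * \<theta> x)) \<longlonglongrightarrow> 0"
        by (rule tendsto_null_sum) (rule weak[OF t])
      ultimately show ?thesis by (simp only:)
    qed
  qed
  have rest: "(\<lambda>k. LINT x|lborel. (\<zeta> x * q k j x) * (U k j x - pd j (u k) x)) \<longlonglongrightarrow> 0" for j
  proof -
    obtain E where E: "0 \<le> E" "\<And>f. f \<in> lspace lborel (6/5) \<Longrightarrow> lnorm lborel (6/5) (\<lambda>x. \<zeta> x * f x) \<le> E * lnorm lborel (6/5) f"
      using lnorm_test_mult_bound[OF \<zeta>', of "6/5"] by auto
    show ?thesis
    proof (rule tendsto_0_mult_le[OF _ close[of j]])
      fix k
      have "\<bar>LINT x|lborel. (\<zeta> x * q k j x) * (U k j x - pd j (u k) x)\<bar> \<le> lnorm lborel (6/5) (\<lambda>x. \<zeta> x * q k j x) * lnorm lborel 6 (\<lambda>x. U k j x - pd j (u k) x)"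
        by (rule Holder_le[OF conjugate_6(2) ql[OF \<zeta>'] rem_lspace])
      also have "\<dots> \<le> (E * B) * lnorm lborel 6 (\<lambda>x. U k j x - pd j (u k) x)"
        using order_trans[OF E(2)[OF q] mult_left_mono[OF B E(1)], of k j] by (intro mult_right_mono) auto
      finally show "\<bar>LINT x|lborel. (\<zeta> x * q k j x) * (U k j x - pd j (u k) x)\<bar> \<le> lnorm lborel 6 (\<lambda>x. U k j x - pd j (u k) x) * (E * B)"
        by (simp add: mult.commute)
    qed
  qed
  have eq: "(LINT x|lborel. \<zeta> x * (\<Sum>j\<in>UNIV. q k j x * U k j x)) = (LINT x|lborel. (\<Sum>j\<in>UNIV. q k j x * pd j (z k) x))
      - (LINT x|lborel. g k x * (u k x - ?c k)) + (\<Sum>j\<in>UNIV. LINT x|lborel. (\<zeta> x * q k j x) * (U k j x - pd j (u k) x))" for k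
  proof -
    have i1: "integrable lborel (\<lambda>x. \<Sum>j\<in>UNIV. q k j x * pd j (z k) x)"
      by (intro Bochner_Integration.integrable_sum Holder_integrable[OF conjugate_6(2) q] test_lspace[OF test_pd[OF z]]) simp
    have sv: "smooth (\<lambda>x. u k x - ?c k)" by (intro smooth_diff smooth_const test_smooth[OF u])
    have i2: "integrable lborel (\<lambda>x. g k x * (u k x - ?c k))"
    proof -
      have "integrable lborel (\<lambda>x. q k j x * (pd j \<zeta> x * (u k x - ?c k)))" for j
        by (rule Holder_integrable[OF conjugate_6(2) q test_lspace[OF test_mult'[OF test_pd[OF \<zeta>'] sv]]]) simp
      then have "integrable lborel (\<lambda>x. \<Sum>j\<in>UNIV. q k j x * (pd j \<zeta> x * (u k x - ?c k)))" by simp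
      then show ?thesis unfolding g_def sum_distrib_right by (simp only: mult_ac)
    qed
    have i3: "integrable lborel (\<lambda>x. \<Sum>j\<in>UNIV. (\<zeta> x * q k j x) * (U k j x - pd j (u k) x))"
      by (intro Bochner_Integration.integrable_sum Holder_integrable[OF conjugate_6(2) ql[OF \<zeta>'] rem_lspace])
    have "(LINT x|lborel. \<zeta> x * (\<Sum>j\<in>UNIV. q k j x * U k j x)) = (LINT x|lborel. (\<Sum>j\<in>UNIV. q k j x * pd j (z k) x)
      - g k x * (u k x - ?c k) + (\<Sum>j\<in>UNIV. (\<zeta> x * q k j x) * (U k j x - pd j (u k) x)))"
      by (intro Bochner_Integration.integral_cong refl)
         (simp add: pdz g_def sum_3 algebra_simps)
    also have "\<dots> = (LINT x|lborel. (\<Sum>j\<in>UNIV. q k j x * pd j (z k) x)) - (LINT x|lborel. g k x * (u k x - ?c k))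
      + (LINT x|lborel. (\<Sum>j\<in>UNIV. (\<zeta> x * q k j x) * (U k j x - pd j (u k) x)))"
      using i1 i2 i3 by simp
    also have "(LINT x|lborel. (\<Sum>j\<in>UNIV. (\<zeta> x * q k j x) * (U k j x - pd j (u k) x))) = (\<Sum>j\<in>UNIV. LINT x|lborel. (\<zeta> x * q k j x) * (U k j x - pd j (u k) x))"
      by (intro Bochner_Integration.integral_sum Holder_integrable[OF conjugate_6(2) ql[OF \<zeta>'] rem_lspace])
    finally show ?thesis .
  qed
  have 3: "(\<lambda>k. \<Sum>j\<in>UNIV. LINT x|lborel. (\<zeta> x * q k j x) * (U k j x - pd j (u k) x)) \<longlonglongrightarrow> 0"
    by (rule tendsto_null_sum) (rule rest)
  show ?thesis unfolding eq using tendsto_add[OF tendsto_diff[OF 1 2] 3] by simp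
qed

end

lemma (in curl_null) almost_grad_cutoff:
  assumes \<kappa>: "\<kappa> \<in> test_functions \<omega>"
  shows "\<exists>u C'. almost_grad (\<lambda>k i x. \<kappa> x * f k i x) u C'"
proof -
  have \<kappa>': "\<kappa> \<in> TF" by (rule test_TF[OF \<kappa>])
  obtain u where u: "\<And>k. u k \<in> TF" "\<And>i. (\<lambda>k. lnorm lborel 6 (\<lambda>x. \<kappa> x * f k i x - pd i (u k) x)) \<longlonglongrightarrow> 0"
    using curl_decomposition[OF \<kappa>] by blast
  obtain B where B: "0 \<le> B" "\<And>h. h \<in> lspace lborel 6 \<Longrightarrow> lnorm lborel 6 (\<lambda>x. \<kappa> x * h x) \<le> B * lnorm lborel 6 h"
    using lnorm_test_mult_bound[OF \<kappa>', of 6] by auto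
  have "almost_grad (\<lambda>k i x. \<kappa> x * f k i x) u (B * C)"
  proof
    show "(\<lambda>x. \<kappa> x * f k i x) \<in> lspace lborel 6" for k i by (intro lspace_test_mult f \<kappa>') simp
    show "lnorm lborel 6 (\<lambda>x. \<kappa> x * f k i x) \<le> B * C" for k i
      using order_trans[OF B(2)[OF f] mult_left_mono[OF bounded B(1)]] .
    show "(\<lambda>k. LINT x|lborel. \<kappa> x * f k i x * \<theta> x) \<longlonglongrightarrow> 0" if "\<theta> \<in> TF" for i \<theta>
      using weak[OF test_mult'[OF \<kappa>' test_smooth[OF that]], of i] by (simp add: mult_ac)
  qed (use u in auto)
  then show ?thesis by blast
qed

section \<open>Weak continuity of minors and determinants\<close>

lemma by_parts_centered:
  assumes a: "a \<in> TF" and u: "u \<in> TF"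
  shows "(LINT x|lborel. a x * pd i u x) = - (LINT x|lborel. pd i a x * (u x - c))"
proof -
  have "pd i (\<lambda>x. u x - c) = pd i u"
    using pd_smooth(5)[OF test_smooth[OF u] smooth_const, of i c] by (simp add: pd_const)
  then show ?thesis
    using integral_by_parts_pd[OF a smooth_diff[OF test_smooth[OF u] smooth_const], of i c] by simp
qed

context almost_grad
begin

lemma rem_times:
  assumes h: "\<And>k. h k \<in> lspace lborel (6/5)" and B: "\<And>k. lnorm lborel (6/5) (h k) \<le> B"
  shows "(\<lambda>k. LINT x|lborel. h k x * (U k i x - pd i (u k) x)) \<longlonglongrightarrow> 0"
proof (rule tendsto_0_mult_le[OF _ close[of i]])
  fix k
  have "\<bar>LINT x|lborel. h k x * (U k i x - pd i (u k) x)\<bar> \<le> lnorm lborel (6/5) (h k) * lnorm lborel 6 (\<lambda>x. U k i x - pd i (u k) x)"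
    by (rule Holder_le[OF conjugate_6(2) h rem_lspace])
  also have "\<dots> \<le> B * lnorm lborel 6 (\<lambda>x. U k i x - pd i (u k) x)"
    by (intro mult_right_mono B) simp
  finally show "\<bar>LINT x|lborel. h k x * (U k i x - pd i (u k) x)\<bar> \<le> lnorm lborel 6 (\<lambda>x. U k i x - pd i (u k) x) * B"
    by (simp add: mult.commute)
qed

lemma localized_bounded:
  assumes \<zeta>: "\<zeta> \<in> TF"
  shows "\<exists>B. (\<forall>k i. (\<lambda>x. \<zeta> x * U k i x) \<in> lspace lborel (6/5) \<and> lnorm lborel (6/5) (\<lambda>x. \<zeta> x * U k i x) \<le> B) \<and>
    (\<forall>k i. (\<lambda>x. \<zeta> x * pd i (u k) x) \<in> lspace lborel (6/5) \<and> lnorm lborel (6/5) (\<lambda>x. \<zeta> x * pd i (u k) x) \<le> B)"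
proof -
  obtain D where D: "0 \<le> D" "\<And>k i. lnorm lborel 6 (pd i (u k)) \<le> D" "\<And>k i. lnorm lborel 6 (U k i) \<le> D"
    using ex_bound by blast
  obtain B where B: "0 \<le> B" "\<And>h. h \<in> lspace lborel 6 \<Longrightarrow> lnorm lborel 6 h \<le> D \<Longrightarrow>
    (\<lambda>x. \<zeta> x * h x) \<in> lspace lborel (6/5) \<and> lnorm lborel (6/5) (\<lambda>x. \<zeta> x * h x) \<le> B"
    using lnorm_test_mult_6[OF \<zeta>, of D] by blast
  show ?thesis
    by (rule exI[of _ B]) (use B(2)[OF U D(3)] B(2)[OF pd_u_lspace D(2)] in auto)
qed

end

lemma localized_bounded2:
  assumes "almost_grad U u C" "almost_grad V v C'" and \<zeta>: "\<zeta> \<in> TF"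
  shows "\<exists>B. (\<forall>k i j. (\<lambda>x. \<zeta> x * (U k i x * V k j x)) \<in> lspace lborel (6/5) \<and> lnorm lborel (6/5) (\<lambda>x. \<zeta> x * (U k i x * V k j x)) \<le> B) \<and>
    (\<forall>k i j. (\<lambda>x. \<zeta> x * (pd i (u k) x * V k j x)) \<in> lspace lborel (6/5) \<and> lnorm lborel (6/5) (\<lambda>x. \<zeta> x * (pd i (u k) x * V k j x)) \<le> B) \<and>
    (\<forall>k i j. (\<lambda>x. \<zeta> x * (pd i (u k) x * pd j (v k) x)) \<in> lspace lborel (6/5) \<and> lnorm lborel (6/5) (\<lambda>x. \<zeta> x * (pd i (u k) x * pd j (v k) x)) \<le> B)"
proof -
  interpret U: almost_grad U u C by fact
  interpret V: almost_grad V v C' by fact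
  obtain D where D: "0 \<le> D" "\<And>k i. lnorm lborel 6 (pd i (u k)) \<le> D" "\<And>k i. lnorm lborel 6 (U k i) \<le> D"
    using U.ex_bound by blast
  obtain E where E: "0 \<le> E" "\<And>k i. lnorm lborel 6 (pd i (v k)) \<le> E" "\<And>k i. lnorm lborel 6 (V k i) \<le> E"
    using V.ex_bound by blast
  obtain B where B: "\<And>a b. a \<in> lspace lborel 6 \<Longrightarrow> b \<in> lspace lborel 6 \<Longrightarrow> lnorm lborel 6 a \<le> max D E \<Longrightarrow> lnorm lborel 6 b \<le> max D E \<Longrightarrow>
    (\<lambda>x. \<zeta> x * (a x * b x)) \<in> lspace lborel (6/5) \<and> lnorm lborel (6/5) (\<lambda>x. \<zeta> x * (a x * b x)) \<le> B"
    using lnorm_test_mult_6_6[OF \<zeta>, of "max D E"] by blast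
  have n: "lnorm lborel 6 (pd i (u k)) \<le> max D E" "lnorm lborel 6 (U k i) \<le> max D E"
    "lnorm lborel 6 (pd i (v k)) \<le> max D E" "lnorm lborel 6 (V k i) \<le> max D E" for i k
    using D(2)[of i k] D(3)[of k i] E(2)[of i k] E(3)[of k i] by linarith+
  show ?thesis
    by (rule exI[of _ B])
      (use B[OF U.U V.U n(2) n(4)] B[OF U.pd_u_lspace V.U n(1) n(4)] B[OF U.pd_u_lspace V.pd_u_lspace n(1) n(3)] in auto)
qed

lemma integrable_mult_localized:
  fixes \<zeta> :: "'a::euclidean_space \<Rightarrow> real"
  assumes "(\<lambda>x. \<zeta> x * h x) \<in> lspace lborel (6/5)" "a \<in> lspace lborel 6"
  shows "integrable lborel (\<lambda>x. \<zeta> x * (a x * h x))"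
  using Holder_integrable[OF conjugate_6(1) assms(2,1)] by (simp add: mult_ac)

lemma product_minus_grad_product:
  assumes "almost_grad U u C" "almost_grad V v C'" and \<zeta>: "\<zeta> \<in> TF"
  shows "(\<lambda>k. (LINT x|lborel. \<zeta> x * (U k i x * V k j x)) - (LINT x|lborel. \<zeta> x * (pd i (u k) x * pd j (v k) x))) \<longlonglongrightarrow> 0"
proof -
  interpret U: almost_grad U u C by fact
  interpret V: almost_grad V v C' by fact
  obtain B where B: "\<And>k i. (\<lambda>x. \<zeta> x * U k i x) \<in> lspace lborel (6/5)" "\<And>k i. lnorm lborel (6/5) (\<lambda>x. \<zeta> x * U k i x) \<le> B"
    "\<And>k i. (\<lambda>x. \<zeta> x * pd i (u k) x) \<in> lspace lborel (6/5)" "\<And>k i. lnorm lborel (6/5) (\<lambda>x. \<zeta> x * pd i (u k) x) \<le> B"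
    using U.localized_bounded[OF \<zeta>] by blast
  obtain E where E: "\<And>k i. (\<lambda>x. \<zeta> x * V k i x) \<in> lspace lborel (6/5)" "\<And>k i. lnorm lborel (6/5) (\<lambda>x. \<zeta> x * V k i x) \<le> E"
    "\<And>k i. (\<lambda>x. \<zeta> x * pd i (v k) x) \<in> lspace lborel (6/5)" "\<And>k i. lnorm lborel (6/5) (\<lambda>x. \<zeta> x * pd i (v k) x) \<le> E"
    using V.localized_bounded[OF \<zeta>] by blast
  have eq: "(LINT x|lborel. \<zeta> x * (U k i x * V k j x)) - (LINT x|lborel. \<zeta> x * (pd i (u k) x * pd j (v k) x))
    = (LINT x|lborel. (\<zeta> x * V k j x) * (U k i x - pd i (u k) x)) + (LINT x|lborel. (\<zeta> x * pd i (u k) x) * (V k j x - pd j (v k) x))" for k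
  proof -
    note i = integrable_mult_localized[OF E(1) U.U, of k i k j] integrable_mult_localized[OF E(3) U.pd_u_lspace, of i k j k]
      Holder_integrable[OF conjugate_6(2) E(1) U.rem_lspace, of k j k i] Holder_integrable[OF conjugate_6(2) B(3) V.rem_lspace, of i k k j]
    have "(LINT x|lborel. \<zeta> x * (U k i x * V k j x)) - (LINT x|lborel. \<zeta> x * (pd i (u k) x * pd j (v k) x))
      = (LINT x|lborel. \<zeta> x * (U k i x * V k j x) - \<zeta> x * (pd i (u k) x * pd j (v k) x))"
      using i(1,2) by simp
    also have "\<dots> = (LINT x|lborel. (\<zeta> x * V k j x) * (U k i x - pd i (u k) x) + (\<zeta> x * pd i (u k) x) * (V k j x - pd j (v k) x))"
      by (intro Bochner_Integration.integral_cong refl) (simp add: algebra_simps)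
    finally show ?thesis using i(3,4) by simp
  qed
  show ?thesis unfolding eq using tendsto_add[OF U.rem_times[OF E(1,2)] V.rem_times[OF B(3,4)]] by simp
qed

text \<open>A 2 by 2 minor of gradients is a divergence. After integration by parts the second
  derivatives of v cancel by symmetry, only derivatives of \<zeta> remain, and a weakly null factor
  meets u minus its mean.\<close>

lemma grad_minor_limit:
  assumes "almost_grad U u C" "almost_grad V v C'" and \<zeta>: "\<zeta> \<in> TF"
  shows "(\<lambda>k. LINT x|lborel. \<zeta> x * (pd i (u k) x * pd j (v k) x - pd j (u k) x * pd i (v k) x)) \<longlonglongrightarrow> 0"
proof -
  interpret U: almost_grad U u C by fact
  interpret V: almost_grad V v C' by fact
  obtain R where R: "0 < R" "\<And>x. R < norm x \<Longrightarrow> \<zeta> x = 0" using test_support_ball[OF \<zeta>] by blast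
  have psupp: "pd a \<zeta> x = 0" if "R < norm x" for a x
    using pd_eq_0_outside[of "cball 0 R" \<zeta> x a] R(2) that by auto
  define g where "g k x = pd i \<zeta> x * pd j (v k) x - pd j \<zeta> x * pd i (v k) x" for k x
  obtain Bi where Bi: "\<And>k a. (\<lambda>x. pd i \<zeta> x * V k a x) \<in> lspace lborel (6/5)" "\<And>k a. lnorm lborel (6/5) (\<lambda>x. pd i \<zeta> x * V k a x) \<le> Bi"
    "\<And>k a. (\<lambda>x. pd i \<zeta> x * pd a (v k) x) \<in> lspace lborel (6/5)" "\<And>k a. lnorm lborel (6/5) (\<lambda>x. pd i \<zeta> x * pd a (v k) x) \<le> Bi"
    using V.localized_bounded[OF test_pd[OF \<zeta>, of i]] by blast
  obtain Bj where Bj: "\<And>k a. (\<lambda>x. pd j \<zeta> x * V k a x) \<in> lspace lborel (6/5)" "\<And>k a. lnorm lborel (6/5) (\<lambda>x. pd j \<zeta> x * V k a x) \<le> Bj"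
    "\<And>k a. (\<lambda>x. pd j \<zeta> x * pd a (v k) x) \<in> lspace lborel (6/5)" "\<And>k a. lnorm lborel (6/5) (\<lambda>x. pd j \<zeta> x * pd a (v k) x) \<le> Bj"
    using V.localized_bounded[OF test_pd[OF \<zeta>, of j]] by blast
  have gl: "g k \<in> lspace lborel (6/5)" for k
    unfolding g_def[abs_def] by (rule lspace_diff[OF Bi(3) Bj(3)]) simp
  have gb: "lnorm lborel (6/5) (g k) \<le> Bi + Bj" for k
    using lnorm_triangle_diff[OF Bi(3)[of j k] Bj(3)[of i k]] Bi(4)[of j k] Bj(4)[of i k] by (simp add: g_def[abs_def])
  have lim: "(\<lambda>k. LINT x|lborel. g k x * (u k x - ball_mean (R + 1) (u k))) \<longlonglongrightarrow> 0"
  proof (rule U.weakly_null_times_u[OF gl gb _ R(1)])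
    show "g k x = 0" if "R < norm x" for k x using psupp[OF that] by (simp add: g_def)
    show "(\<lambda>k. LINT x|lborel. g k x * \<theta> x) \<longlonglongrightarrow> 0" if \<theta>: "\<theta> \<in> TF" for \<theta>
    proof -
      have t: "(\<lambda>x. pd a \<zeta> x * \<theta> x) \<in> TF" for a by (rule test_mult'[OF test_pd[OF \<zeta>] test_smooth[OF \<theta>]])
      have i: "integrable lborel (\<lambda>x. pd b (v k) x * (pd a \<zeta> x * \<theta> x))" for a b k
        by (rule test_integrable[OF test_mult'[OF V.pd_u test_smooth[OF t]]])
      have "(LINT x|lborel. g k x * \<theta> x) = (LINT x|lborel. pd j (v k) x * (pd i \<zeta> x * \<theta> x) - pd i (v k) x * (pd j \<zeta> x * \<theta> x))" for k
        by (intro Bochner_Integration.integral_cong refl) (simp add: g_def algebra_simps)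
      then have "(LINT x|lborel. g k x * \<theta> x) = (LINT x|lborel. pd j (v k) x * (pd i \<zeta> x * \<theta> x)) - (LINT x|lborel. pd i (v k) x * (pd j \<zeta> x * \<theta> x))" for k
        using Bochner_Integration.integral_diff[OF i i] by simp
      then show ?thesis using tendsto_diff[OF V.weak_pd_u[OF t] V.weak_pd_u[OF t]] by simp
    qed
  qed
  have "(LINT x|lborel. \<zeta> x * (pd i (u k) x * pd j (v k) x - pd j (u k) x * pd i (v k) x))
    = - (LINT x|lborel. g k x * (u k x - ball_mean (R + 1) (u k)))" for k
  proof -
    let ?c = "ball_mean (R + 1) (u k)"
    define a where "a b x = \<zeta> x * pd b (v k) x" for b x
    have a: "a b \<in> TF" for b unfolding a_def[abs_def] by (rule test_mult'[OF \<zeta> test_smooth[OF V.pd_u]])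
    have sc: "smooth (\<lambda>x. u k x - ?c)" by (rule smooth_diff[OF test_smooth[OF U.u] smooth_const])
    have ga: "g k x = pd i (a j) x - pd j (a i) x" for x
      unfolding a_def[abs_def] pd_smooth(2)[OF test_smooth[OF \<zeta>] test_smooth[OF V.pd_u]] g_def
      by (simp add: pd_commute[OF test_smooth[OF V.u], of i j])
    have "(LINT x|lborel. \<zeta> x * (pd i (u k) x * pd j (v k) x - pd j (u k) x * pd i (v k) x))
      = (LINT x|lborel. a j x * pd i (u k) x - a i x * pd j (u k) x)"
      by (intro Bochner_Integration.integral_cong refl) (simp add: a_def algebra_simps)
    also have "\<dots> = (LINT x|lborel. a j x * pd i (u k) x) - (LINT x|lborel. a i x * pd j (u k) x)"
      by (rule Bochner_Integration.integral_diff; rule test_integrable[OF test_mult'[OF a test_smooth[OF U.pd_u]]])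
    also have "\<dots> = - ((LINT x|lborel. pd i (a j) x * (u k x - ?c)) - (LINT x|lborel. pd j (a i) x * (u k x - ?c)))"
      by (simp add: by_parts_centered[OF a U.u, of _ _ _ ?c])
    also have "(LINT x|lborel. pd i (a j) x * (u k x - ?c)) - (LINT x|lborel. pd j (a i) x * (u k x - ?c))
      = (LINT x|lborel. pd i (a j) x * (u k x - ?c) - pd j (a i) x * (u k x - ?c))"
      by (rule Bochner_Integration.integral_diff[symmetric]; rule test_integrable[OF test_mult'[OF test_pd[OF a] sc]])
    also have "\<dots> = (LINT x|lborel. g k x * (u k x - ?c))"
      by (intro Bochner_Integration.integral_cong refl) (simp add: ga algebra_simps)
    finally show ?thesis .
  qed
  then show ?thesis using tendsto_minus[OF lim] by simp
qed

lemma minor_limit: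
  assumes UV: "almost_grad U u C" "almost_grad V v C'" and \<zeta>: "\<zeta> \<in> TF"
  shows "(\<lambda>k. LINT x|lborel. \<zeta> x * (U k i x * V k j x - U k j x * V k i x)) \<longlonglongrightarrow> 0"
proof -
  interpret U: almost_grad U u C by fact
  interpret V: almost_grad V v C' by fact
  obtain B where B: "\<And>k i. (\<lambda>x. \<zeta> x * V k i x) \<in> lspace lborel (6/5)" "\<And>k i. lnorm lborel (6/5) (\<lambda>x. \<zeta> x * V k i x) \<le> B"
    "\<And>k i. (\<lambda>x. \<zeta> x * pd i (v k) x) \<in> lspace lborel (6/5)" "\<And>k i. lnorm lborel (6/5) (\<lambda>x. \<zeta> x * pd i (v k) x) \<le> B"
    using V.localized_bounded[OF \<zeta>] by blast
  have "(LINT x|lborel. \<zeta> x * (U k i x * V k j x - U k j x * V k i x)) =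
    ((LINT x|lborel. \<zeta> x * (U k i x * V k j x)) - (LINT x|lborel. \<zeta> x * (pd i (u k) x * pd j (v k) x)))
    - ((LINT x|lborel. \<zeta> x * (U k j x * V k i x)) - (LINT x|lborel. \<zeta> x * (pd j (u k) x * pd i (v k) x)))
    + (LINT x|lborel. \<zeta> x * (pd i (u k) x * pd j (v k) x - pd j (u k) x * pd i (v k) x))" for k
    unfolding right_diff_distrib
      Bochner_Integration.integral_diff[OF integrable_mult_localized[OF B(1) U.U] integrable_mult_localized[OF B(1) U.U]]
      Bochner_Integration.integral_diff[OF integrable_mult_localized[OF B(3) U.pd_u_lspace] integrable_mult_localized[OF B(3) U.pd_u_lspace]]
    by simp
  then show ?thesis
    using tendsto_add[OF tendsto_diff[OF product_minus_grad_product[OF UV \<zeta>, of i j] product_minus_grad_product[OF UV \<zeta>, of j i]] grad_minor_limit[OF UV \<zeta>, of i j]]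
    by simp
qed

lemma minor_bounded:
  assumes "almost_grad U u C" "almost_grad V v C'" and \<zeta>: "\<zeta> \<in> TF"
  shows "\<exists>B. \<forall>k a b. (\<lambda>x. \<zeta> x * (pd a (u k) x * pd b (v k) x - pd b (u k) x * pd a (v k) x)) \<in> lspace lborel (6/5) \<and>
    lnorm lborel (6/5) (\<lambda>x. \<zeta> x * (pd a (u k) x * pd b (v k) x - pd b (u k) x * pd a (v k) x)) \<le> B"
proof -
  obtain B where B: "\<And>k i j. (\<lambda>x. \<zeta> x * (pd i (u k) x * pd j (v k) x)) \<in> lspace lborel (6/5)"
    "\<And>k i j. lnorm lborel (6/5) (\<lambda>x. \<zeta> x * (pd i (u k) x * pd j (v k) x)) \<le> B"
    using localized_bounded2[OF assms] by blast
  have l: "(\<lambda>x. \<zeta> x * (pd a (u k) x * pd b (v k) x - pd b (u k) x * pd a (v k) x)) \<in> lspace lborel (6/5)" for k a b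
    unfolding right_diff_distrib by (rule lspace_diff[OF B(1) B(1)]) simp
  have n: "lnorm lborel (6/5) (\<lambda>x. \<zeta> x * (pd a (u k) x * pd b (v k) x - pd b (u k) x * pd a (v k) x)) \<le> B + B" for k a b
    unfolding right_diff_distrib
    by (rule order_trans[OF lnorm_triangle_diff[OF B(1) B(1)] add_mono[OF B(2) B(2)]]) simp
  show ?thesis using l n by blast
qed

text \<open>Piola's identity: the cyclic divergence of the minors of two gradients vanishes because
  second derivatives commute, so only the derivatives of \<zeta> survive.\<close>

lemma divergence_cross_grads:
  assumes \<zeta>: "smooth \<zeta>" and v: "smooth v" and w: "smooth w"
  defines "m \<equiv> \<lambda>a b x. pd a v x * pd b w x - pd b v x * pd a w x"
  shows "pd i (\<lambda>x. \<zeta> x * m a b x) x + pd a (\<lambda>x. \<zeta> x * m b i x) x + pd b (\<lambda>x. \<zeta> x * m i a x) x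
    = pd i \<zeta> x * m a b x + pd a \<zeta> x * m b i x + pd b \<zeta> x * m i a x"
proof -
  have s: "smooth (\<lambda>x. pd c v x * pd d w x)" for c d by (intro smooth_mult smooth_pd v w)
  have sm: "smooth (m c d)" for c d unfolding m_def by (intro smooth_diff s)
  have pm: "pd e (m c d) = (\<lambda>x. (pd c v x * pd e (pd d w) x + pd d w x * pd e (pd c v) x)
      - (pd d v x * pd e (pd c w) x + pd c w x * pd e (pd d v) x))" for c d e
    unfolding m_def pd_smooth(5)[OF s s] pd_smooth(2)[OF smooth_pd[OF v] smooth_pd[OF w]] by (rule refl)
  note c = pd_commute[OF v, of a i] pd_commute[OF v, of b i] pd_commute[OF v, of b a]
    pd_commute[OF w, of a i] pd_commute[OF w, of b i] pd_commute[OF w, of b a]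
  have "pd i (m a b) x + pd a (m b i) x + pd b (m i a) x = 0"
    unfolding pm c by (simp add: algebra_simps)
  then have "\<zeta> x * pd i (m a b) x + \<zeta> x * pd a (m b i) x + \<zeta> x * pd b (m i a) x = 0"
    unfolding distrib_left[symmetric] by simp
  then show ?thesis unfolding pd_smooth(2)[OF \<zeta> sm] by (simp add: algebra_simps)
qed

text \<open>One degree up from the minors: expand along the row of u, move its derivatives away by
  Piola's identity, and use the weak convergence of the minors of v and w as weak nullity of the
  other factor.\<close>

lemma grad_det_limit:
  assumes "almost_grad U u C" "almost_grad V v C'" "almost_grad W w C''" and \<zeta>: "\<zeta> \<in> TF"
  defines "m \<equiv> \<lambda>k a b x. pd a (v k) x * pd b (w k) x - pd b (v k) x * pd a (w k) x"
  shows "(\<lambda>k. LINT x|lborel. \<zeta> x * (pd i (u k) x * m k a b x + pd a (u k) x * m k b i x + pd b (u k) x * m k i a x)) \<longlonglongrightarrow> 0"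
proof -
  interpret U: almost_grad U u C by fact
  interpret V: almost_grad V v C' by fact
  interpret W: almost_grad W w C'' by fact
  obtain R where R: "0 < R" "\<And>x. R < norm x \<Longrightarrow> \<zeta> x = 0" using test_support_ball[OF \<zeta>] by blast
  have psupp: "pd a \<zeta> x = 0" if "R < norm x" for a x
    using pd_eq_0_outside[of "cball 0 R" \<zeta> x a] R(2) that by auto
  have sm: "smooth (m k c d)" for k c d
    unfolding m_def by (intro smooth_diff smooth_mult test_smooth[OF V.pd_u] test_smooth[OF W.pd_u])
  define g where "g k x = pd i \<zeta> x * m k a b x + pd a \<zeta> x * m k b i x + pd b \<zeta> x * m k i a x" for k x
  have "\<exists>B. \<forall>k c d. (\<lambda>x. pd e \<zeta> x * m k c d x) \<in> lspace lborel (6/5) \<and> lnorm lborel (6/5) (\<lambda>x. pd e \<zeta> x * m k c d x) \<le> B" for e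
    unfolding m_def by (rule minor_bounded[OF assms(2,3) test_pd[OF \<zeta>]])
  then obtain B where B: "\<And>e k c d. (\<lambda>x. pd e \<zeta> x * m k c d x) \<in> lspace lborel (6/5)"
    "\<And>e k c d. lnorm lborel (6/5) (\<lambda>x. pd e \<zeta> x * m k c d x) \<le> B e" by metis
  have gl2: "(\<lambda>x. pd i \<zeta> x * m k a b x + pd a \<zeta> x * m k b i x) \<in> lspace lborel (6/5)" for k
    by (rule lspace_add[OF B(1) B(1)]) simp
  have gl: "g k \<in> lspace lborel (6/5)" for k
    unfolding g_def[abs_def] by (rule lspace_add[OF gl2 B(1)]) simp
  have gb: "lnorm lborel (6/5) (g k) \<le> (B i + B a) + B b" for k
    unfolding g_def[abs_def]
    by (rule order_trans[OF lnorm_triangle[OF gl2 B(1)] add_mono[OF order_trans[OF lnorm_triangle[OF B(1) B(1)] add_mono[OF B(2) B(2)]] B(2)]]) simp_all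
  have lim: "(\<lambda>k. LINT x|lborel. g k x * (u k x - ball_mean (R + 1) (u k))) \<longlonglongrightarrow> 0"
  proof (rule U.weakly_null_times_u[OF gl gb _ R(1)])
    show "g k x = 0" if "R < norm x" for k x using psupp[OF that] by (simp add: g_def)
    show "(\<lambda>k. LINT x|lborel. g k x * \<theta> x) \<longlonglongrightarrow> 0" if \<theta>: "\<theta> \<in> TF" for \<theta>
    proof -
      have t: "(\<lambda>x. pd e \<zeta> x * \<theta> x) \<in> TF" for e by (rule test_mult'[OF test_pd[OF \<zeta>] test_smooth[OF \<theta>]])
      have i: "integrable lborel (\<lambda>x. (pd e \<zeta> x * \<theta> x) * m k c d x)" for e c d k
        by (rule test_integrable[OF test_mult'[OF t sm]])
      have l: "(\<lambda>k. LINT x|lborel. (pd e \<zeta> x * \<theta> x) * m k c d x) \<longlonglongrightarrow> 0" for e c d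
        unfolding m_def by (rule grad_minor_limit[OF assms(2,3) t])
      have "(LINT x|lborel. g k x * \<theta> x) = (LINT x|lborel. (pd i \<zeta> x * \<theta> x) * m k a b x + (pd a \<zeta> x * \<theta> x) * m k b i x + (pd b \<zeta> x * \<theta> x) * m k i a x)" for k
        by (intro Bochner_Integration.integral_cong refl) (simp add: g_def algebra_simps)
      then have "(LINT x|lborel. g k x * \<theta> x) = (LINT x|lborel. (pd i \<zeta> x * \<theta> x) * m k a b x) + (LINT x|lborel. (pd a \<zeta> x * \<theta> x) * m k b i x) + (LINT x|lborel. (pd b \<zeta> x * \<theta> x) * m k i a x)" for k
        using i by simp
      then show ?thesis using tendsto_add[OF tendsto_add[OF l l] l] by simp
    qed
  qed
  have "(LINT x|lborel. \<zeta> x * (pd i (u k) x * m k a b x + pd a (u k) x * m k b i x + pd b (u k) x * m k i a x))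
    = - (LINT x|lborel. g k x * (u k x - ball_mean (R + 1) (u k)))" for k
  proof -
    let ?c = "ball_mean (R + 1) (u k)"
    define z where "z c d x = \<zeta> x * m k c d x" for c d x
    have z: "z c d \<in> TF" for c d unfolding z_def[abs_def] by (rule test_mult'[OF \<zeta> sm])
    have sc: "smooth (\<lambda>x. u k x - ?c)" by (rule smooth_diff[OF test_smooth[OF U.u] smooth_const])
    have gz: "g k x = pd i (z a b) x + pd a (z b i) x + pd b (z i a) x" for x
      unfolding z_def[abs_def] g_def m_def
      by (rule divergence_cross_grads[OF test_smooth[OF \<zeta>] test_smooth[OF V.u] test_smooth[OF W.u], symmetric])
    have i1: "integrable lborel (\<lambda>x. z c d x * pd e (u k) x)" for c d e
      by (rule test_integrable[OF test_mult'[OF z test_smooth[OF U.pd_u]]])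
    have i2: "integrable lborel (\<lambda>x. pd e (z c d) x * (u k x - ?c))" for c d e
      by (rule test_integrable[OF test_mult'[OF test_pd[OF z] sc]])
    have "(LINT x|lborel. \<zeta> x * (pd i (u k) x * m k a b x + pd a (u k) x * m k b i x + pd b (u k) x * m k i a x))
      = (LINT x|lborel. z a b x * pd i (u k) x + z b i x * pd a (u k) x + z i a x * pd b (u k) x)"
      by (intro Bochner_Integration.integral_cong refl) (simp add: z_def algebra_simps)
    also have "\<dots> = (LINT x|lborel. z a b x * pd i (u k) x) + (LINT x|lborel. z b i x * pd a (u k) x) + (LINT x|lborel. z i a x * pd b (u k) x)"
      using i1 by simp
    also have "\<dots> = - ((LINT x|lborel. pd i (z a b) x * (u k x - ?c)) + (LINT x|lborel. pd a (z b i) x * (u k x - ?c)) + (LINT x|lborel. pd b (z i a) x * (u k x - ?c)))"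
      by (simp add: by_parts_centered[OF z U.u, of _ _ _ _ ?c])
    also have "(LINT x|lborel. pd i (z a b) x * (u k x - ?c)) + (LINT x|lborel. pd a (z b i) x * (u k x - ?c)) + (LINT x|lborel. pd b (z i a) x * (u k x - ?c))
      = (LINT x|lborel. pd i (z a b) x * (u k x - ?c) + pd a (z b i) x * (u k x - ?c) + pd b (z i a) x * (u k x - ?c))"
      by (simp only: Bochner_Integration.integral_add[OF Bochner_Integration.integrable_add[OF i2 i2] i2] Bochner_Integration.integral_add[OF i2 i2])
    also have "\<dots> = (LINT x|lborel. g k x * (u k x - ?c))"
      by (simp only: gz distrib_right)
    finally show ?thesis .
  qed
  then show ?thesis using tendsto_minus[OF lim] by simp
qed

text \<open>The three factors are exchanged one at a time; in each difference the other two,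
  multiplied by \<zeta>, stay bounded in L^(6/5).\<close>

lemma triple_minus_grad_triple:
  assumes UVW: "almost_grad U u C" "almost_grad V v C'" "almost_grad W w C''" and \<zeta>: "\<zeta> \<in> TF"
  shows "(\<lambda>k. (LINT x|lborel. \<zeta> x * (U k i x * (V k a x * W k b x))) - (LINT x|lborel. \<zeta> x * (pd i (u k) x * (pd a (v k) x * pd b (w k) x)))) \<longlonglongrightarrow> 0"
proof -
  interpret U: almost_grad U u C by fact
  interpret V: almost_grad V v C' by fact
  interpret W: almost_grad W w C'' by fact
  obtain B where B: "\<And>k i j. (\<lambda>x. \<zeta> x * (V k i x * W k j x)) \<in> lspace lborel (6/5)" "\<And>k i j. lnorm lborel (6/5) (\<lambda>x. \<zeta> x * (V k i x * W k j x)) \<le> B"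
    "\<And>k i j. (\<lambda>x. \<zeta> x * (pd i (v k) x * pd j (w k) x)) \<in> lspace lborel (6/5)"
    using localized_bounded2[OF UVW(2,3) \<zeta>] by blast
  obtain D where D: "\<And>k i j. (\<lambda>x. \<zeta> x * (pd i (u k) x * W k j x)) \<in> lspace lborel (6/5)" "\<And>k i j. lnorm lborel (6/5) (\<lambda>x. \<zeta> x * (pd i (u k) x * W k j x)) \<le> D"
    using localized_bounded2[OF UVW(1,3) \<zeta>] by blast
  obtain E where E: "\<And>k i j. (\<lambda>x. \<zeta> x * (pd i (u k) x * pd j (v k) x)) \<in> lspace lborel (6/5)" "\<And>k i j. lnorm lborel (6/5) (\<lambda>x. \<zeta> x * (pd i (u k) x * pd j (v k) x)) \<le> E"
    using localized_bounded2[OF UVW(1,2) \<zeta>] by blast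
  let ?r1 = "\<lambda>k x. (\<zeta> x * (V k a x * W k b x)) * (U k i x - pd i (u k) x)"
  let ?r2 = "\<lambda>k x. (\<zeta> x * (pd i (u k) x * W k b x)) * (V k a x - pd a (v k) x)"
  let ?r3 = "\<lambda>k x. (\<zeta> x * (pd i (u k) x * pd a (v k) x)) * (W k b x - pd b (w k) x)"
  have eq: "(LINT x|lborel. \<zeta> x * (U k i x * (V k a x * W k b x))) - (LINT x|lborel. \<zeta> x * (pd i (u k) x * (pd a (v k) x * pd b (w k) x)))
    = (LINT x|lborel. ?r1 k x) + (LINT x|lborel. ?r2 k x) + (LINT x|lborel. ?r3 k x)" for k
  proof -
    have i0: "integrable lborel (\<lambda>x. \<zeta> x * (U k i x * (V k a x * W k b x)))" "integrable lborel (\<lambda>x. \<zeta> x * (pd i (u k) x * (pd a (v k) x * pd b (w k) x)))"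
      by (rule integrable_mult_localized[OF B(1) U.U], rule integrable_mult_localized[OF B(3) U.pd_u_lspace])
    have i1: "integrable lborel (?r1 k)" by (rule Holder_integrable[OF conjugate_6(2) B(1) U.rem_lspace])
    have i2: "integrable lborel (?r2 k)" by (rule Holder_integrable[OF conjugate_6(2) D(1) V.rem_lspace])
    have i3: "integrable lborel (?r3 k)" by (rule Holder_integrable[OF conjugate_6(2) E(1) W.rem_lspace])
    have "(LINT x|lborel. \<zeta> x * (U k i x * (V k a x * W k b x))) - (LINT x|lborel. \<zeta> x * (pd i (u k) x * (pd a (v k) x * pd b (w k) x)))
      = (LINT x|lborel. \<zeta> x * (U k i x * (V k a x * W k b x)) - \<zeta> x * (pd i (u k) x * (pd a (v k) x * pd b (w k) x)))"
      by (rule Bochner_Integration.integral_diff[OF i0, symmetric])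
    also have "\<dots> = (LINT x|lborel. ?r1 k x + ?r2 k x + ?r3 k x)"
      by (intro Bochner_Integration.integral_cong refl) (simp add: algebra_simps)
    also have "\<dots> = (LINT x|lborel. ?r1 k x) + (LINT x|lborel. ?r2 k x) + (LINT x|lborel. ?r3 k x)"
      by (simp only: Bochner_Integration.integral_add[OF Bochner_Integration.integrable_add[OF i1 i2] i3] Bochner_Integration.integral_add[OF i1 i2])
    finally show ?thesis .
  qed
  have "(\<lambda>k. LINT x|lborel. ?r1 k x) \<longlonglongrightarrow> 0" "(\<lambda>k. LINT x|lborel. ?r2 k x) \<longlonglongrightarrow> 0" "(\<lambda>k. LINT x|lborel. ?r3 k x) \<longlonglongrightarrow> 0"
    by (rule U.rem_times[OF B(1,2)], rule V.rem_times[OF D], rule W.rem_times[OF E])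
  from tendsto_add[OF tendsto_add[OF this(1,2)] this(3)] show ?thesis unfolding eq by simp
qed

lemma det_limit:
  assumes UVW: "almost_grad U u C" "almost_grad V v C'" "almost_grad W w C''" and \<zeta>: "\<zeta> \<in> TF"
  shows "(\<lambda>k. LINT x|lborel. \<zeta> x * (U k i x * (V k a x * W k b x - V k b x * W k a x) + U k a x * (V k b x * W k i x - V k i x * W k b x)
    + U k b x * (V k i x * W k a x - V k a x * W k i x))) \<longlonglongrightarrow> 0"
proof -
  interpret U: almost_grad U u C by fact
  obtain B where B: "\<And>k i j. (\<lambda>x. \<zeta> x * (V k i x * W k j x)) \<in> lspace lborel (6/5)"
    "\<And>k i j. (\<lambda>x. \<zeta> x * (pd i (v k) x * pd j (w k) x)) \<in> lspace lborel (6/5)"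
    using localized_bounded2[OF UVW(2,3) \<zeta>] by blast
  let ?T = "\<lambda>k i a b. LINT x|lborel. \<zeta> x * (U k i x * (V k a x * W k b x))"
  let ?G = "\<lambda>k i a b. LINT x|lborel. \<zeta> x * (pd i (u k) x * (pd a (v k) x * pd b (w k) x))"
  note iT = integrable_mult_localized[OF B(1) U.U] note iG = integrable_mult_localized[OF B(2) U.pd_u_lspace]
  note t = triple_minus_grad_triple[OF UVW \<zeta>]
  \<comment> \<open>Six signed monomials, stated for generic p, q, r because it is used both for the
    fields and for the gradients.\<close>
  have six: "(LINT x|lborel. \<zeta> x * (p i x * (q a x * r b x - q b x * r a x) + p a x * (q b x * r i x - q i x * r b x) + p b x * (q i x * r a x - q a x * r i x)))
    = (LINT x|lborel. \<zeta> x * (p i x * (q a x * r b x))) - (LINT x|lborel. \<zeta> x * (p i x * (q b x * r a x)))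
    + (LINT x|lborel. \<zeta> x * (p a x * (q b x * r i x))) - (LINT x|lborel. \<zeta> x * (p a x * (q i x * r b x)))
    + (LINT x|lborel. \<zeta> x * (p b x * (q i x * r a x))) - (LINT x|lborel. \<zeta> x * (p b x * (q a x * r i x)))"
    if "\<And>c d e. integrable lborel (\<lambda>x. \<zeta> x * (p c x * (q d x * r e x)))" for p q r :: "3 \<Rightarrow> real^3 \<Rightarrow> real"
  proof -
    have "(LINT x|lborel. \<zeta> x * (p i x * (q a x * r b x - q b x * r a x) + p a x * (q b x * r i x - q i x * r b x) + p b x * (q i x * r a x - q a x * r i x)))
      = (LINT x|lborel. \<zeta> x * (p i x * (q a x * r b x)) - \<zeta> x * (p i x * (q b x * r a x)) + \<zeta> x * (p a x * (q b x * r i x)) - \<zeta> x * (p a x * (q i x * r b x))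
        + \<zeta> x * (p b x * (q i x * r a x)) - \<zeta> x * (p b x * (q a x * r i x)))"
      by (intro Bochner_Integration.integral_cong refl) (simp add: algebra_simps)
    then show ?thesis using that by simp
  qed
  have "(\<lambda>k. (?T k i a b - ?G k i a b) - (?T k i b a - ?G k i b a) + (?T k a b i - ?G k a b i) - (?T k a i b - ?G k a i b)
      + (?T k b i a - ?G k b i a) - (?T k b a i - ?G k b a i)) \<longlonglongrightarrow> 0 - 0 + 0 - 0 + 0 - 0"
    by (intro tendsto_add tendsto_diff t)
  moreover have "(\<lambda>k. ?G k i a b - ?G k i b a + ?G k a b i - ?G k a i b + ?G k b i a - ?G k b a i) \<longlonglongrightarrow> 0"
    using grad_det_limit[OF UVW \<zeta>, of i a b]
    unfolding six[of "\<lambda>c. pd c (u _)" "\<lambda>c. pd c (v _)" "\<lambda>c. pd c (w _)", OF iG] .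
  ultimately have "(\<lambda>k. ((?T k i a b - ?G k i a b) - (?T k i b a - ?G k i b a) + (?T k a b i - ?G k a b i) - (?T k a i b - ?G k a i b)
      + (?T k b i a - ?G k b i a) - (?T k b a i - ?G k b a i)) + (?G k i a b - ?G k i b a + ?G k a b i - ?G k a i b + ?G k b i a - ?G k b a i)) \<longlonglongrightarrow> (0 - 0 + 0 - 0 + 0 - 0) + 0"
    by (rule tendsto_add)
  then show ?thesis unfolding six[of "U _" "V _" "W _", OF iT] by (simp add: algebra_simps)
qed

section \<open>Pointwise monotonicity\<close>

definition cof :: "real^3^3 \<Rightarrow> real^3^3" where
  "cof A = vector
    [vector [A$2$2 * A$3$3 - A$2$3 * A$3$2, A$2$3 * A$3$1 - A$2$1 * A$3$3, A$2$1 * A$3$2 - A$2$2 * A$3$1],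
     vector [A$3$2 * A$1$3 - A$3$3 * A$1$2, A$3$3 * A$1$1 - A$3$1 * A$1$3, A$3$1 * A$1$2 - A$3$2 * A$1$1],
     vector [A$1$2 * A$2$3 - A$1$3 * A$2$2, A$1$3 * A$2$1 - A$1$1 * A$2$3, A$1$1 * A$2$2 - A$1$2 * A$2$1]]"

text \<open>The symmetric bilinear form of the quadratic map \<open>cof\<close>, without the factor
  1/2.\<close>

definition cof_polar :: "real^3^3 \<Rightarrow> real^3^3 \<Rightarrow> real^3^3" where
  "cof_polar A B = cof (A + B) - cof A - cof B"

lemma inner_matrix_3:
  fixes A B :: "real^3^3"
  shows "A \<bullet> B = A$1$1 * B$1$1 + A$1$2 * B$1$2 + A$1$3 * B$1$3 + (A$2$1 * B$2$1 + A$2$2 * B$2$2 + A$2$3 * B$2$3)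
    + (A$3$1 * B$3$1 + A$3$2 * B$3$2 + A$3$3 * B$3$3)"
  by (simp add: inner_vec_def sum_3)

lemma det_add: "det (A + B :: real^3^3) = det A + cof A \<bullet> B + cof B \<bullet> A + det B"
  by (simp add: det_3 cof_def inner_matrix_3 algebra_simps)

lemma cof_inner_self: "cof A \<bullet> A = 3 * det A"
  by (simp add: det_3 cof_def inner_matrix_3 algebra_simps)

lemma det_scaleR_3: "det (t *\<^sub>R A :: real^3^3) = t^3 * det A"
  by (simp add: det_3 algebra_simps power3_eq_cube)

lemma cof_scaleR_inner: "cof (t *\<^sub>R A) \<bullet> B = t^2 * (cof A \<bullet> B)"
  by (simp add: cof_def inner_matrix_3 algebra_simps power2_eq_square)

text \<open>The coefficient of t uses the full symmetry of the trilinear form that polarizes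
  \<open>det\<close>. It brings A out of the polar form, so that this term is visibly linear in A
  and passes to weak limits.\<close>

lemma cof_add_scaleR_inner:
  "cof (A + t *\<^sub>R H) \<bullet> G = cof A \<bullet> G + t * (cof_polar H G \<bullet> A) + t^2 * (cof H \<bullet> G)"
  by (simp add: cof_polar_def cof_def inner_matrix_3 algebra_simps power2_eq_square)

lemma det_add_scaleR:
  "det (A + t *\<^sub>R H :: real^3^3) = det A + t * (cof A \<bullet> H) + t^2 * (cof H \<bullet> A) + t^3 * det H"
  by (simp add: det_add det_scaleR_3 cof_scaleR_inner)

lemma abs_component_le_norm: "\<bar>(A::real^'n^'m) $ i $ j\<bar> \<le> norm A"
  by (rule order_trans[OF component_le_norm_cart Finite_Cartesian_Product.norm_nth_le])

lemma abs_det_le: "\<bar>det (A::real^3^3)\<bar> \<le> 6 * norm A ^ 3"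
proof -
  have p: "\<bar>A$i$j * A$k$l * A$m$n\<bar> \<le> norm A ^ 3" for i j k l m n
    unfolding abs_mult power3_eq_cube by (intro mult_mono abs_component_le_norm) auto
  show ?thesis
    unfolding det_3
    using p[of 1 1 2 2 3 3] p[of 1 2 2 3 3 1] p[of 1 3 2 1 3 2] p[of 1 1 2 3 3 2] p[of 1 2 2 1 3 3] p[of 1 3 2 2 3 1]
    by linarith
qed

text \<open>Each of the nine products of entries is at most 2 |A|^2 |B|. Neither this constant nor
  the 6 for the determinant is sharp, and both enter 1/720.\<close>

lemma abs_cof_inner_le: "\<bar>cof A \<bullet> B\<bar> \<le> 18 * (norm A)\<^sup>2 * norm B"
proof -
  have p: "\<bar>(A$i$j * A$k$l - A$m$n * A$u$v) * B$q$r\<bar> \<le> 2 * ((norm A)\<^sup>2 * norm B)" for i j k l m n u v q r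
  proof -
    have t: "\<bar>A$i$j * A$k$l\<bar> \<le> (norm A)\<^sup>2" for i j k l
      unfolding abs_mult power2_eq_square by (intro mult_mono abs_component_le_norm) auto
    have "\<bar>A$i$j * A$k$l - A$m$n * A$u$v\<bar> \<le> 2 * (norm A)\<^sup>2" using t[of i j k l] t[of m n u v] by linarith
    then have "\<bar>(A$i$j * A$k$l - A$m$n * A$u$v) * B$q$r\<bar> \<le> (2 * (norm A)\<^sup>2) * norm B"
      unfolding abs_mult by (intro mult_mono abs_component_le_norm) auto
    then show ?thesis by simp
  qed
  have "\<bar>x1 + x2 + x3 + (x4 + x5 + x6) + (x7 + x8 + x9)\<bar> \<le> 18 * c"
    if "\<bar>x1\<bar> \<le> 2 * c" "\<bar>x2\<bar> \<le> 2 * c" "\<bar>x3\<bar> \<le> 2 * c" "\<bar>x4\<bar> \<le> 2 * c" "\<bar>x5\<bar> \<le> 2 * c" "\<bar>x6\<bar> \<le> 2 * c" "\<bar>x7\<bar> \<le> 2 * c" "\<bar>x8\<bar> \<le> 2 * c" "\<bar>x9\<bar> \<le> 2 * c"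
    for x1 x2 x3 x4 x5 x6 x7 x8 x9 c :: real
    using abs_le_D1[OF that(1)] abs_le_D2[OF that(1)] abs_le_D1[OF that(2)] abs_le_D2[OF that(2)] abs_le_D1[OF that(3)] abs_le_D2[OF that(3)] abs_le_D1[OF that(4)] abs_le_D2[OF that(4)] abs_le_D1[OF that(5)] abs_le_D2[OF that(5)] abs_le_D1[OF that(6)] abs_le_D2[OF that(6)] abs_le_D1[OF that(7)] abs_le_D2[OF that(7)] abs_le_D1[OF that(8)] abs_le_D2[OF that(8)] abs_le_D1[OF that(9)] abs_le_D2[OF that(9)]
    by (intro abs_leI) linarith+
  note nine = this
  have "\<bar>cof A \<bullet> B\<bar> \<le> 18 * ((norm A)\<^sup>2 * norm B)"
    unfolding inner_matrix_3 cof_def vector_3 by (rule nine) (rule p)+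
  then show ?thesis by simp
qed

definition DW :: "real \<Rightarrow> real \<Rightarrow> (real \<Rightarrow> real) \<Rightarrow> real^3^3 \<Rightarrow> real^3^3" where
  "DW a e g' A = (1 + a * (norm A)\<^sup>2 + e * norm A ^ 4) *\<^sub>R A + g' (det A) *\<^sub>R cof A"

text \<open>For multiples of x and y, (p x - q y) . (x - y) = (p+q)/2 |x-y|^2 + (p-q)/2 (|x|^2 -
  |y|^2). The second term is nonnegative because the multiplier increases with the norm; the first
  keeps the quartic weight that absorbs the determinant error.\<close>

lemma radial_monotone:
  fixes x y :: "'a::real_inner"
  assumes a: "0 < a" and e: "0 < e"
  shows "e / 2 * (norm x ^ 4 + norm y ^ 4) * (norm (x - y))\<^sup>2
    \<le> ((1 + a * (norm x)\<^sup>2 + e * norm x ^ 4) *\<^sub>R x - (1 + a * (norm y)\<^sup>2 + e * norm y ^ 4) *\<^sub>R y) \<bullet> (x - y)"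
proof -
  define \<alpha> where "\<alpha> r = 1 + a * r^2 + e * r^4" for r :: real
  have id: "(p *\<^sub>R x - q *\<^sub>R y) \<bullet> (x - y) = (p + q) / 2 * (norm (x - y))\<^sup>2 + (p - q) / 2 * ((norm x)\<^sup>2 - (norm y)\<^sup>2)" for p q
    by (simp add: power2_norm_eq_inner inner_diff_left inner_diff_right inner_commute field_simps)
  have "0 \<le> (\<alpha> r - \<alpha> s) * (r^2 - s^2)" for r s :: real
  proof -
    have "(\<alpha> r - \<alpha> s) * (r^2 - s^2) = (r^2 - s^2)^2 * (a + e * (r^2 + s^2))"
      unfolding \<alpha>_def by (simp add: algebra_simps power2_eq_square power4_eq_xxxx)
    then show ?thesis using a e by simp
  qed
  from this[of "norm x" "norm y"] have 1: "0 \<le> (\<alpha> (norm x) - \<alpha> (norm y)) / 2 * ((norm x)\<^sup>2 - (norm y)\<^sup>2)" by simp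
  have "e / 2 * (norm x ^ 4 + norm y ^ 4) \<le> (\<alpha> (norm x) + \<alpha> (norm y)) / 2"
    unfolding \<alpha>_def using a e by (simp add: field_simps)
  then have 2: "e / 2 * (norm x ^ 4 + norm y ^ 4) * (norm (x - y))\<^sup>2 \<le> (\<alpha> (norm x) + \<alpha> (norm y)) / 2 * (norm (x - y))\<^sup>2"
    by (rule mult_right_mono) simp
  show ?thesis using 1 2 unfolding id[of "\<alpha> (norm x)" "\<alpha> (norm y)", unfolded \<alpha>_def] \<alpha>_def by linarith
qed

text \<open>For fixed \<open>y\<close> the lower bound is a combination of null Lagrangians of \<open>x - y\<close>, hence it passes to weak limits.\<close>

lemma DW_monotone_up_to_null_terms:
  fixes g' :: "real \<Rightarrow> real"
  assumes g': "\<And>s t. 0 \<le> (g' s - g' t) * (s - t)" and lip: "\<And>s t. \<bar>g' t - g' s\<bar> \<le> d * (\<bar>t\<bar> + \<bar>s\<bar>)"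
    and a: "0 < a" and e: "0 < e" and d: "d \<le> e / 720"
  shows "g' (det y) * (2 * (cof (x - y) \<bullet> y) + 3 * det (x - y)) \<le> (DW a e g' x - DW a e g' y) \<bullet> (x - y)"
proof -
  define D where "D = x - y"
  have d0: "0 \<le> d" using lip[of 1 0] by simp
  let ?x = "norm x" and ?y = "norm y" and ?s = "det x" and ?t = "det y"
  \<comment> \<open>The defect between \<open>cof x\<close> paired with D and the increment of the
    determinant. It is of second order in D, matching the weight |D|^2 in
    \<open>radial_monotone\<close>.\<close>
  define L where "L = cof D \<bullet> y + 2 * det D"
  have x: "x = y + D" by (simp add: D_def)
  have cx: "cof x \<bullet> D = ?s - ?t + L"
  proof -
    have "det (x + (- 1) *\<^sub>R D) = ?s + (- 1) * (cof x \<bullet> D) + (- 1)^2 * (cof D \<bullet> x) + (- 1)^3 * det D"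
      by (rule det_add_scaleR)
    moreover have "x + (- 1) *\<^sub>R D = y" by (simp add: D_def)
    moreover have "cof D \<bullet> x = cof D \<bullet> y + 3 * det D" by (simp add: x inner_add_right cof_inner_self)
    ultimately show ?thesis by (simp add: L_def)
  qed
  have cy: "cof y \<bullet> D = ?s - ?t - cof D \<bullet> y - det D"
    using det_add[of y D] x by simp
  have D: "norm D \<le> ?x + ?y" unfolding D_def by (rule norm_triangle_ineq4)
  have L: "\<bar>L\<bar> \<le> 30 * (norm D)\<^sup>2 * (?x + ?y)"
  proof -
    have "\<bar>L\<bar> \<le> 18 * (norm D)\<^sup>2 * ?y + 12 * norm D ^ 3"
      using abs_cof_inner_le[of D y] abs_det_le[of D] unfolding L_def by linarith
    also have "12 * norm D ^ 3 = 12 * ((norm D)\<^sup>2 * norm D)" by (simp add: power2_eq_square power3_eq_cube)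
    also have "18 * (norm D)\<^sup>2 * ?y + \<dots> \<le> 18 * ((norm D)\<^sup>2 * (?x + ?y)) + 12 * ((norm D)\<^sup>2 * (?x + ?y))"
    proof -
      have "(norm D)\<^sup>2 * ?y \<le> (norm D)\<^sup>2 * (?x + ?y)" "(norm D)\<^sup>2 * norm D \<le> (norm D)\<^sup>2 * (?x + ?y)"
        using D by (intro mult_left_mono; simp)+
      then show ?thesis by linarith
    qed
    finally show ?thesis by (simp add: mult_ac)
  qed
  have st: "\<bar>g' ?s - g' ?t\<bar> \<le> 6 * d * (?x ^ 3 + ?y ^ 3)"
  proof -
    have "\<bar>g' ?s - g' ?t\<bar> \<le> d * (6 * ?x ^ 3 + 6 * ?y ^ 3)"
      by (rule order_trans[OF lip mult_left_mono[OF add_mono[OF abs_det_le abs_det_le] d0]])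
    then show ?thesis by (simp add: algebra_simps)
  qed
  have quartic: "(?x ^ 3 + ?y ^ 3) * (?x + ?y) \<le> 2 * (?x ^ 4 + ?y ^ 4)"
  proof -
    have "2 * (?x ^ 4 + ?y ^ 4) - (?x ^ 3 + ?y ^ 3) * (?x + ?y) = (?x ^ 3 - ?y ^ 3) * (?x - ?y)"
      by (simp add: algebra_simps power3_eq_cube power4_eq_xxxx)
    also have "\<dots> = (?x - ?y)^2 * (?x ^ 2 + ?x * ?y + ?y ^ 2)"
      by (simp add: algebra_simps power2_eq_square power3_eq_cube)
    also have "\<dots> \<ge> 0" by simp
    finally show ?thesis by simp
  qed
  have "\<bar>(g' ?s - g' ?t) * L\<bar> \<le> (6 * d * (?x ^ 3 + ?y ^ 3)) * (30 * (norm D)\<^sup>2 * (?x + ?y))"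
    unfolding abs_mult using st L d0 by (intro mult_mono) auto
  also have "\<dots> = 180 * d * (norm D)\<^sup>2 * ((?x ^ 3 + ?y ^ 3) * (?x + ?y))" by simp
  also have "\<dots> \<le> 180 * d * (norm D)\<^sup>2 * (2 * (?x ^ 4 + ?y ^ 4))"
    using d0 by (intro mult_left_mono quartic) auto
  \<comment> \<open>Here 360 = 6 * 30 * 2, from the bound on \<open>det\<close>, the bound 18 + 12
    on L and the quartic inequality; hence the requirement d \<le> e/720.\<close>
  also have "\<dots> = (360 * d) * ((?x ^ 4 + ?y ^ 4) * (norm D)\<^sup>2)" by simp
  also have "\<dots> \<le> (e / 2) * ((?x ^ 4 + ?y ^ 4) * (norm D)\<^sup>2)"
    using d by (intro mult_right_mono) auto
  finally have 1: "\<bar>(g' ?s - g' ?t) * L\<bar> \<le> e / 2 * (?x ^ 4 + ?y ^ 4) * (norm D)\<^sup>2" by simp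
  have "(DW a e g' x - DW a e g' y) \<bullet> D = ((1 + a * ?x\<^sup>2 + e * ?x ^ 4) *\<^sub>R x - (1 + a * ?y\<^sup>2 + e * ?y ^ 4) *\<^sub>R y) \<bullet> D
      + (g' ?s * (cof x \<bullet> D) - g' ?t * (cof y \<bullet> D))"
    by (simp add: DW_def inner_diff_left inner_add_left)
  \<comment> \<open>Three parts: nonnegative by monotonicity of \<open>g'\<close>, absorbed by the
    radial part, and a combination of null Lagrangians of D with coefficient frozen at y.\<close>
  also have "g' ?s * (cof x \<bullet> D) - g' ?t * (cof y \<bullet> D)
      = (g' ?s - g' ?t) * (?s - ?t) + (g' ?s - g' ?t) * L + g' ?t * (2 * (cof D \<bullet> y) + 3 * det D)"
    unfolding cx cy L_def by (simp add: algebra_simps)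
  finally show ?thesis
    using 1 g'[of ?s ?t] radial_monotone[OF a e, of x y] unfolding D_def[symmetric] by linarith
qed

text \<open>Since F - G = f + t H, the terms are sorted so that those depending on f or p have
  localized integrals tending to 0 along the sequence; the last bracket is the constant that
  survives in the limit.\<close>

lemma minty_expansion:
  fixes g' :: "real \<Rightarrow> real"
  assumes "\<And>s t. 0 \<le> (g' s - g' t) * (s - t)" "\<And>s t. \<bar>g' t - g' s\<bar> \<le> d * (\<bar>t\<bar> + \<bar>s\<bar>)" "0 < a" "0 < e" "d \<le> e / 720"
    and G: "G = F\<^sub>0 - t *\<^sub>R H" and f: "f = F - F\<^sub>0" and p: "p = DW a e g' F - P\<^sub>0"
  defines "\<gamma> \<equiv> g' (det G)" and "Q \<equiv> P\<^sub>0 - DW a e g' G"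
  shows "0 \<le> p \<bullet> f + t * (H \<bullet> p) + Q \<bullet> f
      - \<gamma> * (2 * (cof f \<bullet> G) + 2 * t * (cof_polar H G \<bullet> f) + 3 * det f + 3 * t * (cof f \<bullet> H) + 3 * t^2 * (cof H \<bullet> f))
    + (t * (Q \<bullet> H) - \<gamma> * (2 * t^2 * (cof H \<bullet> G) + 3 * t^3 * det H))"
proof -
  have D: "F - G = f + t *\<^sub>R H" by (simp add: f G)
  have "\<gamma> * (2 * (cof (f + t *\<^sub>R H) \<bullet> G) + 3 * det (f + t *\<^sub>R H)) \<le> (DW a e g' F - DW a e g' G) \<bullet> (f + t *\<^sub>R H)"
    using DW_monotone_up_to_null_terms[OF assms(1-5), where x = F and y = G] by (simp add: D \<gamma>_def)
  also have "DW a e g' F - DW a e g' G = p + Q" by (simp add: p Q_def)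
  finally show ?thesis
    unfolding cof_add_scaleR_inner det_add_scaleR
    by (simp add: inner_add_left inner_add_right inner_commute[of p H] algebra_simps)
qed

section \<open>Identification of the gradient of the energy density\<close>

lemma GDERIV_det_3: "GDERIV det (A::real^3^3) :> cof A"
proof -
  have c [derivative_intros]: "((\<lambda>B::real^3^3. B $ i $ j) has_derivative (\<lambda>h. h $ i $ j)) (at A)" for i j
    by (rule bounded_linear_imp_has_derivative[OF bounded_linear_compose[OF bounded_linear_vec_nth bounded_linear_vec_nth]])
  show ?thesis
    unfolding gderiv_def det_3[abs_def]
    by (rule derivative_eq_intros refl)+ (auto simp: fun_eq_iff cof_def inner_matrix_3 algebra_simps)
qed

text \<open>Even powers of the norm are polynomials in A . A, which avoids differentiating the norm
  at A = 0.\<close>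

lemma grad_W3:
  fixes g :: "real \<Rightarrow> real"
  assumes "\<And>t. (g has_real_derivative g' t) (at t)"
  shows "grad (W3 a e g) A = DW a e g' A"
proof (rule grad_eqI)
  have s: "GDERIV (\<lambda>A::real^3^3. A \<bullet> A) A :> 2 *\<^sub>R A"
    unfolding gderiv_def by (auto intro!: derivative_eq_intros simp: fun_eq_iff inner_commute)
  have W: "W3 a e g = (\<lambda>A. (\<lambda>r. 1/2 * r + 1/4 * a * r^2 + 1/6 * e * r^3) (A \<bullet> A) + g (det A))"
  proof
    fix B :: "real^3^3"
    have "norm B ^ 4 = (B \<bullet> B)^2" "norm B ^ 6 = (B \<bullet> B)^3"
      by (simp_all add: power2_norm_eq_inner[symmetric] power_mult[symmetric])
    then show "W3 a e g B = (\<lambda>r. 1/2 * r + 1/4 * a * r^2 + 1/6 * e * r^3) (B \<bullet> B) + g (det B)"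
      by (simp add: W3_def power2_norm_eq_inner)
  qed
  have r: "DERIV (\<lambda>r::real. 1/2 * r + 1/4 * a * r^2 + 1/6 * e * r^3) r :> 1/2 + 1/2 * a * r + 1/2 * e * r^2" for r
    by (auto intro!: derivative_eq_intros simp: field_simps power2_eq_square)
  have "GDERIV (W3 a e g) A :> (1/2 + 1/2 * a * (A \<bullet> A) + 1/2 * e * (A \<bullet> A)^2) *\<^sub>R (2 *\<^sub>R A) + g' (det A) *\<^sub>R cof A"
    unfolding W by (rule GDERIV_add[OF GDERIV_DERIV_compose[OF s r] GDERIV_DERIV_compose[OF GDERIV_det_3 assms]])
  moreover have "norm A ^ 4 = (A \<bullet> A)^2" by (simp add: power2_norm_eq_inner[symmetric] power_mult[symmetric])
  then have "(1/2 + 1/2 * a * (A \<bullet> A) + 1/2 * e * (A \<bullet> A)^2) *\<^sub>R (2 *\<^sub>R A) + g' (det A) *\<^sub>R cof A = DW a e g' A"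
    by (simp add: DW_def power2_norm_eq_inner algebra_simps)
  ultimately show "GDERIV (W3 a e g) A :> DW a e g' A" by simp
qed

lemma convex_deriv_mono:
  fixes g :: "real \<Rightarrow> real"
  assumes "convex_on UNIV g" and d: "\<And>t. (g has_real_derivative g' t) (at t)"
  shows "0 \<le> (g' s - g' t) * (s - t)"
proof -
  have "g' c * (x - c) \<le> g x - g c" for x c
    using convex_on_imp_above_tangent[OF assms(1), of c x "g' c"] d by simp
  from this[of t s] this[of s t] show ?thesis by (simp add: algebra_simps)
qed

lemma C1_differentiable_on_UNIV_deriv:
  fixes g :: "real \<Rightarrow> real"
  assumes "g C1_differentiable_on UNIV"
  shows "(g has_real_derivative deriv g t) (at t)" and "continuous_on UNIV (deriv g)"
proof -
  obtain D where D: "\<And>x. (g has_vector_derivative D x) (at x)" "continuous_on UNIV D"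
    using assms by (auto simp: C1_differentiable_on_def)
  have d: "(g has_real_derivative D x) (at x)" for x
    using D(1) by (simp add: has_real_derivative_iff_has_vector_derivative)
  then have "deriv g = D" by (auto simp: fun_eq_iff intro: DERIV_imp_deriv)
  then show "(g has_real_derivative deriv g t) (at t)" "continuous_on UNIV (deriv g)" using d D(2) by auto
qed

lemma continuous_on_det_3: "continuous_on S f \<Longrightarrow> continuous_on S (\<lambda>x. det (f x :: real^3^3))"
  unfolding det_3 by (intro continuous_intros)

lemma continuous_on_DW_inner:
  assumes g': "continuous_on UNIV g'" and f: "continuous_on S f"
  shows "continuous_on S (\<lambda>x. DW a e g' (f x) \<bullet> H)"
proof -
  have 1: "continuous_on S (\<lambda>x. g' (det (f x)))"
    using continuous_on_compose2[OF g' continuous_on_det_3[OF f]] by simp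
  have 2: "continuous_on S (\<lambda>x. cof (f x) \<bullet> H)"
    unfolding inner_matrix_3 cof_def vector_3 by (intro continuous_intros f)
  show ?thesis
    unfolding DW_def inner_add_left inner_scaleR_left
    by (intro continuous_on_add continuous_on_mult 1 2) (intro continuous_intros f)+
qed

section \<open>Weak convergence and functionals\<close>

text \<open>The normalized duality map sgn(f) |f|^(s-1). It supplies the functionals for the gliding
  hump.\<close>

lemma norming_functional:
  assumes st: "conjugate s t" and f: "f \<in> lspace M s"
  shows "\<exists>g\<in>lspace M t. lnorm M t g \<le> 1 \<and> (LINT x|M. f x * g x) = lnorm M s f"
proof (cases "lnorm M s f = 0")
  case True
  then show ?thesis by (intro bexI[of _ "\<lambda>x. 0"]) (auto simp: lspace_zero lnorm_def)
next
  case False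
  note c = conjugateD[OF st]
  let ?N = "lnorm M s f"
  have N: "0 < ?N" using False lnorm_nonneg[of M s f] by linarith
  have fm [measurable]: "f \<in> borel_measurable M" by (rule lspace_measurable[OF f])
  define h where "h x = sgn (f x) * \<bar>f x\<bar> powr (s - 1)" for x
  have hm [measurable]: "h \<in> borel_measurable M" unfolding h_def[abs_def] by measurable
  have "\<bar>h x\<bar> = \<bar>\<bar>f x\<bar> powr (s - 1)\<bar>" for x by (cases "f x = 0") (auto simp: h_def abs_mult abs_sgn_eq)
  then have le: "AE x in M. \<bar>h x\<bar> \<le> \<bar>\<bar>f x\<bar> powr (s - 1)\<bar>" by simp
  have t: "0 < t" using c by simp
  have h: "h \<in> lspace M t" "lnorm M t h \<le> ?N powr (s - 1)"
    using lspace_mono[OF lspace_dual(1)[OF st f] hm le t] by (simp_all add: lspace_dual(2)[OF st f])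
  have fh: "f x * h x = \<bar>f x\<bar> powr s" for x
  proof (cases "f x = 0")
    case False
    have "f x * sgn (f x) = \<bar>f x\<bar>" by (simp add: sgn_if)
    then have "f x * h x = \<bar>f x\<bar> powr 1 * \<bar>f x\<bar> powr (s - 1)" by (simp add: h_def mult.assoc[symmetric])
    also have "\<dots> = \<bar>f x\<bar> powr s" by (subst powr_add[symmetric]) simp
    finally show ?thesis .
  qed simp
  let ?c = "1 / ?N powr (s - 1)"
  have P: "0 < ?N powr (s - 1)" using N by simp
  show ?thesis
  proof (intro bexI conjI)
    show "(\<lambda>x. ?c * h x) \<in> lspace M t" by (rule lspace_cmult[OF h(1)])
    show "lnorm M t (\<lambda>x. ?c * h x) \<le> 1" unfolding lnorm_cmult[OF t] using h(2) P by (simp add: field_simps)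
    have "(LINT x|M. f x * (?c * h x)) = (LINT x|M. ?c * \<bar>f x\<bar> powr s)"
      by (intro Bochner_Integration.integral_cong refl) (simp add: fh[symmetric])
    also have "\<dots> = ?c * ?N powr s" using lnorm_powr[of s M f] c by simp
    also have "\<dots> = ?N powr (s - (s - 1))" using powr_diff[of ?N s "s - 1"] by simp
    finally show "(LINT x|M. f x * (?c * h x)) = ?N" using N by simp
  qed
qed

text \<open>Sokal's gliding hump replaces the uniform boundedness principle: the sign \<open>e n c\<close> in the proof prevents
  the earlier terms from cancelling the \<open>n\<close>-th one, and the later terms contribute at most half of it.\<close>

lemma gliding_hump:
  fixes N :: "'z \<Rightarrow> real" and l :: "nat \<Rightarrow> 'z \<Rightarrow> real" and z :: "nat \<Rightarrow> 'z"
  assumes N: "\<And>n m. \<bar>l n (z m)\<bar> \<le> N (z m)" and norming: "\<And>n. l n (z n) = N (z n)"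
    and bounded: "\<And>c \<sigma>. (\<And>n. \<bar>c n\<bar> \<le> (1/3)^n) \<Longrightarrow> \<exists>B. \<forall>k. \<bar>\<Sum>n. c n * l (\<sigma> n) (z k)\<bar> \<le> B"
  shows "\<exists>C. \<forall>k. N (z k) \<le> C"
proof (rule ccontr)
  assume "\<nexists>C. \<forall>k. N (z k) \<le> C"
  \<comment> \<open>Growth 9^n outruns the weights (1/3)^n and leaves 3^n.\<close>
  then have "\<forall>n. \<exists>k. 9 ^ n < N (z k)" by (meson not_le)
  then obtain \<sigma> where \<sigma>: "\<And>n. 9 ^ n < N (z (\<sigma> n))" by metis
  define e where "e n c = (if \<bar>(\<Sum>m<n. c m * l (\<sigma> m) (z (\<sigma> n))) + (1/3)^n * N (z (\<sigma> n))\<bar> \<ge> (1/3)^n * N (z (\<sigma> n)) then 1 else - 1 :: real)"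
    for n and c :: "nat \<Rightarrow> real"
  \<comment> \<open>The n-th sign depends on the earlier coefficients, so the sequence is built as a
    function whose n-th value is filled in at stage n; \<open>c\<close> reads off these
    values.\<close>
  define w where "w = rec_nat (\<lambda>_. 0) (\<lambda>n c. c(n := e n c * (1/3)^n))"
  have w0: "w 0 = (\<lambda>_. 0)" and ws: "w (Suc n) = (w n)(n := e n (w n) * (1/3)^n)" for n by (simp_all add: w_def)
  define c where "c n = w (Suc n) n" for n
  have wc: "m < n \<Longrightarrow> w n m = c m" for n m
    by (induction n) (auto simp: ws c_def less_Suc_eq)
  have e: "e n (w n) = e n c" for n unfolding e_def by (simp add: wc)
  have c: "c n = e n c * (1/3)^n" for n using e by (simp add: c_def ws)
  have ca: "\<bar>c n\<bar> \<le> (1/3)^n" for n by (subst c) (simp add: e_def abs_mult)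
  obtain B where B: "\<And>k. \<bar>\<Sum>n. c n * l (\<sigma> n) (z k)\<bar> \<le> B" using bounded[OF ca, of \<sigma>] by blast
  have "3 ^ n / 2 \<le> B" for n
  proof -
    let ?a = "\<lambda>m. c m * l (\<sigma> m) (z (\<sigma> n))" and ?N = "N (z (\<sigma> n))"
    have N0: "0 < ?N" using \<sigma>[of n] by (meson less_trans zero_less_numeral zero_less_power)
    have am: "\<bar>?a m\<bar> \<le> (1/3)^m * ?N" for m unfolding abs_mult using ca N by (intro mult_mono) auto
    have sg: "summable (\<lambda>m. (1/3)^m * ?N)" by (intro summable_mult2 summable_geometric) simp
    have sa: "summable ?a" by (rule summable_comparison_test'[OF sg]) (use am in simp)
    have "(\<Sum>m. ?a m) = (\<Sum>m. ?a (m + Suc n)) + (\<Sum>m<Suc n. ?a m)" by (rule suminf_split_initial_segment[OF sa])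
    moreover have "\<bar>\<Sum>m. ?a (m + Suc n)\<bar> \<le> (1/3)^n * ?N / 2"
    proof -
      have sg': "summable (\<lambda>m. (1/3)^(m + Suc n) * ?N)" using sg by (rule summable_ignore_initial_segment)
      have sa': "summable (\<lambda>m. \<bar>?a (m + Suc n)\<bar>)"
        by (rule summable_comparison_test'[OF sg', of 0]) (simp only: real_norm_def abs_idempotent am)
      have "\<bar>\<Sum>m. ?a (m + Suc n)\<bar> \<le> (\<Sum>m. \<bar>?a (m + Suc n)\<bar>)" by (rule summable_rabs[OF sa'])
      also have "\<dots> \<le> (\<Sum>m. (1/3)^(m + Suc n) * ?N)" by (rule suminf_le[OF am sa' sg'])
      also have "\<dots> = (\<Sum>m. (1/3)^m * ((1/3)^Suc n * ?N))" by (simp add: power_add mult_ac)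
      also have "\<dots> = (\<Sum>m. (1/3)^m) * ((1/3)^Suc n * ?N)" by (rule suminf_mult2[symmetric]) (rule summable_geometric, simp)
      also have "(\<Sum>m. (1/3::real)^m) = 3 / 2" by (subst suminf_geometric) auto
      finally show ?thesis by (simp add: mult_ac)
    qed
    moreover have "(1/3)^n * ?N \<le> \<bar>\<Sum>m<Suc n. ?a m\<bar>"
    proof -
      have "?a n = e n c * ((1/3)^n * ?N)" using c[of n] by (simp add: norming)
      then have s: "(\<Sum>m<Suc n. ?a m) = (\<Sum>m<n. ?a m) + e n c * ((1/3)^n * ?N)" by simp
      have "0 \<le> (1/3)^n * ?N" using N0 by simp
      \<comment> \<open>For every real a, one of a + b and a - b has modulus at least b.\<close>
      moreover have "b \<le> \<bar>a + (if b \<le> \<bar>a + b\<bar> then 1 else - 1) * b\<bar>" if "0 \<le> b" for a b :: real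
        using that by (cases "b \<le> \<bar>a + b\<bar>") auto
      ultimately show ?thesis unfolding s e_def by blast
    qed
    ultimately have "(1/3)^n * ?N / 2 \<le> \<bar>\<Sum>m. ?a m\<bar>" by linarith
    also have "\<dots> \<le> B" by (rule B)
    finally have le: "(1/3)^n * ?N / 2 \<le> B" .
    have "(1/3)^n * 9^n \<le> (1/3)^n * ?N" using \<sigma>[of n] by (intro mult_left_mono) auto
    then have "3^n \<le> (1/3)^n * ?N" by (simp add: power_mult_distrib[symmetric])
    with le show ?thesis by linarith
  qed
  moreover obtain n where "2 * B < 3 ^ n" using real_arch_pow[of 3 "2 * B"] by auto
  ultimately show False using not_le by (metis mult.commute less_divide_eq_numeral1(1))
qed

section \<open>Passage from Lebesgue measure on a set to Borel functions on the whole space\<close>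

lemma lebesgue_on_representative:
  fixes S :: "'a::euclidean_space set" and h h' :: "'a \<Rightarrow> real"
  assumes S: "S \<in> sets lebesgue" and h: "h \<in> borel_measurable (lebesgue_on S)" and h': "h' \<in> borel_measurable borel"
    and ae: "AE x in lborel. h' x = indicator S x * h x"
  shows "integrable (lebesgue_on S) h \<longleftrightarrow> integrable lborel h'" and "(LINT x|lebesgue_on S. h x) = (LINT x|lborel. h' x)"
proof -
  have S': "S \<inter> space lebesgue \<in> sets lebesgue" using S by simp
  have m: "(\<lambda>x. indicator S x *\<^sub>R h x) \<in> borel_measurable lebesgue"
    using h borel_measurable_restrict_space_iff[OF S'] by blast
  have m': "h' \<in> borel_measurable lebesgue" using h' by (simp add: measurable_completion)
  have ae': "AE x in lebesgue. indicator S x *\<^sub>R h x = h' x" using AE_completion[OF ae] by eventually_elim simp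
  show "integrable (lebesgue_on S) h \<longleftrightarrow> integrable lborel h'"
    unfolding integrable_restrict_space[OF S'] integrable_cong_AE[OF m m' ae']
    using h' by (intro integrable_completion) simp
  show "(LINT x|lebesgue_on S. h x) = (LINT x|lborel. h' x)"
    unfolding integral_restrict_space[OF S'] integral_cong_AE[OF m m' ae']
    using h' by (intro integral_completion) simp
qed

text \<open>Lebesgue measurable functions agree almost everywhere with Borel ones. The
  representative lives on \<open>lborel\<close>, on whose translation and product structure the
  averages rely.\<close>

lemma lebesgue_on_borel_version:
  fixes S :: "'a::euclidean_space set" and h :: "'a \<Rightarrow> real"
  assumes S: "S \<in> sets lebesgue" and h: "h \<in> borel_measurable (lebesgue_on S)"
  shows "\<exists>h'\<in>borel_measurable borel. AE x in lborel. h' x = indicator S x * h x"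
proof -
  have "(\<lambda>x. indicator S x *\<^sub>R h x) \<in> borel_measurable lebesgue"
    using h S borel_measurable_restrict_space_iff[of S lebesgue h] by simp
  from completion_ex_borel_measurable_real[OF this]
  obtain h' where "h' \<in> borel_measurable lborel" "AE x in lborel. indicator S x *\<^sub>R h x = h' x" by blast
  then show ?thesis by (intro bexI[of _ h']) (auto elim: eventually_mono)
qed

lemma borel_measurable_lebesgue_on: "h \<in> borel_measurable borel \<Longrightarrow> (h :: 'a::euclidean_space \<Rightarrow> real) \<in> borel_measurable (lebesgue_on S)"
  by (intro measurable_restrict_space1 measurable_completion) simp

lemma lspace_lebesgue_on:
  fixes S :: "'a::euclidean_space set" and h h' :: "'a \<Rightarrow> real"
  assumes S: "S \<in> sets lebesgue" and h: "h \<in> borel_measurable (lebesgue_on S)" and h': "h' \<in> borel_measurable borel"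
    and ae: "AE x in lborel. h' x = indicator S x * h x" and s: "0 < s"
  shows "h \<in> lspace (lebesgue_on S) s \<longleftrightarrow> h' \<in> lspace lborel s" and "lnorm (lebesgue_on S) s h = lnorm lborel s h'"
    and "\<theta> \<in> borel_measurable borel \<Longrightarrow> (LINT x|lebesgue_on S. h x * \<theta> x) = (LINT x|lborel. h' x * \<theta> x)"
proof -
  have hp: "(\<lambda>x. \<bar>h x\<bar> powr s) \<in> borel_measurable (lebesgue_on S)" and hp': "(\<lambda>x. \<bar>h' x\<bar> powr s) \<in> borel_measurable borel"
    using h h' by measurable
  have aep: "AE x in lborel. \<bar>h' x\<bar> powr s = indicator S x * \<bar>h x\<bar> powr s"
    using ae by eventually_elim (auto simp: indicator_def)
  note r = lebesgue_on_representative[OF S hp hp' aep]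
  show "h \<in> lspace (lebesgue_on S) s \<longleftrightarrow> h' \<in> lspace lborel s" using r(1) h h' by (simp add: lspace_def)
  show "lnorm (lebesgue_on S) s h = lnorm lborel s h'" using r(2) by (simp add: lnorm_def)
  assume \<theta>: "\<theta> \<in> borel_measurable borel"
  show "(LINT x|lebesgue_on S. h x * \<theta> x) = (LINT x|lborel. h' x * \<theta> x)"
  proof (rule lebesgue_on_representative(2)[OF S])
    show "(\<lambda>x. h x * \<theta> x) \<in> borel_measurable (lebesgue_on S)" using h borel_measurable_lebesgue_on[OF \<theta>] by measurable
    show "(\<lambda>x. h' x * \<theta> x) \<in> borel_measurable borel" using h' \<theta> by measurable
    show "AE x in lborel. h' x * \<theta> x = indicator S x * (h x * \<theta> x)" using ae by eventually_elim simp
  qed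
qed

lemma Lp_space_component:
  assumes F: "F \<in> Lp_space p S" and p: "0 < p" and c: "continuous_on UNIV c" "\<And>A. \<bar>c A\<bar> \<le> norm A"
  shows "(\<lambda>x. c (F x)) \<in> lspace (lebesgue_on S) p" and "lnorm (lebesgue_on S) p (\<lambda>x. c (F x)) \<le> Lp_norm p S F"
proof -
  have m: "F \<in> borel_measurable (lebesgue_on S)" and i: "integrable (lebesgue_on S) (\<lambda>x. norm (F x) powr p)"
    using F by (auto simp: Lp_space_def)
  have n: "(\<lambda>x. norm (F x)) \<in> lspace (lebesgue_on S) p" using m i by (auto simp: lspace_def)
  have cm: "(\<lambda>x. c (F x)) \<in> borel_measurable (lebesgue_on S)"
    by (rule borel_measurable_continuous_on[OF c(1) m])
  show "(\<lambda>x. c (F x)) \<in> lspace (lebesgue_on S) p" "lnorm (lebesgue_on S) p (\<lambda>x. c (F x)) \<le> Lp_norm p S F"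
    using lspace_mono[OF n cm _ p] c(2) by (auto simp: lnorm_def Lp_norm_def)
qed

definition bounded_functional :: "'a measure \<Rightarrow> real \<Rightarrow> (('a \<Rightarrow> real) \<Rightarrow> real) \<Rightarrow> bool" where
  "bounded_functional M s T \<longleftrightarrow> (\<forall>f\<in>lspace M s. \<forall>g\<in>lspace M s. T (\<lambda>x. f x + g x) = T f + T g) \<and>
    (\<forall>c. \<forall>f\<in>lspace M s. T (\<lambda>x. c * f x) = c * T f) \<and> (\<exists>B\<ge>0. \<forall>f\<in>lspace M s. \<bar>T f\<bar> \<le> B * lnorm M s f)"

lemma bounded_functionalI:
  assumes "\<And>f g. f \<in> lspace M s \<Longrightarrow> g \<in> lspace M s \<Longrightarrow> T (\<lambda>x. f x + g x) = T f + T g"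
    "\<And>c f. f \<in> lspace M s \<Longrightarrow> T (\<lambda>x. c * f x) = c * T f"
    "\<And>f. f \<in> lspace M s \<Longrightarrow> \<bar>T f\<bar> \<le> B * lnorm M s f" "0 \<le> B"
  shows "bounded_functional M s T"
  unfolding bounded_functional_def using assms by blast

text \<open>A matrix entry is bounded by the Frobenius norm, so scalar functionals of an entry are
  admissible on pairs; entries inherit weak convergence in this way.\<close>

lemma X_dual_component:
  fixes S :: "(real^'n) set"
  assumes T: "bounded_functional (lebesgue_on S) s T" and s: "0 < s"
  shows "(\<lambda>z. T (\<lambda>x. fst z x $ i $ j)) \<in> X_dual s q S" and "(\<lambda>z. T (\<lambda>x. snd z x $ i $ j)) \<in> X_dual p s S"
proof -
  have add: "T (\<lambda>x. f x + g x) = T f + T g" if "f \<in> lspace (lebesgue_on S) s" "g \<in> lspace (lebesgue_on S) s" for f g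
    using T that by (simp add: bounded_functional_def)
  have cm: "T (\<lambda>x. c * f x) = c * T f" if "f \<in> lspace (lebesgue_on S) s" for c f
    using T that by (simp add: bounded_functional_def)
  obtain B where B: "0 \<le> B" and T3: "\<And>f. f \<in> lspace (lebesgue_on S) s \<Longrightarrow> \<bar>T f\<bar> \<le> B * lnorm (lebesgue_on S) s f"
    using T unfolding bounded_functional_def by blast
  have c: "continuous_on UNIV (\<lambda>A::real^'n^'n. A $ i $ j)" by (intro continuous_intros)
  note C = Lp_space_component[OF _ s c abs_component_le_norm]
  have N: "0 \<le> Lp_norm p S f" for p and f :: "real^'n \<Rightarrow> real^'n^'n" by (simp add: Lp_norm_def)
  have le: "\<bar>T (\<lambda>x. F x $ i $ j)\<bar> \<le> B * (Lp_norm s S F + Lp_norm q S P)" "\<bar>T (\<lambda>x. F x $ i $ j)\<bar> \<le> B * (Lp_norm q S P + Lp_norm s S F)"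
    if "F \<in> Lp_space s S" for F P :: "real^'n \<Rightarrow> real^'n^'n" and q
  proof -
    have "\<bar>T (\<lambda>x. F x $ i $ j)\<bar> \<le> B * lnorm (lebesgue_on S) s (\<lambda>x. F x $ i $ j)" by (rule T3[OF C(1)[OF that]])
    also have "\<dots> \<le> B * (Lp_norm s S F + Lp_norm q S P)" using C(2)[OF that] N[of q P] B by (intro mult_left_mono) auto
    finally show "\<bar>T (\<lambda>x. F x $ i $ j)\<bar> \<le> B * (Lp_norm s S F + Lp_norm q S P)" .
    then show "\<bar>T (\<lambda>x. F x $ i $ j)\<bar> \<le> B * (Lp_norm q S P + Lp_norm s S F)" by (simp add: add.commute)
  qed
  show "(\<lambda>z. T (\<lambda>x. fst z x $ i $ j)) \<in> X_dual s q S"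
    unfolding X_dual_def X_space_def X_norm_def using add[OF C(1) C(1)] cm[OF C(1)] le
    by (auto simp: vector_add_component vector_scaleR_component intro!: exI[of _ B])
  show "(\<lambda>z. T (\<lambda>x. snd z x $ i $ j)) \<in> X_dual p s S"
    unfolding X_dual_def X_space_def X_norm_def using add[OF C(1) C(1)] cm[OF C(1)] le
    by (auto simp: vector_add_component vector_scaleR_component intro!: exI[of _ B])
qed

text \<open>Both scalar components of a weakly convergent sequence are covered by one statement: \<open>\<pi>\<close> below
  is a projection \<open>z \<mapsto> fst z x $ i $ j\<close> or \<open>z \<mapsto> snd z x $ i $ j\<close>.\<close>

lemma weakly_convergent_component:
  fixes S :: "(real^'n) set" and \<pi> :: "'z \<Rightarrow> real^'n \<Rightarrow> real"
  assumes st: "conjugate s t"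
    and \<pi>: "\<And>k. \<pi> (Z k) \<in> lspace (lebesgue_on S) s"
    and conv: "\<And>T. bounded_functional (lebesgue_on S) s T \<Longrightarrow> (\<lambda>k. T (\<pi> (Z k))) \<longlonglongrightarrow> T (\<pi> z)"
  shows "\<exists>C. \<forall>k. lnorm (lebesgue_on S) s (\<pi> (Z k)) \<le> C"
    and "g \<in> lspace (lebesgue_on S) t \<Longrightarrow> (\<lambda>k. LINT x|lebesgue_on S. \<pi> (Z k) x * g x) \<longlonglongrightarrow> (LINT x|lebesgue_on S. \<pi> z x * g x)"
proof -
  let ?M = "lebesgue_on S"
  note H = Holder_integrable[OF st]
  have add: "(LINT x|?M. (f x + h x) * g x) = (LINT x|?M. f x * g x) + (LINT x|?M. h x * g x)"
    if "f \<in> lspace ?M s" "h \<in> lspace ?M s" "g \<in> lspace ?M t" for f h g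
    using H[OF that(1,3)] H[OF that(2,3)] by (simp add: distrib_right)
  have cm: "(LINT x|?M. (c * f x) * g x) = c * (LINT x|?M. f x * g x)" for c and f g :: "real^'n \<Rightarrow> real" by (simp add: mult.assoc)
  show "(\<lambda>k. LINT x|?M. \<pi> (Z k) x * g x) \<longlonglongrightarrow> (LINT x|?M. \<pi> z x * g x)" if g: "g \<in> lspace ?M t"
  proof (rule conv, rule bounded_functionalI[where B = "lnorm ?M t g"])
    show "\<bar>LINT x|?M. f x * g x\<bar> \<le> lnorm ?M t g * lnorm ?M s f" if "f \<in> lspace ?M s" for f
      using Holder_le[OF st that g] by (simp add: mult.commute)
  qed (use add[OF _ _ g] cm in auto)
  have "\<forall>k. \<exists>g\<in>lspace ?M t. lnorm ?M t g \<le> 1 \<and> (LINT x|?M. \<pi> (Z k) x * g x) = lnorm ?M s (\<pi> (Z k))"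
    using norming_functional[OF st \<pi>] by blast
  from choice[OF this[unfolded Bex_def]] obtain g where
    "\<forall>k. g k \<in> lspace ?M t \<and> lnorm ?M t (g k) \<le> 1 \<and> (LINT x|?M. \<pi> (Z k) x * g k x) = lnorm ?M s (\<pi> (Z k))" by (elim exE)
  then have g: "\<And>k. g k \<in> lspace ?M t" "\<And>k. lnorm ?M t (g k) \<le> 1" "\<And>k. (LINT x|?M. \<pi> (Z k) x * g k x) = lnorm ?M s (\<pi> (Z k))"
    by simp_all
  have gle: "\<bar>LINT x|?M. f x * g k x\<bar> \<le> lnorm ?M s f" if "f \<in> lspace ?M s" for f k
    using Holder_le[OF st that g(1)[of k]] mult_left_mono[OF g(2)[of k] lnorm_nonneg[of ?M s f]] by simp
  show "\<exists>C. \<forall>k. lnorm ?M s (\<pi> (Z k)) \<le> C"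
  proof (rule gliding_hump[where l = "\<lambda>n f. LINT x|?M. f x * g n x" and z = "\<lambda>k. \<pi> (Z k)" and N = "lnorm ?M s"])
    fix c :: "nat \<Rightarrow> real" and \<sigma> :: "nat \<Rightarrow> nat" assume c: "\<And>n. \<bar>c n\<bar> \<le> (1/3)^n"
    \<comment> \<open>The series of the gliding hump is itself a bounded functional, of norm at most
      3/2, the sum of the powers of 1/3. Weak convergence therefore bounds its values along the
      sequence.\<close>
    define T where "T f = (\<Sum>n. c n * (LINT x|?M. f x * g (\<sigma> n) x))" for f
    have am: "\<bar>c n * (LINT x|?M. f x * g (\<sigma> n) x)\<bar> \<le> (1/3)^n * lnorm ?M s f" if "f \<in> lspace ?M s" for f n
      unfolding abs_mult using c gle[OF that] by (intro mult_mono) auto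
    have sg: "summable (\<lambda>n. (1/3)^n * r)" for r :: real by (intro summable_mult2 summable_geometric) simp
    have sa: "summable (\<lambda>n. \<bar>c n * (LINT x|?M. f x * g (\<sigma> n) x)\<bar>)" if "f \<in> lspace ?M s" for f
      by (rule summable_comparison_test'[OF sg]) (use am[OF that] in simp)
    note sb = summable_rabs_cancel[OF sa]
    have "(\<lambda>k. T (\<pi> (Z k))) \<longlonglongrightarrow> T (\<pi> z)"
    proof (rule conv, rule bounded_functionalI[where B = "3 / 2"])
      show "T (\<lambda>x. f x + h x) = T f + T h" if "f \<in> lspace ?M s" "h \<in> lspace ?M s" for f h
        unfolding T_def add[OF that g(1)] distrib_left by (rule suminf_add[OF sb[OF that(1)] sb[OF that(2)], symmetric])
      show "T (\<lambda>x. a * f x) = a * T f" if "f \<in> lspace ?M s" for a f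
        unfolding T_def cm mult.left_commute[of _ a] by (rule suminf_mult[OF sb[OF that]])
      show "\<bar>T f\<bar> \<le> 3 / 2 * lnorm ?M s f" if f: "f \<in> lspace ?M s" for f
      proof -
        have "\<bar>T f\<bar> \<le> (\<Sum>n. \<bar>c n * (LINT x|?M. f x * g (\<sigma> n) x)\<bar>)" unfolding T_def by (rule summable_rabs[OF sa[OF f]])
        also have "\<dots> \<le> (\<Sum>n. (1/3)^n * lnorm ?M s f)" by (rule suminf_le[OF am[OF f] sa[OF f] sg])
        also have "\<dots> = (\<Sum>n. (1/3)^n) * lnorm ?M s f" by (rule suminf_mult2[symmetric]) (rule summable_geometric, simp)
        also have "(\<Sum>n. (1/3::real)^n) = 3 / 2" by (subst suminf_geometric) auto
        finally show ?thesis .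
      qed
    qed simp
    then have "Bseq (\<lambda>k. T (\<pi> (Z k)))" by (intro convergent_imp_Bseq convergentI)
    then show "\<exists>B. \<forall>k. \<bar>\<Sum>n. c n * (LINT x|?M. \<pi> (Z k) x * g (\<sigma> n) x)\<bar> \<le> B"
      unfolding T_def[symmetric] by (auto simp: Bseq_def)
  qed (use gle[OF \<pi>] g(3) in auto)
qed

section \<open>Test functions in the dual Sobolev norms\<close>

lemma test_outside: "\<phi> \<in> test_functions S \<Longrightarrow> x \<notin> S \<Longrightarrow> \<phi> x = 0"
  unfolding test_functions_iff by blast

lemma test_lebesgue_on:
  assumes S: "S \<in> sets lebesgue" and h: "h \<in> borel_measurable borel" "\<And>x. x \<notin> S \<Longrightarrow> h x = (0::real)"
  shows "integrable (lebesgue_on S) h \<longleftrightarrow> integrable lborel h" and "(LINT x|lebesgue_on S. h x) = (LINT x|lborel. h x)"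
proof -
  have "AE x in lborel. h x = indicator S x * h x" using h(2) by (auto simp: indicator_def)
  note r = lebesgue_on_representative[OF S borel_measurable_lebesgue_on[OF h(1)] h(1) this]
  show "integrable (lebesgue_on S) h \<longleftrightarrow> integrable lborel h" "(LINT x|lebesgue_on S. h x) = (LINT x|lborel. h x)" by (fact r)+
qed

text \<open>A test function is its own approximating sequence. The Euclidean norm of its gradient is
  below the sum of the moduli of the components, hence the comparison with
  \<open>dnorm\<close>.\<close>

lemma test_function_W0:
  fixes \<phi> :: "real^'n \<Rightarrow> real"
  assumes \<phi>: "\<phi> \<in> test_functions S" and S: "S \<in> sets lebesgue" and r: "1 < r"
  shows "(\<phi>, grad \<phi>) \<in> W0_space r S" and "W1_norm r S (\<phi>, grad \<phi>) \<le> lnorm lborel r \<phi> + dnorm r \<phi>"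
proof -
  have r0: "0 < r" using r by simp
  have pl: "pd i \<phi> \<in> lspace lborel r" for i by (rule test_lspace[OF test_pd[OF \<phi>] r0])
  have gm: "grad \<phi> \<in> borel_measurable borel"
  proof (rule borel_measurable_continuous_onI)
    have "continuous_on UNIV (\<lambda>x. \<chi> i. pd i \<phi> x)"
      by (intro continuous_intros smooth_continuous[OF smooth_pd[OF test_smooth[OF \<phi>]]])
    then show "continuous_on UNIV (grad \<phi>)" by (simp add: pd_def)
  qed
  have gm': "grad \<phi> \<in> borel_measurable (lebesgue_on S)"
    by (intro measurable_restrict_space1 measurable_completion) (use gm in simp)
  have g0: "grad \<phi> x = 0" if "x \<notin> S" for x
    using test_outside[OF test_pd[OF \<phi>] that] by (simp add: vec_eq_iff pd_def)
  have sl: "(\<lambda>x. \<Sum>i\<in>UNIV. \<bar>pd i \<phi> x\<bar>) \<in> lspace lborel r"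
    by (intro lspace_sum lspace_mono(1)[OF pl] r0) (use test_measurable[OF test_pd[OF \<phi>]] in auto)
  have nm: "(\<lambda>x. norm (grad \<phi> x)) \<in> borel_measurable lborel" using gm by simp
  have le: "AE x in lborel. \<bar>norm (grad \<phi> x)\<bar> \<le> \<bar>\<Sum>i\<in>UNIV. \<bar>pd i \<phi> x\<bar>\<bar>"
  proof (rule AE_I2)
    fix x
    show "\<bar>norm (grad \<phi> x)\<bar> \<le> \<bar>\<Sum>i\<in>UNIV. \<bar>pd i \<phi> x\<bar>\<bar>"
      using norm_le_l1_cart[of "grad \<phi> x"] by (simp add: pd_def sum_nonneg)
  qed
  have nl: "(\<lambda>x. norm (grad \<phi> x)) \<in> lspace lborel r" "lnorm lborel r (\<lambda>x. norm (grad \<phi> x)) \<le> lnorm lborel r (\<lambda>x. \<Sum>i\<in>UNIV. \<bar>pd i \<phi> x\<bar>)"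
    by (rule lspace_mono[OF sl nm le r0])+
  note nl(2)
  also have "lnorm lborel r (\<lambda>x. \<Sum>i\<in>UNIV. \<bar>pd i \<phi> x\<bar>) \<le> (\<Sum>i\<in>UNIV. lnorm lborel r (\<lambda>x. \<bar>pd i \<phi> x\<bar>))"
    by (rule lnorm_triangle_sum[OF _ r]) (rule lspace_mono(1)[OF pl _ _ r0], use test_measurable[OF test_pd[OF \<phi>]] in auto)
  finally have nd: "lnorm lborel r (\<lambda>x. norm (grad \<phi> x)) \<le> dnorm r \<phi>" by (simp add: dnorm_def lnorm_def)
  have p1: "(\<lambda>x. norm (\<phi> x) powr r) \<in> borel_measurable borel" "(\<lambda>x. norm (grad \<phi> x) powr r) \<in> borel_measurable borel"
    using test_measurable[OF \<phi>] gm by measurable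
  have p2: "norm (\<phi> x) powr r = 0" "norm (grad \<phi> x) powr r = 0" if "x \<notin> S" for x
    using test_outside[OF \<phi> that] g0[OF that] by simp_all
  have L1: "\<phi> \<in> Lp_space r S" "Lp_norm r S \<phi> = lnorm lborel r \<phi>"
    using test_lebesgue_on[OF S p1(1) p2(1)] lspace_integrable[OF test_lspace[OF \<phi> r0]] borel_measurable_lebesgue_on[OF test_measurable[OF \<phi>]]
    by (simp_all add: Lp_space_def Lp_norm_def lnorm_def)
  have L2: "grad \<phi> \<in> Lp_space r S" "Lp_norm r S (grad \<phi>) = lnorm lborel r (\<lambda>x. norm (grad \<phi> x))"
    using test_lebesgue_on[OF S p1(2) p2(2)] lspace_integrable[OF nl(1)] gm'
    by (simp_all add: Lp_space_def Lp_norm_def lnorm_def)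
  have w: "has_weak_grad S \<phi> (grad \<phi>)"
    unfolding has_weak_grad_def pd_def[symmetric]
  proof (intro ballI allI)
    fix \<psi> and i :: 'n assume \<psi>: "\<psi> \<in> test_functions S"
    have "(LINT x|lebesgue_on S. \<phi> x * pd i \<psi> x) = (LINT x|lborel. \<phi> x * pd i \<psi> x)"
      using test_measurable[OF \<phi>] test_measurable[OF test_pd[OF \<psi>]] test_outside[OF \<phi>] by (intro test_lebesgue_on S) auto
    moreover have "(LINT x|lebesgue_on S. pd i \<phi> x * \<psi> x) = (LINT x|lborel. pd i \<phi> x * \<psi> x)"
      using test_measurable[OF \<psi>] test_measurable[OF test_pd[OF \<phi>]] test_outside[OF \<psi>] by (intro test_lebesgue_on S) auto
    ultimately show "(LINT x|lebesgue_on S. \<phi> x * pd i \<psi> x) = - (LINT x|lebesgue_on S. pd i \<phi> x * \<psi> x)"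
      using integral_by_parts_pd[OF test_TF[OF \<phi>] test_smooth[OF \<psi>], of i] by simp
  qed
  have "(\<lambda>m::nat. Lp_norm r S (\<lambda>x. \<phi> x - \<phi> x)) \<longlonglongrightarrow> 0" "(\<lambda>m::nat. Lp_norm r S (\<lambda>x. grad \<phi> x - grad \<phi> x)) \<longlonglongrightarrow> 0"
    by (simp_all add: Lp_norm_def)
  then show "(\<phi>, grad \<phi>) \<in> W0_space r S"
    unfolding W0_space_def using L1(1) L2(1) w \<phi> by (auto intro!: exI[of _ "\<lambda>_. \<phi>"])
  show "W1_norm r S (\<phi>, grad \<phi>) \<le> lnorm lborel r \<phi> + dnorm r \<phi>"
    using L1(2) L2(2) nd by (simp add: W1_norm_def)
qed

text \<open>The dual norm is a supremum over the unit ball, and homogeneity extends the bound to all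
  test functions. The form A is compared with T only in modulus, since the distributional derivative
  carries a minus sign.\<close>

lemma dual_W0_tendsto_test_functions:
  fixes S :: "(real^'n) set"
  assumes conv: "dual_W0_tendsto r S T T\<^sub>0" and S: "S \<in> sets lebesgue" and r: "1 < r" and \<eta>: "0 < \<eta>"
    and A: "\<And>m \<phi>. \<phi> \<in> test_functions S \<Longrightarrow> \<bar>A m \<phi>\<bar> = \<bar>T m (\<phi>, grad \<phi>) - T\<^sub>0 (\<phi>, grad \<phi>)\<bar>"
    and scale: "\<And>m c \<phi>. \<phi> \<in> test_functions S \<Longrightarrow> A m (\<lambda>x. c * \<phi> x) = c * A m \<phi>"
  shows "\<forall>\<^sub>F m in sequentially. \<forall>\<phi>\<in>test_functions S. \<bar>A m \<phi>\<bar> \<le> \<eta> * (lnorm lborel r \<phi> + dnorm r \<phi>)"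
proof -
  have "\<forall>\<^sub>F m in sequentially. dual_W0_norm r S (\<lambda>v. T m v - T\<^sub>0 v) < ennreal \<eta>"
    using conv \<eta> unfolding dual_W0_tendsto_def by (intro order_tendstoD) auto
  then show ?thesis
  proof (rule eventually_mono, intro ballI)
    fix m and \<phi> :: "real^'n \<Rightarrow> real"
    assume lt: "dual_W0_norm r S (\<lambda>v. T m v - T\<^sub>0 v) < ennreal \<eta>" and \<phi>: "\<phi> \<in> test_functions S"
    let ?n = "\<lambda>\<phi>. lnorm lborel r \<phi> + dnorm r \<phi>"
    \<comment> \<open>Scaling by some c strictly above the norm avoids dividing by a norm that may
      vanish; the bound for all such c gives the claim.\<close>
    have "\<bar>A m \<phi>\<bar> \<le> \<eta> * c" if c: "?n \<phi> < c" for c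
    proof -
      have c0: "0 < c" using c lnorm_nonneg[of lborel r \<phi>] dnorm_nonneg[of r \<phi>] by linarith
      let ?\<psi> = "\<lambda>x. 1 / c * \<phi> x"
      have \<psi>: "?\<psi> \<in> test_functions S" by (rule test_cmult[OF \<phi>])
      have pd: "pd i ?\<psi> = (\<lambda>x. 1 / c * pd i \<phi> x)" for i
        by (rule pd_smooth(3)[OF test_smooth[OF \<phi>] test_smooth[OF \<phi>]])
      have r0: "0 < r" using r by simp
      have "?n ?\<psi> = 1 / c * ?n \<phi>"
        using c0 by (simp only: dnorm_def pd lnorm_cmult[OF r0] distrib_left sum_distrib_left) simp
      also have "\<dots> \<le> 1" using c c0 by simp
      finally have "W1_norm r S (?\<psi>, grad ?\<psi>) \<le> 1" using test_function_W0(2)[OF \<psi> S r] by linarith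
      then have "ennreal \<bar>T m (?\<psi>, grad ?\<psi>) - T\<^sub>0 (?\<psi>, grad ?\<psi>)\<bar> \<le> dual_W0_norm r S (\<lambda>v. T m v - T\<^sub>0 v)"
        unfolding dual_W0_norm_def using test_function_W0(1)[OF \<psi> S r] by (intro SUP_upper2[OF _ order_refl]) auto
      then have "ennreal \<bar>A m ?\<psi>\<bar> < ennreal \<eta>" unfolding A[OF \<psi>] using lt by (rule le_less_trans)
      then have "\<bar>A m ?\<psi>\<bar> < \<eta>" using \<eta> by (simp add: ennreal_less_iff)
      then show ?thesis unfolding scale[OF \<phi>] using c0 by (simp add: abs_mult field_simps)
    qed
    note b = this
    have "\<bar>A m \<phi>\<bar> / \<eta> \<le> c" if "?n \<phi> < c" for c using b[OF that] \<eta> by (simp add: pos_divide_le_eq mult.commute)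
    then have "\<bar>A m \<phi>\<bar> / \<eta> \<le> ?n \<phi>" by (rule dense_ge)
    then show "\<bar>A m \<phi>\<bar> \<le> \<eta> * ?n \<phi>" using \<eta> by (simp add: field_simps)
  qed
qed

text \<open>Collects for one entry all that the whole-space arguments consume: the difference from
  the limit as a Borel function with its bound, its weak nullity, the link to the original pairings,
  and its values on S.\<close>

lemma weakly_convergent_borel_version:
  fixes S :: "(real^'n) set" and g :: "nat \<Rightarrow> real^'n \<Rightarrow> real"
  assumes S: "S \<in> sets lebesgue" and st: "conjugate s t"
    and g: "\<And>k. g k \<in> lspace (lebesgue_on S) s" and g0: "g0 \<in> lspace (lebesgue_on S) s"
    and bd: "\<exists>C. \<forall>k. lnorm (lebesgue_on S) s (g k) \<le> C"
    and conv: "\<And>\<theta>. \<theta> \<in> lspace (lebesgue_on S) t \<Longrightarrow> (\<lambda>k. LINT x|lebesgue_on S. g k x * \<theta> x) \<longlonglongrightarrow> (LINT x|lebesgue_on S. g0 x * \<theta> x)"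
  shows "\<exists>f C. (\<forall>k. f k \<in> lspace lborel s) \<and> (\<forall>k. lnorm lborel s (f k) \<le> C) \<and>
    (\<forall>\<theta>\<in>TF. (\<lambda>k. LINT x|lborel. f k x * \<theta> x) \<longlonglongrightarrow> 0) \<and>
    (\<forall>k. \<forall>\<theta>\<in>TF. (LINT x|lborel. f k x * \<theta> x) = (LINT x|lebesgue_on S. g k x * \<theta> x) - (LINT x|lebesgue_on S. g0 x * \<theta> x)) \<and>
    (\<forall>k. AE x in lborel. x \<in> S \<longrightarrow> f k x = g k x - g0 x)"
proof -
  let ?M = "lebesgue_on S"
  have s: "0 < s" "1 < s" "0 < t" using conjugateD[OF st] by simp_all
  have d: "(\<lambda>x. g k x - g0 x) \<in> lspace ?M s" for k by (rule lspace_diff[OF g g0 s(1)])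
  have dm: "(\<lambda>x. g k x - g0 x) \<in> borel_measurable ?M" for k by (rule lspace_measurable[OF d])
  have "\<forall>k. \<exists>h'\<in>borel_measurable borel. AE x in lborel. h' x = indicator S x * (g k x - g0 x)"
    using lebesgue_on_borel_version[OF S dm] by blast
  from choice[OF this[unfolded Bex_def]] obtain f where
    "\<forall>k. f k \<in> borel_measurable borel \<and> (AE x in lborel. f k x = indicator S x * (g k x - g0 x))" by (elim exE)
  then have f: "f k \<in> borel_measurable borel" "AE x in lborel. f k x = indicator S x * (g k x - g0 x)" for k by simp_all
  note L = lspace_lebesgue_on[OF S dm f s(1)]
  obtain C where C: "\<And>k. lnorm ?M s (g k) \<le> C" using bd by blast
  have b: "lnorm lborel s (f k) \<le> C + lnorm ?M s g0" for k
    unfolding L(2)[symmetric] using lnorm_triangle_diff[OF g g0 s(2), of k] C[of k] by linarith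
  have \<theta>l: "\<theta> \<in> lspace ?M t" if "\<theta> \<in> TF" for \<theta>
  proof -
    have m: "\<theta> \<in> borel_measurable borel" by (rule test_measurable[OF that])
    have i: "integrable lebesgue (\<lambda>x. \<bar>\<theta> x\<bar> powr t)"
      using lspace_integrable[OF test_lspace[OF that s(3)]] m by (subst integrable_completion) auto
    have "integrable ?M (\<lambda>x. \<bar>\<theta> x\<bar> powr t)"
      by (subst integrable_restrict_space) (use S integrable_mult_indicator[OF S i] in simp_all)
    then show ?thesis using borel_measurable_lebesgue_on[OF m] by (rule lspaceI[rotated])
  qed
  have e: "(LINT x|lborel. f k x * \<theta> x) = (LINT x|?M. g k x * \<theta> x) - (LINT x|?M. g0 x * \<theta> x)" if \<theta>: "\<theta> \<in> TF" for \<theta> k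
    unfolding L(3)[OF test_measurable[OF \<theta>], symmetric]
    using Holder_integrable[OF st g \<theta>l[OF \<theta>], of k] Holder_integrable[OF st g0 \<theta>l[OF \<theta>]] by (simp add: left_diff_distrib)
  have "(\<lambda>k. LINT x|lborel. f k x * \<theta> x) \<longlonglongrightarrow> 0" if \<theta>: "\<theta> \<in> TF" for \<theta>
    unfolding e[OF \<theta>] using tendsto_diff[OF conv[OF \<theta>l[OF \<theta>]] tendsto_const, of "LINT x|?M. g0 x * \<theta> x"] by simp
  moreover have "AE x in lborel. x \<in> S \<longrightarrow> f k x = g k x - g0 x" for k using f(2)[of k] by eventually_elim auto
  moreover have "f k \<in> lspace lborel s" for k using L(1) d by blast
  ultimately show ?thesis using b e by (intro exI[of _ f] exI[of _ "C + lnorm ?M s g0"]) simp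
qed

section \<open>Weak limits in the data set\<close>

lemma X_weakly_tendsto_fst:
  fixes S :: "(real^'n) set"
  assumes conv: "X_weakly_tendsto s q S Z z" and st: "conjugate s t"
  shows "\<exists>C. \<forall>k. lnorm (lebesgue_on S) s (\<lambda>x. fst (Z k) x $ i $ j) \<le> C"
    and "\<theta> \<in> lspace (lebesgue_on S) t \<Longrightarrow> (\<lambda>k. LINT x|lebesgue_on S. fst (Z k) x $ i $ j * \<theta> x) \<longlonglongrightarrow> (LINT x|lebesgue_on S. fst z x $ i $ j * \<theta> x)"
    and "(\<lambda>x. fst (Z k) x $ i $ j) \<in> lspace (lebesgue_on S) s" and "(\<lambda>x. fst z x $ i $ j) \<in> lspace (lebesgue_on S) s"
proof -
  have s: "0 < s" using conjugateD[OF st] by simp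
  have c: "continuous_on UNIV (\<lambda>A::real^'n^'n. A $ i $ j)" by (intro continuous_intros)
  show l: "(\<lambda>x. fst (Z k) x $ i $ j) \<in> lspace (lebesgue_on S) s" for k
    using conv by (intro Lp_space_component(1)[OF _ s c abs_component_le_norm]) (auto simp: X_weakly_tendsto_def X_space_def mem_Times_iff)
  show "(\<lambda>x. fst z x $ i $ j) \<in> lspace (lebesgue_on S) s"
    using conv by (intro Lp_space_component(1)[OF _ s c abs_component_le_norm]) (auto simp: X_weakly_tendsto_def X_space_def mem_Times_iff)
  have l_conv: "(\<lambda>k. l (Z k)) \<longlonglongrightarrow> l z" if "l \<in> X_dual s q S" for l
    using conv that by (simp add: X_weakly_tendsto_def)
  have d: "(\<lambda>k. T (\<lambda>x. fst (Z k) x $ i $ j)) \<longlonglongrightarrow> T (\<lambda>x. fst z x $ i $ j)"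
    if "bounded_functional (lebesgue_on S) s T" for T
    by (rule l_conv[OF X_dual_component(1)[OF that s]])
  note w = weakly_convergent_component[where \<pi> = "\<lambda>z x. fst z x $ i $ j" and Z = Z and z = z, OF st l d]
  show "\<exists>C. \<forall>k. lnorm (lebesgue_on S) s (\<lambda>x. fst (Z k) x $ i $ j) \<le> C" by (rule w(1))
  show "(\<lambda>k. LINT x|lebesgue_on S. fst (Z k) x $ i $ j * \<theta> x) \<longlonglongrightarrow> (LINT x|lebesgue_on S. fst z x $ i $ j * \<theta> x)"
    if "\<theta> \<in> lspace (lebesgue_on S) t" by (rule w(2)[OF _ that])
qed

lemma X_weakly_tendsto_snd:
  fixes S :: "(real^'n) set"
  assumes conv: "X_weakly_tendsto p s S Z z" and st: "conjugate s t"
  shows "\<exists>C. \<forall>k. lnorm (lebesgue_on S) s (\<lambda>x. snd (Z k) x $ i $ j) \<le> C"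
    and "\<theta> \<in> lspace (lebesgue_on S) t \<Longrightarrow> (\<lambda>k. LINT x|lebesgue_on S. snd (Z k) x $ i $ j * \<theta> x) \<longlonglongrightarrow> (LINT x|lebesgue_on S. snd z x $ i $ j * \<theta> x)"
    and "(\<lambda>x. snd (Z k) x $ i $ j) \<in> lspace (lebesgue_on S) s" and "(\<lambda>x. snd z x $ i $ j) \<in> lspace (lebesgue_on S) s"
proof -
  have s: "0 < s" using conjugateD[OF st] by simp
  have c: "continuous_on UNIV (\<lambda>A::real^'n^'n. A $ i $ j)" by (intro continuous_intros)
  show l: "(\<lambda>x. snd (Z k) x $ i $ j) \<in> lspace (lebesgue_on S) s" for k
    using conv by (intro Lp_space_component(1)[OF _ s c abs_component_le_norm]) (auto simp: X_weakly_tendsto_def X_space_def mem_Times_iff)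
  show "(\<lambda>x. snd z x $ i $ j) \<in> lspace (lebesgue_on S) s"
    using conv by (intro Lp_space_component(1)[OF _ s c abs_component_le_norm]) (auto simp: X_weakly_tendsto_def X_space_def mem_Times_iff)
  have l_conv: "(\<lambda>k. l (Z k)) \<longlonglongrightarrow> l z" if "l \<in> X_dual p s S" for l
    using conv that by (simp add: X_weakly_tendsto_def)
  have d: "(\<lambda>k. T (\<lambda>x. snd (Z k) x $ i $ j)) \<longlonglongrightarrow> T (\<lambda>x. snd z x $ i $ j)"
    if "bounded_functional (lebesgue_on S) s T" for T
    by (rule l_conv[OF X_dual_component(2)[OF that s]])
  note w = weakly_convergent_component[where \<pi> = "\<lambda>z x. snd z x $ i $ j" and Z = Z and z = z, OF st l d]
  show "\<exists>C. \<forall>k. lnorm (lebesgue_on S) s (\<lambda>x. snd (Z k) x $ i $ j) \<le> C" by (rule w(1))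
  show "(\<lambda>k. LINT x|lebesgue_on S. snd (Z k) x $ i $ j * \<theta> x) \<longlonglongrightarrow> (LINT x|lebesgue_on S. snd z x $ i $ j * \<theta> x)"
    if "\<theta> \<in> lspace (lebesgue_on S) t" by (rule w(2)[OF _ that])
qed

text \<open>Integrability is part of the notion so that linear combinations can be integrated term
  by term.\<close>

definition null_seq :: "('a::euclidean_space \<Rightarrow> real) \<Rightarrow> (nat \<Rightarrow> 'a \<Rightarrow> real) \<Rightarrow> bool" where
  "null_seq w h \<longleftrightarrow> (\<forall>k. integrable lborel (\<lambda>x. w x * h k x)) \<and> (\<lambda>k. LINT x|lborel. w x * h k x) \<longlonglongrightarrow> 0"

lemma null_seq_add: "null_seq w h \<Longrightarrow> null_seq w g \<Longrightarrow> null_seq w (\<lambda>k x. h k x + g k x)"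
  using tendsto_add[of "\<lambda>k. LINT x|lborel. w x * h k x" 0 sequentially "\<lambda>k. LINT x|lborel. w x * g k x" 0]
  by (simp add: null_seq_def distrib_left)

lemma null_seq_cmult: "null_seq w h \<Longrightarrow> null_seq w (\<lambda>k x. c * h k x)"
  using tendsto_mult_right_zero[of "\<lambda>k. LINT x|lborel. w x * h k x" sequentially c]
  by (simp add: null_seq_def mult.left_commute[of _ c])

lemma null_seq_multc: "null_seq w h \<Longrightarrow> null_seq w (\<lambda>k x. h k x * c)"
  using null_seq_cmult[of w h c] by (simp add: mult.commute)

lemma null_seq_diff: "null_seq w h \<Longrightarrow> null_seq w g \<Longrightarrow> null_seq w (\<lambda>k x. h k x - g k x)"
  using null_seq_add[OF _ null_seq_cmult[of w g "- 1"], of h] by simp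

lemma null_seq_zero: "null_seq w (\<lambda>k x. 0)"
  by (simp add: null_seq_def)

lemma null_seq_sum: "(\<And>i. i \<in> I \<Longrightarrow> null_seq w (h i)) \<Longrightarrow> null_seq w (\<lambda>k x. \<Sum>i\<in>I. h i k x)"
  by (induction I rule: infinite_finite_induct) (auto intro: null_seq_add null_seq_zero)

text \<open>The weight \<kappa>^4 is split by degree: every entry of f takes one \<kappa> and
  becomes part of an almost-gradient. What remains, \<kappa>^3 for the div-curl product, \<kappa>^2
  for the minors and \<kappa> for the determinant, is the test function in the respective
  limit.\<close>

lemma null_Lagrangians:
  fixes f p :: "3 \<Rightarrow> 3 \<Rightarrow> nat \<Rightarrow> real^3 \<Rightarrow> real"
  assumes cn: "\<And>i. curl_null S (\<lambda>k j. f i j k) (C i)"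
    and p: "\<And>i j k. p i j k \<in> lspace lborel (6/5)" "\<And>i j k. lnorm lborel (6/5) (p i j k) \<le> D"
    and pw: "\<And>i j \<theta>. \<theta> \<in> TF \<Longrightarrow> (\<lambda>k. LINT x|lborel. p i j k x * \<theta> x) \<longlonglongrightarrow> 0"
    and divg: "\<And>i \<eta>. 0 < \<eta> \<Longrightarrow> \<forall>\<^sub>F k in sequentially. \<forall>v\<in>test_functions S.
      \<bar>LINT x|lborel. (\<Sum>j\<in>UNIV. p i j k x * pd j v x)\<bar> \<le> \<eta> * (lnorm lborel 6 v + dnorm 6 v)"
    and \<kappa>: "\<kappa> \<in> test_functions S"
  defines "w \<equiv> \<lambda>x. \<kappa> x ^ 4" and "F \<equiv> \<lambda>k x. (\<chi> i j. f i j k x) :: real^3^3" and "P \<equiv> \<lambda>k x. (\<chi> i j. p i j k x) :: real^3^3"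
  shows "null_seq w (\<lambda>k x. P k x \<bullet> F k x)" and "null_seq w (\<lambda>k x. H \<bullet> P k x)" and "null_seq w (\<lambda>k x. H \<bullet> F k x)"
    and "null_seq w (\<lambda>k x. cof (F k x) \<bullet> H)" and "null_seq w (\<lambda>k x. det (F k x))"
proof -
  have "\<exists>u C'. almost_grad (\<lambda>k j x. \<kappa> x * f i j k x) u C'" for i
    by (rule curl_null.almost_grad_cutoff[OF cn \<kappa>])
  then obtain u C' where ag: "\<And>i. almost_grad (\<lambda>k j x. \<kappa> x * f i j k x) (u i) (C' i)" by metis
  have \<kappa>': "\<kappa> \<in> TF" by (rule test_TF[OF \<kappa>])
  have pow: "(\<lambda>x. \<kappa> x ^ 2) \<in> TF" "(\<lambda>x. \<kappa> x ^ 3) \<in> test_functions S" "w \<in> TF"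
    using test_power[OF \<kappa>', of 1] test_power[OF \<kappa>, of 2] test_power[OF \<kappa>', of 3] by (simp_all add: w_def numeral_eq_Suc)
  have fl: "f i j k \<in> lspace lborel 6" for i j k using curl_null.f[OF cn] .
  have Ul: "(\<lambda>x. \<kappa> x * f i j k x) \<in> lspace lborel 6" for i j k by (rule lspace_test_mult[OF fl \<kappa>']) simp
  have fn: "null_seq w (f i j)" for i j
    unfolding null_seq_def mult.commute[of "w _"]
    using curl_null.integrable_mult_test[OF cn pow(3)] curl_null.weak[OF cn pow(3)] by simp
  have pn: "null_seq w (p i j)" for i j
    unfolding null_seq_def mult.commute[of "w _"]
    using Holder_integrable[OF conjugate_6(2) p(1) test_lspace[OF pow(3)], of i j] pw[OF pow(3)] by simp
  show "null_seq w (\<lambda>k x. H \<bullet> F k x)"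
    unfolding F_def inner_matrix_3 vec_lambda_beta by (intro null_seq_add null_seq_cmult fn)
  show "null_seq w (\<lambda>k x. H \<bullet> P k x)"
    unfolding P_def inner_matrix_3 vec_lambda_beta by (intro null_seq_add null_seq_cmult pn)
  have pf: "null_seq w (\<lambda>k x. \<Sum>j\<in>UNIV. p i j k x * f i j k x)" for i
  proof -
    have eq: "w x * (\<Sum>j\<in>UNIV. p i j k x * f i j k x) = \<kappa> x ^ 3 * (\<Sum>j\<in>UNIV. p i j k x * (\<kappa> x * f i j k x))" for k x
      by (simp add: w_def sum_distrib_left power3_eq_cube power4_eq_xxxx mult_ac)
    have "(\<lambda>k. LINT x|lborel. \<kappa> x ^ 3 * (\<Sum>j\<in>UNIV. p i j k x * (\<kappa> x * f i j k x))) \<longlonglongrightarrow> 0"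
      by (rule almost_grad.div_curl[OF ag, of "\<lambda>k j. p i j k" D S]) (use p pw divg pow(2) in auto)
    moreover have "integrable lborel (\<lambda>x. \<kappa> x ^ 3 * (\<Sum>j\<in>UNIV. p i j k x * (\<kappa> x * f i j k x)))" for k
    proof -
      have "integrable lborel (\<lambda>x. (\<kappa> x ^ 3 * p i j k x) * (\<kappa> x * f i j k x))" for j
        by (rule Holder_integrable[OF conjugate_6(2) lspace_test_mult[OF p(1) test_TF[OF pow(2)]] Ul]) simp
      then have "integrable lborel (\<lambda>x. \<Sum>j\<in>UNIV. (\<kappa> x ^ 3 * p i j k x) * (\<kappa> x * f i j k x))"
        by (rule Bochner_Integration.integrable_sum)
      then show ?thesis by (simp only: sum_distrib_left mult.assoc)
    qed
    ultimately show ?thesis unfolding null_seq_def eq by blast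
  qed
  have "P k x \<bullet> F k x = (\<Sum>i\<in>UNIV. \<Sum>j\<in>UNIV. p i j k x * f i j k x)" for k x
    by (simp add: P_def F_def inner_vec_def)
  then show "null_seq w (\<lambda>k x. P k x \<bullet> F k x)" by (simp only:) (intro null_seq_sum pf)
  have lb: "(\<lambda>x. \<zeta> x * (\<kappa> x * f i j k x)) \<in> lspace lborel (6/5)" if "\<zeta> \<in> TF" for \<zeta> i j k
    using almost_grad.localized_bounded[OF ag that, of i] by blast
  have lb2: "(\<lambda>x. \<zeta> x * ((\<kappa> x * f a i k x) * (\<kappa> x * f b j k x))) \<in> lspace lborel (6/5)" if "\<zeta> \<in> TF" for \<zeta> a i b j k
    using localized_bounded2[OF ag ag that, of a b] by blast
  have mn: "null_seq w (\<lambda>k x. f a i k x * f b j k x - f a j k x * f b i k x)" for a b i j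
  proof -
    have eq: "w x * (f a i k x * f b j k x - f a j k x * f b i k x)
      = \<kappa> x ^ 2 * ((\<kappa> x * f a i k x) * (\<kappa> x * f b j k x) - (\<kappa> x * f a j k x) * (\<kappa> x * f b i k x))" for k x
      by (simp add: w_def algebra_simps power2_eq_square power4_eq_xxxx)
    have "integrable lborel (\<lambda>x. \<kappa> x ^ 2 * ((\<kappa> x * f a i k x) * (\<kappa> x * f b j k x) - (\<kappa> x * f a j k x) * (\<kappa> x * f b i k x)))" for k
      unfolding right_diff_distrib
      by (intro Bochner_Integration.integrable_diff integrable_mult_localized[OF lb[OF pow(1)] Ul])
    then show ?thesis unfolding null_seq_def eq using minor_limit[OF ag ag pow(1), of a i b j] by blast
  qed
  show "null_seq w (\<lambda>k x. cof (F k x) \<bullet> H)"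
    unfolding F_def inner_matrix_3 cof_def vector_3 vec_lambda_beta by (intro null_seq_add null_seq_multc mn)
  let ?U = "\<lambda>a i k x. \<kappa> x * f a i k x"
  have eq: "w x * det (F k x) = \<kappa> x * (?U 1 1 k x * (?U 2 2 k x * ?U 3 3 k x - ?U 2 3 k x * ?U 3 2 k x)
      + ?U 1 2 k x * (?U 2 3 k x * ?U 3 1 k x - ?U 2 1 k x * ?U 3 3 k x) + ?U 1 3 k x * (?U 2 1 k x * ?U 3 2 k x - ?U 2 2 k x * ?U 3 1 k x))" for k x
    by (simp add: w_def F_def det_3 algebra_simps power4_eq_xxxx)
  have "integrable lborel (\<lambda>x. \<kappa> x * (?U 1 1 k x * (?U 2 2 k x * ?U 3 3 k x - ?U 2 3 k x * ?U 3 2 k x)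
      + ?U 1 2 k x * (?U 2 3 k x * ?U 3 1 k x - ?U 2 1 k x * ?U 3 3 k x) + ?U 1 3 k x * (?U 2 1 k x * ?U 3 2 k x - ?U 2 2 k x * ?U 3 1 k x)))" for k
    unfolding distrib_left[of "\<kappa> _"] right_diff_distrib
    by (intro Bochner_Integration.integrable_add Bochner_Integration.integrable_diff integrable_mult_localized[OF lb2[OF \<kappa>'] Ul])
  then show "null_seq w (\<lambda>k x. det (F k x))"
    unfolding null_seq_def eq using det_limit[OF ag[of 1] ag[of 2] ag[of 3] \<kappa>', of 1 2 3] by blast
qed

text \<open>Integrating \<open>minty_expansion\<close> against the nonnegative weight removes all
  terms depending on k in the limit; what is left is the constant times the positive integral of
  \<open>w\<close>, which cancels.\<close>

lemma minty_inequality: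
  fixes f p :: "3 \<Rightarrow> 3 \<Rightarrow> nat \<Rightarrow> real^3 \<Rightarrow> real"
  defines "F \<equiv> \<lambda>k x. (\<chi> i j. f i j k x) :: real^3^3" and "P \<equiv> \<lambda>k x. (\<chi> i j. p i j k x) :: real^3^3"
  assumes null: "null_seq w (\<lambda>k x. P k x \<bullet> F k x)" "\<And>H. null_seq w (\<lambda>k x. H \<bullet> P k x)" "\<And>H. null_seq w (\<lambda>k x. H \<bullet> F k x)"
      "\<And>H. null_seq w (\<lambda>k x. cof (F k x) \<bullet> H)" "null_seq w (\<lambda>k x. det (F k x))"
    and w: "integrable lborel w" "0 < (LINT x|lborel. w x)" "\<And>x. 0 \<le> w x"
    and graph: "\<And>k. AE x in lborel. w x \<noteq> 0 \<longrightarrow> P\<^sub>0 + P k x = DW a e g' (F\<^sub>0 + F k x)"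
    and g': "\<And>s t. 0 \<le> (g' s - g' t) * (s - t)" "\<And>s t. \<bar>g' t - g' s\<bar> \<le> d * (\<bar>t\<bar> + \<bar>s\<bar>)" "0 < a" "0 < e" "d \<le> e / 720"
  shows "0 \<le> t * ((P\<^sub>0 - DW a e g' (F\<^sub>0 - t *\<^sub>R H)) \<bullet> H)
    - g' (det (F\<^sub>0 - t *\<^sub>R H)) * (2 * t^2 * (cof H \<bullet> (F\<^sub>0 - t *\<^sub>R H)) + 3 * t^3 * det H)" (is "0 \<le> ?c")
proof -
  let ?G = "F\<^sub>0 - t *\<^sub>R H"
  let ?Q = "P\<^sub>0 - DW a e g' ?G"
  define E where "E k x = P k x \<bullet> F k x + t * (H \<bullet> P k x) + ?Q \<bullet> F k x
    - g' (det ?G) * (2 * (cof (F k x) \<bullet> ?G) + 2 * t * (cof_polar H ?G \<bullet> F k x) + 3 * det (F k x) + 3 * t * (cof (F k x) \<bullet> H) + 3 * t^2 * (cof H \<bullet> F k x))" for k x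
  have E: "null_seq w E"
    unfolding E_def[abs_def] by (intro null_seq_add null_seq_diff null_seq_cmult null)
  have "0 \<le> (LINT x|lborel. w x * E k x) + ?c * (LINT x|lborel. w x)" for k
  proof -
    have "AE x in lborel. 0 \<le> w x * E k x + ?c * w x"
      using graph[of k]
    proof eventually_elim
      case (elim x)
      show ?case
      proof (cases "w x = 0")
        case False
        with elim have "P k x = DW a e g' (F\<^sub>0 + F k x) - P\<^sub>0" by (simp add: algebra_simps)
        then have "0 \<le> E k x + ?c"
          unfolding E_def by (intro minty_expansion[OF g' refl, where F = "F\<^sub>0 + F k x"]) simp_all
        then have "0 \<le> w x * (E k x + ?c)" using w(3) by (rule mult_nonneg_nonneg[rotated])
        then show ?thesis by (simp only: distrib_left[of "w x" "E k x"] mult.commute[of "w x" ?c])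
      qed simp
    qed
    then have "0 \<le> (LINT x|lborel. w x * E k x + ?c * w x)" by (rule integral_nonneg_AE)
    then show ?thesis using E w(1) by (simp add: null_seq_def)
  qed
  moreover have "(\<lambda>k. (LINT x|lborel. w x * E k x) + ?c * (LINT x|lborel. w x)) \<longlonglongrightarrow> 0 + ?c * (LINT x|lborel. w x)"
    using E unfolding null_seq_def by (intro tendsto_add tendsto_const) simp
  ultimately have "0 \<le> 0 + ?c * (LINT x|lborel. w x)" by (intro LIMSEQ_le_const) auto
  then show ?thesis using w(2) by (simp add: zero_le_mult_iff)
qed

text \<open>Divide by t and let t decrease to 0: the second term keeps a factor t and vanishes, and
  \<open>DW\<close> is continuous along the segment because \<open>g'\<close> is. As H is arbitrary,
  it may be taken as minus the residual, whose squared norm is then nonpositive.\<close>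

lemma minty_conclusion:
  assumes cont: "continuous_on UNIV g'"
    and ineq: "\<And>t H. 0 < t \<Longrightarrow> 0 \<le> t * ((P\<^sub>0 - DW a e g' (F\<^sub>0 - t *\<^sub>R H)) \<bullet> H)
      - g' (det (F\<^sub>0 - t *\<^sub>R H)) * (2 * t^2 * (cof H \<bullet> (F\<^sub>0 - t *\<^sub>R H)) + 3 * t^3 * det H)"
  shows "P\<^sub>0 = DW a e g' F\<^sub>0"
proof -
  have nonneg: "0 \<le> (P\<^sub>0 - DW a e g' F\<^sub>0) \<bullet> H" for H
  proof -
    define h where "h t = P\<^sub>0 \<bullet> H - DW a e g' (F\<^sub>0 - t *\<^sub>R H) \<bullet> H
      - g' (det (F\<^sub>0 - t *\<^sub>R H)) * (2 * t * (cof H \<bullet> (F\<^sub>0 - t *\<^sub>R H)) + 3 * t^2 * det H)" for t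
    have f: "continuous_on UNIV (\<lambda>t::real. F\<^sub>0 - t *\<^sub>R H)" by (intro continuous_intros)
    have 1: "continuous_on UNIV (\<lambda>t. g' (det (F\<^sub>0 - t *\<^sub>R H)))"
      using continuous_on_compose2[OF cont continuous_on_det_3[OF f]] by simp
    have "continuous_on UNIV h"
      unfolding h_def[abs_def] by (intro continuous_intros continuous_on_DW_inner[OF cont f] 1)
    then have "(h \<longlongrightarrow> h 0) (at_right 0)"
      by (metis UNIV_I continuous_on_def filterlim_at_split tendsto_within_subset top_greatest)
    moreover have "\<forall>\<^sub>F t in at_right 0. 0 \<le> h t"
    proof (rule eventually_at_rightI[of 0 1])
      fix t :: real assume t: "t \<in> {0<..<1}"
      have "t * ((P\<^sub>0 - DW a e g' (F\<^sub>0 - t *\<^sub>R H)) \<bullet> H)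
        - g' (det (F\<^sub>0 - t *\<^sub>R H)) * (2 * t^2 * (cof H \<bullet> (F\<^sub>0 - t *\<^sub>R H)) + 3 * t^3 * det H) = t * h t"
        unfolding h_def by (simp only: inner_diff_left[of P\<^sub>0] power2_eq_square power3_eq_cube right_diff_distrib distrib_left mult_ac)
      then have "0 \<le> t * h t" using ineq[of t H] t by simp
      then show "0 \<le> h t" using t by (simp add: zero_le_mult_iff)
    qed simp
    ultimately have "0 \<le> h 0" by (intro tendsto_lowerbound) auto
    then show ?thesis by (simp add: h_def inner_diff_left)
  qed
  from nonneg[of "- (P\<^sub>0 - DW a e g' F\<^sub>0)"] have "(P\<^sub>0 - DW a e g' F\<^sub>0) \<bullet> (P\<^sub>0 - DW a e g' F\<^sub>0) \<le> 0"
    by (simp only: inner_minus_right)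
  then have "(P\<^sub>0 - DW a e g' F\<^sub>0) \<bullet> (P\<^sub>0 - DW a e g' F\<^sub>0) = 0" by (intro antisym inner_ge_zero)
  then show ?thesis by simp
qed

lemma div_curl_limit_in_graph:
  fixes S :: "(real^3) set"
  assumes S: "open S" "S \<noteq> {}" and conv: "div_curl_tendsto 6 (6/5) S Z (\<lambda>x. F\<^sub>0, \<lambda>x. P\<^sub>0)"
    and graph: "\<And>m. AE x in lebesgue_on S. snd (Z m) x = DW a e g' (fst (Z m) x)"
    and cont: "continuous_on UNIV g'"
    and g': "\<And>s t. 0 \<le> (g' s - g' t) * (s - t)" "\<And>s t. \<bar>g' t - g' s\<bar> \<le> d * (\<bar>t\<bar> + \<bar>s\<bar>)" "0 < a" "0 < e" "d \<le> e / 720"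
  shows "P\<^sub>0 = DW a e g' F\<^sub>0"
proof -
  have Sl: "S \<in> sets lebesgue" using S(1) by (simp add: sets_completionI_sets)
  have X: "X_weakly_tendsto 6 (6/5) S Z (\<lambda>x. F\<^sub>0, \<lambda>x. P\<^sub>0)" using conv by (simp add: div_curl_tendsto_def)
  \<comment> \<open>Bundles the representative of one entry with its properties, so that
    representatives for all i, j can be chosen at once.\<close>
  define R where "R s g g0 f C \<longleftrightarrow> (\<forall>k. f k \<in> lspace lborel s) \<and> (\<forall>k. lnorm lborel s (f k) \<le> C) \<and>
    (\<forall>\<theta>\<in>TF. (\<lambda>k. LINT x|lborel. f k x * \<theta> x) \<longlonglongrightarrow> 0) \<and>
    (\<forall>k. \<forall>\<theta>\<in>TF. (LINT x|lborel. f k x * \<theta> x) = (LINT x|lebesgue_on S. g k x * \<theta> x) - (LINT x|lebesgue_on S. g0 x * \<theta> x)) \<and>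
    (\<forall>k. AE x in lborel. x \<in> S \<longrightarrow> f k x = g k x - g0 x)" for s g g0 f and C :: real
  note wf = X_weakly_tendsto_fst[OF X conjugate_6(1), unfolded fst_conv] and wp = X_weakly_tendsto_snd[OF X conjugate_6(2), unfolded snd_conv]
  have "\<exists>f C. R 6 (\<lambda>k x. fst (Z k) x $ i $ j) (\<lambda>x. F\<^sub>0 $ i $ j) f C" for i j
    unfolding R_def by (rule weakly_convergent_borel_version[OF Sl conjugate_6(1) wf(3,4,1,2)])
  then obtain f Cf where "\<And>i j. R 6 (\<lambda>k x. fst (Z k) x $ i $ j) (\<lambda>x. F\<^sub>0 $ i $ j) (f i j) (Cf i j)" by metis
  then have f: "\<And>i j k. f i j k \<in> lspace lborel 6" "\<And>i j k. lnorm lborel 6 (f i j k) \<le> Cf i j"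
      "\<And>i j \<theta>. \<theta> \<in> TF \<Longrightarrow> (\<lambda>k. LINT x|lborel. f i j k x * \<theta> x) \<longlonglongrightarrow> 0"
      "\<And>i j k \<theta>. \<theta> \<in> TF \<Longrightarrow> (LINT x|lborel. f i j k x * \<theta> x) = (LINT x|lebesgue_on S. fst (Z k) x $ i $ j * \<theta> x) - (LINT x|lebesgue_on S. F\<^sub>0 $ i $ j * \<theta> x)"
      "\<And>i j k. AE x in lborel. x \<in> S \<longrightarrow> f i j k x = fst (Z k) x $ i $ j - F\<^sub>0 $ i $ j"
    unfolding R_def by blast+
  have "\<exists>f C. R (6/5) (\<lambda>k x. snd (Z k) x $ i $ j) (\<lambda>x. P\<^sub>0 $ i $ j) f C" for i j
    unfolding R_def by (rule weakly_convergent_borel_version[OF Sl conjugate_6(2) wp(3,4,1,2)])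
  then obtain p Cp where "\<And>i j. R (6/5) (\<lambda>k x. snd (Z k) x $ i $ j) (\<lambda>x. P\<^sub>0 $ i $ j) (p i j) (Cp i j)" by metis
  then have p: "\<And>i j k. p i j k \<in> lspace lborel (6/5)" "\<And>i j k. lnorm lborel (6/5) (p i j k) \<le> Cp i j"
      "\<And>i j \<theta>. \<theta> \<in> TF \<Longrightarrow> (\<lambda>k. LINT x|lborel. p i j k x * \<theta> x) \<longlonglongrightarrow> 0"
      "\<And>i j k \<theta>. \<theta> \<in> TF \<Longrightarrow> (LINT x|lborel. p i j k x * \<theta> x) = (LINT x|lebesgue_on S. snd (Z k) x $ i $ j * \<theta> x) - (LINT x|lebesgue_on S. P\<^sub>0 $ i $ j * \<theta> x)"
      "\<And>i j k. AE x in lborel. x \<in> S \<longrightarrow> p i j k x = snd (Z k) x $ i $ j - P\<^sub>0 $ i $ j"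
    unfolding R_def by blast+
  have fi: "integrable lborel (\<lambda>x. f i j k x * \<theta> x)" if "\<theta> \<in> TF" for i j k \<theta>
    by (rule Holder_integrable[OF conjugate_6(1) f(1) test_lspace[OF that]]) simp
  have pint: "integrable lborel (\<lambda>x. p i j k x * \<theta> x)" if "\<theta> \<in> TF" for i j k \<theta>
    by (rule Holder_integrable[OF conjugate_6(2) p(1) test_lspace[OF that]]) simp
  have pdT: "pd j \<phi> \<in> TF" if "\<phi> \<in> test_functions S" for j \<phi> by (rule test_pd[OF test_TF[OF that]])
  have pdc: "pd j (\<lambda>x. c * \<phi> x) x = c * pd j \<phi> x" if "\<phi> \<in> test_functions S" for j c \<phi> x
    using pd_smooth(3)[OF test_smooth[OF that] test_smooth[OF that], of j c] by simp
  have curl: "\<forall>\<^sub>F m in sequentially. \<forall>v\<in>test_functions S. \<bar>LINT x|lborel. f i j m x * pd k v x - f i k m x * pd j v x\<bar> \<le> \<eta> * (lnorm lborel (6/5) v + dnorm (6/5) v)"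
    if \<eta>: "0 < \<eta>" for i j k \<eta>
  proof (rule dual_W0_tendsto_test_functions[OF _ Sl _ \<eta>])
    show "dual_W0_tendsto (6/5) S (\<lambda>m. dist_curl S (fst (Z m)) i j k) (dist_curl S (\<lambda>x. F\<^sub>0) i j k)"
      using conv by (simp add: div_curl_tendsto_def)
    show "\<bar>LINT x|lborel. f i j m x * pd k \<phi> x - f i k m x * pd j \<phi> x\<bar> = \<bar>dist_curl S (fst (Z m)) i j k (\<phi>, grad \<phi>) - dist_curl S (\<lambda>x. F\<^sub>0) i j k (\<phi>, grad \<phi>)\<bar>"
      if \<phi>: "\<phi> \<in> test_functions S" for m \<phi>
      using fi[OF pdT[OF \<phi>]] f(4)[OF pdT[OF \<phi>]] by (simp add: dist_curl_def dist_partial_def pd_def[symmetric])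
    show "(LINT x|lborel. f i j m x * pd k (\<lambda>x. c * \<phi> x) x - f i k m x * pd j (\<lambda>x. c * \<phi> x) x) = c * (LINT x|lborel. f i j m x * pd k \<phi> x - f i k m x * pd j \<phi> x)"
      if \<phi>: "\<phi> \<in> test_functions S" for m c \<phi>
      unfolding pdc[OF \<phi>] by (subst integral_mult_right_zero[symmetric]) (simp only: right_diff_distrib mult.left_commute[of c])
  qed simp
  have divg: "\<forall>\<^sub>F m in sequentially. \<forall>v\<in>test_functions S. \<bar>LINT x|lborel. (\<Sum>j\<in>UNIV. p i j m x * pd j v x)\<bar> \<le> \<eta> * (lnorm lborel 6 v + dnorm 6 v)"
    if \<eta>: "0 < \<eta>" for i \<eta>
  proof (rule dual_W0_tendsto_test_functions[OF _ Sl _ \<eta>])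
    show "dual_W0_tendsto 6 S (\<lambda>m. dist_div S (snd (Z m)) i) (dist_div S (\<lambda>x. P\<^sub>0) i)"
      using conv by (simp add: div_curl_tendsto_def)
    show "\<bar>LINT x|lborel. (\<Sum>j\<in>UNIV. p i j m x * pd j \<phi> x)\<bar> = \<bar>dist_div S (snd (Z m)) i (\<phi>, grad \<phi>) - dist_div S (\<lambda>x. P\<^sub>0) i (\<phi>, grad \<phi>)\<bar>"
      if \<phi>: "\<phi> \<in> test_functions S" for m \<phi>
      using pint[OF pdT[OF \<phi>]] p(4)[OF pdT[OF \<phi>]]
      by (simp add: dist_div_def dist_partial_def pd_def[symmetric] sum_subtractf sum_negf)
    show "(LINT x|lborel. (\<Sum>j\<in>UNIV. p i j m x * pd j (\<lambda>x. c * \<phi> x) x)) = c * (LINT x|lborel. (\<Sum>j\<in>UNIV. p i j m x * pd j \<phi> x))"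
      if \<phi>: "\<phi> \<in> test_functions S" for m c \<phi>
      unfolding pdc[OF \<phi>] by (subst integral_mult_right_zero[symmetric]) (simp only: sum_distrib_left mult.left_commute[of c])
  qed simp
  \<comment> \<open>\<open>curl_null\<close> asks for one bound valid for all entries of the row,
    hence the sum of moduli.\<close>
  have cn: "curl_null S (\<lambda>k j. f i j k) (\<Sum>j\<in>UNIV. \<bar>Cf i j\<bar>)" for i
  proof
    show "lnorm lborel 6 (f i j k) \<le> (\<Sum>j\<in>UNIV. \<bar>Cf i j\<bar>)" for k j
      using f(2)[of i j k] member_le_sum[of j UNIV "\<lambda>j. \<bar>Cf i j\<bar>"] by simp
  qed (use f(1,3) curl in auto)
  have pb: "lnorm lborel (6/5) (p i j k) \<le> (\<Sum>i\<in>UNIV. \<Sum>j\<in>UNIV. \<bar>Cp i j\<bar>)" for i j k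
  proof -
    have "\<bar>Cp i j\<bar> \<le> (\<Sum>j\<in>UNIV. \<bar>Cp i j\<bar>)" by (rule member_le_sum) auto
    also have "\<dots> \<le> (\<Sum>i\<in>UNIV. \<Sum>j\<in>UNIV. \<bar>Cp i j\<bar>)"
      by (rule member_le_sum[of i UNIV "\<lambda>i. \<Sum>j\<in>UNIV. \<bar>Cp i j\<bar>"]) (auto intro: sum_nonneg)
    finally show ?thesis using p(2)[of i j k] by linarith
  qed
  \<comment> \<open>The limit is constant, so it is enough to test with one bump supported in a
    small ball inside S.\<close>
  obtain x0 where "x0 \<in> S" using S(2) by blast
  then obtain r where r: "0 < r" "cball x0 r \<subseteq> S" using S(1) open_contains_cball by blast
  obtain \<kappa> where \<kappa>: "\<kappa> \<in> TF" "\<And>x. 0 \<le> \<kappa> x" "\<And>x. norm (x - x0) < r \<Longrightarrow> 0 < \<kappa> x" "\<And>x. r \<le> norm (x - x0) \<Longrightarrow> \<kappa> x = 0"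
      "\<And>y. \<kappa> (x0 - y) = \<kappa> (x0 + y)"
    using exists_bump[OF r(1), of x0] by blast
  have outside: "\<kappa> x = 0" if "x \<notin> cball x0 r" for x
    using \<kappa>(4)[of x] that by (simp add: dist_norm norm_minus_commute)
  have \<kappa>S: "\<kappa> \<in> test_functions S"
    unfolding test_functions_iff
    by (intro conjI exI[of _ "cball x0 r"] allI impI test_smooth[OF \<kappa>(1)] compact_cball r(2)) (rule outside)
  have w: "(\<lambda>x. \<kappa> x ^ 4) \<in> TF" using test_power[OF \<kappa>(1), of 3] by (simp add: numeral_eq_Suc)
  note null = null_Lagrangians[OF cn p(1) pb p(3) divg \<kappa>S]
  show ?thesis
  proof (rule minty_conclusion[OF cont minty_inequality[OF null _ _ _ _ g']])
    show "integrable lborel (\<lambda>x. \<kappa> x ^ 4)" by (rule test_integrable[OF w])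
    show "0 < (LINT x|lborel. \<kappa> x ^ 4)"
      by (rule integral_pos_if_pos_on_ball[OF test_integrable[OF w] zero_le_power[OF \<kappa>(2)] zero_less_power[OF \<kappa>(3)] r(1)])
    show "0 \<le> \<kappa> x ^ 4" for x using \<kappa>(2) by simp
    show "AE x in lborel. \<kappa> x ^ 4 \<noteq> 0 \<longrightarrow> P\<^sub>0 + (\<chi> i j. p i j k x) = DW a e g' (F\<^sub>0 + (\<chi> i j. f i j k x))" for k
    proof -
      have "AE x in lebesgue. x \<in> S \<longrightarrow> snd (Z k) x = DW a e g' (fst (Z k) x)"
        using graph[of k] Sl by (subst (asm) AE_restrict_space_iff) auto
      then have "AE x in lborel. x \<in> S \<longrightarrow> snd (Z k) x = DW a e g' (fst (Z k) x)" unfolding AE_completion_iff .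
      moreover have "AE x in lborel. \<forall>i j. x \<in> S \<longrightarrow> f i j k x = fst (Z k) x $ i $ j - F\<^sub>0 $ i $ j"
        by (intro eventually_all_finite f(5))
      moreover have "AE x in lborel. \<forall>i j. x \<in> S \<longrightarrow> p i j k x = snd (Z k) x $ i $ j - P\<^sub>0 $ i $ j"
        by (intro eventually_all_finite p(5))
      ultimately show ?thesis
      proof eventually_elim
        case (elim x)
        show ?case
        proof
          assume "\<kappa> x ^ 4 \<noteq> 0"
          then have "x \<in> S" using test_outside[OF \<kappa>S, of x] by auto
          then have "F\<^sub>0 + (\<chi> i j. f i j k x) = fst (Z k) x" "P\<^sub>0 + (\<chi> i j. p i j k x) = snd (Z k) x"
            using elim by (simp_all add: vec_eq_iff)
          then show "P\<^sub>0 + (\<chi> i j. p i j k x) = DW a e g' (F\<^sub>0 + (\<chi> i j. f i j k x))" using elim \<open>x \<in> S\<close> by simp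
        qed
      qed
    qed
  qed
qed

theorem proposition4p14:
  "\<exists>c>0. \<forall>(g :: real \<Rightarrow> real) (d :: real) (a :: real) (e :: real).
     g C1_differentiable_on UNIV \<longrightarrow> convex_on UNIV g \<longrightarrow>
     (\<forall>s t. \<bar>deriv g t - deriv g s\<bar> \<le> d * (\<bar>t\<bar> + \<bar>s\<bar>)) \<longrightarrow>
     a > 0 \<longrightarrow> e > 0 \<longrightarrow> d \<le> c * e \<longrightarrow>
     locally_div_curl_closed 6 (6/5) (data_set_of_gradient (W3 a e g))"
\<comment> \<open>The constant of \<open>DW_monotone_up_to_null_terms\<close>.\<close>
proof (intro exI[of _ "1 / 720"] conjI allI impI)
  fix g :: "real \<Rightarrow> real" and d a e :: real
  assume g: "g C1_differentiable_on UNIV" "convex_on UNIV g" and lip: "\<forall>s t. \<bar>deriv g t - deriv g s\<bar> \<le> d * (\<bar>t\<bar> + \<bar>s\<bar>)"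
    and a: "0 < a" and e: "0 < e" and d: "d \<le> 1 / 720 * e"
  note dg = C1_differentiable_on_UNIV_deriv[OF g(1)]
  have grad: "grad (W3 a e g) = DW a e (deriv g)" by (rule ext) (rule grad_W3[OF dg(1)])
  have graph: "(F, P) \<in> data_set_of_gradient (W3 a e g) \<longleftrightarrow> P = DW a e (deriv g) F" for F P
    by (auto simp: data_set_of_gradient_def grad)
  show "locally_div_curl_closed 6 (6/5) (data_set_of_gradient (W3 a e g))"
    unfolding locally_div_curl_closed_def graph
  proof (intro allI impI, elim conjE exE)
    fix S :: "(real^3) set" and F\<^sub>0 P\<^sub>0 Z
    assume S: "open S" "S \<noteq> {}" and conv: "div_curl_tendsto 6 (6/5) S Z (\<lambda>x. F\<^sub>0, \<lambda>x. P\<^sub>0)"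
      and ae: "\<forall>m. AE x in lebesgue_on S. snd (Z m) x = DW a e (deriv g) (fst (Z m) x)"
    show "P\<^sub>0 = DW a e (deriv g) F\<^sub>0"
      by (rule div_curl_limit_in_graph[OF S conv _ dg(2) convex_deriv_mono[OF g(2) dg(1)] _ a e])
        (use ae lip d in auto)
  qed
qed simp

end
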